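(* Let $(s_k)_{k\in\mathbb N}\subset(0,1)$ with $s_k\to1$, let $p\in(1,+\infty)$ and let $\Omega\subset\mathbb R^n$ be open, bounded and Lipschitz. Then: (i) If $u_{s_k}\in X^{s_k,p}(\Omega)$ and $M\in(0,+\infty)$ satisfy $\sup_k(1-s_k)\mathcal K^p_{s_k}(u_{s_k},\Omega)\le M$, then, up to a subsequence, $u_{s_k}\to u$ in $L^p(\Omega)$ for some $u\in W^{1,p}(\Omega)$. If moreover $u_{s_k}\in X^{s_k,p}_0(\Omega)$ for every $k$, then $u\in W^{1,p}_0(\Omega)$. (ii) For every $u\in L^p(\Omega)$ and every sequence $u_{s_k}\in X^{s_k,p}(\Omega)$ with $u_{s_k}\to u$ in $L^p(\Omega)$, one has $\mathcal E^p_1(u,\Omega)\le\liminf_{k\to\infty}\mathcal E^p_{s_k}(u_{s_k},\Omega)$. (iii) For every $u\in L^p(\Omega)$ with $|u|\le1$ a.e. in $\Omega$ there is a sequence $u_{s_k}\in X^{s_k,p}(\Omega)$ with $u_{s_k}\to u$ in $L^p(\Omega)$ and $\mathcal E^p_1(u,\Omega)\ge\limsup_{k\to\infty}\mathcal E^p_{s_k}(u_{s_k},\Omega)$. Furthermore, if $u\in X^{1,p}(\Omega)$, there exists $v$ belonging to $X^{s,p}(\Omega)$ for every $s\in(0,1)$ with $v=u$ in $\Omega$ and $\mathcal E^p_1(u,\Omega)=\limsup_{k\to\infty}\mathcal E^p_{s_k}(v,\Omega)$.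
   Context: $W:[-1,1]\to[0,+\infty)$ is lower semicontinuous with $W(x)\le\Lambda|1+x|^m$ for some $\Lambda\ge1$, $m\ge p$ (in the paper it also satisfies $\lambda\chi_{(-\infty,\theta]}(x)|1+x|^m\le W(x)$ and a growth condition near $-1$). For $s\in(0,1)$ and measurable $u:\mathbb R^n\to\mathbb R$: $\mathcal K^p_s(u,\Omega):=\frac12\int_\Omega\int_\Omega\frac{|u(x)-u(y)|^p}{|x-y|^{n+sp}}dx\,dy+\int_\Omega\int_{\mathbb R^n\setminus\Omega}\frac{|u(x)-u(y)|^p}{|x-y|^{n+sp}}dx\,dy$, $\mathcal E^p_s(u,\Omega):=(1-s)\mathcal K^p_s(u,\Omega)+\int_\Omega W(u)dx$. $X^{s,p}(\Omega)$: measurable $u:\mathbb R^n\to\mathbb R$ with $\mathcal K^p_s(u,\Omega)<\infty$ and $\|u\|_{L^\infty(\mathbb R^n)}\le1$; $X^{s,p}_0(\Omega)$: those with $u=0$ a.e. outside $\Omega$. $K_{n,p}:=\int_{\partial B_1}|\omega\cdot e_1|^p\,d\mathcal H^{n-1}_\omega$; for $u\in W^{1,p}(\Omega)$, $\mathcal K^p_1(u,\Omega):=\frac{K_{n,p}}{2p}\int_\Omega|\nabla u|^p$ and $\mathcal E^p_1(u,\Omega):=\mathcal K^p_1(u,\Omega)+\int_\Omega W(u)dx$ (with $\mathcal E^p_1:=+\infty$ if $u\notin W^{1,p}(\Omega)$ or $|u|\le 1$ fails). $X^{1,p}(\Omega):=\{u\in W^{1,p}(\Omega):\|u\|_{L^\infty(\Omega)}\le1\}$;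 $W^{1,p}_0(\Omega)$ is the closure of $C^\infty_c(\Omega)$ in $W^{1,p}(\Omega)$. *)

theory Defs
  imports "HOL-Analysis.Analysis"
begin

fun iter_dd :: "'a::euclidean_space list \<Rightarrow> ('a \<Rightarrow> real) \<Rightarrow> 'a \<Rightarrow> real" where
  "iter_dd [] f = f"
| "iter_dd (v # vs) f = (\<lambda>x. frechet_derivative (iter_dd vs f) (at x) v)"

definition smooth_fun :: "('a::euclidean_space \<Rightarrow> real) \<Rightarrow> bool" where
  "smooth_fun f \<longleftrightarrow> (\<forall>vs x. iter_dd vs f differentiable (at x))"

definition test_fun :: "'a::euclidean_space set \<Rightarrow> ('a \<Rightarrow> real) \<Rightarrow> bool" where
  "test_fun \<Omega> \<phi> \<longleftrightarrow> smooth_fun \<phi> \<and> compact (closure {x. \<phi> x \<noteq> 0})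
      \<and> closure {x. \<phi> x \<noteq> 0} \<subseteq> \<Omega>"

definition in_Lp :: "real \<Rightarrow> 'a::euclidean_space set \<Rightarrow> ('a \<Rightarrow> real) \<Rightarrow> bool" where
  "in_Lp p \<Omega> u \<longleftrightarrow> u \<in> borel_measurable (lebesgue_on \<Omega>)
      \<and> set_nn_integral lebesgue \<Omega> (\<lambda>x. ennreal (\<bar>u x\<bar> powr p)) < \<infinity>"

definition Lp_conv :: "real \<Rightarrow> 'a::euclidean_space set \<Rightarrow> (nat \<Rightarrow> 'a \<Rightarrow> real) \<Rightarrow> ('a \<Rightarrow> real) \<Rightarrow> bool" where
  "Lp_conv p \<Omega> uk u \<longleftrightarrow>
     ((\<lambda>k. set_nn_integral lebesgue \<Omega> (\<lambda>x. ennreal (\<bar>uk k x - u x\<bar> powr p))) \<longlonglongrightarrow> 0)"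

definition weak_grad :: "real \<Rightarrow> 'a::euclidean_space set \<Rightarrow> ('a \<Rightarrow> real) \<Rightarrow> ('a \<Rightarrow> 'a) \<Rightarrow> bool" where
  "weak_grad p \<Omega> u G \<longleftrightarrow>
     (\<forall>i\<in>Basis. in_Lp p \<Omega> (\<lambda>x. G x \<bullet> i)) \<and>
     (\<forall>\<phi>. test_fun \<Omega> \<phi> \<longrightarrow> (\<forall>i\<in>Basis.
        (LINT x:\<Omega>|lebesgue. u x * frechet_derivative \<phi> (at x) i)
          = - (LINT x:\<Omega>|lebesgue. (G x \<bullet> i) * \<phi> x)))"

definition W1p :: "real \<Rightarrow> 'a::euclidean_space set \<Rightarrow> ('a \<Rightarrow> real) \<Rightarrow> bool" where
  "W1p p \<Omega> u \<longleftrightarrow> in_Lp p \<Omega> u \<and> (\<exists>G. weak_grad p \<Omega> u G)"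

definition W01p :: "real \<Rightarrow> 'a::euclidean_space set \<Rightarrow> ('a \<Rightarrow> real) \<Rightarrow> bool" where
  "W01p p \<Omega> u \<longleftrightarrow> W1p p \<Omega> u \<and>
     (\<exists>G \<phi> G\<phi>. weak_grad p \<Omega> u G \<and> (\<forall>j. test_fun \<Omega> (\<phi> j) \<and> weak_grad p \<Omega> (\<phi> j) (G\<phi> j))
        \<and> Lp_conv p \<Omega> \<phi> u
        \<and> ((\<lambda>j. set_nn_integral lebesgue \<Omega> (\<lambda>x. ennreal (norm (G\<phi> j x - G x) powr p))) \<longlonglongrightarrow> 0))"

definition X1p :: "real \<Rightarrow> 'a::euclidean_space set \<Rightarrow> ('a \<Rightarrow> real) \<Rightarrow> bool" where
  "X1p p \<Omega> u \<longleftrightarrow> W1p p \<Omega> u \<and> (AE x in lebesgue. x \<in> \<Omega> \<longrightarrow> \<bar>u x\<bar> \<le> 1)"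

definition e_dir :: "'a::euclidean_space" where
  "e_dir = (SOME b. b \<in> Basis)"

definition lipschitz_domain :: "'a::euclidean_space set \<Rightarrow> bool" where
  "lipschitz_domain \<Omega> \<longleftrightarrow> open \<Omega> \<and> bounded \<Omega> \<and>
     (\<forall>z\<in>frontier \<Omega>. \<exists>r>0. \<exists>T (g::'a \<Rightarrow> real) L.
        orthogonal_transformation T \<and> lipschitz_on L UNIV g \<and>
        \<Omega> \<inter> ball z r = {x \<in> ball z r.
           T (x - z) \<bullet> e_dir < g (T (x - z) - (T (x - z) \<bullet> e_dir) *\<^sub>R e_dir)})"

definition Kp_s :: "real \<Rightarrow> real \<Rightarrow> ('a::euclidean_space \<Rightarrow> real) \<Rightarrow> 'a set \<Rightarrow> ennreal" where
  "Kp_s p s u \<Omega> =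
     ennreal (1/2) * set_nn_integral lebesgue \<Omega> (\<lambda>x. set_nn_integral lebesgue \<Omega> (\<lambda>y.
        ennreal (\<bar>u x - u y\<bar> powr p / norm (x - y) powr (real DIM('a) + s * p))))
   + set_nn_integral lebesgue \<Omega> (\<lambda>y. set_nn_integral lebesgue (UNIV - \<Omega>) (\<lambda>x.
        ennreal (\<bar>u x - u y\<bar> powr p / norm (x - y) powr (real DIM('a) + s * p))))"

definition Ep_s :: "(real \<Rightarrow> real) \<Rightarrow> real \<Rightarrow> real \<Rightarrow> ('a::euclidean_space \<Rightarrow> real) \<Rightarrow> 'a set \<Rightarrow> ennreal" where
  "Ep_s W p s u \<Omega> = ennreal (1 - s) * Kp_s p s u \<Omega>
      + set_nn_integral lebesgue \<Omega> (\<lambda>x. ennreal (W (u x)))"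

definition Xsp :: "real \<Rightarrow> real \<Rightarrow> 'a::euclidean_space set \<Rightarrow> ('a \<Rightarrow> real) \<Rightarrow> bool" where
  "Xsp s p \<Omega> u \<longleftrightarrow> u \<in> borel_measurable lebesgue \<and> Kp_s p s u \<Omega> < \<infinity>
      \<and> (AE x in lebesgue. \<bar>u x\<bar> \<le> 1)"

definition Xsp0 :: "real \<Rightarrow> real \<Rightarrow> 'a::euclidean_space set \<Rightarrow> ('a \<Rightarrow> real) \<Rightarrow> bool" where
  "Xsp0 s p \<Omega> u \<longleftrightarrow> Xsp s p \<Omega> u \<and> (AE x in lebesgue. x \<notin> \<Omega> \<longrightarrow> u x = 0)"

text \<open>\<open>K_{n,p} = \<integral>_{\<partial>B_1} |\<omega>\<cdot>e_1|^p d\<H>^{n-1}\<close>, expressed through polar coordinates as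
  \<open>(n+p) \<integral>_{B_1} |x\<cdot>e_1|^p dx\<close> (no surface measure in the library).\<close>
definition K_np :: "real \<Rightarrow> 'a::euclidean_space itself \<Rightarrow> real" where
  "K_np p _ = (real DIM('a) + p) *
     (LINT x:ball (0::'a) 1|lebesgue. \<bar>x \<bullet> e_dir\<bar> powr p)"

definition Ep_1 :: "(real \<Rightarrow> real) \<Rightarrow> real \<Rightarrow> ('a::euclidean_space \<Rightarrow> real) \<Rightarrow> 'a set \<Rightarrow> ennreal" where
  "Ep_1 W p u \<Omega> =
     (if W1p p \<Omega> u \<and> (AE x in lebesgue. x \<in> \<Omega> \<longrightarrow> \<bar>u x\<bar> \<le> 1) then
        ennreal (K_np p TYPE('a) / (2 * p)) *
          set_nn_integral lebesgue \<Omega> (\<lambda>x. ennreal (norm ((SOME G. weak_grad p \<Omega> u G) x) powr p))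
        + set_nn_integral lebesgue \<Omega> (\<lambda>x. ennreal (W (u x)))
      else \<infinity>)"

definition lsc_on_interval :: "(real \<Rightarrow> real) \<Rightarrow> bool" where
  "lsc_on_interval W \<longleftrightarrow> (\<forall>x\<in>{-1..1}. \<forall>c<W x. \<exists>d>0. \<forall>y\<in>{-1..1}. \<bar>y - x\<bar> < d \<longrightarrow> c < W y)"

end

theory Submission
 imports Defs "HOL-Library.Diagonal_Subsequence"
begin

text \<open>
  With the kernel \<open>k\<^sub>s(h) = (1 - s) |h|\<^sup>-\<^sup>(\<^sup>n\<^sup>+\<^sup>s\<^sup>p\<^sup>)\<close> the rescaled functional is a weighted average, over the translations \<open>h\<close>,
  of \<open>\<integral> |u(x + h) - u(x)|\<^sup>p dx\<close>, and the identity \<open>\<integral>\<^sub>|\<^sub>h\<^sub>|\<^sub><\<^sub>d k\<^sub>s(h) |h \<cdot> v|\<^sup>p dh = (K / p) d\<^sup>p\<^sup>(\<^sup>1\<^sup>-\<^sup>s\<^sup>) |v|\<^sup>p\<close>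
  with \<open>K = K_np\<close> fixes the constant of the limit.

  Lower bound: mollify at a fixed scale. By Jensen's inequality this does not increase the energy, a Taylor expansion turns
  the difference quotients into gradients, and \<open>s \<rightarrow> 1\<close> bounds the mollified gradients in \<open>L\<^sup>p\<close>. Removing the mollification
  needs weak compactness only, which is obtained by minimising a strictly convex functional over convex combinations of the tail.

  Compactness: averaging over small translations shows that mollification at scale \<open>e\<close> moves the functions by an amount
  that is small in \<open>L\<^sup>p\<close> uniformly in \<open>k\<close>; mollified sequences are precompact, and a diagonal argument concludes.

  Upper bound: a Sobolev function on a Lipschitz domain is extended by reflection across the boundary graph, a cut-off at a time.
  The extension is controlled through the translation condition \<open>AT\<close>, which survives reflections, cut-offs and sums. Pairs of
  points that straddle the boundary only see the gradient near the frontier, a null set.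

  Zero boundary values: localise by cut-offs, shift each piece into the domain along its chart direction, and mollify.
\<close>

text \<open>The obstacle is the boundary. Arguing with weak derivatives would call for a chain rule
  under Lipschitz changes of variables. Integrals of translation differences over small balls avoid
  it: they only feel how a map acts on measure and on distances, and the reflection across a
  Lipschitz graph preserves measure and is Lipschitz. To return from such integrals to a weak
  gradient, the lower bound is proved for abstract sequences of kernels. Normalised indicators of
  shrinking balls are admissible as well as the fractional kernels, so one argument yields both the
  liminf inequality and the criterion for being Sobolev. Sharp constants must survive every
  approximation. Errors are therefore split off with a weight \<open>l\<close>: the main term is
  multiplied by \<open>(1 - l) powr (1 - p)\<close>, only the error pays
  \<open>l powr (1 - p)\<close>, and \<open>l\<close> tends to 0 last. In the compactness part the
  zero extension of a function on the domain has no controlled energy across the boundary, so a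
  Lipschitz cut-off is applied first. Its cost does not depend on the index, because the
  \<open>p\<close>-th moments of the kernels over the unit ball are bounded.\<close>

abbreviation nn_lborel :: "('a::euclidean_space \<Rightarrow> ennreal) \<Rightarrow> ennreal" (binder "NN " 10) where
  "nn_lborel f \<equiv> integral\<^sup>N lborel f"

abbreviation integral_lborel :: "('a::euclidean_space \<Rightarrow> real) \<Rightarrow> real" (binder "LL " 10) where
  "integral_lborel f \<equiv> integral\<^sup>L lborel f"

abbreviation pw :: "real \<Rightarrow> real \<Rightarrow> ennreal" where "pw p a \<equiv> ennreal (\<bar>a\<bar> powr p)"

abbreviation dd :: "('a::euclidean_space \<Rightarrow> real) \<Rightarrow> 'a \<Rightarrow> 'a \<Rightarrow> real" where
  "dd f x \<equiv> frechet_derivative f (at x)"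

notation indicator ("ind")

notation ennreal ("en")

notation LIMSEQ (infixr "---->" 60)

abbreviation bmeas :: "('a::euclidean_space \<Rightarrow> 'b::topological_space) set" where "bmeas \<equiv> borel_measurable borel"


section \<open>Elementary inequalities for powers\<close>

lemma ball_borel_measurable [measurable]: "ball x r : sets borel"
 by auto

text \<open>The tangent of \<open>t powr p\<close> at \<open>c\<close> lies below the graph. Leaving
  the point of tangency \<open>c\<close> free turns Jensen's inequality into a mere integration of
  this bound.\<close>

lemma young_tangent:
 fixes p f c :: real
 assumes "1 <= p" "0 <= f" "0 <= c"
 shows "p * c powr (p - 1) * f <= f powr p + (p - 1) * c powr p"
proof (cases "p = 1")
 case True
 then show ?thesis using assms by (cases "c = 0") auto
next
 case False
 with assms have p: "1 < p" by auto
 define q where "q = p / (p - 1)"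
 have q: "q > 1" "1 / p + 1 / q = 1" using p by (auto simp: q_def field_simps)
 have "f * c powr (p - 1) <= f powr p / p + (c powr (p - 1)) powr q / q"
  using p q assms by (intro Youngs_inequality) auto
 also have "(c powr (p - 1)) powr q = c powr p"
  using p by (simp add: powr_powr q_def)
 finally show ?thesis using p by (simp add: q_def field_simps)
qed

text \<open>Convexity of the power at \<open>(1 - l) * (b / (1 - l)) + l * (c / l)\<close>. In
  contrast to the crude factor \<open>2 powr p\<close>, the factor of \<open>b\<close> tends to 1
  with \<open>l\<close>, so sharp constants survive when \<open>c\<close> is an error term.\<close>

lemma powr_add_weighted:
 fixes p b c l :: real
 assumes p: "1 <= p" and "0 <= b" "0 <= c" and l: "0 < l" "l < 1"
 shows "(b + c) powr p <= (1 - l) powr (1 - p) * b powr p + l powr (1 - p) * c powr p"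
proof -
 define s where "s = b + c"
 have s: "0 <= s" using assms by (simp add: s_def)
 have t: "k * (p * s powr (p - 1) * (f / k)) <= k powr (1 - p) * f powr p + k * ((p - 1) * s powr p)"
  if "0 < k" "0 <= f" for k f
 proof -
  have "k * (p * s powr (p - 1) * (f / k)) <= k * ((f / k) powr p + (p - 1) * s powr p)"
   using that young_tangent[of p "f / k" s] p s by (intro mult_left_mono) auto
  moreover have "k * (f / k) powr p = k powr (1 - p) * f powr p"
   using that by (simp add: powr_divide powr_diff)
  ultimately show ?thesis by (simp only: distrib_left)
 qed
 have t': "p * s powr (p - 1) * f <= k powr (1 - p) * f powr p + k * ((p - 1) * s powr p)"
  if "0 < k" "0 <= f" for k f
  using t[OF that] that by simp
 have "p * s powr (p - 1) * b + p * s powr (p - 1) * c <=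
  (1 - l) powr (1 - p) * b powr p + l powr (1 - p) * c powr p + (p - 1) * s powr p"
  using t'[of "1 - l" b] t'[of l c] l assms by (simp add: left_diff_distrib)
 moreover have "p * s powr (p - 1) * b + p * s powr (p - 1) * c = p * s powr p"
 proof (cases "s = 0")
  case True
  then show ?thesis using assms by (simp add: s_def)
 next
  case False
  have "p * s powr (p - 1) * b + p * s powr (p - 1) * c = p * (s powr (p - 1) * s)"
   by (simp add: s_def distrib_left)
  also have "s powr (p - 1) * s = s powr p"
   using s False by (simp add: powr_diff)
  finally show ?thesis .
 qed
 ultimately show ?thesis by (simp add: s_def left_diff_distrib)
qed

lemma powr_add_le2:
 fixes p a b :: real
 assumes "0 <= p" "0 <= a" "0 <= b"
 shows "(a + b) powr p <= 2 powr p * (a powr p + b powr p)"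
proof -
 have "(a + b) powr p <= (2 * max a b) powr p"
  using assms by (intro powr_mono2) auto
 also have "... = 2 powr p * max a b powr p" using assms by (intro powr_mult)
 also have "max a b powr p <= a powr p + b powr p" by (auto simp: max_def)
 finally show ?thesis by (simp add: mult_left_mono)
qed

lemma powr_add_le3:
 fixes p a b c :: real
 assumes "0 <= p" "0 <= a" "0 <= b" "0 <= c"
 shows "(a + b + c) powr p <= 3 powr p * (a powr p + b powr p + c powr p)"
proof -
 have "(a + b + c) powr p <= (3 * max a (max b c)) powr p"
  using assms by (intro powr_mono2) auto
 also have "... = 3 powr p * max a (max b c) powr p" using assms by (intro powr_mult)
 also have "max a (max b c) powr p <= a powr p + b powr p + c powr p"
  by (auto simp: max_def)
 finally show ?thesis by (simp add: mult_left_mono)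
qed

text \<open>Integrate the tangent inequality at \<open>c\<close> against \<open>w\<close>. Mass at
  most 1 is enough because the term that it multiplies, \<open>(p - 1) * c powr p\<close>, is
  nonnegative; this finite term is cancelled at the end.\<close>

lemma jensen_powr_nn:
 fixes w f :: "'b => real"
 assumes p: "1 <= p" and [measurable]: "w : borel_measurable M" "f : borel_measurable M"
  and w: "!!x. 0 <= w x" and f: "!!x. 0 <= f x" and one: "(\<integral>\<^sup>+x. en (w x) \<partial>M) <= 1"
  and c: "0 <= c" "en c <= (\<integral>\<^sup>+x. en (w x * f x) \<partial>M)"
 shows "en (c powr p) <= (\<integral>\<^sup>+x. en (w x * f x powr p) \<partial>M)"
proof -
 have "en (p * c powr (p - 1)) * en c <= en (p * c powr (p - 1)) * (\<integral>\<^sup>+x. en (w x * f x) \<partial>M)"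
  by (intro mult_left_mono c) auto
 also have "... = (\<integral>\<^sup>+x. en (p * c powr (p - 1) * (w x * f x)) \<partial>M)"
  using p c w f by (subst nn_integral_cmult[symmetric]) (auto simp: ennreal_mult'')
 also have "... <= (\<integral>\<^sup>+x. en (w x * f x powr p) + en ((p - 1) * c powr p) * en (w x) \<partial>M)"
 proof (rule nn_integral_mono)
  fix x
  have "w x * (p * c powr (p - 1) * f x) <= w x * (f x powr p + (p - 1) * c powr p)"
   using p c w f by (intro mult_left_mono young_tangent) auto
  then show "en (p * c powr (p - 1) * (w x * f x)) <= en (w x * f x powr p) + en ((p - 1) * c powr p) * en (w x)"
   using p c(1) w[of x] f[of x] mult_nonneg_nonneg[of "p - 1" "w x * c powr p"]
   unfolding ennreal_mult''[OF w[of x], symmetric]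
   by (subst ennreal_plus[symmetric]) (auto simp: algebra_simps intro!: ennreal_leI)
 qed
 also have "... = (\<integral>\<^sup>+x. en (w x * f x powr p) \<partial>M) + en ((p - 1) * c powr p) * (\<integral>\<^sup>+x. en (w x) \<partial>M)"
  by (subst nn_integral_add) (auto simp: nn_integral_cmult)
 also have "... <= (\<integral>\<^sup>+x. en (w x * f x powr p) \<partial>M) + en ((p - 1) * c powr p) * 1"
  using one by (intro add_mono mult_left_mono) auto
 finally have "en (p * c powr (p - 1)) * en c <= (\<integral>\<^sup>+x. en (w x * f x powr p) \<partial>M) + en ((p - 1) * c powr p)"
  by simp
 moreover have "en (p * c powr (p - 1)) * en c = en (c powr p) + en ((p - 1) * c powr p)"
 proof -
  have "p * c powr (p - 1) * c = c powr p + (p - 1) * c powr p"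
   using c by (cases "c = 0") (simp_all add: powr_diff left_diff_distrib)
  then show ?thesis using p c by (simp flip: ennreal_mult ennreal_plus)
 qed
 ultimately show ?thesis
  by (simp add: add.commute[of _ "en ((p - 1) * c powr p)"])
qed

section \<open>Changes of variables for Lebesgue measure\<close>

lemma nn_integral_translate:
 fixes f :: "'a::euclidean_space => ennreal"
 assumes [measurable]: "f : bmeas"
 shows "(NN x. f (x + a)) = (NN x. f x)"
 by (subst lborel_distr_plus[of a, symmetric]) (subst nn_integral_distr, auto simp: add.commute)

lemma nn_integral_scaleR:
 fixes f :: "'a::euclidean_space => ennreal"
 assumes [measurable]: "f : bmeas" and c: "c ~= 0"
 shows "(NN x. f x) = en (abs c ^ DIM('a)) * (NN x. f (c *\<^sub>R x))"
proof -
 have "(NN x. f x) = (\<integral>\<^sup>+x. f x \<partial>density (distr lborel borel (%x. 0 + c *\<^sub>R x)) (%_. abs c^DIM('a)))"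
  by (subst lborel_affine[OF c, of 0]) (rule refl)
 then show ?thesis by (simp add: nn_integral_density nn_integral_distr nn_integral_cmult)
qed

lemma nn_integral_reflect:
 fixes f :: "'a::euclidean_space => ennreal"
 assumes [measurable]: "f : bmeas"
 shows "(NN x. f (a - x)) = (NN x. f x)"
proof -
 have "(NN x. f x) = (NN x. f (x + a))" by (simp add: nn_integral_translate)
 also have "... = (NN x. f (-1 *\<^sub>R x + a))"
  by (subst nn_integral_scaleR[of _ "-1"]) auto
 finally show ?thesis by (simp add: algebra_simps)
qed

text \<open>Invariance without determinants: multiply by the volume \<open>b\<close> of the unit
  ball, insert an average over translations by points of that ball, and exchange the integrals.
  Since \<open>T\<close> preserves norms, the set of admissible \<open>y\<close> for a given
  \<open>x\<close> is again a unit ball, and \<open>b\<close>, which is finite and nonzero,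
  cancels.\<close>

lemma nn_integral_orthogonal_transformation:
 fixes f :: "'a::euclidean_space => ennreal" and T :: "'a => 'a"
 assumes [measurable]: "f : bmeas" and T: "orthogonal_transformation T"
 shows "(NN x. f (T x)) = (NN x. f x)"
proof -
 have lin: "linear T" using T by (simp add: orthogonal_transformation_def)
 then have [measurable]: "T : bmeas"
  by (intro borel_measurable_continuous_onI linear_continuous_on linear_conv_bounded_linear[THEN iffD1])
 obtain S where S: "!!x. T (S x) = x"
  using orthogonal_transformation_surj[OF T] by (metis surj_def)
 let ?B = "ball (0::'a) 1" and ?I = "%g. (NN x. g x)"
 define b where "b = emeasure lborel ?B"
 have b: "b ~= 0" "b ~= \<infinity>"
  using unit_ball_vol_pos[of "real DIM('a)"] by (simp_all add: b_def emeasure_ball del: unit_ball_vol_pos)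
 have "b * ?I (%y. f (T y)) = (NN x. ind ?B x * ?I (%y. f (T y)))"
  by (subst nn_integral_multc) (auto simp: b_def)
 also have "... = (NN x. ind ?B x * (NN y. f (T y + x)))"
 proof (rule nn_integral_cong)
  fix x
  have "(NN y. f (T y + x)) = (NN y. f (T (y + S x)))"
   by (simp add: linear_add[OF lin] S)
  also have "... = ?I (%y. f (T y))" by (rule nn_integral_translate) measurable
  finally show "ind ?B x * ?I (%y. f (T y)) = ind ?B x * (NN y. f (T y + x))" by simp
 qed
 also have "... = (NN x. (NN y. ind ?B x * f (T y + x)))"
  by (simp add: nn_integral_cmult)
 also have "... = (NN y. (NN x. ind ?B x * f (T y + x)))"
  by (rule lborel_pair.Fubini') measurable
 also have "... = (NN y. (NN x. ind ?B (x - T y) * f x))"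
 proof (rule nn_integral_cong)
  fix y
  show "(NN x. ind ?B x * f (T y + x)) = (NN x. ind ?B (x - T y) * f x)"
   using nn_integral_translate[of "%x. ind ?B (x - T y) * f x" "T y"] by (simp add: add.commute)
 qed
 also have "... = (NN x. (NN y. ind ?B (x - T y) * f x))"
  by (rule lborel_pair.Fubini') measurable
 also have "... = (NN x. b * f x)"
 proof (rule nn_integral_cong)
  fix x
  have "ind ?B (x - T y) = (ind ?B (S x - y) :: ennreal)" for y
   using orthogonal_transformation_norm[OF T, of "S x - y"] S[of x]
   by (auto simp: indicator_def linear_diff[OF lin])
  then have "(NN y. ind ?B (x - T y) * f x) = (NN y. ind ?B (S x - y)) * f x"
   by (simp add: nn_integral_multc)
  also have "(NN y. ind ?B (S x - y)) = b"
   using nn_integral_reflect[of "ind ?B" "S x"] by (simp add: b_def)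
  finally show "(NN y. ind ?B (x - T y) * f x) = b * f x" .
 qed
 also have "... = b * ?I f" by (simp add: nn_integral_cmult)
 finally show ?thesis using b by (simp add: ennreal_mult_cancel_left)
qed

text \<open>The Householder reflection in the hyperplane orthogonal to \<open>a - b\<close>
  exchanges \<open>a\<close> and \<open>b\<close>, because their norms agree.\<close>

lemma orthogonal_transformation_ex_unit:
 fixes a b :: "'a::euclidean_space"
 assumes "norm a = 1" "norm b = 1"
 obtains T where "orthogonal_transformation T" "T a = b"
proof (cases "a = b")
 case True
 then show ?thesis using that[of "%x. x"] by (simp add: orthogonal_transformation_id)
next
 case False
 define w where "w = a - b"
 define T where "T x = x - (2 * (x \<bullet> w) / (w \<bullet> w)) *\<^sub>R w" for x
 have ww: "w \<bullet> w ~= 0" using False by (simp add: w_def)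
 have lin: "linear T"
  by (rule linearI) (auto simp: T_def inner_add_left algebra_simps add_divide_distrib)
 have "T x \<bullet> T y = x \<bullet> y" for x y
  using ww by (simp add: T_def inner_diff_left inner_diff_right inner_commute field_simps)
 moreover have "T a = b"
 proof -
  have aa: "a \<bullet> a = 1" "b \<bullet> b = 1" using assms by (auto simp: norm_eq_1)
  have "w \<bullet> w = 2 * (a \<bullet> w)"
   by (simp add: w_def inner_diff_left inner_diff_right aa inner_commute)
  then have "2 * (a \<bullet> w) / (w \<bullet> w) = 1" using ww by (simp del: inner_eq_zero_iff)
  then have "T a = a - 1 *\<^sub>R w" unfolding T_def by (simp only:)
  then show ?thesis by (simp add: w_def)
 qed
 ultimately show ?thesis using that lin by (auto simp: orthogonal_transformation_def)
qed

section \<open>The constant of the limit energy and radial integrals\<close>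

lemma norm_e_dir: "norm (e_dir::'a::euclidean_space) = 1"
 unfolding e_dir_def by (rule someI2_ex) auto

text \<open>\<open>K_np\<close> is \<open>DIM('a) + p\<close> times this ball integral. The factor
  is kept apart because it reappears on its own from the radial integration of the kernel.\<close>

definition cnp :: "real => 'a::euclidean_space itself => real" where
 "cnp p _ = (LINT x:ball (0::'a) 1|lebesgue. abs(x \<bullet> e_dir) powr p)"

lemma nn_integral_cnp:
 assumes "0 <= p"
 shows "(NN x. pw p (x \<bullet> e_dir) * ind (ball (0::'a::euclidean_space) 1) x)
  = en (cnp p TYPE('a))"
proof -
 let ?f = "%x::'a. ind (ball 0 1) x * abs(x \<bullet> e_dir) powr p"
 have bd: "abs(x \<bullet> e_dir) powr p <= 1" if "x : ball 0 1" for x :: 'a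
  using that assms norm_e_dir[where ?'a='a] Cauchy_Schwarz_ineq2[of x "e_dir::'a"]
  by (intro powr_le1) auto
 have int: "integrable lborel ?f"
  by (rule integrableI_bounded_set[where A="ball 0 1" and B=1])
   (auto simp: indicator_def bd emeasure_ball intro!: AE_I2)
 have "cnp p TYPE('a) = integral\<^sup>L lborel ?f"
  unfolding cnp_def set_lebesgue_integral_def by (subst integral_completion) auto
 then have "en (cnp p TYPE('a)) = (NN x. en (?f x))"
  using int by (subst nn_integral_eq_integral) auto
 then show ?thesis by (auto simp: indicator_def intro!: nn_integral_cong)
qed

lemma cnp_nonneg: "0 <= cnp p TYPE('a::euclidean_space)"
 unfolding cnp_def set_lebesgue_integral_def by (intro Bochner_Integration.integral_nonneg) auto

text \<open>Otherwise almost all of the unit ball would lie in the hyperplane orthogonal to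
  \<open>e_dir\<close>.\<close>

lemma cnp_pos:
 assumes "0 <= p"
 shows "0 < cnp p TYPE('a::euclidean_space)"
proof (rule ccontr)
 assume "~  ?thesis"
 then have "cnp p TYPE('a) = 0" using cnp_nonneg[of p, where ?'a='a] by linarith
 then have "AE x::'a in lborel. pw p (x \<bullet> e_dir) * ind (ball (0::'a) 1) x = 0"
  using nn_integral_cnp[OF assms, where ?'a='a] by (subst nn_integral_0_iff_AE[symmetric]) auto
 then have "AE x::'a in lborel. x : ball 0 1 --> x \<bullet> e_dir = 0"
  by (rule AE_mp) (auto simp: indicator_def split: if_splits)
 moreover have "AE x::'a in lebesgue. x ~: {x. e_dir \<bullet> x = 0}"
 proof (rule AE_not_in)
  have "(e_dir::'a) ~= 0" using norm_e_dir[where ?'a='a] by force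
  then show "{x. e_dir \<bullet> x = 0} : null_sets (lebesgue :: 'a measure)"
   using negligible_hyperplane[of "e_dir::'a" 0] by (simp add: negligible_iff_null_sets)
 qed
 ultimately have "AE x::'a in lborel. x ~: ball 0 1"
  by (auto simp: AE_completion_iff inner_commute)
 then have "emeasure lborel (ball (0::'a) 1) = 0"
  by (subst (asm) AE_iff_measurable[of "ball 0 1"]) auto
 moreover have "emeasure lborel (ball (0::'a) 1) > 0"
  using content_ball_pos[of 1 "0::'a"] emeasure_lborel_ball_finite[of "0::'a" 1]
  by (simp add: emeasure_eq_ennreal_measure)
 ultimately show False by simp
qed

text \<open>Rotate the direction of \<open>v\<close> to \<open>e_dir\<close> and scale by
  \<open>r\<close>: the volume element gives \<open>r ^ DIM('a)\<close> and the homogeneity of the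
  integrand gives \<open>r powr p\<close>.\<close>

lemma nn_integral_ball_inner_powr:
 fixes v :: "'a::euclidean_space"
 assumes p: "0 < p" and r: "0 < r"
 shows "(NN x. pw p (x \<bullet> v) * ind (ball 0 r) x)
  = en (norm v powr p * r powr (real DIM('a) + p) * cnp p TYPE('a))"
proof (cases "v = 0")
 case True
 then show ?thesis using p by simp
next
 case False
 obtain T where T: "orthogonal_transformation T" "T (v /\<^sub>R norm v) = (e_dir::'a)"
  using orthogonal_transformation_ex_unit[of "v /\<^sub>R norm v" "e_dir::'a"] False norm_e_dir[where ?'a='a]
  by (metis norm_sgn sgn_div_norm)
 have lin: "linear T" using T by (simp add: orthogonal_transformation_def)
 then have [measurable]: "T : bmeas"
  by (intro borel_measurable_continuous_onI linear_continuous_on linear_conv_bounded_linear[THEN iffD1])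
 have Tv: "x \<bullet> v = norm v * (T x \<bullet> e_dir)" for x
 proof -
  have "x \<bullet> v = norm v * (x \<bullet> (v /\<^sub>R norm v))" using False by simp
  also have "x \<bullet> (v /\<^sub>R norm v) = T x \<bullet> T (v /\<^sub>R norm v)"
   using T(1) unfolding orthogonal_transformation_def by metis
  finally show ?thesis by (simp only: T(2))
 qed
 have rn: "r powr real DIM('a) = r ^ DIM('a)" using r by (simp add: powr_realpow)
 have "(NN x. pw p (x \<bullet> v) * ind (ball 0 r) x)
  = (NN x. en (norm v powr p * abs(T x \<bullet> e_dir) powr p) * ind (ball 0 r) (T x))"
  by (intro nn_integral_cong) (simp add: Tv abs_mult powr_mult indicator_def orthogonal_transformation_norm[OF T(1)])
 also have "... = (NN x. en (norm v powr p * abs(x \<bullet> e_dir) powr p) * ind (ball (0::'a) r) x)"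
  by (rule nn_integral_orthogonal_transformation[OF _ T(1)]) measurable
 also have "... = en (r ^ DIM('a)) * (NN x. en (norm v powr p * abs((r *\<^sub>R x) \<bullet> e_dir) powr p) * ind (ball (0::'a) r) (r *\<^sub>R x))"
  using r by (subst nn_integral_scaleR[of _ r]) auto
 also have "(NN x. en (norm v powr p * abs((r *\<^sub>R x) \<bullet> e_dir) powr p) * ind (ball (0::'a) r) (r *\<^sub>R x))
  = (NN x. en (norm v powr p * r powr p) * (pw p (x \<bullet> e_dir) * ind (ball (0::'a) 1) x))"
  using r by (intro nn_integral_cong) (simp add: abs_mult powr_mult indicator_def mult.assoc flip: ennreal_mult)
 also have "... = en (norm v powr p * r powr p) * en (cnp p TYPE('a))"
  using p by (subst nn_integral_cmult) (auto simp: nn_integral_cnp)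
 finally show ?thesis using r cnp_nonneg[of p, where ?'a='a]
  by (simp add: powr_add rn ennreal_mult'[symmetric] mult_ac)
qed


text \<open>A substitute for polar coordinates. Writing \<open>norm x powr - a\<close> as
  \<open>d powr - a\<close> plus the integral of \<open>a * r powr (- a - 1)\<close> over
  \<open>r\<close> between \<open>norm x\<close> and \<open>d\<close> reduces the weighted integral
  to the ball integrals of \<open>phi\<close>. The condition \<open>a < b\<close> makes the
  remaining integral over \<open>r\<close> converge at 0.\<close>

lemma nn_integral_powr_ball:
 fixes phi :: "'a::euclidean_space => ennreal"
 assumes [measurable]: "phi : bmeas"
  and phi: "!!r. 0 < r ==> (NN x. phi x * ind (ball 0 r) x) = en (C * r powr b)"
  and C: "0 <= C" and ab: "0 < a" "a < b" and d: "0 < d"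
 shows "(NN x. phi x * en (norm x powr - a) * ind (ball 0 d) x)
  = en (C * b / (b - a) * d powr (b - a))"
proof -
 let ?k = "%r. en (a * r powr (- a - 1))"
 have rep: "en (norm x powr - a) = en (d powr - a) + (NN r. ?k r * ind {0<..d} r * ind (ball 0 r) x)"
  if x: "x ~= 0" "norm x < d" for x :: 'a
 proof -
  have "(NN r. ?k r * ind {norm x..d} r) = en (- (d powr - a) - (- (norm x powr - a)))"
  proof (rule nn_integral_FTC_Icc)
   fix r assume r: "r : {norm x..d}"
   then have "0 < r" using x by (smt (verit) zero_less_norm_iff atLeastAtMost_iff)
   then show "((%r. - (r powr - a)) has_real_derivative a * r powr (- a - 1)) (at r)"
    by (auto intro!: derivative_eq_intros)
   show "0 <= a * r powr (- a - 1)" using ab by simp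
  qed (use x in auto)
  also have "(NN r. ?k r * ind {norm x..d} r)
    = (NN r. ?k r * ind {0<..d} r * ind (ball 0 r) x)"
   using AE_lborel_singleton[of "norm x"]
   by (intro nn_integral_cong_AE, elim AE_mp) (use x in \<open>auto simp: indicator_def intro!: AE_I2 dest: le_less_trans[OF norm_ge_zero]\<close>)
  finally have "(NN r. ?k r * ind {0<..d} r * ind (ball 0 r) x) = en (norm x powr - a - d powr - a)"
   by simp
  moreover have "d powr - a <= norm x powr - a"
   using x ab by (intro powr_mono2') auto
  ultimately show ?thesis by (simp flip: ennreal_plus)
 qed
 have [measurable]: "Measurable.pred (borel \<Otimes>\<^sub>M borel) (%z::'a \<times> real. fst z : ball 0 (snd z))"
  "Measurable.pred (borel \<Otimes>\<^sub>M borel) (%z::real \<times> 'a. snd z : ball 0 (fst z))"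
  "!!x::'a. Measurable.pred borel (%r. x : ball 0 r)"
  by (simp_all add: dist_norm)
 have "(NN x. phi x * en (norm x powr - a) * ind (ball 0 d) x)
  = (NN x. phi x * (en (d powr - a) + (NN r. ?k r * ind {0<..d} r * ind (ball 0 r) x)) * ind (ball 0 d) x)"
  using AE_lborel_singleton[of "0::'a"]
  by (intro nn_integral_cong_AE, elim AE_mp) (auto simp: indicator_def rep intro!: AE_I2)
 also have "... = (NN x. en (d powr - a) * (phi x * ind (ball 0 d) x) + (NN r. phi x * ind (ball 0 d) x * (?k r * ind {0<..d} r * ind (ball 0 r) x)))"
  by (intro nn_integral_cong, subst nn_integral_cmult) (simp_all add: distrib_left distrib_right mult_ac)
 also have "... = en (d powr - a) * (NN x. phi x * ind (ball 0 d) x) + (NN x. (NN r. phi x * ind (ball 0 d) x * (?k r * ind {0<..d} r * ind (ball 0 r) x)))"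
  by (subst nn_integral_add) (auto simp: nn_integral_cmult)
 also have "(NN x. (NN r. phi x * ind (ball 0 d) x * (?k r * ind {0<..d} r * ind (ball 0 r) x)))
  = (NN r. (NN x. phi x * ind (ball 0 d) x * (?k r * ind {0<..d} r * ind (ball 0 r) x)))"
  by (rule lborel_pair.Fubini') measurable
 also have "... = (NN r. en (ind {0..d} r * (a * C * r powr (b - a - 1))))"
 proof (rule nn_integral_cong)
  fix r :: real
  show "(NN x. phi x * ind (ball 0 d) x * (?k r * ind {0<..d} r * ind (ball 0 r) x)) = en (ind {0..d} r * (a * C * r powr (b - a - 1)))"
  proof (cases "0 < r & r <= d")
   case True
   then have "(NN x. phi x * ind (ball 0 d) x * (?k r * ind {0<..d} r * ind (ball 0 r) x))
    = (NN x. ?k r * (phi x * ind (ball 0 r) x))"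
    by (intro nn_integral_cong) (auto simp: indicator_def mult_ac)
   also have "... = ?k r * en (C * r powr b)"
    using True by (simp add: nn_integral_cmult phi)
   also have "... = en (a * C * (r powr (- a - 1) * r powr b))"
    using ab C by (subst ennreal_mult'[symmetric]) (auto simp: mult_ac)
   also have "r powr (- a - 1) * r powr b = r powr (b - a - 1)"
    by (simp add: algebra_simps flip: powr_add)
   finally show ?thesis using True by simp
  qed (auto simp: indicator_def)
 qed
 also have "... = en (a * C * (d powr (b - a) / (b - a)))"
 proof (rule nn_integral_has_integral_lebesgue)
  have "((%r. r powr (b - a - 1)) has_integral (d powr (b - a - 1 + 1) / (b - a - 1 + 1))) {0..d}"
   using ab d by (intro has_integral_powr_from_0) auto
  then show "((%r. a * C * r powr (b - a - 1)) has_integral (a * C * (d powr (b - a) / (b - a)))) {0..d}"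
   by (intro has_integral_mult_right) simp
 qed (use ab C in auto)
 finally have "(NN x. phi x * en (norm x powr - a) * ind (ball 0 d) x)
  = en (d powr - a * (C * d powr b)) + en (a * C * (d powr (b - a) / (b - a)))"
  using C by (simp add: phi[OF d] ennreal_mult'')
 also have "... = en (d powr - a * (C * d powr b) + a * C * (d powr (b - a) / (b - a)))"
  using C ab by (subst ennreal_plus[symmetric]) (auto intro!: divide_nonneg_pos mult_nonneg_nonneg)
 also have "d powr - a * (C * d powr b) = C * d powr (b - a)"
  using d by (simp add: powr_minus powr_diff field_simps)
 also have "C * d powr (b - a) + a * C * (d powr (b - a) / (b - a)) = C * b / (b - a) * d powr (b - a)"
  using ab by (simp add: field_simps)
 finally show ?thesis .
qed

text \<open>The same layer-cake argument outside a ball, with \<open>r\<close> running to infinity.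
  Filling in the removed ball only worsens the constant, and \<open>DIM('a) < a\<close> gives
  convergence.\<close>

lemma nn_integral_powr_tail:
 assumes a: "real DIM('a::euclidean_space) < a" and d: "0 < d"
 shows "(NN x. en (norm x powr - a) * ind (- ball (0::'a) d) x)
  <= en (a * unit_ball_vol (real DIM('a)) * d powr (real DIM('a) - a) / (a - real DIM('a)))"
proof -
 define n where "n = real DIM('a)"
 have n: "0 < n" "n < a" using a by (auto simp: n_def)
 let ?k = "%r. en (a * r powr (- a - 1))"
 have lim0: "((%r. r powr - c) \<longlongrightarrow> 0) at_top" if "0 < c" for c :: real
  using that by (intro tendsto_neg_powr filterlim_ident) auto
 have rep: "en (norm x powr - a) = (NN r. ?k r * ind {norm x..} r)" if x: "x ~= 0" for x :: 'a
 proof -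
  have "(NN r. ?k r * ind {norm x..} r) = en (- 0 - (- (norm x powr - a)))"
  proof (rule nn_integral_FTC_atLeast)
   fix r assume r: "norm x <= r"
   then have "0 < r" using x by (smt (verit) zero_less_norm_iff)
   then show "((%r. - (r powr - a)) has_real_derivative a * r powr (- a - 1)) (at r)"
    by (auto intro!: derivative_eq_intros)
   show "0 <= a * r powr (- a - 1)" using n by simp
  next
   show "((%r. - (r powr - a)) \<longlongrightarrow> - 0) at_top"
    using n lim0[of a] by (intro tendsto_minus) auto
  qed auto
  then show ?thesis by simp
 qed
 have [measurable]: "Measurable.pred (borel \<Otimes>\<^sub>M borel) (%z::'a \<times> real. norm (fst z) <= snd z)" by measurable
 have "(NN x. en (norm x powr - a) * ind (- ball (0::'a) d) x)
  = (NN x. (NN r. ?k r * ind {z. norm (fst z) <= snd z} (x, r) * ind (- ball (0::'a) d) x))"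
 proof (rule nn_integral_cong)
  fix x :: 'a
  show "en (norm x powr - a) * ind (- ball (0::'a) d) x = (NN r. ?k r * ind {z. norm (fst z) <= snd z} (x, r) * ind (- ball (0::'a) d) x)"
  proof (cases "x : ball 0 d")
   case False
   then have "x ~= 0" using d by auto
   moreover have "ind {z. norm (fst z) <= snd z} (x, r) = (ind {norm x..} r :: ennreal)" for r
    by (auto simp: indicator_def)
   ultimately show ?thesis using False by (simp add: rep)
  qed auto
 qed
 also have "... = (NN r. (NN x. ?k r * ind {z. norm (fst z) <= snd z} (x, r) * ind (- ball (0::'a) d) x))"
  by (rule lborel_pair.Fubini') measurable
 also have "... <= (NN r. en (a * unit_ball_vol n * r powr (n - a - 1)) * ind {d..} r)"
 proof (rule nn_integral_mono)
  fix r :: real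
  show "(NN x. ?k r * ind {z. norm (fst z) <= snd z} (x, r) * ind (- ball (0::'a) d) x)
   <= en (a * unit_ball_vol n * r powr (n - a - 1)) * ind {d..} r"
  proof (cases "d <= r")
   case True
   then have r: "0 < r" using d by auto
   have "(NN x. ?k r * ind {z. norm (fst z) <= snd z} (x, r) * ind (- ball (0::'a) d) x)
    <= (NN x. ?k r * ind (cball (0::'a) r) x)"
    by (intro nn_integral_mono) (auto simp: indicator_def)
   also have "... = ?k r * emeasure lborel (cball (0::'a) r)"
    by (rule nn_integral_cmult_indicator) auto
   also have "... = ?k r * en (unit_ball_vol n * r powr n)"
    using r by (simp add: emeasure_cball n_def powr_realpow)
   also have "... = en (a * unit_ball_vol n * (r powr (- a - 1) * r powr n))"
    using n by (subst ennreal_mult'[symmetric]) (auto simp: mult_ac)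
   also have "r powr (- a - 1) * r powr n = r powr (n - a - 1)"
    by (simp add: algebra_simps flip: powr_add)
   finally show ?thesis using True by simp
  next
   case False
   then have "(NN x. ?k r * ind {z. norm (fst z) <= snd z} (x, r) * ind (- ball (0::'a) d) x)
    = (\<integral>\<^sup>+x. 0 \<partial>(lborel :: 'a measure))"
    by (intro nn_integral_cong) (auto simp: indicator_def)
   then show ?thesis by simp
  qed
 qed
 also have "... = en (- 0 - (- (a * unit_ball_vol n * d powr (n - a) / (a - n))))"
 proof (rule nn_integral_FTC_atLeast)
  fix r assume "d <= r"
  then have r: "0 < r" using d by auto
  define c where "c = a * unit_ball_vol n / (a - n)"
  have "((%r. - (c * r powr (n - a))) has_real_derivative - (c * ((n - a) * r powr (n - a - 1)))) (at r)"
   using r by (auto intro!: derivative_eq_intros)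
  moreover have "- (c * ((n - a) * r powr (n - a - 1))) = (c * (a - n)) * r powr (n - a - 1)"
   by (simp add: algebra_simps)
  moreover have "c * (a - n) = a * unit_ball_vol n" using n by (simp add: c_def)
  ultimately show "((%r. - (a * unit_ball_vol n * r powr (n - a) / (a - n))) has_real_derivative a * unit_ball_vol n * r powr (n - a - 1)) (at r)"
   by (simp add: c_def)
  show "0 <= a * unit_ball_vol n * r powr (n - a - 1)" using n by simp
 next
  have "((%r. a * unit_ball_vol n / (a - n) * r powr - (a - n)) \<longlongrightarrow> a * unit_ball_vol n / (a - n) * 0) at_top"
   using n by (intro tendsto_mult lim0 tendsto_const) auto
  then show "((%r. - (a * unit_ball_vol n * r powr (n - a) / (a - n))) \<longlongrightarrow> - 0) at_top"
   by (intro tendsto_minus) (simp add: algebra_simps)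
 qed auto
 finally show ?thesis by (simp add: n_def)
qed

section \<open>Smooth functions and a compactly supported bump\<close>

lemma smooth_fun_class:
 assumes C: "!!f. C f ==> EX f'. (ALL x. (f has_derivative f' x) (at x)) & (ALL v. C (%x. f' x v))"
  and f: "C f"
 shows "smooth_fun (f :: 'a::euclidean_space => real)"
proof -
 have D: "f differentiable at x & C (%x. dd f x v)" if Cf: "C f" for f x and v :: 'a
 proof -
  obtain f' where f': "!!x. (f has_derivative f' x) (at x)" "!!v. C (%x. f' x v)"
   using C[OF Cf] by auto
  then have "(%x. dd f x v) = (%x. f' x v)"
   by (metis frechet_derivative_at)
  then show ?thesis using f' by (auto simp: differentiable_def)
 qed
 \<comment> \<open>Closure of the class under one directional derivative carries through all lists
   of directions at once, so a concrete function only needs a suitable class and no induction of its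
   own.\<close>
 have "C (iter_dd vs f)" for vs by (induction vs) (use f D in auto)
 then show ?thesis unfolding smooth_fun_def using D by blast
qed

lemma smooth_funD:
 assumes "smooth_fun f"
 shows "(f has_derivative dd f x) (at x)"
 using assms iter_dd.simps(1) unfolding smooth_fun_def by (metis frechet_derivative_works)

lemma iter_dd_append: "iter_dd (vs @ ws) f = iter_dd vs (iter_dd ws f)"
 by (induction vs) auto

lemma smooth_fun_deriv:
 assumes "smooth_fun f"
 shows "smooth_fun (%x. dd f x v)"
proof -
 have "(%x. dd f x v) = iter_dd [v] f" by simp
 then show ?thesis using assms unfolding smooth_fun_def by (metis iter_dd_append)
qed

lemma smooth_fun_affine:
 assumes f: "smooth_fun f"
 shows "smooth_fun (%x. k * f (a + c *\<^sub>R x))"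
proof (rule smooth_fun_class[where C="%g. EX k h. smooth_fun h & g = (%x. k * h (a + c *\<^sub>R x))"])
 fix g assume "EX k h. smooth_fun h & g = (%x. k * h (a + c *\<^sub>R x))"
 then obtain k h where h: "smooth_fun h" and g: "g = (%x. k * h (a + c *\<^sub>R x))" by auto
 let ?D = "%x v. k * c * dd h (a + c *\<^sub>R x) v"
 have lin: "linear (dd h y)" for y
  using smooth_funD[OF h] has_derivative_linear by blast
 have "(g has_derivative ?D x) (at x)" for x
 proof -
  have "((%x. h (a + c *\<^sub>R x)) has_derivative (%v. dd h (a + c *\<^sub>R x) (c *\<^sub>R v))) (at x)"
   by (rule has_derivative_compose[OF _ smooth_funD[OF h]]) (auto intro!: derivative_eq_intros)
  then show ?thesis unfolding g
   by (auto intro!: derivative_eq_intros simp: linear_cmul[OF lin] algebra_simps)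
 qed
 moreover have "EX k' h'. smooth_fun h' & (%x. ?D x v) = (%x. k' * h' (a + c *\<^sub>R x))" for v
  using smooth_fun_deriv[OF h, of v] by blast
 ultimately show "EX f'. (ALL x. (g has_derivative f' x) (at x)) & (ALL v. EX k h. smooth_fun h & (%x. f' x v) = (%x. k * h (a + c *\<^sub>R x)))"
  by (intro exI[of _ ?D]) auto
qed (use f in auto)

lemma smooth_fun_add:
 assumes f: "smooth_fun f" and g: "smooth_fun g"
 shows "smooth_fun (%x. f x + g x)"
proof (rule smooth_fun_class[where C="%h. EX f g. smooth_fun f & smooth_fun g & h = (%x. f x + g x)"])
 fix h :: "'a => real" assume "EX f g. smooth_fun f & smooth_fun g & h = (%x. f x + g x)"
 then obtain f g where fg: "smooth_fun f" "smooth_fun g" "h = (%x. f x + g x)" by auto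
 let ?D = "%x v. dd f x v + dd g x v"
 have "(h has_derivative ?D x) (at x)" for x
  unfolding fg(3) by (intro has_derivative_add smooth_funD fg)
 then show "EX f'. (ALL x. (h has_derivative f' x) (at x)) & (ALL v. EX f g. smooth_fun f & smooth_fun g & (%x. f' x v) = (%x. f x + g x))"
  using fg smooth_fun_deriv by (intro exI[of _ ?D]) blast
qed (use f g in auto)

text \<open>The polynomial factor closes the family under differentiation: \<open>flat_exp 1\<close>
  is the classical function \<open>exp (- (1 / t))\<close> continued by 0, and all its derivatives
  are of this form.\<close>

definition flat_exp :: "real poly => real => real" where
 "flat_exp P t = (if t > 0 then poly P (1 / t) * exp (- (1 / t)) else 0)"

lemma tendsto_poly_exp_neg:
 "((%y::real. poly P y * exp (- y)) \<longlongrightarrow> 0) at_top"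
proof -
 have "((%y::real. \<Sum>i\<le>degree P. coeff P i * (y ^ i / exp y)) \<longlongrightarrow> (\<Sum>i\<le>degree P. coeff P i * 0)) at_top"
  by (intro tendsto_sum tendsto_mult tendsto_const tendsto_power_div_exp_0)
 moreover have "(\<Sum>i\<le>degree P. coeff P i * (y ^ i / exp y)) = poly P y * exp (- y)" for y
  unfolding poly_altdef sum_distrib_right by (simp add: exp_minus divide_inverse mult_ac)
 ultimately show ?thesis by simp
qed

text \<open>In the variable \<open>y = 1 / t\<close> the chain rule contributes
  \<open>- y ^ 2\<close>, and differentiating \<open>poly P y * exp (- y)\<close> replaces
  \<open>P\<close> by \<open>pderiv P - P\<close>.\<close>

lemma flat_exp_deriv:
 "(flat_exp P has_real_derivative flat_exp (monom 1 2 * (P - pderiv P)) t) (at t)"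
proof (cases t "0::real" rule: linorder_cases)
 case less
 have "((%t. 0) has_real_derivative 0) (at t)" by simp
 then show ?thesis
  by (rule DERIV_cong_ev[THEN iffD1, rotated -1])
   (use less in \<open>auto simp: flat_exp_def intro!: eventually_mono[OF eventually_nhds_in_open[of "{..<0}" t]]\<close>)
next
 case greater
 have "((%t. poly P (1 / t) * exp (- (1 / t))) has_real_derivative flat_exp (monom 1 2 * (P - pderiv P)) t) (at t)"
  using greater
  by (auto intro!: derivative_eq_intros simp: flat_exp_def poly_monom field_simps power2_eq_square)
 then show ?thesis
  by (rule DERIV_cong_ev[THEN iffD1, rotated -1])
   (use greater in \<open>auto simp: flat_exp_def intro!: eventually_mono[OF eventually_nhds_in_open[of "{0<..}" t]]\<close>)
next
 case equal
 \<comment> \<open>The difference quotient at 0 divides by \<open>h\<close>, that is, multiplies by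
   \<open>y = 1 / h\<close>; \<open>pCons 0 P\<close> is the polynomial \<open>y * P(y)\<close>, so
   the quotient again decays exponentially from the right.\<close>
 have "((%h. poly (pCons 0 P) (1 / h) * exp (- (1 / h))) \<longlongrightarrow> 0) (at_right 0)"
  using filterlim_compose[OF tendsto_poly_exp_neg[of "pCons 0 P"] filterlim_inverse_at_top_right]
  by (simp add: inverse_eq_divide)
 then have r: "((%h. flat_exp P h / h) \<longlongrightarrow> 0) (at_right 0)"
  by (rule Lim_transform_eventually) (auto simp: flat_exp_def eventually_at_filter)
 have "((%h. 0) \<longlongrightarrow> (0::real)) (at_left 0)" by simp
 then have l: "((%h. flat_exp P h / h) \<longlongrightarrow> 0) (at_left 0)"
  by (rule Lim_transform_eventually) (auto simp: flat_exp_def eventually_at_filter)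
 have "((%h. flat_exp P h / h) \<longlongrightarrow> 0) (at 0)" using l r by (simp add: filterlim_at_split)
 moreover have "flat_exp Q 0 = 0" for Q by (simp add: flat_exp_def)
 ultimately show ?thesis using equal by (simp add: DERIV_def)
qed

text \<open>The algebra generated by the flat exponentials of \<open>1 - x \<bullet> x\<close>, the
  linear functionals and the constants. Linear functionals are included because differentiating
  \<open>x \<bullet> x\<close> produces them.\<close>

inductive bump_class :: "('a::euclidean_space => real) => bool" where
 "bump_class (%x. flat_exp P (1 - x \<bullet> x))"
| "bump_class (%x. x \<bullet> v)"
| "bump_class (%x. c)"
| "bump_class f ==> bump_class g ==> bump_class (%x. f x + g x)"
| "bump_class f ==> bump_class g ==> bump_class (%x. f x * g x)"

lemma bump_class_deriv:
 assumes "bump_class f"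
 shows "EX f'. (ALL x. (f has_derivative f' x) (at x)) & (ALL v. bump_class (%x. f' x v))"
 using assms
proof induction
 case (1 P)
 let ?Q = "monom 1 2 * (P - pderiv P)"
 let ?D = "%x v. flat_exp ?Q (1 - x \<bullet> x) * (- 2 * (x \<bullet> v))"
 have "((%x. flat_exp P (1 - x \<bullet> x)) has_derivative ?D x) (at x)" for x :: 'a
 proof -
  have "((%x::'a. 1 - x \<bullet> x) has_derivative (%v. - 2 * (x \<bullet> v))) (at x)"
   by (auto intro!: derivative_eq_intros simp: inner_commute)
  then show ?thesis
   using has_derivative_compose[OF _ flat_exp_deriv[unfolded has_field_derivative_def], of "%x. 1 - x \<bullet> x" _ x UNIV P]
   by blast
 qed
 moreover have "bump_class (%x. ?D x v)" for v :: 'a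
  by (intro bump_class.intros(1,2,3,5))
 ultimately show ?case by (intro exI[of _ ?D]) auto
next
 case (2 v)
 have "((%x. x \<bullet> v) has_derivative (%w. w \<bullet> v)) (at x)" for x by (auto intro!: derivative_eq_intros)
 then show ?case using bump_class.intros(3) by (intro exI[of _ "%x w. w \<bullet> v"]) auto
next
 case (3 c)
 show ?case using bump_class.intros(3)[of 0] by (intro exI[of _ "%x w. 0"]) auto
next
 case (4 f g)
 then obtain f' g' where "!!x. (f has_derivative f' x) (at x)" "!!v. bump_class (%x. f' x v)"
  "!!x. (g has_derivative g' x) (at x)" "!!v. bump_class (%x. g' x v)" by blast
 then show ?case
  by (intro exI[of _ "%x v. f' x v + g' x v"]) (auto intro!: has_derivative_add bump_class.intros(4))
next
 case (5 f g)
 then obtain f' g' where "!!x. (f has_derivative f' x) (at x)" "!!v. bump_class (%x. f' x v)"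
  "!!x. (g has_derivative g' x) (at x)" "!!v. bump_class (%x. g' x v)" by blast
 then show ?case using 5
  by (intro exI[of _ "%x v. f x * g' x v + f' x v * g x"]) (auto intro!: has_derivative_mult bump_class.intros(4,5))
qed

definition bump :: "'a::euclidean_space => real" where
 "bump x = flat_exp 1 (1 - x \<bullet> x)"

lemma smooth_fun_bump: "smooth_fun bump"
 unfolding bump_def[abs_def]
 by (rule smooth_fun_class[of bump_class]) (auto intro: bump_class_deriv bump_class.intros(1))

lemma bump_nonneg: "0 <= bump x" and bump_le_1: "bump x <= 1"
 by (auto simp: bump_def flat_exp_def)

lemma bump_eq_0: "1 <= norm x ==> bump x = 0"
 by (auto simp: bump_def flat_exp_def power2_norm_eq_inner[symmetric] not_less one_le_power)

lemma bump_pos: "norm x < 1 ==> 0 < bump x"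
 by (auto simp: bump_def flat_exp_def power2_norm_eq_inner[symmetric] abs_square_less_1)


section \<open>Reflection, translation and bounded supports in Bochner integrals\<close>

lemma lborel_distr_reflect:
 fixes a :: "'a::euclidean_space"
 shows "distr lborel borel (%y. a - y) = lborel"
 by (subst lborel_affine[of "-1" a]) (auto simp: density_1 one_ennreal_def[symmetric])

lemma integral_reflect:
 fixes f :: "'a::euclidean_space => real"
 assumes [measurable]: "f : bmeas"
 shows "(LL y. f (a - y)) = (LL y. f y)"
 by (subst lborel_distr_reflect[of a, symmetric]) (subst integral_distr, auto)

lemma integral_translate:
 fixes f :: "'a::euclidean_space => real"
 assumes [measurable]: "f : bmeas"
 shows "(LL y. f (y + a)) = (LL y. f y)"
 by (subst lborel_distr_plus[of a, symmetric]) (subst integral_distr, auto simp: add.commute)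

lemma integrable_translate:
 fixes f :: "'a::euclidean_space => real"
 assumes "integrable lborel f"
 shows "integrable lborel (%y. f (y + a))"
proof -
 have [measurable]: "f : bmeas" using borel_measurable_integrable[OF assms] by simp
 have "integrable (distr lborel borel ((+) a)) f" using assms by (simp add: lborel_distr_plus)
 then show ?thesis by (subst (asm) integrable_distr_eq) (auto simp: add.commute)
qed

lemma integrable_reflect:
 fixes f :: "'a::euclidean_space => real"
 assumes "integrable lborel f"
 shows "integrable lborel (%y. f (a - y))"
proof -
 have [measurable]: "f : bmeas" using borel_measurable_integrable[OF assms] by simp
 have "integrable (distr lborel borel (%y. a - y)) f" using assms by (simp add: lborel_distr_reflect)
 then show ?thesis by (subst (asm) integrable_distr_eq) auto
qed

lemma emeasure_lborel_bounded:
 assumes "bounded S"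
 shows "emeasure lborel S < \<infinity>"
proof -
 obtain a r where "S \<subseteq> ball a r" using assms bounded_subset_ballD by blast
 then have "emeasure lborel S <= emeasure lborel (ball a r)" by (intro emeasure_mono) auto
 also have "... < \<infinity>" by (rule emeasure_lborel_ball_finite)
 finally show ?thesis .
qed

lemma integrable_bounded_support:
 fixes f :: "'a::euclidean_space => real"
 assumes "f : bmeas" "!!x. abs(f x) <= B" "bounded S" "!!x. x ~: S ==> f x = 0"
 shows "integrable lborel f"
proof -
 obtain a r where r: "S \<subseteq> ball a r" using assms(3) bounded_subset_ballD by blast
 then have "!!x. x ~: ball a r ==> f x = 0" using assms by blast
 then show ?thesis
  by (intro integrableI_bounded_set[where A="ball a r" and B=B])
   (use assms emeasure_lborel_ball_finite[of a r] in \<open>auto intro!: AE_I2\<close>)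
qed

subsection \<open>Test functions\<close>

lemma smooth_fun_continuous: "smooth_fun f ==> continuous_on S f"
 using smooth_funD by (metis continuous_at_imp_continuous_on has_derivative_continuous)

lemma smooth_fun_borel: "smooth_fun f ==> f : bmeas"
 by (intro borel_measurable_continuous_onI smooth_fun_continuous)

lemma smooth_fun_deriv_borel:
 "smooth_fun f ==> (%x. dd f x v) : bmeas"
 by (intro smooth_fun_borel smooth_fun_deriv)

lemma test_funI:
 assumes "smooth_fun f" "!!x. x ~: K ==> f x = 0" "compact K" "K \<subseteq> U"
 shows "test_fun U f"
proof -
 have "closure {x. f x ~= 0} \<subseteq> K"
  using assms by (intro closure_minimal compact_imp_closed) auto
 moreover have "compact (closure {x. f x ~= 0})"
  using calculation assms(3) by (metis closed_closure compact_Int_closed inf.absorb_iff2)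
 ultimately show ?thesis using assms unfolding test_fun_def by auto
qed

lemma test_fun_mono: "test_fun U f ==> U \<subseteq> V ==> test_fun V f"
 unfolding test_fun_def by auto

lemma test_fun_smooth: "test_fun U f ==> smooth_fun f"
 unfolding test_fun_def by auto

lemma test_fun_borel: "test_fun U f ==> f : bmeas"
 using smooth_fun_borel test_fun_smooth by blast

lemma test_fun_deriv_eq_0:
 assumes "test_fun U f" "x ~: closure {x. f x ~= 0}"
 shows "dd f x v = 0"
proof -
 let ?K = "closure {x. f x ~= 0}"
 have "((%x. 0) has_derivative (%v. 0::real)) (at x)" by simp
 then have "(f has_derivative (%v. 0)) (at x)"
 proof (rule has_derivative_transform_within_open)
  show "open (- ?K)" by (simp add: open_Compl)
  show "x : - ?K" using assms(2) by simp
  show "0 = f y" if "y : - ?K" for y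
   using that closure_subset[of "{x. f x ~= 0}"] by auto
 qed
 then show ?thesis by (metis frechet_derivative_at)
qed

lemma test_fun_deriv:
 assumes "test_fun U f"
 shows "test_fun U (%x. dd f x v)"
 using assms test_fun_deriv_eq_0[OF assms]
 by (intro test_funI[where K="closure {x. f x ~= 0}"] smooth_fun_deriv) (auto simp: test_fun_def)

lemma test_fun_cases:
 assumes "test_fun U f"
 obtains K where "compact K" "K \<subseteq> U" "!!x. x ~: K ==> f x = 0"
  "!!x v. x ~: K ==> dd f x v = 0"
 using assms test_fun_deriv_eq_0[OF assms] closure_subset[of "{x. f x ~= 0}"]
 by (intro that[of "closure {x. f x ~= 0}"]) (auto simp: test_fun_def)

lemma test_fun_bounded:
 assumes "test_fun U f"
 obtains B where "0 <= B" "!!x. abs(f x) <= B"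
proof -
 obtain K where K: "compact K" "!!x. x ~: K ==> f x = 0" using test_fun_cases[OF assms] by metis
 have "compact (f ` K)"
  using K smooth_fun_continuous[OF test_fun_smooth[OF assms]] by (intro compact_continuous_image) auto
 then obtain B where B: "!!x. x : K ==> abs(f x) <= B"
  using compact_imp_bounded[of "f ` K"] by (auto simp: bounded_iff)
 have "abs(f x) <= max 0 B" for x using B[of x] K(2)[of x] by (cases "x : K") auto
 then show thesis by (intro that[of "max 0 B"]) auto
qed

lemma test_fun_integrable:
 assumes "test_fun U f"
 shows "integrable lborel f"
proof -
 obtain K where K: "compact K" "!!x. x ~: K ==> f x = 0" using test_fun_cases[OF assms] by metis
 obtain B where "!!x. abs(f x) <= B" using test_fun_bounded[OF assms] by metis
 then show ?thesis
  using K test_fun_borel[OF assms] compact_imp_bounded by (intro integrable_bounded_support[of f B K]) auto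
qed

lemma frechet_derivative_Basis:
 assumes "smooth_fun f"
 shows "dd f x v = (\<Sum>b\<in>Basis. (v \<bullet> b) * dd f x b)"
proof -
 have lin: "linear (dd f x)"
  using smooth_funD[OF assms] has_derivative_linear by blast
 have "dd f x (\<Sum>b\<in>Basis. (v \<bullet> b) *\<^sub>R b) = (\<Sum>b\<in>Basis. (v \<bullet> b) * dd f x b)"
  by (simp add: linear_sum[OF lin] linear_cmul[OF lin])
 then show ?thesis by (simp add: euclidean_representation)
qed

lemma test_fun_lipschitz:
 assumes f: "test_fun U f"
 obtains L where "0 <= L" "!!x y. abs(f x - f y) <= L * norm (x - y)"
proof -
 have "EX B. 0 <= B & (ALL x. abs(dd f x b) <= B)" for b
  using test_fun_bounded[OF test_fun_deriv[OF f]] by metis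
 then obtain B where B: "!!b. 0 <= B b" "!!b x. abs(dd f x b) <= B b" by metis
 let ?L = "\<Sum>b\<in>Basis. B b"
 have "onorm (dd f x) <= ?L" for x
 proof (rule onorm_le)
  fix v
  have "abs(dd f x v) <= (\<Sum>b\<in>Basis. abs(v \<bullet> b) * abs(dd f x b))"
   unfolding frechet_derivative_Basis[OF test_fun_smooth[OF f], of x v]
   using sum_abs[of "%b. (v \<bullet> b) * dd f x b" Basis] by (simp add: abs_mult)
  also have "... <= (\<Sum>b\<in>Basis. norm v * B b)"
   using B by (intro sum_mono mult_mono) (auto simp: Basis_le_norm)
  finally show "norm (dd f x v) <= ?L * norm v"
   by (simp add: sum_distrib_left mult.commute)
 qed
 then have "norm (f x - f y) <= ?L * norm (x - y)" for x y
  using smooth_funD[OF test_fun_smooth[OF f]]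
  by (intro differentiable_bound[of UNIV f "%x. dd f x"]) auto
 then show thesis using B by (intro that[of ?L]) (auto intro!: sum_nonneg)
qed

text \<open>The constant is uniform in \<open>x\<close> because the partial derivatives are test
  functions again and hence globally Lipschitz.\<close>

lemma test_fun_second_order:
 assumes f: "test_fun U f"
 obtains C where "0 <= C" "!!x h. abs(f (x + h) - f x - dd f x h) <= C * (norm h)\<^sup>2"
proof -
 have "EX L. 0 <= L & (ALL x y. abs(dd f x b - dd f y b) <= L * norm (x - y))" for b
  using test_fun_lipschitz[OF test_fun_deriv[OF f]] by metis
 then obtain L where L: "!!b. 0 <= L b"
  "!!b x y. abs(dd f x b - dd f y b) <= L b * norm (x - y)" by metis
 let ?L = "\<Sum>b\<in>Basis. L b"
 have D: "abs(dd f x v - dd f y v) <= ?L * norm (x - y) * norm v" for x y v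
 proof -
  have "abs(dd f x v - dd f y v)
   = abs(\<Sum>b\<in>Basis. (v \<bullet> b) * (dd f x b - dd f y b))"
   unfolding frechet_derivative_Basis[OF test_fun_smooth[OF f], of _ v]
   by (simp add: sum_subtractf right_diff_distrib)
  also have "... <= (\<Sum>b\<in>Basis. abs(v \<bullet> b) * abs(dd f x b - dd f y b))"
   using sum_abs[of "%b. (v \<bullet> b) * (dd f x b - dd f y b)" Basis] by (simp add: abs_mult)
  also have "... <= (\<Sum>b\<in>Basis. norm v * (L b * norm (x - y)))"
   using L by (intro sum_mono mult_mono) (auto simp: Basis_le_norm)
  also have "... = ?L * norm (x - y) * norm v"
   by (simp add: sum_distrib_left sum_distrib_right mult_ac)
  finally show ?thesis .
 qed
 have "abs(f (x + h) - f x - dd f x h) <= ?L * (norm h)\<^sup>2" for x h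
 proof -
  have "norm (f (x + h) - f x - dd f x (x + h - x)) <= norm (x + h - x) * (?L * norm h)"
  proof (rule differentiable_bound_linearization[where S="closed_segment x (x + h)"])
   fix y assume "y : closed_segment x (x + h)"
   then have y: "norm (y - x) <= norm h"
    using segment_bound(1)[of y x "x + h"] by (simp add: norm_minus_commute)
   show "(f has_derivative dd f y) (at y within closed_segment x (x + h))"
    using smooth_funD[OF test_fun_smooth[OF f]] by (rule has_derivative_at_withinI)
   show "onorm (dd f y - dd f x) <= ?L * norm h"
   proof (rule onorm_le)
    fix v
    have "abs(dd f y v - dd f x v) <= ?L * norm (y - x) * norm v" by (rule D)
    also have "... <= ?L * norm h * norm v"
     using y L by (intro mult_right_mono mult_left_mono) (auto intro!: sum_nonneg)
    finally show "norm ((dd f y - dd f x) v) <= ?L * norm h * norm v" by simp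
   qed
  qed (auto simp: closed_segment_def algebra_simps intro!: exI)
  then show ?thesis by (simp add: power2_eq_square mult_ac)
 qed
 then show thesis using L by (intro that[of ?L]) (auto intro!: sum_nonneg)
qed

subsection \<open>Mollifiers\<close>

definition moll :: "real => 'a::euclidean_space => real" where
 "moll e x = bump (x /\<^sub>R e) / (e ^ DIM('a) * integral\<^sup>L lborel (bump :: 'a => real))"

lemma bump_integrable: "integrable lborel (bump :: 'a::euclidean_space => real)"
 by (rule integrable_bounded_support[of _ 1 "ball 0 1"])
  (auto simp: smooth_fun_borel smooth_fun_bump bump_nonneg bump_le_1 bump_eq_0)

lemma bump_integral_pos: "0 < integral\<^sup>L lborel (bump :: 'a::euclidean_space => real)"
proof -
 have "integral\<^sup>L lborel (bump :: 'a => real) ~= 0"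
 proof
  assume "integral\<^sup>L lborel (bump :: 'a => real) = 0"
  then have "AE x::'a in lborel. bump x = 0"
   using integral_nonneg_eq_0_iff_AE[OF bump_integrable] by (auto simp: bump_nonneg)
  then have "AE x::'a in lborel. x ~: ball 0 1"
   by (rule AE_mp) (auto intro!: AE_I2 dest: bump_pos)
  then have "emeasure lborel (ball (0::'a) 1) = 0"
   by (subst (asm) AE_iff_measurable[of "ball 0 1"]) auto
  then show False using unit_ball_vol_pos[of "real DIM('a)"] by (simp add: emeasure_ball del: unit_ball_vol_pos)
 qed
 moreover have "0 <= integral\<^sup>L lborel (bump :: 'a => real)" by (simp add: bump_nonneg)
 ultimately show ?thesis by simp
qed

lemma moll_nonneg: "0 < e ==> 0 <= moll e (x::'a::euclidean_space)"
 unfolding moll_def using bump_integral_pos[where ?'a='a]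
 by (intro divide_nonneg_nonneg mult_nonneg_nonneg bump_nonneg) auto

lemma moll_eq_0: "0 < e ==> e <= norm x ==> moll e x = 0"
 by (simp add: moll_def bump_eq_0 field_simps)

lemma moll_minus: "moll e (- x) = moll e x"
 by (simp add: moll_def bump_def)

lemma smooth_fun_moll: "smooth_fun (moll e)"
 using smooth_fun_affine[OF smooth_fun_bump, of "1 / (e ^ DIM('a) * integral\<^sup>L lborel (bump :: 'a => real))" 0 "inverse e"]
 by (simp add: moll_def[abs_def])

lemma moll_borel [measurable]: "moll e : bmeas"
 by (rule smooth_fun_borel[OF smooth_fun_moll])

lemma moll_nn_integral:
 assumes "0 < e"
 shows "(\<integral>\<^sup>+x. en (moll e x) \<partial>(lborel :: 'a::euclidean_space measure)) = 1"
proof -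
 let ?Z = "integral\<^sup>L lborel (bump :: 'a => real)"
 note smooth_fun_borel[OF smooth_fun_bump, measurable]
 have "(\<integral>\<^sup>+x. en (moll e x) \<partial>(lborel :: 'a measure)) = en (e ^ DIM('a)) * (NN x. en (moll e (e *\<^sub>R x :: 'a)))"
  using assms by (subst nn_integral_scaleR[of _ e]) auto
 also have "(NN x. en (moll e (e *\<^sub>R x :: 'a))) = (NN x. en (1 / (e ^ DIM('a) * ?Z)) * en (bump (x :: 'a)))"
  using assms bump_integral_pos[where ?'a='a]
  by (intro nn_integral_cong) (simp add: moll_def bump_nonneg flip: ennreal_mult)
 also have "... = en (1 / (e ^ DIM('a) * ?Z)) * en ?Z"
  by (subst nn_integral_cmult) (auto simp: nn_integral_eq_integral[OF bump_integrable] bump_nonneg)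
 finally show ?thesis using assms bump_integral_pos[where ?'a='a]
  by (simp flip: ennreal_mult)
qed

lemma moll_le:
 "0 < e ==> moll e (x::'a::euclidean_space) <= 1 / (e ^ DIM('a) * integral\<^sup>L lborel (bump :: 'a => real))"
 unfolding moll_def using bump_integral_pos[where ?'a='a] bump_le_1
 by (intro divide_right_mono) (auto simp: less_imp_le)

lemma test_fun_moll: "0 < e ==> cball 0 e \<subseteq> U ==> test_fun U (moll e)"
 using moll_eq_0 by (intro test_funI[of _ "cball 0 e"] smooth_fun_moll) (auto simp: not_le intro: less_imp_le)

lemma test_fun_moll_shift:
 assumes "0 < e" "cball x e \<subseteq> U"
 shows "test_fun U (%y. moll e (x - y))"
proof (rule test_funI[of _ "cball x e"])
 show "smooth_fun (%y. moll e (x - y))"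
  using smooth_fun_affine[OF smooth_fun_moll, of 1 e x "-1"] by simp
qed (use assms moll_eq_0 in \<open>auto simp: dist_norm not_le intro: less_imp_le\<close>)

lemma frechet_derivative_moll_shift:
 "frechet_derivative (%y. moll e (x - y)) (at y) v = - dd (moll e) (x - y) v"
proof -
 have lin: "linear (dd (moll e :: 'a => real) z)" for z
  using smooth_funD[OF smooth_fun_moll] has_derivative_linear by blast
 have "((%y. x - y) has_derivative (%v. - v)) (at y)" by (auto intro!: derivative_eq_intros)
 then have "((%y. moll e (x - y)) has_derivative (%v. dd (moll e) (x - y) (- v))) (at y)"
  by (rule has_derivative_compose[OF _ smooth_funD[OF smooth_fun_moll]])
 then show ?thesis by (metis frechet_derivative_at linear_neg[OF lin])
qed

subsection \<open>Convolutions\<close>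

definition convol :: "('a::euclidean_space => real) => ('a => real) => 'a => real" where
 "convol f g x = (LL y. f y * g (x - y))"

lemma convol_integrable:
 fixes f g :: "'a::euclidean_space => real"
 assumes f: "integrable lborel f" and g: "g : bmeas" "!!x. abs(g x) <= B"
 shows "integrable lborel (%y. f y * g (x - y))"
proof -
 have [measurable]: "f : bmeas" using borel_measurable_integrable[OF f] by simp
 note g(1)[measurable]
 have le: "abs(f y * g (x - y)) <= abs(B * f y)" for y
  using mult_left_mono[OF g(2)[of "x - y"], of "abs(f y)"] g(2)[of 0] by (simp add: abs_mult mult.commute)
 have "integrable lborel (%y. B * f y)" using f by simp
 from Bochner_Integration.integrable_bound[OF this, of "%y. f y * g (x - y)"] show ?thesis
  using le by auto
qed

lemma test_convol_integrable:
 fixes f g :: "'a::euclidean_space => real"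
 assumes "integrable lborel f" "test_fun U g"
 shows "integrable lborel (%y. f y * g (x - y))"
 using test_fun_bounded[OF assms(2)] convol_integrable[OF assms(1) test_fun_borel[OF assms(2)]] by metis

lemma convol_commute:
 assumes [measurable]: "f : bmeas" "g : bmeas"
 shows "convol f g x = (LL y. g y * f (x - y))"
 using integral_reflect[of "%y. f y * g (x - y)" x] by (simp add: convol_def mult.commute)

lemma convol_eq_0:
 assumes "!!y. y ~: S ==> f y = 0" "!!z. e <= norm z ==> g z = 0" "!!y. y : S ==> e <= dist x y"
 shows "convol f g x = 0"
proof -
 have "f y * g (x - y) = 0" for y using assms by (cases "y : S") (auto simp: dist_norm)
 then have "(%y. f y * g (x - y)) = (%y. 0)" by auto
 then show ?thesis by (simp add: convol_def)
qed

lemma convol_lipschitz: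
 assumes f: "integrable lborel f" and g: "g : bmeas" "!!x. abs(g x) <= B"
  and L: "!!x y. abs(g x - g y) <= L * norm (x - y)"
 shows "abs(convol f g x - convol f g x') <= L * norm (x - x') * (LL y. abs(f y))"
proof -
 note i = convol_integrable[OF f g]
 have "convol f g x - convol f g x' = (LL y. f y * (g (x - y) - g (x' - y)))"
  unfolding convol_def by (subst Bochner_Integration.integral_diff[symmetric, OF i i]) (simp add: right_diff_distrib)
 also have "abs(...) <= (LL y. abs(f y * (g (x - y) - g (x' - y))))"
  using integral_norm_bound[of lborel "%y. f y * (g (x - y) - g (x' - y))"] by simp
 also have "... <= (LL y. L * norm (x - x') * abs(f y))"
 proof (rule integral_mono)
  show "integrable lborel (%y. abs(f y * (g (x - y) - g (x' - y))))"
   using i[of x] i[of x'] by (auto simp: right_diff_distrib)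
  show "integrable lborel (%y. L * norm (x - x') * abs(f y))" using f by auto
  show "abs(f y * (g (x - y) - g (x' - y))) <= L * norm (x - x') * abs(f y)" for y
   using mult_left_mono[OF L[of "x - y" "x' - y"], of "abs(f y)"] by (simp add: abs_mult mult_ac)
 qed
 finally show ?thesis by simp
qed

text \<open>The Taylor bound for \<open>g\<close> integrated against \<open>f\<close>. It gives
  differentiability of the convolution and, quantitatively, the comparison of difference quotients
  with mollified gradients on which the lower bound rests.\<close>

lemma convol_remainder:
 assumes f: "integrable lborel f" and g: "test_fun U g"
  and C: "!!x h. abs(g (x + h) - g x - dd g x h) <= C * (norm h)\<^sup>2"
 shows "abs(convol f g (x + h) - convol f g x - convol f (%z. dd g z h) x)
  <= C * (norm h)\<^sup>2 * (LL y. abs(f y))"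
proof -
 let ?D = "%z. dd g z h"
 note i = test_convol_integrable[OF f g] and j = test_convol_integrable[OF f test_fun_deriv[OF g, of h]]
 let ?r = "%y. g (x + h - y) - g (x - y) - ?D (x - y)"
 have eq: "convol f g (x + h) - convol f g x - convol f ?D x = (LL y. f y * ?r y)"
  unfolding convol_def right_diff_distrib
   Bochner_Integration.integral_diff[OF Bochner_Integration.integrable_diff[OF i i] j]
   Bochner_Integration.integral_diff[OF i i] by (rule refl)
 have "abs(convol f g (x + h) - convol f g x - convol f ?D x) <= (LL y. abs(f y * ?r y))"
  unfolding eq by (rule integral_abs_bound)
 also have "... <= (LL y. C * (norm h)\<^sup>2 * abs(f y))"
 proof (rule integral_mono)
  show "integrable lborel (%y. abs(f y * ?r y))"
   unfolding right_diff_distrib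
   by (intro Bochner_Integration.integrable_abs Bochner_Integration.integrable_diff i j)
  show "integrable lborel (%y. C * (norm h)\<^sup>2 * abs(f y))" using f by auto
  show "abs(f y * ?r y) <= C * (norm h)\<^sup>2 * abs(f y)" for y
  proof -
   have e: "x - y + h = x + h - y" by simp
   show ?thesis
    using mult_left_mono[OF C[of "x - y" h, unfolded e] abs_ge_zero[of "f y"]]
    unfolding abs_mult by (simp only: mult_ac)
  qed
 qed
 finally show ?thesis by simp
qed

lemma convol_deriv_linear:
 assumes f: "integrable lborel f" and g: "test_fun U g"
 shows "convol f (%z. dd g z v) x
  = (\<Sum>b\<in>Basis. (v \<bullet> b) * convol f (%z. dd g z b) x)"
proof -
 have "convol f (%z. dd g z v) x
  = (LL y. (\<Sum>b\<in>Basis. (v \<bullet> b) * (f y * dd g (x - y) b)))"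
  unfolding convol_def frechet_derivative_Basis[OF test_fun_smooth[OF g], of _ v]
  by (simp add: sum_distrib_left mult_ac)
 also have "... = (\<Sum>b\<in>Basis. (LL y. (v \<bullet> b) * (f y * dd g (x - y) b)))"
  using test_convol_integrable[OF f test_fun_deriv[OF g]] by (intro Bochner_Integration.integral_sum) auto
 finally show ?thesis by (simp add: convol_def)
qed

lemma convol_has_derivative:
 assumes f: "integrable lborel f" and g: "test_fun U g"
 shows "(convol f g has_derivative (%v. convol f (%z. dd g z v) x)) (at x)"
proof -
 obtain C where C: "0 <= C" "!!x h. abs(g (x + h) - g x - dd g x h) <= C * (norm h)\<^sup>2"
  using test_fun_second_order[OF g] by blast
 let ?D = "%v. convol f (%z. dd g z v) x" and ?I = "LL y. abs(f y)"
 have "linear ?D"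
 proof (rule linearI)
  fix v w and c :: real
  note E = convol_deriv_linear[OF f g, where x=x]
  show "?D (v + w) = ?D v + ?D w"
   unfolding E[of "v + w"] E[of v] E[of w] by (simp add: inner_add_left distrib_right sum.distrib)
  show "?D (c *\<^sub>R v) = c *\<^sub>R ?D v"
   unfolding E[of "c *\<^sub>R v"] E[of v] by (simp add: sum_distrib_left mult.assoc)
 qed
 then have "bounded_linear ?D" by (simp add: linear_conv_bounded_linear)
 moreover have "((%h. norm (convol f g (x + h) - convol f g x - ?D h) / norm h) \<longlongrightarrow> 0) (at 0)"
 proof (rule Lim_null_comparison)
  show "\<forall>\<^sub>F h in at 0. norm (norm (convol f g (x + h) - convol f g x - ?D h) / norm h) <= C * norm h * ?I"
  proof (rule always_eventually, rule allI)
   fix h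
   show "norm (norm (convol f g (x + h) - convol f g x - ?D h) / norm h) <= C * norm h * ?I"
    using convol_remainder[OF f g C(2), of x h] C(1)
    by (cases "h = 0") (auto simp: field_simps power2_eq_square)
  qed
  show "((%h::'a. C * norm h * ?I) \<longlongrightarrow> 0) (at 0)"
   by (auto intro!: tendsto_eq_intros)
 qed
 ultimately show ?thesis by (simp add: has_derivative_at)
qed

lemma smooth_fun_convol:
 assumes f: "integrable lborel f" and g: "test_fun UNIV g"
 shows "smooth_fun (convol f g)"
proof (rule smooth_fun_class[where C="%h. EX g. test_fun UNIV g & h = convol f g"])
 fix h assume "EX g. test_fun UNIV g & h = convol f g"
 then obtain g where g: "test_fun UNIV g" "h = convol f g" by auto
 have "EX g'. test_fun UNIV g' & (%x. convol f (%z. dd g z v) x) = convol f g'" for v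
  using test_fun_deriv[OF g(1), of v] by (intro exI[of _ "%z. dd g z v"]) auto
 then show "EX f'. (ALL x. (h has_derivative f' x) (at x)) & (ALL v. EX g. test_fun UNIV g & (%x. f' x v) = convol f g)"
  using convol_has_derivative[OF f g(1)] g(2)
  by (intro exI[of _ "%x v. convol f (%z. dd g z v) x"]) auto
qed (use g in auto)


section \<open>Approximation, translation and mollification in L^p\<close>

lemma weighted_limit_le:
 fixes X Y :: ennreal
 assumes le: "!!l e. 0 < l ==> l < 1 ==> 0 < e ==>
   X <= en ((1 - l) powr (1 - p)) * Y + en (l powr (1 - p)) * en e"
 shows "X <= Y"
proof (cases Y)
 case (real y)
 have step: "X <= en ((1 - l) powr (1 - p) * y)" if l: "0 < l" "l < 1" for l
 proof (rule ennreal_le_epsilon)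
  fix e :: real assume "0 < e"
  \<comment> \<open>For fixed \<open>l\<close> the error is rescaled by
    \<open>l powr (p - 1)\<close>, which absorbs the blow-up of its factor; only afterwards does
    \<open>l\<close> tend to 0.\<close>
  have "X <= en ((1 - l) powr (1 - p)) * Y + en (l powr (1 - p)) * en (e * l powr (p - 1))"
   using l \<open>0 < e\<close> by (intro le) auto
  also have "en (l powr (1 - p)) * en (e * l powr (p - 1)) = en (e * (l powr (1 - p) * l powr (p - 1)))"
   using \<open>0 < e\<close> by (subst ennreal_mult[symmetric]) (auto simp: mult_ac)
  also have "l powr (1 - p) * l powr (p - 1) = 1" using l by (simp flip: powr_add)
  finally show "X <= en ((1 - l) powr (1 - p) * y) + en e"
   using real by (simp add: ennreal_mult)
 qed
 have "((%l. en ((1 - l) powr (1 - p) * y)) \<longlongrightarrow> en ((1 - 0) powr (1 - p) * y)) (at_right 0)"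
  by (intro tendsto_ennrealI tendsto_mult tendsto_powr tendsto_diff tendsto_const tendsto_ident_at) auto
 moreover have "\<forall>\<^sub>F l in at_right 0. X <= en ((1 - l) powr (1 - p) * y)"
  using eventually_at_right_less[of 0] eventually_at_right[of 0 1] step
  by (auto simp: eventually_at_right[of 0 1] intro!: exI[of _ 1])
 ultimately show ?thesis
  using real by (intro tendsto_lowerbound[of _ _ "at_right (0::real)"]) auto
qed auto

text \<open>Truncate in value by \<open>tr\<close> and in space by \<open>chi\<close>, then use that
  a measurable function is an a.e. limit of continuous ones. Applying the same truncations to the
  continuous functions gives the common bound and support that dominated convergence asks
  for.\<close>

lemma Lp_continuous_approx:
 fixes f :: "'a::euclidean_space => real"
 assumes p: "0 < p" and [measurable]: "f : bmeas"
  and fin: "(NN x. pw p (f x)) < \<infinity>" and e: "0 < e"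
 obtains g R where "continuous_on UNIV g" "!!x. R <= norm x ==> g x = 0"
  "(NN x. pw p (f x - g x)) < e"
proof -
 define e' where "e' = e / en (2 powr p * 2)"
 define chi where "chi M x = max 0 (min 1 (real M - norm x))" for M :: nat and x :: 'a
 define tr where "tr M y = max (- real M) (min (real M) y)" for M :: nat and y :: real
 define F where "F M x = tr M (f x) * chi M x" for M x
 have [measurable]: "chi M : bmeas" "tr M : bmeas" for M
  unfolding chi_def tr_def by measurable
 have [measurable]: "F M : bmeas" for M unfolding F_def by measurable
 have chi: "0 <= chi M x" "chi M x <= 1" for M x by (auto simp: chi_def)
 have chi0: "chi M x = 0" if "real M <= norm x" for M x using that by (auto simp: chi_def)
 have tr_le: "abs(tr M y) <= real M" for M y by (auto simp: tr_def)
 have ev: "\<forall>\<^sub>F M in sequentially. F M x = f x" for x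
 proof -
  obtain N where "norm x + abs(f x) + 1 <= real N" using real_arch_simple by blast
  then have "F M x = f x" if "M >= N" for M
  proof -
   have "norm x + abs(f x) + 1 <= real M" using that \<open>norm x + abs(f x) + 1 <= real N\<close> by linarith
   then have "abs(f x) <= real M" "1 <= real M - norm x" using norm_ge_zero[of x] abs_ge_zero[of "f x"] by linarith+
   then show ?thesis by (auto simp: F_def tr_def chi_def)
  qed
  then show ?thesis by (auto simp: eventually_sequentially)
 qed
 have Fle: "abs(f x - F M x) <= abs(f x)" for M x
 proof -
  have "F M x = (chi M x * min 1 (real M / abs(f x))) * f x" if "f x ~= 0"
   using that by (auto simp: F_def tr_def max_def min_def field_simps)
  moreover have "0 <= chi M x * min 1 (real M / abs(f x))" "chi M x * min 1 (real M / abs(f x)) <= 1"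
   using chi[of M x] by (auto intro!: mult_le_one)
  ultimately have "EX t. 0 <= t & t <= 1 & F M x = t * f x"
   by (cases "f x = 0") (auto simp: F_def tr_def)
  then obtain t where "0 <= t" "t <= 1" "F M x = t * f x" by auto
  moreover have "f x - t * f x = (1 - t) * f x" by (simp add: algebra_simps)
  ultimately show ?thesis by (simp add: abs_mult mult_left_le_one_le)
 qed
 have "(%M. NN x. pw p (f x - F M x)) ----> (\<integral>\<^sup>+x. 0 \<partial>(lborel::'a measure))"
 proof (rule nn_integral_dominated_convergence[where w="%x. pw p (f x)"])
  show "AE x in lborel. pw p (f x - F M x) <= pw p (f x)" for M
   using Fle p by (intro AE_I2 ennreal_leI powr_mono2) auto
  show "AE x in lborel. (%M. pw p (f x - F M x)) ----> 0"
  proof (rule AE_I2)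
   fix x
   show "(%M. pw p (f x - F M x)) ----> 0"
    by (rule tendsto_eventually, rule eventually_mono[OF ev[of x]]) auto
  qed
 qed (use fin in auto)
 moreover have e': "0 < e'" using e p by (simp add: e'_def ennreal_zero_less_divide)
 ultimately have "\<forall>\<^sub>F M in sequentially. (NN x. pw p (f x - F M x)) < e'"
  by (simp add: order_tendstoD(2))
 then obtain M where M: "(NN x. pw p (f x - F M x)) < e'"
  by (auto simp: eventually_sequentially)
 have "f measurable_on UNIV"
  by (rule lebesgue_measurable_imp_measurable_on) (auto intro: measurable_completion)
 then obtain N g where N: "negligible N" and g: "!!n. continuous_on UNIV (g n)"
  "!!x. x ~: N ==> (%n. g n x) ----> f x"
  unfolding measurable_on_def by auto
 define H where "H n x = tr M (g n x) * chi M x" for n x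
 have Hc: "continuous_on UNIV (H n)" for n
  unfolding H_def tr_def chi_def by (intro continuous_intros g)
 then have [measurable]: "H n : bmeas" for n by (rule borel_measurable_continuous_onI)
 have "AE x in lebesgue. x ~: N" using N by (intro AE_not_in) (simp add: negligible_iff_null_sets)
 then have aeN: "AE x in lborel. x ~: N" by (simp add: AE_completion_iff)
 have "(%n. NN x. pw p (F M x - H n x)) ----> (\<integral>\<^sup>+x. 0 \<partial>(lborel::'a measure))"
 proof (rule nn_integral_dominated_convergence[where w="%x. en ((2 * real M) powr p) * ind (ball 0 (real M)) x"])
  show "AE x in lborel. pw p (F M x - H n x) <= en ((2 * real M) powr p) * ind (ball 0 (real M)) x" for n
  proof (rule AE_I2)
   fix x :: 'a
   have "abs(F M x - H n x) <= 2 * real M"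
   proof -
    have "F M x - H n x = (tr M (f x) - tr M (g n x)) * chi M x" by (simp add: F_def H_def algebra_simps)
    moreover have "abs(tr M (f x) - tr M (g n x)) <= 2 * real M" using tr_le[of M "f x"] tr_le[of M "g n x"] by linarith
    ultimately show ?thesis using chi[of M x] mult_mono[of "abs(tr M (f x) - tr M (g n x))" "2 * real M" "chi M x" 1]
     by (simp add: abs_mult)
   qed
   then have "abs(F M x - H n x) powr p <= (2 * real M) powr p" using p by (intro powr_mono2) auto
   moreover have "abs(F M x - H n x) powr p = 0" if "x ~: ball 0 (real M)"
    using that chi0[of M x] by (simp add: F_def H_def)
   ultimately show "pw p (F M x - H n x) <= en ((2 * real M) powr p) * ind (ball 0 (real M)) x"
    by (cases "x : ball 0 (real M)") (auto simp: ennreal_leI)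
  qed
  show "AE x in lborel. (%n. pw p (F M x - H n x)) ----> 0"
   using aeN
  proof (rule AE_mp, intro AE_I2 impI)
   fix x assume "x ~: N"
   then have "(%n. H n x) ----> F M x"
    unfolding H_def F_def tr_def by (intro tendsto_intros g)
   then have "(%n. abs(F M x - H n x)) ----> abs(F M x - F M x)" by (intro tendsto_intros)
   then have "(%n. abs(F M x - H n x)) ----> 0" by simp
   then have "(%n. abs(F M x - H n x) powr p) ----> 0" using p by (intro tendsto_zero_powrI[where b=p]) auto
   then show "(%n. pw p (F M x - H n x)) ----> 0"
    by (metis ennreal_0 tendsto_ennrealI)
  qed
  have "(\<integral>\<^sup>+x. en ((2 * real M) powr p) * ind (ball 0 (real M)) x \<partial>(lborel::'a measure))
   = en ((2 * real M) powr p) * emeasure lborel (ball (0::'a) (real M))"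
   by (rule nn_integral_cmult_indicator) auto
  also have "... < \<infinity>" using emeasure_lborel_ball_finite[of "0::'a" "real M"] by (auto simp: ennreal_mult_less_top)
  finally show "(\<integral>\<^sup>+x. en ((2 * real M) powr p) * ind (ball 0 (real M)) x \<partial>(lborel::'a measure)) < \<infinity>" .
 qed auto
 then have "\<forall>\<^sub>F n in sequentially. (NN x. pw p (F M x - H n x)) < e'"
  using e' by (simp add: order_tendstoD(2))
 then obtain n where n: "(NN x. pw p (F M x - H n x)) < e'"
  by (auto simp: eventually_sequentially)
 let ?c = "en (2 powr p)"
 have "(NN x. pw p (f x - H n x))
  <= (NN x. ?c * (pw p (f x - F M x) + pw p (F M x - H n x)))"
 proof (rule nn_integral_mono)
  fix x
  have "abs(f x - H n x) powr p <= (abs(f x - F M x) + abs(F M x - H n x)) powr p"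
   using p by (intro powr_mono2) auto
  also have "... <= 2 powr p * (abs(f x - F M x) powr p + abs(F M x - H n x) powr p)"
   using p by (intro powr_add_le2) auto
  finally show "pw p (f x - H n x) <= ?c * (pw p (f x - F M x) + pw p (F M x - H n x))"
   by (simp add: ennreal_leI flip: ennreal_plus ennreal_mult)
 qed
 also have "... = ?c * ((NN x. pw p (f x - F M x)) + (NN x. pw p (F M x - H n x)))"
  by (simp add: nn_integral_cmult nn_integral_add)
 also have "... < ?c * (e' + e')"
  using M n by (intro ennreal_mult_strict_left_mono add_strict_mono) auto
 also have "... = e"
 proof -
  have "?c * (e' + e') = en (2 powr p * 2) * (e / en (2 powr p * 2))"
   by (simp add: e'_def ennreal_mult mult_2_right[symmetric] mult_ac distrib_left)
  also have "... = e" by (simp add: ennreal_times_divide mult.commute[of _ e] ennreal_mult_divide_eq)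
  finally show ?thesis .
 qed
 finally show thesis using Hc chi0 by (intro that[of "H n" "real M"]) (auto simp: H_def)
qed

lemma Lp_translation_continuous:
 fixes f :: "'a::euclidean_space => real"
 assumes p: "0 < p" and [measurable]: "f : bmeas"
  and fin: "(NN x. pw p (f x)) < \<infinity>" and e: "0 < (e::real)"
 obtains d where "0 < d" "!!h. norm h < d ==> (NN x. pw p (f (x + h) - f x)) <= en e"
proof -
 define e1 where "e1 = e / (3 powr p * 3)"
 have e1: "0 < e1" using e by (simp add: e1_def)
 obtain g R where g: "continuous_on UNIV g" "!!x. R <= norm x ==> g x = 0"
  and fg: "(NN x. pw p (f x - g x)) < en e1"
  using Lp_continuous_approx[OF p assms(2) fin, of "en e1"] e1 by (metis ennreal_less_zero_iff)
 have [measurable]: "g : bmeas" using g(1) by (rule borel_measurable_continuous_onI)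
 let ?S = "cball (0::'a) (abs R + 1)"
 define V where "V = measure lborel ?S"
 have V: "emeasure lborel ?S = en V" "0 <= V"
  using emeasure_lborel_bounded[OF bounded_cball[of "0::'a" "abs R + 1"]]
  unfolding V_def by (auto intro!: emeasure_eq_ennreal_measure)
 \<comment> \<open>Chosen such that \<open>eta powr p\<close> times the volume of the ball carrying
   the increments of \<open>g\<close> is at most \<open>e1\<close>.\<close>
 define eta where "eta = (e1 / (V + 1)) powr (1 / p)"
 have eta: "0 < eta" using e1 V by (simp add: eta_def)
 have etap: "eta powr p * V <= e1"
 proof -
  have "eta powr p = e1 / (V + 1)" using p e1 V by (simp add: eta_def powr_powr)
  then have "eta powr p * (V + 1) = e1" using V by simp
  moreover have "eta powr p * V <= eta powr p * (V + 1)" by (intro mult_left_mono) auto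
  ultimately show ?thesis by simp
 qed
 have "uniformly_continuous_on (cball 0 (abs R + 2)) g"
  by (intro compact_uniformly_continuous continuous_on_subset[OF g(1)]) auto
 then obtain d0 where d0: "0 < d0"
  "!!x y. x : cball 0 (abs R + 2) ==> y : cball 0 (abs R + 2) ==> dist y x < d0 ==> dist (g y) (g x) < eta"
  using eta unfolding uniformly_continuous_on_def by metis
 let ?d = "min d0 1"
 have "(NN x. pw p (f (x + h) - f x)) <= en e" if h: "norm h < ?d" for h
 proof -
  have gg: "pw p (g (x + h) - g x) <= en (eta powr p) * ind ?S x" for x
  proof (cases "x : ?S")
   case True
   then have "norm (x + h) <= abs R + 2" using h norm_triangle_ineq[of x h] by auto
   then have "dist (g (x + h)) (g x) < eta" using True h by (intro d0(2)) (auto simp: dist_norm norm_minus_commute add.commute)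
   then have "abs(g (x + h) - g x) powr p <= eta powr p" using p by (intro powr_mono2) (auto simp: dist_real_def)
   then show ?thesis using True by (simp add: ennreal_leI)
  next
   case False
   then have "R <= norm x" "R <= norm (x + h)" using h norm_diff_ineq[of x h] by auto
   then show ?thesis using False g(2) by simp
  qed
  have "(NN x. pw p (f (x + h) - f x))
   <= (NN x. en (3 powr p) * (pw p (f (x + h) - g (x + h)) + pw p (g (x + h) - g x) + pw p (f x - g x)))"
  proof (rule nn_integral_mono)
   fix x
   have "abs(f (x + h) - f x) powr p <= (abs(f (x + h) - g (x + h)) + abs(g (x + h) - g x) + abs(f x - g x)) powr p"
    using p by (intro powr_mono2) auto
   also have "... <= 3 powr p * (abs(f (x + h) - g (x + h)) powr p + abs(g (x + h) - g x) powr p + abs(f x - g x) powr p)"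
    using p by (intro powr_add_le3) auto
   finally show "pw p (f (x + h) - f x) <= en (3 powr p) * (pw p (f (x + h) - g (x + h)) + pw p (g (x + h) - g x) + pw p (f x - g x))"
    by (simp add: ennreal_leI flip: ennreal_plus ennreal_mult)
  qed
  also have "... = en (3 powr p) * ((NN x. pw p (f (x + h) - g (x + h))) + (NN x. pw p (g (x + h) - g x)) + (NN x. pw p (f x - g x)))"
   by (simp add: nn_integral_cmult nn_integral_add)
  also have "... <= en (3 powr p) * (en e1 + en e1 + en e1)"
  proof (intro mult_left_mono add_mono)
   show "(NN x. pw p (f (x + h) - g (x + h))) <= en e1"
    using fg nn_integral_translate[of "%x. pw p (f x - g x)" h] by simp
   have "(NN x. pw p (g (x + h) - g x)) <= (NN x. en (eta powr p) * ind ?S x)"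
    by (intro nn_integral_mono gg)
   also have "... = en (eta powr p * V)"
    by (subst nn_integral_cmult_indicator) (auto simp: V ennreal_mult)
   also have "... <= en e1" using etap by (rule ennreal_leI)
   finally show "(NN x. pw p (g (x + h) - g x)) <= en e1" .
  qed (use fg in auto)
  also have "... = en (3 powr p * (e1 + e1 + e1))"
   using e1 by (subst ennreal_mult) (auto simp del: ennreal_plus simp flip: ennreal_plus)
  also have "3 powr p * (e1 + e1 + e1) = e" by (simp add: e1_def)
  finally show ?thesis .
 qed
 then show thesis using d0 by (intro that[of ?d]) auto
qed

lemma moll_jensen:
 fixes g :: "'a::euclidean_space => real"
 assumes p: "1 <= p" and e: "0 < e" and [measurable]: "g : bmeas"
 shows "pw p (LL y. moll e y * g y) <= (NN y. en (moll e y * abs(g y) powr p))"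
proof (rule jensen_powr_nn[OF p])
 show "en (abs(LL y. moll e y * g y)) <= (NN y. en (moll e y * abs(g y)))"
 proof (cases "integrable lborel (%y. moll e y * g y)")
  case True
  have "abs(moll e y) = moll e y" for y :: 'a using moll_nonneg[OF e, of y] by simp
  then show ?thesis using integral_norm_bound_ennreal[OF True] by (simp add: abs_mult)
 qed (simp add: not_integrable_integral_eq)
qed (use e in \<open>auto simp: moll_nonneg moll_nn_integral\<close>)

lemma moll_integrable: "0 < e ==> integrable lborel (moll e :: 'a::euclidean_space => real)"
 by (intro test_fun_integrable[of UNIV] test_fun_moll) auto

lemma moll_integral:
 assumes "0 < e" shows "(\<integral>x. moll e x \<partial>(lborel :: 'a::euclidean_space measure)) = 1"
 using moll_nn_integral[OF assms, where ?'a='a] nn_integral_eq_integral[OF moll_integrable[OF assms, where ?'a='a]] moll_nonneg[OF assms]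
 by (auto simp: ennreal_eq_1)

lemma convol_moll_commute:
 assumes [measurable]: "f : bmeas"
 shows "convol f (moll e) x = (LL y. moll e y * f (x - y))"
 by (rule convol_commute) auto

lemma convol_moll_integrable:
 fixes f :: "'a::euclidean_space => real"
 assumes "0 < e" "integrable lborel f"
 shows "integrable lborel (%y. moll e y * f (x - y))"
 using integrable_reflect[OF test_convol_integrable[OF assms(2) test_fun_moll[OF assms(1), of UNIV], of x], of x]
 by (simp add: mult.commute)

lemma convol_moll_diff:
 fixes f :: "'a::euclidean_space => real"
 assumes e: "0 < e" and f: "integrable lborel f"
 shows "convol f (moll e) x - f x = (LL y. moll e y * (f (x - y) - f x))"
proof -
 have [measurable]: "f : bmeas" using borel_measurable_integrable[OF f] by simp
 have "(LL y. moll e y * (f (x - y) - f x)) = (LL y. moll e y * f (x - y)) - (\<integral>y. moll e y * f x \<partial>(lborel :: 'a measure))"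
  unfolding right_diff_distrib
  by (intro Bochner_Integration.integral_diff convol_moll_integrable[OF e f] integrable_mult_left moll_integrable[OF e])
 then show ?thesis by (simp add: convol_moll_commute moll_integral[OF e])
qed

lemma convol_moll_borel:
 fixes f :: "'a::euclidean_space => real"
 assumes "0 < e" "integrable lborel f"
 shows "convol f (moll e) : bmeas"
 using assms by (intro smooth_fun_borel smooth_fun_convol test_fun_moll) auto

text \<open>The average over translations stays explicit for two uses: plain convergence from the
  continuity of translations, and later a rate in \<open>e\<close> once this average is bounded by
  an energy over a small ball.\<close>

lemma convol_moll_dist_le:
 fixes f :: "'a::euclidean_space => real"
 assumes p: "1 <= p" and e: "0 < e" and f: "integrable lborel f"
 shows "(NN x. pw p (convol f (moll e) x - f x))
  <= (NN y. en (moll e y) * (NN x. pw p (f (x - y) - f x)))"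
proof -
 have [measurable]: "f : bmeas" using borel_measurable_integrable[OF f] by simp
 have "(NN x. pw p (convol f (moll e) x - f x))
  <= (NN x. (NN y. en (moll e y * abs(f (x - y) - f x) powr p)))"
  unfolding convol_moll_diff[OF e f] using p e by (intro nn_integral_mono moll_jensen) auto
 also have "... = (NN y. (NN x. en (moll e y * abs(f (x - y) - f x) powr p)))"
  by (rule lborel_pair.Fubini') measurable
 also have "... = (NN y. en (moll e y) * (NN x. pw p (f (x - y) - f x)))"
  by (intro nn_integral_cong) (subst nn_integral_cmult[symmetric], auto simp: ennreal_mult' moll_nonneg[OF e])
 finally show ?thesis .
qed

lemma convol_moll_Lp:
 fixes f :: "'a::euclidean_space => real"
 assumes p: "1 <= p" and f: "integrable lborel f"
  and fin: "(NN x. pw p (f x)) < \<infinity>" and eta: "0 < (eta::real)"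
 obtains d where "0 < d" "!!e. 0 < e ==> e < d ==>
  (NN x. pw p (convol f (moll e) x - f x)) <= en eta"
proof -
 have [measurable]: "f : bmeas" using borel_measurable_integrable[OF f] by simp
 obtain d where d: "0 < d" "!!h. norm h < d ==> (NN x. pw p (f (x + h) - f x)) <= en eta"
  using Lp_translation_continuous[of p f eta] p fin eta by auto
 have "(NN x. pw p (convol f (moll e) x - f x)) <= en eta" if e: "0 < e" "e < d" for e
 proof -
  have "(NN x. pw p (convol f (moll e) x - f x))
   <= (NN y. en (moll e y) * (NN x. pw p (f (x - y) - f x)))"
   by (rule convol_moll_dist_le[OF p e(1) f])
  also have "... <= (NN y. en (moll e (y::'a)) * en eta)"
  proof (rule nn_integral_mono)
   fix y :: 'a
   show "en (moll e y) * (NN x. pw p (f (x - y) - f x)) <= en (moll e y) * en eta"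
    using d(2)[of "- y"] e moll_eq_0[OF e(1), of y] by (cases "norm y < e") (auto intro!: mult_left_mono)
  qed
  also have "... = en eta"
   by (subst nn_integral_multc) (auto simp: moll_nn_integral[OF e(1)])
  finally show ?thesis .
 qed
 then show thesis using d by (intro that[of d]) auto
qed


subsection \<open>Weak gradients\<close>

text \<open>The integration-by-parts half of \<open>weak_grad\<close> with integrals over the whole
  space: test functions and their derivatives vanish outside \<open>U\<close>, so the values of
  \<open>u\<close> and \<open>G\<close> there do not count.\<close>

definition wgrad :: "'a::euclidean_space set => ('a => real) => ('a => 'a) => bool" where
 "wgrad U u G \<longleftrightarrow> (ALL \<phi> i. test_fun U \<phi> --> i : Basis -->
  (LL x. u x * dd \<phi> x i) = - (LL x. (G x \<bullet> i) * \<phi> x))"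

lemma wgrad_mono: "wgrad U u G ==> V \<subseteq> U ==> wgrad V u G"
 unfolding wgrad_def using test_fun_mono by blast

lemma integrable_mult_test_fun:
 fixes f g :: "'a::euclidean_space => real"
 assumes f: "integrable lborel f" and g: "test_fun U g"
 shows "integrable lborel (%x. f x * g x)"
proof -
 have [measurable]: "f : bmeas" using borel_measurable_integrable[OF f] by simp
 note test_fun_borel[OF g, measurable]
 obtain B where B: "0 <= B" "!!x. abs(g x) <= B" using test_fun_bounded[OF g] by blast
 have "integrable lborel (%x. B * f x)" using f by simp
 from Bochner_Integration.integrable_bound[OF this, of "%x. f x * g x"] show ?thesis
  using B mult_left_mono[OF B(2) abs_ge_zero] by (auto simp: abs_mult mult.commute)
qed

lemma integrable_inner_vec:
 fixes G :: "'a::euclidean_space => 'a"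
 assumes "!!b. b : Basis ==> integrable lborel (%x. G x \<bullet> b)"
 shows "integrable lborel (%x. G x \<bullet> v)"
 unfolding euclidean_inner[of _ v] using assms by (intro Bochner_Integration.integrable_sum integrable_mult_left) auto

lemma wgrad_direction:
 assumes w: "wgrad U u G" and u: "integrable lborel u"
  and G: "!!b. b : Basis ==> integrable lborel (%x. G x \<bullet> b)" and phi: "test_fun U \<phi>"
 shows "(LL x. u x * dd \<phi> x v) = - (LL x. (G x \<bullet> v) * \<phi> x)"
proof -
 have "(LL x. u x * dd \<phi> x v)
  = (LL x. (\<Sum>b\<in>Basis. (v \<bullet> b) * (u x * dd \<phi> x b)))"
  unfolding frechet_derivative_Basis[OF test_fun_smooth[OF phi], of _ v]
  by (simp add: sum_distrib_left mult_ac)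
 also have "... = (\<Sum>b\<in>Basis. (LL x. (v \<bullet> b) * (u x * dd \<phi> x b)))"
  using integrable_mult_test_fun[OF u test_fun_deriv[OF phi]] by (intro Bochner_Integration.integral_sum) auto
 also have "... = (\<Sum>b\<in>Basis. (v \<bullet> b) * - (LL x. (G x \<bullet> b) * \<phi> x))"
  using w phi unfolding wgrad_def by (intro sum.cong) auto
 also have "... = - (\<Sum>b\<in>Basis. (LL x. (v \<bullet> b) * ((G x \<bullet> b) * \<phi> x)))"
  by (simp add: sum_negf)
 also have "(\<Sum>b\<in>Basis. (LL x. (v \<bullet> b) * ((G x \<bullet> b) * \<phi> x)))
  = (LL x. (\<Sum>b\<in>Basis. (v \<bullet> b) * ((G x \<bullet> b) * \<phi> x)))"
  using integrable_mult_test_fun[OF G phi] by (intro Bochner_Integration.integral_sum[symmetric]) auto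
 also have "(%x. \<Sum>b\<in>Basis. (v \<bullet> b) * ((G x \<bullet> b) * \<phi> x)) = (%x. (G x \<bullet> v) * \<phi> x)"
  unfolding euclidean_inner[of _ v] by (simp add: sum_distrib_left sum_distrib_right mult_ac)
 finally show ?thesis .
qed

text \<open>Once the closed ball around \<open>x\<close> lies in \<open>U\<close>, the shifted
  mollifier \<open>moll e (x - y)\<close> is a test function of \<open>y\<close>. The sign from
  differentiating it in \<open>y\<close> cancels the one in \<open>wgrad\<close>.\<close>

lemma wgrad_convol:
 assumes w: "wgrad U u G" and u: "integrable lborel u"
  and G: "!!b. b : Basis ==> integrable lborel (%x. G x \<bullet> b)" and e: "0 < e" "cball x e \<subseteq> U"
 shows "convol u (%z. dd (moll e) z v) x = convol (%y. G y \<bullet> v) (moll e) x"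
 using wgrad_direction[OF w u G test_fun_moll_shift[OF e], of v]
 by (simp add: frechet_derivative_moll_shift convol_def)

text \<open>Testing with shifted mollifiers makes the mollifications of \<open>f\<close> vanish at
  points of \<open>V m\<close> for small scales, while they converge to \<open>f\<close> in L1. The
  sets \<open>V m\<close> exhaust \<open>U\<close>.\<close>

lemma fundamental_lemma_variations:
 fixes f :: "'a::euclidean_space => real"
 assumes f: "integrable lborel f" and U: "open U"
  and z: "!!\<phi>. test_fun U \<phi> ==> (LL x. f x * \<phi> x) = 0"
 shows "AE x in lborel. x : U --> f x = 0"
proof -
 have [measurable]: "f : bmeas" using borel_measurable_integrable[OF f] by simp
 define V where "V m = {x. ball x (1 / real (Suc m)) \<subseteq> U}" for m
 have Vcl: "closed (V m)" for m
 proof -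
  have "- V m = (\<Union>y\<in>-U. ball y (1 / real (Suc m)))"
   by (auto simp: V_def dist_commute)
  then show ?thesis by (metis closed_def open_UN open_ball)
 qed
 then have [measurable]: "V m : sets borel" for m by auto
 have fin: "(NN x. pw 1 (f x)) < \<infinity>"
  using f by (simp add: integrable_iff_bounded)
 have "AE x in lborel. x : V m --> f x = 0" for m
 proof -
  have small: "(NN x. en (abs(f x)) * ind (V m) x) <= en eta" if eta: "0 < eta" for eta
  proof -
   obtain d where d: "0 < d" "!!e. 0 < e ==> e < d ==>
    (NN x. pw 1 (convol f (moll e) x - f x)) <= en eta"
    using convol_moll_Lp[of 1 f eta] f fin eta by auto
   define e where "e = min d (1 / real (Suc m)) / 2"
   have e: "0 < e" "e < d" "e < 1 / real (Suc m)" using d(1) by (auto simp: e_def min_def field_simps)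
   have "convol f (moll e) x = 0" if "x : V m" for x
   proof -
    have "cball x e \<subseteq> U" using that e by (auto simp: V_def subset_eq)
    then show ?thesis unfolding convol_def by (intro z test_fun_moll_shift e)
   qed
   then have "(NN x. en (abs(f x)) * ind (V m) x) <= (NN x. pw 1 (convol f (moll e) x - f x))"
    by (intro nn_integral_mono) (auto simp: indicator_def)
   also have "... <= en eta" using d e by auto
   finally show ?thesis .
  qed
  have "(NN x. en (abs(f x)) * ind (V m) x) <= 0"
  proof (rule ennreal_le_epsilon)
   fix e :: real assume "0 < e"
   from small[OF this] show "(NN x. en (abs(f x)) * ind (V m) x) <= 0 + en e"
    by (simp only: add_0)
  qed
  then have "(NN x. en (abs(f x)) * ind (V m) x) = 0" by simp
  then have "AE x in lborel. en (abs(f x)) * ind (V m) x = 0"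
   by (subst (asm) nn_integral_0_iff_AE) auto
  then show ?thesis by (rule AE_mp) (auto simp: indicator_def intro!: AE_I2)
 qed
 then have "AE x in lborel. ALL m. x : V m --> f x = 0" by (rule AE_all_countable[THEN iffD2, OF allI])
 then show ?thesis
 proof (rule AE_mp, intro AE_I2 impI)
  fix x assume a: "ALL m. x : V m --> f x = 0" and "x : U"
  then obtain e where "0 < e" "ball x e \<subseteq> U" using U open_contains_ball by blast
  moreover obtain m where "1 / real (Suc m) < e" using \<open>0 < e\<close> nat_approx_posE by blast
  ultimately have "x : V m" by (auto simp: V_def)
  then show "f x = 0" using a by blast
 qed
qed

text \<open>For the mollified function the increment along \<open>h\<close> is an integral over the
  segment of the mollified \<open>G \<bullet> h\<close>. Jensen's inequality is applied once over
  the segment and once against the mollifier, and \<open>weighted_limit_le\<close> removes the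
  mollification without losing the constant 1. The margin \<open>e0\<close> keeps the mollifier
  inside \<open>U\<close>. The bound keeps \<open>G \<bullet> h\<close> instead of norms because the
  sharp limit constant is an average over directions.\<close>

lemma translation_estimate_margin:
 fixes u :: "'a::euclidean_space => real"
 assumes p: "1 <= p" and w: "wgrad U u G" and u: "integrable lborel u"
  and fin: "(NN x. pw p (u x)) < \<infinity>"
  and Gm [measurable]: "G : bmeas"
  and G: "!!b. b : Basis ==> integrable lborel (%x. G x \<bullet> b)"
  and A [measurable]: "A : sets borel" and U: "open U" and e0: "0 < e0"
  and seg: "!!x t. x : A ==> 0 <= t ==> t <= 1 ==> cball (x + t *\<^sub>R h) e0 \<subseteq> U"
 shows "(NN x. pw p (u (x + h) - u x) * ind A x)
  <= (NN x. pw p (G x \<bullet> h) * ind U x)" (is "_ <= ?Y")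
proof -
 have [measurable]: "u : bmeas" using borel_measurable_integrable[OF u] by simp
 have [measurable]: "U : sets borel" using U by auto
 define g where "g y = pw p (G y \<bullet> h) * ind U y" for y
 have [measurable]: "g : bmeas" unfolding g_def by measurable
 have Gh: "integrable lborel (%y. G y \<bullet> h)" by (rule integrable_inner_vec[OF G])
 have mollified: "(NN x. pw p (convol u (moll e) (x + h) - convol u (moll e) x) * ind A x) <= ?Y"
  if e: "0 < e" "e < e0" for e
 proof -
  let ?v = "convol (%y. G y \<bullet> h) (moll e)"
  have sv: "smooth_fun ?v" by (intro smooth_fun_convol Gh test_fun_moll e) auto
  note smooth_fun_borel[OF sv, measurable]
  have pt: "pw p (convol u (moll e) (x + h) - convol u (moll e) x)
   <= (NN t. ind {0..1} t * (NN y. en (moll e y) * g (x + t *\<^sub>R h - y)))"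
   if x: "x : A" for x
  proof -
   have D: "((%t. convol u (moll e) (x + t *\<^sub>R h)) has_real_derivative ?v (x + t *\<^sub>R h)) (at t)" if t: "0 <= t" "t <= 1" for t
   proof -
    have lin: "linear (%v. convol u (%z. dd (moll e) z v) (x + t *\<^sub>R h))"
     using convol_has_derivative[OF u test_fun_moll[OF e(1) subset_UNIV]] has_derivative_linear by blast
    have "((%t. x + t *\<^sub>R h) has_derivative (%s. s *\<^sub>R h)) (at t)" by (auto intro!: derivative_eq_intros)
    then have "((%t. convol u (moll e) (x + t *\<^sub>R h)) has_derivative
     (%s. convol u (%z. dd (moll e) z (s *\<^sub>R h)) (x + t *\<^sub>R h))) (at t)"
     by (rule has_derivative_compose[OF _ convol_has_derivative[OF u test_fun_moll[OF e(1) subset_UNIV]]])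
    moreover have "convol u (%z. dd (moll e) z (s *\<^sub>R h)) (x + t *\<^sub>R h)
     = ?v (x + t *\<^sub>R h) * s" for s
    proof -
     have "cball (x + t *\<^sub>R h) e \<subseteq> U" using seg[OF x t] e by (auto simp: subset_eq)
     then show ?thesis using linear_cmul[OF lin, of s h] wgrad_convol[OF w u G e(1), of "x + t *\<^sub>R h" h] by simp
    qed
    ultimately show ?thesis by (simp add: has_field_derivative_def fun_eq_iff)
   qed
   have cont: "isCont (%t. ?v (x + t *\<^sub>R h)) t" for t
   proof -
    have "continuous_on UNIV (%t. ?v (x + t *\<^sub>R h))"
     by (intro continuous_on_compose2[OF smooth_fun_continuous[OF sv, of UNIV]] continuous_intros) auto
    then show ?thesis by (simp add: continuous_on_eq_continuous_at)
   qed
   have FTC: "(LL t. ?v (x + t *\<^sub>R h) * ind {0..1} t) = convol u (moll e) (x + 1 *\<^sub>R h) - convol u (moll e) (x + 0 *\<^sub>R h)"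
    and FTCi: "has_bochner_integral lborel (%t. ?v (x + t *\<^sub>R h) * ind {0..1} t) (convol u (moll e) (x + 1 *\<^sub>R h) - convol u (moll e) (x + 0 *\<^sub>R h))"
    using cont by (intro integral_FTC_Icc_real has_bochner_integral_FTC_Icc_real D; simp)+
   have "pw p (convol u (moll e) (x + h) - convol u (moll e) x)
    <= (NN t. en (ind {0..1} t * abs(?v (x + t *\<^sub>R h)) powr p))"
   proof (rule jensen_powr_nn[OF p])
    have "en (norm (LL t. ?v (x + t *\<^sub>R h) * ind {0..1} t)) <= (NN t. norm (?v (x + t *\<^sub>R h) * ind {0..1} t))"
     using FTCi by (intro integral_norm_bound_ennreal) (auto simp: has_bochner_integral_iff)
    then show "en (abs(convol u (moll e) (x + h) - convol u (moll e) x)) <= (NN t. en (ind {0..1} t * abs(?v (x + t *\<^sub>R h))))"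
     unfolding FTC by (simp add: abs_mult mult.commute)
    show "(\<integral>\<^sup>+t. en (ind {0..1} t) \<partial>(lborel :: real measure)) <= 1" by (simp add: ennreal_indicator)
   qed auto
   also have "... <= (NN t. ind {0..1} t * (NN y. en (moll e y) * g (x + t *\<^sub>R h - y)))"
   proof (rule nn_integral_mono)
    fix t :: real
    show "en (ind {0..1} t * abs(?v (x + t *\<^sub>R h)) powr p) <= ind {0..1} t * (NN y. en (moll e y) * g (x + t *\<^sub>R h - y))"
    proof (cases "0 <= t & t <= 1")
     case True
     have "pw p (?v (x + t *\<^sub>R h)) <= (NN y. en (moll e y * abs(G (x + t *\<^sub>R h - y) \<bullet> h) powr p))"
      using p e by (subst convol_moll_commute) (auto intro!: moll_jensen)
     also have "... <= (NN y. en (moll e y) * g (x + t *\<^sub>R h - y))"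
     proof (rule nn_integral_mono)
      fix y :: 'a
      show "en (moll e y * abs(G (x + t *\<^sub>R h - y) \<bullet> h) powr p) <= en (moll e y) * g (x + t *\<^sub>R h - y)"
      proof (cases "norm y < e")
       case yes: True
       have "x + t *\<^sub>R h - y : cball (x + t *\<^sub>R h) e0" using yes e by (simp add: dist_norm)
       then have "x + t *\<^sub>R h - y : U" using seg[OF x, of t] True by blast
       then show ?thesis by (simp add: g_def ennreal_mult' moll_nonneg[OF e(1)])
      qed (simp add: moll_eq_0[OF e(1)])
     qed
     finally show ?thesis using True by simp
    qed auto
   qed
   finally show ?thesis .
  qed
  have "(NN x. pw p (convol u (moll e) (x + h) - convol u (moll e) x) * ind A x)
   <= (NN x. (\<integral>\<^sup>+t. ind {0..1} t * (NN y. en (moll e y) * g (x + t *\<^sub>R h - y)) \<partial>(lborel::real measure)))"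
   using pt by (intro nn_integral_mono) (auto simp: indicator_def)
  also have "... = (\<integral>\<^sup>+t. (NN x. ind {0..1} t * (NN y. en (moll e y) * g (x + t *\<^sub>R h - y))) \<partial>(lborel::real measure))"
   by (rule lborel_pair.Fubini') measurable
  also have "... = (\<integral>\<^sup>+t. ind {0..1} t * ?Y \<partial>(lborel::real measure))"
  proof (rule nn_integral_cong)
   fix t :: real
   have "(NN x. (NN y. en (moll e y) * g (x + t *\<^sub>R h - y)))
    = (NN y. (NN x. en (moll e y) * g (x + t *\<^sub>R h - y)))"
    by (rule lborel_pair.Fubini') measurable
   also have "... = (\<integral>\<^sup>+y. en (moll e y) * ?Y \<partial>(lborel :: 'a measure))"
   proof (rule nn_integral_cong)
    fix y :: 'a
    have "(NN x. g (x + (t *\<^sub>R h - y))) = ?Y"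
     by (subst nn_integral_translate) (simp_all add: g_def[abs_def])
    then show "(NN x. en (moll e y) * g (x + t *\<^sub>R h - y)) = en (moll e y) * ?Y"
     by (subst nn_integral_cmult) (auto simp: add_diff_eq)
   qed
   also have "... = ?Y" by (subst nn_integral_multc) (auto simp: moll_nn_integral[OF e(1)])
   finally show "(NN x. ind {0..1} t * (NN y. en (moll e y) * g (x + t *\<^sub>R h - y))) = ind {0..1} t * ?Y"
    by (subst nn_integral_cmult) auto
  qed
  also have "... = ?Y" by (subst nn_integral_multc) auto
  finally show ?thesis .
 qed
 show ?thesis
 proof (rule weighted_limit_le[where p=p])
  fix l eta :: real assume l: "0 < l" "l < 1" and eta: "0 < eta"
  define eta' where "eta' = eta / (2 powr p * 2)"
  have eta': "0 < eta'" using eta by (simp add: eta'_def)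
  obtain d where d: "0 < d" "!!e. 0 < e ==> e < d ==>
   (NN x. pw p (convol u (moll e) x - u x)) <= en eta'"
   using convol_moll_Lp[OF p u fin eta'] by blast
  define e where "e = min d e0 / 2"
  have e: "0 < e" "e < d" "e < e0" using d(1) e0 by (auto simp: e_def)
  let ?ue = "convol u (moll e)"
  note convol_moll_borel[OF e(1) u, measurable]
  let ?c = "(1 - l) powr (1 - p)" and ?k = "l powr (1 - p)"
  let ?r = "%x. abs(?ue x - u x)"
  have "(NN x. pw p (u (x + h) - u x) * ind A x)
   <= (NN x. en ?c * (pw p (?ue (x + h) - ?ue x) * ind A x)
     + en (?k * 2 powr p) * (en (?r (x + h) powr p) + en (?r x powr p)))"
  proof (rule nn_integral_mono)
   fix x
   have "abs(u (x + h) - u x) powr p <= (abs(?ue (x + h) - ?ue x) + (?r (x + h) + ?r x)) powr p"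
    using p by (intro powr_mono2) auto
   also have "... <= ?c * abs(?ue (x + h) - ?ue x) powr p + ?k * (?r (x + h) + ?r x) powr p"
    using p l by (intro powr_add_weighted) auto
   also have "... <= ?c * abs(?ue (x + h) - ?ue x) powr p + ?k * (2 powr p * (?r (x + h) powr p + ?r x powr p))"
    using p by (intro add_left_mono mult_left_mono powr_add_le2) auto
   finally have "pw p (u (x + h) - u x) <= en ?c * pw p (?ue (x + h) - ?ue x)
     + en (?k * 2 powr p) * (en (?r (x + h) powr p) + en (?r x powr p))"
    by (simp add: ennreal_leI mult.assoc flip: ennreal_plus ennreal_mult)
   then show "pw p (u (x + h) - u x) * ind A x <= en ?c * (pw p (?ue (x + h) - ?ue x) * ind A x)
     + en (?k * 2 powr p) * (en (?r (x + h) powr p) + en (?r x powr p))"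
    by (cases "x : A") auto
  qed
  also have "... = en ?c * (NN x. pw p (?ue (x + h) - ?ue x) * ind A x)
   + en (?k * 2 powr p) * ((NN x. en (?r (x + h) powr p)) + (NN x. en (?r x powr p)))"
   by (simp add: nn_integral_add nn_integral_cmult)
  also have "... <= en ?c * ?Y + en (?k * 2 powr p) * (en eta' + en eta')"
  proof (intro add_mono mult_left_mono mollified e)
   show "(NN x. en (?r (x + h) powr p)) <= en eta'"
    using d(2)[OF e(1,2)] nn_integral_translate[of "%x. en (?r x powr p)" h] by simp
   show "(NN x. en (?r x powr p)) <= en eta'" using d(2)[OF e(1,2)] by simp
  qed auto
  also have "en (?k * 2 powr p) * (en eta' + en eta') = en ?k * en eta"
  proof -
   have "?k * 2 powr p * (eta' + eta') = ?k * eta" by (simp add: eta'_def)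
   then show ?thesis using eta' eta by (metis ennreal_mult ennreal_plus less_imp_le mult_nonneg_nonneg powr_ge_zero add_nonneg_nonneg)
  qed
  finally show "(NN x. pw p (u (x + h) - u x) * ind A x) <= en ?c * ?Y + en ?k * en eta" .
 qed
qed

text \<open>A segment inside \<open>U\<close> is compact and so has some margin. The starting points
  with margin \<open>1 / Suc m\<close> increase to all of \<open>A\<close>, and monotone convergence
  disposes of the uniform margin.\<close>

lemma translation_estimate:
 fixes u :: "'a::euclidean_space => real"
 assumes p: "1 <= p" and w: "wgrad U u G" and u: "integrable lborel u"
  and fin: "(NN x. pw p (u x)) < \<infinity>"
  and Gm [measurable]: "G : bmeas"
  and G: "!!b. b : Basis ==> integrable lborel (%x. G x \<bullet> b)"
  and A [measurable]: "A : sets borel" and U: "open U"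
  and seg: "!!x t. x : A ==> 0 <= t ==> t <= 1 ==> x + t *\<^sub>R h : U"
 shows "(NN x. pw p (u (x + h) - u x) * ind A x)
  <= (NN x. pw p (G x \<bullet> h) * ind U x)"
proof -
 have [measurable]: "u : bmeas" using borel_measurable_integrable[OF u] by simp
 define V where "V m = {x. ALL t:{0..1}. ball (x + t *\<^sub>R h) (1 / real (Suc m)) \<subseteq> U}" for m
 have "closed (V m)" for m
 proof -
  have d: "dist (x + t *\<^sub>R h) y = dist (y - t *\<^sub>R h) x" for x y :: 'a and t
  proof -
   have "y - t *\<^sub>R h - x = - (x + t *\<^sub>R h - y)" by simp
   then show ?thesis unfolding dist_norm by (metis norm_minus_cancel)
  qed
  have "- V m = (\<Union>t\<in>{0..1}. \<Union>y\<in>-U. ball (y - t *\<^sub>R h) (1 / real (Suc m)))"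
   unfolding V_def set_eq_iff Compl_iff mem_Collect_eq UN_iff subset_eq Ball_def mem_ball d by blast
  moreover have "open (\<Union>t\<in>{0..1}. \<Union>y\<in>-U. ball (y - t *\<^sub>R h) (1 / real (Suc m)))" by (intro open_UN ballI open_ball)
  ultimately show ?thesis by (simp add: closed_def)
 qed
 then have [measurable]: "V m : sets borel" for m by auto
 have inc: "incseq (%m x. pw p (u (x + h) - u x) * ind (A \<inter> V m) x)"
 proof (rule incseq_SucI, rule le_funI)
  fix m x
  have "1 / real (Suc (Suc m)) <= 1 / real (Suc m)" by (intro divide_left_mono) auto
  then have "V m \<subseteq> V (Suc m)" unfolding V_def using subset_ball[of "1 / real (Suc (Suc m))" "1 / real (Suc m)"] by blast
  then show "pw p (u (x + h) - u x) * ind (A \<inter> V m) x <= pw p (u (x + h) - u x) * ind (A \<inter> V (Suc m)) x"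
   by (auto simp: indicator_def)
 qed
 have "(SUP m. pw p (u (x + h) - u x) * ind (A \<inter> V m) x) = pw p (u (x + h) - u x) * ind A x" for x
 proof (cases "x : A")
  case True
  have "compact ((%t. x + t *\<^sub>R h) ` {0..1})" by (intro compact_continuous_image continuous_intros) auto
  then obtain e where e: "0 < e" "(\<Union>y\<in>(%t. x + t *\<^sub>R h) ` {0..1}. ball y e) \<subseteq> U"
   using seg[OF True] by (elim compact_subset_open_imp_ball_epsilon_subset[OF _ U]) auto
  obtain m where m: "1 / real (Suc m) < e" using e(1) nat_approx_posE by blast
  have "x : V m"
   unfolding V_def
  proof (intro CollectI ballI)
   fix t :: real assume "t : {0..1}"
   then have "ball (x + t *\<^sub>R h) e \<subseteq> U" using e(2) by blast
   moreover have "ball (x + t *\<^sub>R h) (1 / real (Suc m)) \<subseteq> ball (x + t *\<^sub>R h) e" using m by (intro subset_ball) auto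
   ultimately show "ball (x + t *\<^sub>R h) (1 / real (Suc m)) \<subseteq> U" by blast
  qed
  then have "pw p (u (x + h) - u x) * ind A x <= pw p (u (x + h) - u x) * ind (A \<inter> V m) x"
   by (auto simp: indicator_def)
  also have "... <= (SUP m. pw p (u (x + h) - u x) * ind (A \<inter> V m) x)" by (intro SUP_upper) auto
  finally show ?thesis by (intro antisym SUP_least) (auto simp: indicator_def)
 qed (simp add: indicator_def)
 then have "(NN x. pw p (u (x + h) - u x) * ind A x)
  = (SUP m. NN x. pw p (u (x + h) - u x) * ind (A \<inter> V m) x)"
  using nn_integral_monotone_convergence_SUP[OF inc, of lborel] by simp
 also have "... <= (NN x. pw p (G x \<bullet> h) * ind U x)"
 proof (rule SUP_least)
  fix m
  show "(NN x. pw p (u (x + h) - u x) * ind (A \<inter> V m) x)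
   <= (NN x. pw p (G x \<bullet> h) * ind U x)"
  proof (rule translation_estimate_margin[OF p w u fin Gm G _ U])
   fix x and t :: real assume "x : A \<inter> V m" "0 <= t" "t <= 1"
   then have "ball (x + t *\<^sub>R h) (1 / real (Suc m)) \<subseteq> U" by (auto simp: V_def)
   moreover have "cball (x + t *\<^sub>R h) (1 / real (Suc m) / 2) \<subseteq> ball (x + t *\<^sub>R h) (1 / real (Suc m))" by (auto simp: field_simps)
   ultimately show "cball (x + t *\<^sub>R h) (1 / real (Suc m) / 2) \<subseteq> U" by blast
  qed auto
 qed
 finally show ?thesis .
qed


subsection \<open>Weak compactness through convex combinations\<close>

lemma tendsto_0_ennrealI:
 fixes f :: "'x => ennreal"
 assumes "!!e::real. 0 < e ==> \<forall>\<^sub>F n in F. f n <= en e"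
 shows "(f \<longlongrightarrow> 0) F"
proof (rule order_tendstoI)
 fix a :: ennreal assume "0 < a"
 then obtain b where "0 < b" "b < a" using dense by blast
 then obtain e where "0 < e" "b = en e" by (cases b) auto
 then show "\<forall>\<^sub>F n in F. f n < a" using assms[of e] \<open>b < a\<close> by (auto elim: eventually_mono)
qed auto

text \<open>A Riesz-Fischer argument that also covers \<open>q < 1\<close>, where L^q has no
  triangle inequality. The increments of the subsequence are weighted by
  \<open>(2 ^ i) powr q\<close>; the first factor of \<open>c i\<close> pays for that weight and the
  second makes the integrals summable. Where the sum is finite, the increments decay like
  \<open>(1 / 2) ^ i\<close>.\<close>

lemma Cauchy_powr_AE_subseq:
 fixes g :: "nat => 'x => 'b::euclidean_space"
 assumes [measurable]: "!!n. g n : borel_measurable M" and q: "0 < q"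
  and C: "!!e. 0 < e ==> EX N. ALL n>=N. ALL m>=n. (\<integral>\<^sup>+x. en (norm (g n x - g m x) powr q) \<partial>M) <= en e"
 obtains r f where "strict_mono r" "f : borel_measurable M" "AE x in M. (%i. g (r i) x) ----> f x"
proof -
 define c where "c i = (1 / 2 ^ i) powr q * (1 / 2) ^ i" for i :: nat
 have c: "0 < c i" for i by (simp add: c_def)
 have "EX N. ALL i. ALL n>=N i. ALL m>=n. (\<integral>\<^sup>+x. en (norm (g n x - g m x) powr q) \<partial>M) <= en (c i)"
  using C[OF c] by (intro choice) auto
 then obtain N where N: "!!i n m. N i <= n ==> n <= m ==> (\<integral>\<^sup>+x. en (norm (g n x - g m x) powr q) \<partial>M) <= en (c i)"
  by blast
 define r where "r i = i + (\<Sum>j\<le>i. N j)" for i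
 have r: "strict_mono r" by (rule strict_mono_Suc_iff[THEN iffD2]) (auto simp: r_def)
 have rN: "N i <= r i" for i
 proof -
  have "N i <= (\<Sum>j\<le>i. N j)" by (rule member_le_sum) auto
  then show ?thesis by (simp add: r_def)
 qed
 define F where "F i x = en ((2 ^ i) powr q * norm (g (r i) x - g (r (Suc i)) x) powr q)" for i x
 have [measurable]: "F i : borel_measurable M" for i unfolding F_def by measurable
 have "(\<integral>\<^sup>+x. F i x \<partial>M) <= en ((1 / 2) ^ i)" for i
 proof -
  have "(\<integral>\<^sup>+x. F i x \<partial>M) = en ((2 ^ i) powr q) * (\<integral>\<^sup>+x. en (norm (g (r i) x - g (r (Suc i)) x) powr q) \<partial>M)"
   unfolding F_def by (subst nn_integral_cmult[symmetric]) (auto simp: ennreal_mult)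
  also have "... <= en ((2 ^ i) powr q) * en (c i)"
   using N[OF rN, of i "r (Suc i)"] strict_monoD[OF r, of i "Suc i"] by (intro mult_left_mono) auto
  also have "... = en (((2 ^ i) powr q * (1 / 2 ^ i) powr q) * (1 / 2) ^ i)"
   using c[of i] by (subst ennreal_mult[symmetric]) (auto simp: c_def mult_ac)
  also have "(2 ^ i) powr q * (1 / 2 ^ i) powr q = 1" by (simp add: powr_divide)
  finally show ?thesis by simp
 qed
 then have "(\<Sum>i. \<integral>\<^sup>+x. F i x \<partial>M) <= (\<Sum>i. en ((1 / 2) ^ i))" by (intro suminf_le) auto
 also have "... < \<infinity>"
  using summable_geometric[of "1/2::real"] by (subst suminf_ennreal2) auto
 finally have "(\<integral>\<^sup>+x. (\<Sum>i. F i x) \<partial>M) < \<infinity>" by (subst nn_integral_suminf) auto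
 then have ae: "AE x in M. (\<Sum>i. F i x) ~= \<infinity>" by (intro nn_integral_PInf_AE) auto
 define f where "f x = lim (%i. g (r i) x)" for x
 have fm: "f : borel_measurable M" unfolding f_def by (rule borel_measurable_lim_metric) auto
 have "AE x in M. (%i. g (r i) x) ----> f x"
  using ae
 proof (rule AE_mp, intro AE_I2 impI)
  fix x assume fin: "(\<Sum>i. F i x) ~= \<infinity>"
  then obtain S where S: "0 <= S" "(\<Sum>i. F i x) = en S" by (cases "\<Sum>i. F i x") auto
  have bd: "norm (g (r (Suc i)) x - g (r i) x) <= S powr (1 / q) * (1 / 2) ^ i" for i
  proof -
   have "F i x <= (\<Sum>i. F i x)" using sum_le_suminf[of "%i. F i x" "{i}"] by auto
   then have "(2 ^ i) powr q * norm (g (r i) x - g (r (Suc i)) x) powr q <= S"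
    using S by (auto simp: F_def)
   then have "((2 ^ i * norm (g (r i) x - g (r (Suc i)) x)) powr q) powr (1 / q) <= S powr (1 / q)"
    using q by (intro powr_mono2) (auto simp: powr_mult)
   then have "2 ^ i * norm (g (r i) x - g (r (Suc i)) x) <= S powr (1 / q)"
    using q by (simp add: powr_powr)
   then show ?thesis by (simp add: field_simps norm_minus_commute power_one_over)
  qed
  have "summable (%i. S powr (1 / q) * (1 / 2) ^ i)" by (intro summable_mult summable_geometric) auto
  then have "summable (%i. g (r (Suc i)) x - g (r i) x)" by (rule summable_comparison_test'[of _ 0]) (use bd in auto)
  then have "(%n. \<Sum>i<n. g (r (Suc i)) x - g (r i) x) ----> (\<Sum>i. g (r (Suc i)) x - g (r i) x)" by (rule summable_LIMSEQ)
  then have "(%n. g (r n) x - g (r 0) x) ----> (\<Sum>i. g (r (Suc i)) x - g (r i) x)"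
   unfolding sum_lessThan_telescope[of "%i. g (r i) x"] .
  then have "(%n. g (r n) x - g (r 0) x + g (r 0) x) ----> (\<Sum>i. g (r (Suc i)) x - g (r i) x) + g (r 0) x"
   by (intro tendsto_add tendsto_const)
  then have "convergent (%n. g (r n) x)" by (auto simp: convergent_def)
  then show "(%i. g (r i) x) ----> f x" unfolding f_def by (simp add: convergent_LIMSEQ_iff)
 qed
 then show thesis using that r fm by blast
qed

lemma nn_integral_AE_limit_le:
 fixes h :: "nat => 'x => 'b::euclidean_space"
 assumes [measurable]: "!!n. h n : borel_measurable M" "f : borel_measurable M" and p: "0 < p"
  and lim: "AE x in M. (%i. h i x) ----> f x"
  and C: "!!n. (\<integral>\<^sup>+x. en (norm (h n x) powr p) \<partial>M) <= C"
 shows "(\<integral>\<^sup>+x. en (norm (f x) powr p) \<partial>M) <= C"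
proof -
 have "(\<integral>\<^sup>+x. en (norm (f x) powr p) \<partial>M) = (\<integral>\<^sup>+x. liminf (%n. en (norm (h n x) powr p)) \<partial>M)"
 proof (rule nn_integral_cong_AE, use lim in \<open>rule AE_mp\<close>, intro AE_I2 impI)
  fix x assume "(%i. h i x) ----> f x"
  then have "(%n. en (norm (h n x) powr p)) ----> en (norm (f x) powr p)"
   using p by (intro tendsto_ennrealI tendsto_powr2 tendsto_norm tendsto_const) auto
  then show "en (norm (f x) powr p) = liminf (%n. en (norm (h n x) powr p))"
   by (rule lim_imp_Liminf[OF sequentially_bot, symmetric])
 qed
 also have "... <= liminf (%n. \<integral>\<^sup>+x. en (norm (h n x) powr p) \<partial>M)"
  by (rule nn_integral_liminf) auto
 also have "... <= C" using C by (intro Liminf_le) auto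
 finally show ?thesis .
qed

text \<open>Boundedness in L^p with \<open>p > 1\<close> gives uniform integrability: above the
  level \<open>R\<close> the distance is at most \<open>R powr (1 - p)\<close> times its
  \<open>p\<close>-th power, and below it dominated convergence applies on the finite measure
  space.\<close>

lemma L1_convergence_AE_Lp_bounded:
 fixes h :: "nat => 'x => 'b::euclidean_space"
 assumes M: "finite_measure M"
  and hm [measurable]: "!!n. h n : borel_measurable M" and fm [measurable]: "f : borel_measurable M" and p: "1 < p"
  and lim: "AE x in M. (%i. h i x) ----> f x"
  and C: "!!n. (\<integral>\<^sup>+x. en (norm (h n x) powr p) \<partial>M) <= en C"
 shows "(%n. \<integral>\<^sup>+x. en (norm (h n x - f x)) \<partial>M) ----> 0"
proof -
 interpret finite_measure M by fact
 have fC: "(\<integral>\<^sup>+x. en (norm (f x) powr p) \<partial>M) <= en C"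
  by (rule nn_integral_AE_limit_le[OF hm fm _ lim C]) (use p in auto)
 let ?d = "%n x. norm (h n x - f x)"
 define K where "K = 2 powr p * (2 * max 0 C)"
 have dp: "(\<integral>\<^sup>+x. en (?d n x powr p) \<partial>M) <= en K" for n
 proof -
  have "(\<integral>\<^sup>+x. en (?d n x powr p) \<partial>M) <= (\<integral>\<^sup>+x. en (2 powr p) * (en (norm (h n x) powr p) + en (norm (f x) powr p)) \<partial>M)"
  proof (rule nn_integral_mono)
   fix x
   have "?d n x powr p <= (norm (h n x) + norm (f x)) powr p"
    using p by (intro powr_mono2 norm_triangle_ineq4) auto
   also have "... <= 2 powr p * (norm (h n x) powr p + norm (f x) powr p)" using p by (intro powr_add_le2) auto
   finally show "en (?d n x powr p) <= en (2 powr p) * (en (norm (h n x) powr p) + en (norm (f x) powr p))"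
    by (simp add: ennreal_leI flip: ennreal_plus ennreal_mult)
  qed
  also have "... = en (2 powr p) * ((\<integral>\<^sup>+x. en (norm (h n x) powr p) \<partial>M) + (\<integral>\<^sup>+x. en (norm (f x) powr p) \<partial>M))"
   by (simp add: nn_integral_cmult nn_integral_add)
  also have "... <= en (2 powr p) * (en (max 0 C) + en (max 0 C))"
   using C[of n] fC by (intro mult_left_mono add_mono) (auto simp: max_def ennreal_neg intro: order_trans)
  also have "... = en K" by (simp add: K_def flip: ennreal_plus ennreal_mult)
  finally show ?thesis .
 qed
 show ?thesis
 proof (rule tendsto_0_ennrealI)
  fix e :: real assume e: "0 < e"
  obtain R where R: "0 < R" "R powr (1 - p) * K <= e / 2"
  proof -
   have "((%R. R powr (- (p - 1)) * K) \<longlongrightarrow> 0 * K) at_top"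
    using p by (intro tendsto_mult tendsto_neg_powr filterlim_ident tendsto_const) auto
   then have "\<forall>\<^sub>F R in at_top. R powr (- (p - 1)) * K < e / 2" using e by (intro order_tendstoD(2)) auto
   then have "\<forall>\<^sub>F R in at_top. R powr (- (p - 1)) * K < e / 2 & 0 < R" using eventually_gt_at_top[of 0] by (rule eventually_conj)
   then obtain R where "R powr (- (p - 1)) * K < e / 2" "0 < R" by (auto dest!: eventually_happens)
   then show thesis by (intro that[of R]) auto
  qed
  have "(%n. \<integral>\<^sup>+x. en (min (?d n x) R) \<partial>M) ----> (\<integral>\<^sup>+x. 0 \<partial>M)"
  proof (rule nn_integral_dominated_convergence[where w="%x. en R"])
   show "AE x in M. (%n. en (min (?d n x) R)) ----> 0"
    using lim
   proof (rule AE_mp, intro AE_I2 impI)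
    fix x assume "(%i. h i x) ----> f x"
    then have "(%n. en (min (?d n x) R)) ----> en (min (norm (f x - f x)) R)"
     by (intro tendsto_intros)
    then show "(%n. en (min (?d n x) R)) ----> 0" using R by simp
   qed
   have "emeasure M (space M) < top" by (simp add: emeasure_eq_measure)
   then show "(\<integral>\<^sup>+x. en R \<partial>M) < \<infinity>" by (simp add: ennreal_mult_less_top)
  qed (auto intro!: AE_I2 ennreal_leI)
  then have "\<forall>\<^sub>F n in sequentially. (\<integral>\<^sup>+x. en (min (?d n x) R) \<partial>M) < en (e / 2)"
   using e by (intro order_tendstoD(2)) auto
  then show "\<forall>\<^sub>F n in sequentially. (\<integral>\<^sup>+x. en (?d n x) \<partial>M) <= en e"
  proof (rule eventually_mono)
   fix n assume n: "(\<integral>\<^sup>+x. en (min (?d n x) R) \<partial>M) < en (e / 2)"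
   have "(\<integral>\<^sup>+x. en (?d n x) \<partial>M) <= (\<integral>\<^sup>+x. en (min (?d n x) R) + en (R powr (1 - p)) * en (?d n x powr p) \<partial>M)"
   proof (rule nn_integral_mono)
    fix x
    have "?d n x <= min (?d n x) R + R powr (1 - p) * ?d n x powr p"
    proof (cases "?d n x <= R")
     case False
     then have "R powr (p - 1) <= ?d n x powr (p - 1)" using p R by (intro powr_mono2) auto
     then have "R powr (1 - p) * R powr (p - 1) * ?d n x <= R powr (1 - p) * ?d n x powr (p - 1) * ?d n x"
      using R by (intro mult_right_mono mult_left_mono) auto
     moreover have "R powr (1 - p) * R powr (p - 1) = 1" using R by (simp flip: powr_add)
     moreover have "?d n x powr (p - 1) * ?d n x = ?d n x powr p" using False R by (simp add: powr_diff)
     ultimately show ?thesis using R False by (simp add: mult.assoc)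
    qed auto
    then show "en (?d n x) <= en (min (?d n x) R) + en (R powr (1 - p)) * en (?d n x powr p)"
     using R by (simp add: ennreal_leI flip: ennreal_plus ennreal_mult)
   qed
   also have "... = (\<integral>\<^sup>+x. en (min (?d n x) R) \<partial>M) + en (R powr (1 - p)) * (\<integral>\<^sup>+x. en (?d n x powr p) \<partial>M)"
    by (subst nn_integral_add) (auto simp: nn_integral_cmult)
   also have "... <= en (e / 2) + en (R powr (1 - p)) * en K"
    using n dp by (intro add_mono mult_left_mono) auto
   also have "... = en (e / 2 + R powr (1 - p) * K)"
    using e by (simp add: K_def ennreal_plus ennreal_mult)
   also have "... <= en e" using R by (intro ennreal_leI) auto
   finally show "(\<integral>\<^sup>+x. en (?d n x) \<partial>M) <= en e" .
  qed
 qed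
qed

text \<open>Quantitative strict convexity. With \<open>D\<close> the midpoint defect and
  \<open>w = P a + P b\<close>, the core estimate is \<open>d\<^sup>2 <= D * w ^ 3\<close> for
  \<open>d = norm (a - b)\<close>. For the square root of \<open>d\<close>, comparing it with
  \<open>t * w\<close> separates this into a part small with \<open>t\<close> and a multiple of
  \<open>D\<close>. Both terms are then linear in values of \<open>P\<close>, so they can be
  integrated knowing only first moments of \<open>P\<close>.\<close>

lemma sqrt_convexity_gap:
 fixes a b :: "'b::euclidean_space" and t :: real
 defines "P \<equiv> %z::'b. sqrt (1 + (norm z)\<^sup>2)"
 assumes t: "0 < t"
 shows "norm (a - b) powr (1/2) <= t * (P a + P b) + (P a + P b - 2 * P ((1/2) *\<^sub>R (a + b))) / t ^ 3"
proof -
 define A B S where "A = P a" and "B = P b" and "S = 2 * P ((1/2) *\<^sub>R (a + b))"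
 define d where "d = norm (a - b)"
 have AB: "1 <= A" "1 <= B" "0 <= S" by (auto simp: A_def B_def S_def P_def)
 have A2: "A\<^sup>2 = 1 + a \<bullet> a" and B2: "B\<^sup>2 = 1 + b \<bullet> b" by (auto simp: A_def B_def P_def power2_norm_eq_inner)
 have S2: "S\<^sup>2 = 4 + (a + b) \<bullet> (a + b)"
 proof -
  have "S\<^sup>2 = 4 * (1 + (norm ((1/2) *\<^sub>R (a + b)))\<^sup>2)" unfolding S_def P_def power_mult_distrib by simp
  also have "norm ((1/2) *\<^sub>R (a + b)) = norm (a + b) / 2" by simp
  finally show ?thesis by (simp add: power_divide power2_norm_eq_inner)
 qed
 \<comment> \<open>\<open>c\<close> is the inner product of the lifted vectors \<open>(1, a)\<close>
   and \<open>(1, b)\<close>, whose norms are \<open>A\<close> and \<open>B\<close>; hence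
   \<open>A * B - c\<close> is a Cauchy-Schwarz defect.\<close>
 define c where "c = 1 + a \<bullet> b"
 have key: "(A + B)\<^sup>2 - S\<^sup>2 = 2 * (A * B - c)"
  using A2 B2 S2 by (simp add: power2_sum c_def inner_add_left inner_add_right inner_commute)
 have d2: "d\<^sup>2 = a \<bullet> a + b \<bullet> b - 2 * (a \<bullet> b)"
  by (simp add: d_def power2_norm_eq_inner inner_diff_left inner_diff_right inner_commute)
 have CS: "(a \<bullet> b)\<^sup>2 <= (a \<bullet> a) * (b \<bullet> b)" by (rule Cauchy_Schwarz_ineq)
 have "(A * B)\<^sup>2 = (1 + a \<bullet> a) * (1 + b \<bullet> b)" by (simp add: power_mult_distrib A2 B2)
 then have diff2: "d\<^sup>2 <= (A * B)\<^sup>2 - c\<^sup>2"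
  using CS d2 by (simp add: c_def power2_eq_square algebra_simps)
 then have "c\<^sup>2 <= (A * B)\<^sup>2" using zero_le_power2[of d] by linarith
 then have "abs c <= abs(A * B)" by (simp only: abs_le_square_iff)
 moreover have "0 <= A * B" using AB by (intro mult_nonneg_nonneg) auto
 ultimately have cAB: "abs c <= A * B" by simp
 have D0: "S <= A + B"
 proof -
  have "0 <= A * B - c" using cAB by simp
  then have "0 <= (A + B)\<^sup>2 - S\<^sup>2" unfolding key by simp
  then have "S\<^sup>2 <= (A + B)\<^sup>2" by simp
  then show ?thesis by (rule power2_le_imp_le) (use AB in simp)
 qed
 define D where "D = A + B - S"
 define w where "w = A + B"
 have w: "2 <= w" using AB by (simp add: w_def)
 have "d\<^sup>2 <= (A * B - c) * (A * B + c)" using diff2 by (simp add: power2_eq_square algebra_simps)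
 also have "... <= (A * B - c) * (2 * (A * B))" using cAB by (intro mult_left_mono) auto
 also have "... = ((A + B)\<^sup>2 - S\<^sup>2) * (A * B)" using key by simp
 also have "(A + B)\<^sup>2 - S\<^sup>2 = D * (A + B + S)" by (simp add: D_def power2_eq_square algebra_simps)
 also have "D * (A + B + S) * (A * B) <= D * (2 * w) * (w\<^sup>2 / 4)"
 proof (intro mult_mono mult_left_mono)
  show "A * B <= w\<^sup>2 / 4" using zero_le_power2[of "A - B"] by (simp add: w_def power2_eq_square algebra_simps)
 qed (use D0 AB w in \<open>auto simp: D_def w_def\<close>)
 also have "... = D * w ^ 3 / 2" by (simp add: power2_eq_square power3_eq_cube)
 also have "... <= D * w ^ 3" using D0 w mult_nonneg_nonneg[of D "w ^ 3"] by (simp add: D_def)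
 finally have main: "d\<^sup>2 <= D * w ^ 3" .
 have D: "0 <= D" using D0 by (simp add: D_def)
 define q where "q = d powr (1/2)"
 have q: "0 <= q" "q * q = d" using powr_half_sqrt[of d] by (auto simp: q_def d_def)
 have "q <= t * w + D / t ^ 3"
 proof (cases "q <= t * w")
  case True
  then show ?thesis using D t by (simp add: add_increasing2)
 next
  case False
  then have qw: "t * w < q" by simp
  have "q ^ 4 = (q * q) * (q * q)" by (simp add: power4_eq_xxxx)
  then have "q ^ 4 <= D * w ^ 3" using main unfolding q(2) by (simp add: power2_eq_square)
  then have "t ^ 3 * q ^ 4 <= t ^ 3 * (D * w ^ 3)" using t by (intro mult_left_mono) auto
  also have "... = D * (t * w) ^ 3" by (simp add: power_mult_distrib mult_ac)
  also have "... <= D * q ^ 3" using D qw t w by (intro mult_left_mono power_mono) auto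
  finally have "(t ^ 3 * q) * q ^ 3 <= D * q ^ 3" by (simp add: power_numeral_reduce mult_ac)
  moreover have "0 < q" using qw t w by (smt (verit) mult_pos_pos)
  ultimately have "t ^ 3 * q <= D" by simp
  then have "q <= D / t ^ 3" using t by (simp add: field_simps)
  then show ?thesis using t w by (smt (verit) mult_pos_pos)
 qed
 then show ?thesis by (simp add: q_def d_def w_def D_def A_def B_def S_def)
qed

lemma powr_convex_combination:
 fixes w a :: "nat => real"
 assumes p: "1 <= p" and "!!j. 0 <= w j" "sum w {..<m} = 1" "!!j. 0 <= a j"
 shows "(\<Sum>j<m. w j * a j) powr p <= (\<Sum>j<m. w j * a j powr p)"
proof -
 define c where "c = (\<Sum>j<m. w j * a j)"
 have c: "0 <= c" using assms by (simp add: c_def sum_nonneg)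
 have K: "k * (\<Sum>j<m. w j * a j) = (\<Sum>j<m. w j * (k * a j))" for k
  by (simp add: sum_distrib_left mult_ac)
 have "p * c powr (p - 1) * c = (\<Sum>j<m. w j * (p * c powr (p - 1) * a j))"
  using K[of "p * c powr (p - 1)"] by (simp only: c_def[symmetric])
 also have "... <= (\<Sum>j<m. w j * (a j powr p + (p - 1) * c powr p))"
  using assms c by (intro sum_mono mult_left_mono young_tangent) auto
 also have "... = (\<Sum>j<m. w j * a j powr p) + sum w {..<m} * ((p - 1) * c powr p)"
  by (simp add: distrib_left sum.distrib sum_distrib_right)
 finally have "p * c powr (p - 1) * c <= (\<Sum>j<m. w j * a j powr p) + (p - 1) * c powr p" using assms by simp
 moreover have "p * c powr (p - 1) * c = c powr p + (p - 1) * c powr p"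
  using c by (cases "c = 0") (simp_all add: powr_diff left_diff_distrib)
 ultimately show ?thesis by (simp add: c_def)
qed

text \<open>Almost-minimisers \<open>H n\<close> of the convex functional \<open>I\<close> over the
  convex combinations \<open>cc n\<close> of the tail from \<open>n\<close> on form a Cauchy
  sequence: the midpoint of \<open>H n\<close> and \<open>H m\<close> is still admissible and cannot
  beat the infimum \<open>J n\<close>, and \<open>J\<close> is increasing and bounded. A strong
  limit \<open>F\<close> of the \<open>H n\<close> has the required pairings, because convex
  combinations of a tail have the same limits of pairings as the sequence itself. The norm bound
  passes to \<open>F\<close> by convexity and Fatou's lemma.\<close>

lemma weak_compactness_Lp:
 fixes f :: "nat => 'x => 'b::euclidean_space"
 assumes M: "finite_measure M" and fm [measurable]: "!!j. f j : borel_measurable M" and p: "1 < p"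
  and C: "!!j. (\<integral>\<^sup>+x. en (norm (f j x) powr p) \<partial>M) <= en C"
 obtains F where "F : borel_measurable M" "(\<integral>\<^sup>+x. en (norm (F x) powr p) \<partial>M) <= en C"
  "!!g c B. g : borel_measurable M ==> (!!x. norm (g x) <= B) ==>
   (%j. \<integral>x. f j x \<bullet> g x \<partial>M) ----> c ==> (\<integral>x. F x \<bullet> g x \<partial>M) = c"
proof -
 interpret finite_measure M by fact
 define cc where "cc n h \<longleftrightarrow> (EX m w. (ALL j. 0 <= w j) & (ALL j. w j ~= 0 --> n <= j & j < m) &
  sum w {..<m} = 1 & h = (%x. \<Sum>j<m. w j *\<^sub>R f j x))" for n :: nat and h :: "'x => 'b"
 \<comment> \<open>Strictly convex, but of linear growth: an L^p bound on a finite measure space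
   makes \<open>P\<close> integrable.\<close>
 define P where "P z = sqrt (1 + (norm z)\<^sup>2)" for z :: 'b
 define V where "V = measure M (space M)"
 define K where "K = 2 * V + max 0 C"
 have V: "emeasure M (space M) = en V" "0 <= V" by (auto simp: V_def emeasure_eq_measure)
 have K: "0 <= K" using V by (simp add: K_def)
 have cc_borel: "h : borel_measurable M" if "cc n h" for n h using that by (auto simp: cc_def)
 have cc_pow: "(\<integral>\<^sup>+x. en (norm (h x) powr p) \<partial>M) <= en C" if "cc n h" for n h
 proof -
  obtain m w where w: "!!j. 0 <= w j" "sum w {..<m} = 1" "h = (%x. \<Sum>j<m. w j *\<^sub>R f j x)"
   using \<open>cc n h\<close> unfolding cc_def by blast
  have "(\<integral>\<^sup>+x. en (norm (h x) powr p) \<partial>M) <= (\<integral>\<^sup>+x. (\<Sum>j<m. en (w j) * en (norm (f j x) powr p)) \<partial>M)"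
  proof (rule nn_integral_mono)
   fix x
   have "norm (h x) <= (\<Sum>j<m. norm (w j *\<^sub>R f j x))" unfolding w(3) by (rule norm_sum)
   also have "... = (\<Sum>j<m. w j * norm (f j x))" using w(1) by simp
   finally have "norm (h x) powr p <= (\<Sum>j<m. w j * norm (f j x)) powr p" using p by (intro powr_mono2) auto
   also have "... <= (\<Sum>j<m. w j * norm (f j x) powr p)" using p w by (intro powr_convex_combination) auto
   finally show "en (norm (h x) powr p) <= (\<Sum>j<m. en (w j) * en (norm (f j x) powr p))"
    using w(1) by (simp add: ennreal_leI sum_ennreal flip: ennreal_mult)
  qed
  also have "... = (\<Sum>j<m. en (w j) * (\<integral>\<^sup>+x. en (norm (f j x) powr p) \<partial>M))"
   by (subst nn_integral_sum) (auto simp: nn_integral_cmult)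
  also have "... <= (\<Sum>j<m. en (w j) * en C)" using C by (intro sum_mono mult_left_mono) auto
  also have "... = en (sum w {..<m}) * en C" using w(1) by (simp add: sum_distrib_right[symmetric] sum_ennreal)
  finally show ?thesis using w by simp
 qed
 have P: "1 <= P z" "P z <= 2 + norm z powr p" for z
 proof -
  show "1 <= P z" by (simp add: P_def)
  have "P z <= 1 + norm z" unfolding P_def by (rule real_le_lsqrt) (auto simp: power2_sum)
  moreover have "norm z <= 1 + norm z powr p"
  proof (cases "norm z <= 1")
   case False
   then have "norm z powr 1 <= norm z powr p" using p by (intro powr_mono) auto
   then show ?thesis using False by simp
  qed (smt (verit) powr_ge_zero)
  ultimately show "P z <= 2 + norm z powr p" by simp
 qed
 have [measurable]: "P : bmeas" unfolding P_def by measurable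
 have PK: "(\<integral>\<^sup>+x. en (P (h x)) \<partial>M) <= en K" if hm [measurable]: "h : borel_measurable M"
  and hC: "(\<integral>\<^sup>+x. en (norm (h x) powr p) \<partial>M) <= en C" for h
 proof -
  have "(\<integral>\<^sup>+x. en (P (h x)) \<partial>M) <= (\<integral>\<^sup>+x. en 2 + en (norm (h x) powr p) \<partial>M)"
   using P(2) by (intro nn_integral_mono) (simp add: ennreal_leI del: ennreal_numeral flip: ennreal_plus)
  also have "... = en 2 * en V + (\<integral>\<^sup>+x. en (norm (h x) powr p) \<partial>M)"
   by (subst nn_integral_add) (auto simp: V)
  also have "... <= en 2 * en V + en (max 0 C)"
   using hC by (intro add_mono) (auto simp: max_def ennreal_neg)
  also have "... = en K" using V by (simp add: K_def ennreal_plus ennreal_mult)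
  finally show ?thesis .
 qed
 have Pint: "integrable M (%x. P (h x))" if "cc n h" for n h
 proof (rule integrableI_bounded)
  show "(%x. P (h x)) : borel_measurable M" using cc_borel[OF that] by measurable
  have "abs(P z) = P z" for z using P(1)[of z] by linarith
  then show "(\<integral>\<^sup>+x. en (norm (P (h x))) \<partial>M) < \<infinity>"
   using PK[OF cc_borel[OF that] cc_pow[OF that]] by (auto intro: le_less_trans)
 qed
 define I where "I h = (\<integral>x. P (h x) \<partial>M)" for h
 have I0: "0 <= I h" for h unfolding I_def using P(1) by (intro Bochner_Integration.integral_nonneg) (meson order_trans zero_le_one)
 have IK: "I h <= K" if "cc n h" for n h
 proof -
  have "AE x in M. 0 <= P (h x)" using P(1) by (intro AE_I2) (meson order_trans zero_le_one)
  then have "en (I h) = (\<integral>\<^sup>+x. en (P (h x)) \<partial>M)"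
   unfolding I_def using nn_integral_eq_integral[OF Pint[OF that]] by simp
  then have "en (I h) <= en K" using PK[OF cc_borel[OF that] cc_pow[OF that]] by simp
  then show ?thesis by (simp only: ennreal_le_iff[OF K])
 qed
 have cc_self: "cc n (f n)" for n
  unfolding cc_def
  by (rule exI[of _ "Suc n"], rule exI[of _ "%j. if j = n then 1 else 0"]) (auto simp: if_distrib[of "%c. c *\<^sub>R _"] cong: if_cong)
 have cc_mono: "cc n h" if "cc n' h" "n <= n'" for n n' h
 proof -
  obtain m w where w: "!!j. 0 <= w j" "!!j. w j ~= 0 ==> n' <= j & j < m" "sum w {..<m} = 1" "h = (%x. \<Sum>j<m. w j *\<^sub>R f j x)"
   using \<open>cc n' h\<close> unfolding cc_def by blast
  show ?thesis unfolding cc_def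
   by (rule exI[of _ m], rule exI[of _ w]) (use w order_trans[OF \<open>n <= n'\<close>] in auto)
 qed
 have cc_mid: "cc n (%x. (1/2) *\<^sub>R (h x + h' x))" if "cc n h" "cc n h'" for n h h'
 proof -
  obtain m w where w: "!!j. 0 <= w j" "!!j. w j ~= 0 ==> n <= j & j < m" "sum w {..<m} = 1" "h = (%x. \<Sum>j<m. w j *\<^sub>R f j x)"
   using \<open>cc n h\<close> unfolding cc_def by blast
  obtain m' w' where w': "!!j. 0 <= w' j" "!!j. w' j ~= 0 ==> n <= j & j < m'" "sum w' {..<m'} = 1" "h' = (%x. \<Sum>j<m'. w' j *\<^sub>R f j x)"
   using \<open>cc n h'\<close> unfolding cc_def by blast
  let ?m = "max m m'"
  have s: "sum w {..<?m} = 1" "sum w' {..<?m} = 1"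
   using w w' by (metis (no_types, lifting) DiffD2 finite_lessThan lessThan_iff lessThan_subset_iff max.cobounded1 max.cobounded2 sum.mono_neutral_right)+
  have hh: "h = (%x. \<Sum>j<?m. w j *\<^sub>R f j x)" "h' = (%x. \<Sum>j<?m. w' j *\<^sub>R f j x)"
   unfolding w(4) w'(4) using w(2) w'(2) by (auto intro!: ext sum.mono_neutral_left)
  show ?thesis
   unfolding cc_def
  proof (rule exI[of _ ?m], rule exI[of _ "%j. (w j + w' j) / 2"], intro conjI allI impI)
   show "(\<Sum>j<?m. (w j + w' j) / 2) = 1" using s by (simp add: sum.distrib flip: sum_divide_distrib)
   show "(%x. (1/2) *\<^sub>R (h x + h' x)) = (%x. \<Sum>j<?m. ((w j + w' j) / 2) *\<^sub>R f j x)"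
    unfolding hh by (rule ext) (simp add: scaleR_add_right scaleR_sum_right sum.distrib scaleR_add_left add_divide_distrib)
   fix j assume nz: "(w j + w' j) / 2 ~= 0"
   then have "w j ~= 0 \<or> w' j ~= 0" by auto
   then show "n <= j" "j < ?m" using w(2)[of j] w'(2)[of j] by auto
  qed (use w(1) w'(1) in auto)
 qed
 define J where "J n = Inf (I ` {h. cc n h})" for n
 have bdd: "bdd_below (I ` A)" for A using I0 by (intro bdd_belowI2[of _ 0]) auto
 have J_le: "J n <= I h" if "cc n h" for n h unfolding J_def using that bdd by (intro cInf_lower) auto
 have J_mono: "J n <= J n'" if "n <= n'" for n n'
  unfolding J_def[of n'] using cc_self[of n'] cc_mono[OF _ that] by (intro cInf_greatest) (auto intro!: J_le)
 have JK: "J n <= K" for n using J_le[OF cc_self] IK[OF cc_self] by (rule order_trans)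
 have "EX h. cc n h & I h < J n + 1 / real (Suc n)" for n
 proof -
  have "Inf (I ` {h. cc n h}) < J n + 1 / real (Suc n)" by (simp add: J_def)
  from cInf_lessD[OF _ this] show ?thesis using cc_self[of n] by auto
 qed
 then obtain H where H: "!!n. cc n (H n)" "!!n. I (H n) < J n + 1 / real (Suc n)" by metis
 note [measurable] = cc_borel[OF H(1)]
 have est: "(\<integral>\<^sup>+x. en (norm (H n x - H m x) powr (1/2)) \<partial>M) <= en (t * (2 * K) + (J m - J n + 2 / real (Suc n)) / t ^ 3)"
  if t: "0 < t" and nm: "n <= m" for t n m
 proof -
  let ?mid = "%x. (1/2) *\<^sub>R (H n x + H m x)"
  let ?R = "%x. t * (P (H n x) + P (H m x)) + (P (H n x) + P (H m x) - 2 * P (?mid x)) / t ^ 3"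
  have ccm: "cc n (H m)" using cc_mono[OF H(1) nm] .
  have i: "integrable M (%x. P (H n x))" "integrable M (%x. P (H m x))" "integrable M (%x. P (?mid x))"
   by (rule Pint[OF H(1)] Pint[OF cc_mid[OF H(1) ccm]])+
  have gap: "norm (H n x - H m x) powr (1/2) <= ?R x" for x
   using sqrt_convexity_gap[OF t, of "H n x" "H m x"] unfolding P_def .
  have "(\<integral>\<^sup>+x. en (norm (H n x - H m x) powr (1/2)) \<partial>M) <= (\<integral>\<^sup>+x. en (?R x) \<partial>M)"
   using gap by (intro nn_integral_mono ennreal_leI)
  also have "... = en (\<integral>x. ?R x \<partial>M)"
   using i order_trans[OF powr_ge_zero gap] by (intro nn_integral_eq_integral) auto
  also have "(\<integral>x. ?R x \<partial>M) = t * (I (H n) + I (H m)) + (I (H n) + I (H m) - 2 * I ?mid) / t ^ 3"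
   unfolding I_def using i by simp
  also have "... <= t * (2 * K) + (J m - J n + 2 / real (Suc n)) / t ^ 3"
  proof (intro add_mono mult_left_mono divide_right_mono)
   show "I (H n) + I (H m) <= 2 * K" using IK[OF H(1), of n] IK[OF H(1), of m] by simp
   have "1 / real (Suc m) <= 1 / real (Suc n)" using nm by (intro divide_left_mono) auto
   then show "I (H n) + I (H m) - 2 * I ?mid <= J m - J n + 2 / real (Suc n)"
    using H(2)[of n] H(2)[of m] J_le[OF cc_mid[OF H(1) ccm]] by simp
  qed (use t in auto)
  finally show ?thesis by (simp add: ennreal_leI)
 qed
 have cau: "EX N. ALL n>=N. ALL m>=n. (\<integral>\<^sup>+x. en (norm (H n x - H m x) powr (1/2)) \<partial>M) <= en e" if e: "0 < e" for e
 proof -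
  \<comment> \<open>First \<open>t\<close> makes the linear term at most \<open>e / 2\<close> for
    all indices; only then is the tail index chosen so that the defect is small compared with
    \<open>t ^ 3\<close>.\<close>
  define t where "t = e / (4 * (K + 1))"
  have t: "0 < t" "t * (2 * K) <= e / 2" using e K by (auto simp: t_def field_simps)
  have "convergent J"
   using incseq_convergent[of J K] J_mono JK by (metis convergentI incseq_def)
  then have "Cauchy J" by (rule convergent_Cauchy)
  then obtain N1 where N1: "!!m n. N1 <= m ==> N1 <= n ==> abs(J m - J n) < t ^ 3 * e / 4"
   using t e unfolding Cauchy_def dist_real_def by (metis divide_pos_pos mult_pos_pos zero_less_numeral zero_less_power)
  obtain N2 where N2: "8 / (t ^ 3 * e) < real N2" using reals_Archimedean2 by blast
  show ?thesis
  proof (intro exI[of _ "max N1 N2"] allI impI)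
   fix n m assume n: "max N1 N2 <= n" and nm: "n <= m"
   have "2 / real (Suc n) <= t ^ 3 * e / 4"
   proof -
    have "8 / (t ^ 3 * e) < real (Suc n)" using N2 n by simp
    moreover have "0 < t ^ 3 * e" using t e by simp
    ultimately have "8 < real (Suc n) * (t ^ 3 * e)" by (simp only: pos_divide_less_eq)
    then have "2 <= t ^ 3 * e / 4 * real (Suc n)" by (simp add: mult.commute)
    then show ?thesis by (subst pos_divide_le_eq) auto
   qed
   moreover have "abs(J m - J n) < t ^ 3 * e / 4" using N1[of m n] n nm by auto
   ultimately have "J m - J n + 2 / real (Suc n) <= t ^ 3 * e / 4 + t ^ 3 * e / 4" by linarith
   also have "... = (e / 2) * t ^ 3" by simp
   finally have "(J m - J n + 2 / real (Suc n)) / t ^ 3 <= e / 2" using t by (simp only: pos_divide_le_eq zero_less_power)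
   then have "t * (2 * K) + (J m - J n + 2 / real (Suc n)) / t ^ 3 <= e" using t by linarith
   then show "(\<integral>\<^sup>+x. en (norm (H n x - H m x) powr (1/2)) \<partial>M) <= en e"
    using est[OF t(1) nm] by (meson ennreal_leI order_trans)
  qed
 qed
 obtain r F where r: "strict_mono r" and Fm [measurable]: "F : borel_measurable M"
  and lim: "AE x in M. (%i. H (r i) x) ----> F x"
  using Cauchy_powr_AE_subseq[of H M "1/2", OF cc_borel[OF H(1)] _ cau] by auto
 have Fp: "(\<integral>\<^sup>+x. en (norm (F x) powr p) \<partial>M) <= en C"
  by (rule nn_integral_AE_limit_le[of "%i. H (r i)", OF _ _ _ lim cc_pow[OF H(1)]]) (use p in auto)
 have L1: "(%n. \<integral>\<^sup>+x. en (norm (H (r n) x - F x)) \<partial>M) ----> 0"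
  by (rule L1_convergence_AE_Lp_bounded[OF M _ _ p lim cc_pow[OF H(1)]]) auto
 have nint: "integrable M h" if [measurable]: "h : borel_measurable M" and hC: "(\<integral>\<^sup>+x. en (norm (h x) powr p) \<partial>M) <= en C" for h :: "'x => 'b"
 proof (rule integrableI_bounded)
  have "norm z <= P z" for z unfolding P_def by (rule real_le_rsqrt) simp
  then have "(\<integral>\<^sup>+x. en (norm (h x)) \<partial>M) <= (\<integral>\<^sup>+x. en (P (h x)) \<partial>M)" by (intro nn_integral_mono ennreal_leI)
  also have "... <= en K" by (rule PK[OF _ hC]) auto
  finally show "(\<integral>\<^sup>+x. en (norm (h x)) \<partial>M) < \<infinity>" by (auto intro: le_less_trans)
 qed auto
 have "(\<integral>x. F x \<bullet> g x \<partial>M) = c" if gm [measurable]: "g : borel_measurable M" and gB: "!!x. norm (g x) <= B"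
  and gc: "(%j. \<integral>x. f j x \<bullet> g x \<partial>M) ----> c" for g c B
 proof -
  have B: "0 <= B" using norm_ge_zero gB by (rule order_trans)
  have gi: "integrable M (%x. h x \<bullet> g x)" if hi: "integrable M h" for h :: "'x => 'b"
  proof -
   have [measurable]: "h : borel_measurable M" using hi by auto
   have le: "abs(h x \<bullet> g x) <= norm (B *\<^sub>R h x)" for x
    using Cauchy_Schwarz_ineq2[of "h x" "g x"] mult_left_mono[OF gB[of x] norm_ge_zero[of "h x"]] B by (simp add: mult.commute)
   have "integrable M (%x. B *\<^sub>R h x)" using hi by auto
   from Bochner_Integration.integrable_bound[OF this, of "%x. h x \<bullet> g x"] show ?thesis using le by auto
  qed
  have fi: "integrable M (f j)" for j by (rule nint[OF fm C])
  have Hi: "integrable M (H n)" for n by (rule nint[OF cc_borel[OF H(1)] cc_pow[OF H(1)]])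
  have Fi: "integrable M F" by (rule nint[OF Fm Fp])
  have "(%n. \<integral>x. H n x \<bullet> g x \<partial>M) ----> c"
  proof (rule LIMSEQ_I)
   fix e :: real assume e: "0 < e"
   obtain N where N: "!!j. N <= j ==> abs((\<integral>x. f j x \<bullet> g x \<partial>M) - c) < e / 2"
    using LIMSEQ_D[OF gc, of "e / 2"] e by auto
   show "EX no. ALL n>=no. norm ((\<integral>x. H n x \<bullet> g x \<partial>M) - c) < e"
   proof (intro exI[of _ N] allI impI)
    fix n assume n: "N <= n"
    obtain m w where w: "!!j. 0 <= w j" "!!j. w j ~= 0 ==> n <= j & j < m" "sum w {..<m} = 1" "H n = (%x. \<Sum>j<m. w j *\<^sub>R f j x)"
     using H(1)[of n] unfolding cc_def by blast
    have "(\<integral>x. H n x \<bullet> g x \<partial>M) = (\<integral>x. (\<Sum>j<m. w j * (f j x \<bullet> g x)) \<partial>M)"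
     unfolding w(4) by (simp add: inner_sum_left)
    also have "... = (\<Sum>j<m. w j * (\<integral>x. f j x \<bullet> g x \<partial>M))"
     using gi[OF fi] by (subst Bochner_Integration.integral_sum) auto
    finally have "(\<integral>x. H n x \<bullet> g x \<partial>M) - c = (\<Sum>j<m. w j * ((\<integral>x. f j x \<bullet> g x \<partial>M) - c))"
     using w(3) by (simp add: right_diff_distrib sum_subtractf flip: sum_distrib_right)
    also have "abs(...) <= (\<Sum>j<m. abs(w j * ((\<integral>x. f j x \<bullet> g x \<partial>M) - c)))" by (rule sum_abs)
    also have "... <= (\<Sum>j<m. w j * (e / 2))"
    proof (rule sum_mono)
     fix j
     show "abs(w j * ((\<integral>x. f j x \<bullet> g x \<partial>M) - c)) <= w j * (e / 2)"
      using w(1)[of j] w(2)[of j] N[of j] n by (cases "w j = 0") (auto simp: abs_mult intro!: mult_left_mono)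
    qed
    also have "... = e / 2" using w(3) by (simp flip: sum_distrib_right sum_divide_distrib)
    finally show "norm ((\<integral>x. H n x \<bullet> g x \<partial>M) - c) < e" using e by simp
   qed
  qed
  then have c1: "(%n. \<integral>x. H (r n) x \<bullet> g x \<partial>M) ----> c"
   using LIMSEQ_subseq_LIMSEQ[OF _ r] by (auto simp: o_def)
  have L1r: "(%n. \<integral>x. norm (H (r n) x - F x) \<partial>M) ----> 0"
  proof -
   have "(\<integral>\<^sup>+x. en (norm (H (r n) x - F x)) \<partial>M) = en (\<integral>x. norm (H (r n) x - F x) \<partial>M)" for n
    using Hi Fi by (intro nn_integral_eq_integral) auto
   then have "(%n. en (\<integral>x. norm (H (r n) x - F x) \<partial>M)) ----> en 0" using L1 by simp
   then show ?thesis by (subst (asm) tendsto_ennreal_iff) auto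
  qed
  have "(%n. (\<integral>x. H (r n) x \<bullet> g x \<partial>M) - (\<integral>x. F x \<bullet> g x \<partial>M)) ----> 0"
  proof (rule Lim_null_comparison)
   show "\<forall>\<^sub>F n in sequentially. norm ((\<integral>x. H (r n) x \<bullet> g x \<partial>M) - (\<integral>x. F x \<bullet> g x \<partial>M)) <= B * (\<integral>x. norm (H (r n) x - F x) \<partial>M)"
   proof (intro always_eventually allI)
    fix n
    have "(\<integral>x. H (r n) x \<bullet> g x \<partial>M) - (\<integral>x. F x \<bullet> g x \<partial>M) = (\<integral>x. (H (r n) x - F x) \<bullet> g x \<partial>M)"
     using gi[OF Hi] gi[OF Fi] by (simp add: inner_diff_left)
    also have "norm ... <= (\<integral>x. norm ((H (r n) x - F x) \<bullet> g x) \<partial>M)" by (rule integral_norm_bound)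
    also have "... <= (\<integral>x. B * norm (H (r n) x - F x) \<partial>M)"
    proof (rule integral_mono)
     show "integrable M (%x. norm ((H (r n) x - F x) \<bullet> g x))" using Hi Fi by (intro integrable_norm gi) auto
     show "integrable M (%x. B * norm (H (r n) x - F x))" using Hi Fi by auto
     show "norm ((H (r n) x - F x) \<bullet> g x) <= B * norm (H (r n) x - F x)" for x
      using Cauchy_Schwarz_ineq2[of "H (r n) x - F x" "g x"] mult_left_mono[OF gB[of x] norm_ge_zero[of "H (r n) x - F x"]] by (simp add: mult.commute)
    qed
    finally show "norm ((\<integral>x. H (r n) x \<bullet> g x \<partial>M) - (\<integral>x. F x \<bullet> g x \<partial>M)) <= B * (\<integral>x. norm (H (r n) x - F x) \<partial>M)" by simp
   qed
   show "(%n. B * (\<integral>x. norm (H (r n) x - F x) \<partial>M)) ----> 0" using tendsto_mult_right_zero[OF L1r] .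
  qed
  then have "(%n. \<integral>x. H (r n) x \<bullet> g x \<partial>M) ----> (\<integral>x. F x \<bullet> g x \<partial>M)" by (simp add: LIM_zero_iff)
  then show ?thesis using c1 LIMSEQ_unique by blast
 qed
 then show thesis using that[OF Fm Fp] by blast
qed


subsection \<open>Nonlocal energies\<close>

definition trd :: "real => 'a::euclidean_space set => ('a => real) => 'a => ennreal" where
 "trd p B u h = (NN x. pw p (u (x + h) - u x) * ind B x * ind B (x + h))"

text \<open>In the variable \<open>h = y - x\<close> this is the double integral over pairs in
  \<open>B\<close>. Ordering the pairs by translations allows one estimate of \<open>trd\<close> to
  be integrated against any kernel.\<close>

definition energy :: "real => ('a => real) => 'a::euclidean_space set => ('a => real) => ennreal" where
 "energy p k B u = (NN h. en (k h) * trd p B u h)"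

lemma trd_borel [measurable]:
 assumes [measurable]: "u : bmeas" "B : sets borel"
 shows "trd p B u : bmeas"
 unfolding trd_def by measurable

lemma norm_powr_le_Basis:
 fixes h :: "'a::euclidean_space"
 assumes p: "0 < p"
 shows "norm h powr p <= real DIM('a) powr p * (\<Sum>b\<in>Basis. abs(h \<bullet> b) powr p)"
proof -
 define m where "m = Max ((%b. abs(h \<bullet> b)) ` Basis)"
 have mle: "abs(h \<bullet> b) <= m" if "b : Basis" for b unfolding m_def using that by (intro Max_ge) auto
 have "m : (%b. abs(h \<bullet> b)) ` Basis" unfolding m_def by (intro Max_in) auto
 then obtain b0 where b0: "b0 : Basis" "m = abs(h \<bullet> b0)" by auto
 have "norm h <= (\<Sum>b\<in>Basis. abs(h \<bullet> b))" by (rule norm_le_l1)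
 also have "... <= (\<Sum>b\<in>(Basis::'a set). m)" using mle by (intro sum_mono)
 finally have "norm h <= real DIM('a) * m" by simp
 then have "norm h powr p <= (real DIM('a) * m) powr p" using p by (intro powr_mono2) auto
 also have "... = real DIM('a) powr p * m powr p" using b0 by (intro powr_mult) 
 also have "m powr p <= (\<Sum>b\<in>Basis. abs(h \<bullet> b) powr p)"
  unfolding b0(2) using b0(1) by (intro member_le_sum[of b0 Basis "%b. abs(h \<bullet> b) powr p"]) auto
 finally show ?thesis by (simp add: mult_left_mono)
qed

text \<open>The directional moments along the basis vectors add up to control of the full
  \<open>p\<close>-th moment. The dimensional loss is harmless, as the result only multiplies error
  terms.\<close>

lemma kernel_norm_powr_le:
 fixes k :: "'a::euclidean_space => real"
 assumes p: "0 < p" and [measurable]: "k : bmeas" and k0: "!!h. 0 <= k h" and a: "0 <= a"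
  and ka: "!!v. (NN h. en (k h) * pw p (h \<bullet> v) * ind (ball 0 d) h) = en (a * norm v powr p)"
 shows "(NN h. en (k h) * en (norm h powr p) * ind (ball 0 d) h)
  <= en (real DIM('a) powr p * real DIM('a) * a)"
proof -
 have "(NN h. en (k h) * en (norm h powr p) * ind (ball 0 d) h)
  <= (NN h. en (real DIM('a) powr p) * (\<Sum>b\<in>Basis. en (k h) * pw p (h \<bullet> b) * ind (ball 0 d) h))"
 proof (rule nn_integral_mono)
  fix h :: 'a
  have "en (norm h powr p) <= en (real DIM('a) powr p) * (\<Sum>b\<in>Basis. pw p (h \<bullet> b))"
   using norm_powr_le_Basis[OF p, of h] by (simp add: ennreal_leI sum_ennreal sum_nonneg flip: ennreal_mult)
  then have "en (k h) * en (norm h powr p) * ind (ball 0 d) h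
   <= en (k h) * (en (real DIM('a) powr p) * (\<Sum>b\<in>Basis. pw p (h \<bullet> b))) * ind (ball 0 d) h"
   by (intro mult_left_mono mult_right_mono) auto
  also have "... = en (real DIM('a) powr p) * (\<Sum>b\<in>Basis. en (k h) * pw p (h \<bullet> b) * ind (ball 0 d) h)"
   by (simp add: sum_distrib_left sum_distrib_right mult_ac del: sum_ennreal)
  finally show "en (k h) * en (norm h powr p) * ind (ball 0 d) h
   <= en (real DIM('a) powr p) * (\<Sum>b\<in>Basis. en (k h) * pw p (h \<bullet> b) * ind (ball 0 d) h)" .
 qed
 also have "... = en (real DIM('a) powr p) * (\<Sum>b\<in>(Basis::'a set). en (a * norm b powr p))"
  by (subst nn_integral_cmult, simp, subst nn_integral_sum) (auto simp: ka)
 also have "(\<Sum>b\<in>(Basis::'a set). en (a * norm b powr p)) = (\<Sum>b\<in>(Basis::'a set). en a)"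
  by (intro sum.cong) auto
 also have "... = en (real DIM('a) * a)" using a by (simp add: ennreal_mult flip: ennreal_of_nat_eq_real_of_nat)
 finally show ?thesis using a by (simp add: mult.assoc flip: ennreal_mult)
qed

text \<open>Jensen's inequality against the mollifier, with constant 1. The margin
  \<open>2 * e\<close> leaves room for the mollification radius \<open>e\<close> together with a
  translation of length below \<open>e\<close>.\<close>

lemma trd_convol_le:
 fixes w :: "'a::euclidean_space => real"
 assumes p: "1 <= p" and e: "0 < e" and w: "integrable lborel w" and U [measurable]: "U : sets borel" and h: "norm h < e"
 shows "(NN x. pw p (convol w (moll e) (x + h) - convol w (moll e) x) * ind {x. ball x (2 * e) \<subseteq> U} x)
  <= trd p U w h"
proof -
 have [measurable]: "w : bmeas" using borel_measurable_integrable[OF w] by simp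
 let ?V = "{x. ball x (2 * e) \<subseteq> U}"
 have "- ?V = (\<Union>y\<in>-U. ball y (2 * e))" by (auto simp: dist_commute)
 then have "closed ?V" by (metis closed_def open_UN open_ball)
 then have [measurable]: "?V : sets borel" by auto
 define g where "g x = pw p (w (x + h) - w x) * ind U x * ind U (x + h)" for x
 have [measurable]: "g : bmeas" unfolding g_def by measurable
 have "(NN x. pw p (convol w (moll e) (x + h) - convol w (moll e) x) * ind ?V x)
  <= (NN x. (NN y. en (moll e y) * g (x - y)))"
 proof (rule nn_integral_mono)
  fix x
  show "pw p (convol w (moll e) (x + h) - convol w (moll e) x) * ind ?V x <= (NN y. en (moll e y) * g (x - y))"
  proof (cases "x : ?V")
   case True
   have "convol w (moll e) (x + h) - convol w (moll e) x = (LL y. moll e y * (w (x + h - y) - w (x - y)))"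
    unfolding convol_moll_commute[OF \<open>w : bmeas\<close>] right_diff_distrib
    by (intro Bochner_Integration.integral_diff[symmetric] convol_moll_integrable e w)
   then have "pw p (convol w (moll e) (x + h) - convol w (moll e) x)
    <= (NN y. en (moll e y * abs(w (x + h - y) - w (x - y)) powr p))"
    using p e by (simp only:) (intro moll_jensen, auto)
   also have "... <= (NN y. en (moll e y) * g (x - y))"
   proof (rule nn_integral_mono)
    fix y :: 'a
    show "en (moll e y * abs(w (x + h - y) - w (x - y)) powr p) <= en (moll e y) * g (x - y)"
    proof (cases "norm y < e")
     case yes: True
     have "norm (y - h) < 2 * e" using yes h norm_triangle_ineq4[of y h] by linarith
     then have "x - y : ball x (2 * e)" "x - y + h : ball x (2 * e)"
      using yes e by (auto simp: dist_norm)
     then have "x - y : U" "x - y + h : U" using True by blast+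
     then show ?thesis by (simp add: g_def ennreal_mult' moll_nonneg[OF e] algebra_simps)
    qed (simp add: moll_eq_0[OF e])
   qed
   finally show ?thesis using True by simp
  qed auto
 qed
 also have "... = (NN y. (NN x. en (moll e y) * g (x - y)))"
  by (rule lborel_pair.Fubini') measurable
 also have "... = (\<integral>\<^sup>+y. en (moll e y) * trd p U w h \<partial>(lborel :: 'a measure))"
 proof (rule nn_integral_cong)
  fix y :: 'a
  have "(NN x. g (x + - y)) = trd p U w h"
   by (subst nn_integral_translate) (auto simp: g_def[abs_def] trd_def)
  then show "(NN x. en (moll e y) * g (x - y)) = en (moll e y) * trd p U w h"
   by (subst nn_integral_cmult) auto
 qed
 also have "... = trd p U w h" by (subst nn_integral_multc) (auto simp: moll_nn_integral[OF e])
 finally show ?thesis .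
qed

text \<open>Translation invariance moves the shift by \<open>t *\<^sub>R i\<close> from
  \<open>v\<close> to \<open>\<phi>\<close>. Both first-order expansions have remainders of order
  \<open>t\<^sup>2\<close>, so dividing by \<open>t\<close> and letting \<open>t\<close> tend to 0
  leaves the identity.\<close>

lemma integral_by_parts_remainder:
 fixes v d :: "'a::euclidean_space => real"
 assumes v: "integrable lborel v" and phi: "test_fun U \<phi>" and d: "integrable lborel (%x. d x * \<phi> x)"
  and C: "!!x t. abs(v (x + t *\<^sub>R i) - v x - t * d x) <= C * t\<^sup>2"
 shows "(LL x. d x * \<phi> x) = - (LL x. v x * dd \<phi> x i)"
proof -
 have [measurable]: "v : bmeas" using borel_measurable_integrable[OF v] by simp
 note test_fun_borel[OF phi, measurable] smooth_fun_deriv_borel[OF test_fun_smooth[OF phi], measurable]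
 obtain C' where C': "0 <= C'" "!!x h. abs(\<phi> (x + h) - \<phi> x - dd \<phi> x h) <= C' * (norm h)\<^sup>2"
  using test_fun_second_order[OF phi] by blast
 have lin: "linear (dd \<phi> x)" for x
  using smooth_funD[OF test_fun_smooth[OF phi]] has_derivative_linear by blast
 let ?D = "%x. dd \<phi> x i"
 let ?I = "LL x. d x * \<phi> x" and ?I' = "LL x. v x * ?D x"
 define K where "K = C * (LL x. abs(\<phi> x)) + C' * (norm i)\<^sup>2 * (LL x. abs(v x))"
 have phi_int: "integrable lborel \<phi>" by (rule test_fun_integrable[OF phi])
 have vD: "integrable lborel (%x. v x * ?D x)" by (rule integrable_mult_test_fun[OF v test_fun_deriv[OF phi]])
 have bound: "t * abs(?I + ?I') <= K * t\<^sup>2" if t: "0 < t" for t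
 proof -
  have tr: "test_fun UNIV (%x. \<phi> (x - t *\<^sub>R i))"
  proof -
   obtain K where K: "compact K" "!!x. x ~: K ==> \<phi> x = 0" using test_fun_cases[OF phi] by metis
   show ?thesis
   proof (rule test_funI[of _ "(%x. x + t *\<^sub>R i) ` K"])
    show "smooth_fun (%x. \<phi> (x - t *\<^sub>R i))"
     using smooth_fun_affine[OF test_fun_smooth[OF phi], of 1 "- (t *\<^sub>R i)" 1] by simp
    show "\<phi> (x - t *\<^sub>R i) = 0" if "x ~: (%x. x + t *\<^sub>R i) ` K" for x
     using that K(2)[of "x - t *\<^sub>R i"] by (metis diff_add_cancel image_eqI)
    show "compact ((%x. x + t *\<^sub>R i) ` K)" using K by (intro compact_continuous_image continuous_intros) auto
   qed auto
  qed
  have i1: "integrable lborel (%x. v x * \<phi> (x - t *\<^sub>R i))" by (rule integrable_mult_test_fun[OF v tr])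
  have i2: "integrable lborel (%x. v x * \<phi> x)" by (rule integrable_mult_test_fun[OF v phi])
  have i3: "integrable lborel (%x. v (x + t *\<^sub>R i) * \<phi> x)" using integrable_translate[OF i1, of "t *\<^sub>R i"] by simp
  have "(LL x. v (x + t *\<^sub>R i) * \<phi> x) = (LL x. v x * \<phi> (x - t *\<^sub>R i))"
   using integral_translate[of "%x. v x * \<phi> (x - t *\<^sub>R i)" "t *\<^sub>R i"] by simp
  then have eq: "(LL x. (v (x + t *\<^sub>R i) - v x - t * d x) * \<phi> x) + t * ?I
   = (LL x. v x * (\<phi> (x - t *\<^sub>R i) - \<phi> x + t * ?D x)) - t * ?I'"
   using i1 i2 i3 d vD by (simp add: left_diff_distrib right_diff_distrib distrib_left mult.assoc mult.left_commute[of _ t])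
  have "abs(LL x. (v (x + t *\<^sub>R i) - v x - t * d x) * \<phi> x) <= (LL x. abs((v (x + t *\<^sub>R i) - v x - t * d x) * \<phi> x))"
   by (rule integral_abs_bound)
  also have "... <= (LL x. C * t\<^sup>2 * abs(\<phi> x))"
  proof (rule integral_mono)
   show "integrable lborel (%x. abs((v (x + t *\<^sub>R i) - v x - t * d x) * \<phi> x))"
    using i2 i3 d by (simp add: left_diff_distrib mult.assoc)
   show "integrable lborel (%x. C * t\<^sup>2 * abs(\<phi> x))" using phi_int by simp
   show "abs((v (x + t *\<^sub>R i) - v x - t * d x) * \<phi> x) <= C * t\<^sup>2 * abs(\<phi> x)" for x
    unfolding abs_mult using C[of x t] by (intro mult_right_mono) auto
  qed
  finally have e1: "abs(LL x. (v (x + t *\<^sub>R i) - v x - t * d x) * \<phi> x) <= C * t\<^sup>2 * (LL x. abs(\<phi> x))" by simp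
  have "abs(LL x. v x * (\<phi> (x - t *\<^sub>R i) - \<phi> x + t * ?D x)) <= (LL x. abs(v x * (\<phi> (x - t *\<^sub>R i) - \<phi> x + t * ?D x)))"
   by (rule integral_abs_bound)
  also have "... <= (LL x. C' * (norm i)\<^sup>2 * t\<^sup>2 * abs(v x))"
  proof (rule integral_mono)
   show "integrable lborel (%x. abs(v x * (\<phi> (x - t *\<^sub>R i) - \<phi> x + t * ?D x)))"
    using i1 i2 vD by (simp add: right_diff_distrib distrib_left mult.left_commute[of _ t])
   show "integrable lborel (%x. C' * (norm i)\<^sup>2 * t\<^sup>2 * abs(v x))" using v by simp
   show "abs(v x * (\<phi> (x - t *\<^sub>R i) - \<phi> x + t * ?D x)) <= C' * (norm i)\<^sup>2 * t\<^sup>2 * abs(v x)" for x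
   proof -
    have "dd \<phi> x ((- t) *\<^sub>R i) = - t * ?D x" using linear_cmul[OF lin, of x "- t" i] by (simp only: real_scaleR_def)
    then have "abs(\<phi> (x - t *\<^sub>R i) - \<phi> x + t * ?D x) <= C' * (norm i)\<^sup>2 * t\<^sup>2"
     using C'(2)[of x "(- t) *\<^sub>R i"] by (simp add: power_mult_distrib mult_ac)
    then show ?thesis unfolding abs_mult by (subst mult.commute) (rule mult_right_mono, auto)
   qed
  qed
  finally have e2: "abs(LL x. v x * (\<phi> (x - t *\<^sub>R i) - \<phi> x + t * ?D x)) <= C' * (norm i)\<^sup>2 * t\<^sup>2 * (LL x. abs(v x))" by simp
  have "t * ?I + t * ?I' = (LL x. v x * (\<phi> (x - t *\<^sub>R i) - \<phi> x + t * ?D x)) - (LL x. (v (x + t *\<^sub>R i) - v x - t * d x) * \<phi> x)"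
   using eq by linarith
  then have "abs(t * (?I + ?I')) <= C' * (norm i)\<^sup>2 * t\<^sup>2 * (LL x. abs(v x)) + C * t\<^sup>2 * (LL x. abs(\<phi> x))"
   using e1 e2 by (simp only: distrib_left)
  also have "... = K * t\<^sup>2" by (simp add: K_def algebra_simps)
  finally show ?thesis using t by (simp only: abs_mult abs_of_pos)
 qed
 have "abs(?I + ?I') <= K * t" if "0 < t" for t
 proof -
  have "t * abs(?I + ?I') <= t * (K * t)" using bound[OF that] by (simp only: power2_eq_square mult_ac)
  then show ?thesis using that by (simp only: mult_le_cancel_left_pos)
 qed
 then have "abs(?I + ?I') <= 0"
 proof (intro tendsto_lowerbound[of "%t. K * t" 0 "at_right 0"])
  show "((%t. K * t) \<longlongrightarrow> 0) (at_right 0)" by (auto intro!: tendsto_eq_intros)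
  assume "!!t. 0 < t ==> abs(?I + ?I') <= K * t"
  then show "\<forall>\<^sub>F t in at_right 0. abs(?I + ?I') <= K * t"
   using eventually_at_right_less[of 0] by (auto elim: eventually_mono)
 qed auto
 then show ?thesis by linarith
qed

definition cgrad :: "real => ('a::euclidean_space => real) => 'a => 'a" where
 "cgrad e u x = (\<Sum>b\<in>Basis. convol u (%z. dd (moll e) z b) x *\<^sub>R b)"

lemma cgrad_inner:
 assumes "0 < e" "integrable lborel u"
 shows "cgrad e u x \<bullet> v = convol u (%z. dd (moll e) z v) x"
 unfolding cgrad_def convol_deriv_linear[OF assms(2) test_fun_moll[OF assms(1) subset_UNIV], of v]
 by (simp add: inner_sum_left inner_commute[of v] mult.commute)

lemma cgrad_borel:
 assumes "0 < e" "integrable lborel u"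
 shows "cgrad e u : bmeas"
proof -
 have "convol u (%z. dd (moll e) z b) : bmeas" for b
  by (intro smooth_fun_borel smooth_fun_convol assms test_fun_deriv test_fun_moll) auto
 then show ?thesis unfolding cgrad_def by measurable
qed

lemma cgrad_bounded:
 assumes e: "0 < e" and u: "integrable lborel u"
 obtains B where "0 <= B" "!!x. norm (cgrad e u x) <= B"
proof -
 have "EX B. 0 <= B & (ALL x. abs(dd (moll e) (x::'a) b) <= B)" for b
  using test_fun_bounded[OF test_fun_deriv[OF test_fun_moll[OF e subset_UNIV]]] by metis
 then obtain B where B: "!!b. 0 <= B b" "!!b x. abs(dd (moll e) (x::'a) b) <= B b" by metis
 have b: "abs(convol u (%z. dd (moll e) z b) x) <= B b * (LL y. abs(u y))" for b x
 proof -
  have i: "integrable lborel (%y. u y * dd (moll e) (x - y) b)"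
   by (rule test_convol_integrable[OF u test_fun_deriv[OF test_fun_moll[OF e subset_UNIV]]])
  have "abs(convol u (%z. dd (moll e) z b) x) <= (LL y. abs(u y * dd (moll e) (x - y) b))"
   unfolding convol_def by (rule integral_abs_bound)
  also have "... <= (LL y. B b * abs(u y))"
  proof (rule integral_mono[OF Bochner_Integration.integrable_abs[OF i]])
   show "integrable lborel (%y. B b * abs(u y))" using u by simp
   show "abs(u y * dd (moll e) (x - y) b) <= B b * abs(u y)" for y
    unfolding abs_mult using B(2)[of "x - y" b] by (subst mult.commute) (rule mult_right_mono, auto)
  qed
  finally show ?thesis by simp
 qed
 show thesis
 proof (rule that[of "\<Sum>b\<in>Basis. B b * (LL y. abs(u y))"])
  show "norm (cgrad e u x) <= (\<Sum>b\<in>Basis. B b * (LL y. abs(u y)))" for x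
   unfolding cgrad_def using b by (intro order_trans[OF norm_sum] sum_mono) auto
 qed (use B in \<open>auto intro!: sum_nonneg mult_nonneg_nonneg\<close>)
qed

lemma moll_deriv_eq_0: "0 < e ==> e < norm z ==> dd (moll e) z v = 0"
proof -
 assume e: "0 < e" "e < norm z"
 have "closure {x. moll e x ~= 0} \<subseteq> cball (0::'a) e"
 proof (rule closure_minimal)
  show "{x. moll e x ~= 0} \<subseteq> cball (0::'a) e"
  proof
   fix x :: 'a assume "x : {x. moll e x ~= 0}"
   then show "x : cball 0 e" using moll_eq_0[OF e(1), of x] by (cases "e <= norm x") auto
  qed
 qed auto
 then have "z ~: closure {x. moll e x ~= 0}" using e by auto
 then show ?thesis by (rule test_fun_deriv_eq_0[OF test_fun_moll[OF e(1) subset_UNIV]])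
qed

lemma cgrad_eq_0:
 assumes "0 < e" "e < 1" "!!y. y ~: S ==> u y = 0" "!!y. y : S ==> 1 <= dist x y"
 shows "cgrad e u x = 0"
proof -
 have "convol u (%z. dd (moll e) z b) x = 0" for b
  using assms by (intro convol_eq_0[of S u 1 _ x] moll_deriv_eq_0) auto
 then show ?thesis by (simp add: cgrad_def)
qed

lemma cgrad_by_parts:
 assumes e: "0 < e" and u: "integrable lborel u" and S: "bounded S" "!!y. y ~: S ==> u y = 0" and phi: "test_fun U \<phi>"
 shows "(LL x. (cgrad e u x \<bullet> i) * \<phi> x) = - (LL x. convol u (moll e) x * dd \<phi> x i)"
proof -
 note tm = test_fun_moll[OF e subset_UNIV]
 obtain C where C: "0 <= C" "!!x h::'a. abs(moll e (x + h) - moll e x - dd (moll e) x h) <= C * (norm h)\<^sup>2"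
  using test_fun_second_order[OF tm] by blast
 show ?thesis
 proof (rule integral_by_parts_remainder[where C="C * (norm i)\<^sup>2 * (LL y. abs(u y))", OF _ phi])
  obtain B where B: "0 <= B" "!!x::'a. abs(moll e x) <= B" using test_fun_bounded[OF tm] by blast
  obtain R where R: "S \<subseteq> ball 0 R" using S(1) bounded_subset_ballD by blast
  have "abs(convol u (moll e) x) <= B * (LL y. abs(u y))" for x
  proof -
   have "abs(convol u (moll e) x) <= (LL y. abs(u y * moll e (x - y)))"
    unfolding convol_def by (rule integral_abs_bound)
   also have "... <= (LL y. B * abs(u y))"
   proof (rule integral_mono[OF Bochner_Integration.integrable_abs[OF test_convol_integrable[OF u tm]]])
    show "integrable lborel (%y. B * abs(u y))" using u by simp
    show "abs(u y * moll e (x - y)) <= B * abs(u y)" for y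
     unfolding abs_mult using B(2)[of "x - y"] by (subst mult.commute) (rule mult_right_mono, auto)
   qed
   finally show ?thesis by simp
  qed
  moreover have "convol u (moll e) x = 0" if "x ~: ball 0 (R + e)" for x
  proof (rule convol_eq_0[of S u e])
   fix y assume "y : S"
   then have "norm y < R" using R by auto
   then show "e <= dist x y" using that norm_triangle_ineq2[of x y] by (simp add: dist_norm)
  qed (use S moll_eq_0[OF e] in auto)
  ultimately show "integrable lborel (convol u (moll e))"
   by (intro integrable_bounded_support[of _ _ "ball 0 (R + e)"] convol_moll_borel e u) auto
  show "integrable lborel (%x. (cgrad e u x \<bullet> i) * \<phi> x)"
  proof -
   obtain B where "0 <= B" "!!x. norm (cgrad e u x) <= B" using cgrad_bounded[OF e u] by blast
   then have B: "abs(cgrad e u x \<bullet> i) <= B * norm i" for x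
    using Cauchy_Schwarz_ineq2[of "cgrad e u x" i] by (meson mult_right_mono norm_ge_zero order_trans)
   note [measurable] = cgrad_borel[OF e u] test_fun_borel[OF phi]
   have "integrable lborel (%x. (B * norm i) * \<phi> x)" using test_fun_integrable[OF phi] by simp
   then show ?thesis
   proof (rule Bochner_Integration.integrable_bound)
    show "(%x. (cgrad e u x \<bullet> i) * \<phi> x) : borel_measurable lborel" by measurable
    have "abs(cgrad e u x \<bullet> i) * abs(\<phi> x) <= abs(B * norm i) * abs(\<phi> x)" for x
     using B[of x] by (intro mult_right_mono) auto
    then show "AE x in lborel. norm ((cgrad e u x \<bullet> i) * \<phi> x) <= norm ((B * norm i) * \<phi> x)"
     by (intro AE_I2) (simp only: real_norm_def abs_mult[of _ "\<phi> _"])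
   qed
  qed
  show "abs(convol u (moll e) (x + t *\<^sub>R i) - convol u (moll e) x - t * (cgrad e u x \<bullet> i)) <= C * (norm i)\<^sup>2 * (LL y. abs(u y)) * t\<^sup>2" for x t
  proof -
   have "t * (cgrad e u x \<bullet> i) = convol u (%z. dd (moll e) z (t *\<^sub>R i)) x"
    by (simp flip: cgrad_inner[OF e u])
   then show ?thesis using convol_remainder[OF u tm C(2), of x "t *\<^sub>R i"] by (simp add: power_mult_distrib mult_ac)
  qed
 qed
qed


lemma closed_inner_parallel: "closed {x. ball x r \<subseteq> U}"
proof -
 have "- {x. ball x r \<subseteq> U} = (\<Union>y\<in>-U. ball y r)" by (auto simp: dist_commute)
 then show ?thesis by (metis closed_def open_UN open_ball)
qed

lemma convol_diff:
 assumes "integrable lborel f" "integrable lborel g" "test_fun UNIV m"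
 shows "convol (%x. f x - g x) m x = convol f m x - convol g m x"
 unfolding convol_def left_diff_distrib
 by (intro Bochner_Integration.integral_diff test_convol_integrable[OF assms(1,3)] test_convol_integrable[OF assms(2,3)])

text \<open>What the lower bound uses of a kernel is its directional moments over small balls, which
  must depend on \<open>v\<close> through its norm alone. That \<open>a i d\<close> has the same
  limit \<open>A\<close> for every radius \<open>d\<close> expresses concentration of the kernels at
  the origin.\<close>

locale kernel_sequence =
 fixes p :: real and k :: "nat => 'a::euclidean_space => real" and a :: "nat => real => real" and A :: real
 assumes p: "1 < p" and k_borel [measurable]: "!!i. k i : bmeas" and k_nonneg: "!!i h. 0 <= k i h"
  and a_nonneg: "!!i d. 0 < d ==> d <= 1 ==> 0 <= a i d"
  and k_moment: "!!i d v. 0 < d ==> d <= 1 ==>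
   (NN h. en (k i h) * pw p (h \<bullet> v) * ind (ball 0 d) h) = en (a i d * norm v powr p)"
  and a_lim: "!!d. 0 < d ==> d <= 1 ==> (%i. a i d) ----> A" and A_pos: "0 < A"
begin

text \<open>The moment identity is applied pointwise with \<open>v\<close> the gradient of the
  mollified \<open>u\<close> at \<open>x\<close>, so \<open>a i d * J\<close> becomes an average of
  \<open>h \<bullet> cgrad e u x\<close> over small \<open>h\<close>. Taylor's formula turns this
  linear term into an increment of the mollified \<open>w\<close>, which the energy of
  \<open>w\<close> controls; the errors are proportional to \<open>norm h\<close> and are absorbed
  by the full moment.\<close>

lemma mollified_gradient_bound_aux:
 assumes e: "0 < e" "e <= 1" and d: "0 < d" "d <= e" and l: "0 < l" "l < 1" and U: "open U"
  and u: "integrable lborel u" and w: "integrable lborel w" and en: "energy p (k i) U w <= en L" and L: "0 <= L"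
  and C: "0 <= C" "!!x h::'a. abs(moll e (x + h) - moll e x - dd (moll e) x h) <= C * (norm h)\<^sup>2"
  and Lip: "0 <= Lip" "!!x y::'a. abs(moll e x - moll e y) <= Lip * norm (x - y)"
  and V: "emeasure lborel (ball (0::'a) R) = en V" "0 <= V"
  and J: "(NN x. en (norm (cgrad e u x) powr p) * ind ({x. ball x (2 * e) \<subseteq> U} \<inter> ball 0 R) x) = en J" "0 <= J"
 shows "a i d * J <= (1 - l) powr (1 - p) * L
  + l powr (1 - p) * (C * (LL y. abs(u y)) * d + Lip * (LL y. abs(w y - u y))) powr p
    * V * (real DIM('a) powr p * real DIM('a) * a i d)"
proof -
 let ?W = "{x. ball x (2 * e) \<subseteq> U}" and ?m = "cgrad e u"
 let ?Q = "?W \<inter> ball 0 R"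
 have [measurable]: "?W : sets borel" using closed_inner_parallel by (intro borel_closed)
 then have [measurable]: "?Q : sets borel" by auto
 have [measurable]: "U : sets borel" using U by auto
 have [measurable]: "w : bmeas" "u : bmeas"
  using borel_measurable_integrable[OF w] borel_measurable_integrable[OF u] by auto
 note [measurable] = cgrad_borel[OF e(1) u] convol_moll_borel[OF e(1) u] convol_moll_borel[OF e(1) w]
 note tm = test_fun_moll[OF e(1) subset_UNIV[of "cball (0::'a) e"]]
 have d1: "0 < d" "d <= 1" using d e by auto
 \<comment> \<open>Two errors per unit of \<open>norm h\<close>: the Taylor remainder of the
   mollified \<open>u\<close> for \<open>norm h < d\<close>, and the mollified difference
   \<open>w - u\<close>, bounded by its L1 norm and the Lipschitz constant of the mollifier.\<close>
 define rho where "rho = C * (LL y. abs(u y)) * d + Lip * (LL y. abs(w y - u y))"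
 have rho: "0 <= rho" using C(1) Lip(1) d by (auto simp: rho_def)
 let ?c = "(1 - l) powr (1 - p)" and ?k = "l powr (1 - p)"
 let ?we = "convol w (moll e)" and ?ue = "convol u (moll e)"
 have wi: "integrable lborel (%x. w x - u x)" using w u by auto
 have pt: "abs(?m x \<bullet> h) <= abs(?we (x + h) - ?we x) + rho * norm h" if h: "norm h < d" for x h
 proof -
  have r1: "abs(?ue (x + h) - ?ue x - ?m x \<bullet> h) <= C * (LL y. abs(u y)) * d * norm h"
  proof -
   have "abs(?ue (x + h) - ?ue x - ?m x \<bullet> h) <= C * (norm h)\<^sup>2 * (LL y. abs(u y))"
    unfolding cgrad_inner[OF e(1) u] by (rule convol_remainder[OF u tm C(2)])
   also have "... = (C * (LL y. abs(u y)) * norm h) * norm h" by (simp add: power2_eq_square mult_ac)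
   also have "... <= (C * (LL y. abs(u y)) * d) * norm h"
    using h C(1) by (intro mult_right_mono mult_left_mono) auto
   finally show ?thesis .
  qed
  obtain B where "!!x::'a. abs(moll e x) <= B" using test_fun_bounded[OF tm] by blast
  from convol_lipschitz[OF wi _ this Lip(2), of "x + h" x]
  have r2: "abs((?we (x + h) - ?ue (x + h)) - (?we x - ?ue x)) <= Lip * (LL y. abs(w y - u y)) * norm h"
   by (simp add: convol_diff[OF w u tm] mult_ac)
  show ?thesis using r1 r2 unfolding rho_def distrib_right by linarith
 qed
 have ptp: "pw p (?m x \<bullet> h) <= en ?c * pw p (?we (x + h) - ?we x) + en (?k * rho powr p) * en (norm h powr p)"
  if h: "norm h < d" for x h
 proof -
  have "abs(?m x \<bullet> h) powr p <= (abs(?we (x + h) - ?we x) + rho * norm h) powr p"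
   using pt[OF h] p by (intro powr_mono2) auto
  also have "... <= ?c * abs(?we (x + h) - ?we x) powr p + ?k * (rho * norm h) powr p"
   using p l rho by (intro powr_add_weighted) auto
  also have "(rho * norm h) powr p = rho powr p * norm h powr p" using rho by (intro powr_mult)
  finally show ?thesis using rho by (simp add: ennreal_leI mult.assoc flip: ennreal_plus ennreal_mult)
 qed
 have "en (a i d * J) = en (a i d) * (NN x. en (norm (?m x) powr p) * ind ?Q x)"
  using a_nonneg[OF d1] J by (simp add: ennreal_mult)
 also have "... = (NN x. en (a i d * norm (?m x) powr p) * ind ?Q x)"
  using a_nonneg[OF d1, of i] by (subst nn_integral_cmult[symmetric]) (auto simp: ennreal_mult mult.assoc)
 also have "... = (NN x. (NN h. en (k i h) * pw p (h \<bullet> ?m x) * ind (ball 0 d) h * ind ?Q x))"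
  by (subst k_moment[OF d1, symmetric], subst nn_integral_multc[symmetric]) auto
 also have "... = (NN h. (NN x. en (k i h) * pw p (h \<bullet> ?m x) * ind (ball 0 d) h * ind ?Q x))"
  by (rule lborel_pair.Fubini') measurable
 also have "... <= (NN h. en ?c * (en (k i h) * trd p U w h)
  + en (?k * rho powr p) * en V * (en (k i h) * en (norm h powr p) * ind (ball 0 d) h))"
 proof (rule nn_integral_mono)
  fix h :: 'a
  show "(NN x. en (k i h) * pw p (h \<bullet> ?m x) * ind (ball 0 d) h * ind ?Q x)
   <= en ?c * (en (k i h) * trd p U w h)
  + en (?k * rho powr p) * en V * (en (k i h) * en (norm h powr p) * ind (ball 0 d) h)"
  proof (cases "norm h < d")
   case True
   have "(NN x. pw p (h \<bullet> ?m x) * ind ?Q x)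
    <= (NN x. en ?c * (pw p (?we (x + h) - ?we x) * ind ?W x) + en (?k * rho powr p) * en (norm h powr p) * ind (ball 0 R) x)"
    using ptp[OF True] by (intro nn_integral_mono) (auto simp: indicator_def inner_commute)
   also have "... = en ?c * (NN x. pw p (?we (x + h) - ?we x) * ind ?W x) + en (?k * rho powr p) * en (norm h powr p) * en V"
    by (subst nn_integral_add) (auto simp: nn_integral_cmult nn_integral_cmult_indicator V)
   also have "... <= en ?c * trd p U w h + en (?k * rho powr p) * en (norm h powr p) * en V"
    using p True d by (intro add_mono mult_left_mono trd_convol_le e w) auto
   finally have "en (k i h) * (NN x. pw p (h \<bullet> ?m x) * ind ?Q x)
    <= en (k i h) * (en ?c * trd p U w h + en (?k * rho powr p) * en (norm h powr p) * en V)"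
    by (intro mult_left_mono) auto
   moreover have "(NN x. en (k i h) * pw p (h \<bullet> ?m x) * ind (ball 0 d) h * ind ?Q x)
    = en (k i h) * (NN x. pw p (h \<bullet> ?m x) * ind ?Q x)"
    using True by (subst nn_integral_cmult[symmetric]) (auto simp: mult.assoc)
   ultimately show ?thesis using True by (simp add: distrib_left mult_ac)
  qed auto
 qed
 also have "... = en ?c * energy p (k i) U w + en (?k * rho powr p) * en V * (NN h. en (k i h) * en (norm h powr p) * ind (ball 0 d) h)"
  unfolding energy_def by (subst nn_integral_add) (auto simp: nn_integral_cmult)
 also have "... <= en ?c * en L + en (?k * rho powr p) * en V * en (real DIM('a) powr p * real DIM('a) * a i d)"
  using p a_nonneg[OF d1] k_moment[OF d1] k_nonneg by (intro add_mono mult_left_mono en kernel_norm_powr_le) auto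
 also have "... = en (?c * L + ?k * rho powr p * V * (real DIM('a) powr p * real DIM('a) * a i d))"
  using L V a_nonneg[OF d1, of i] by (simp add: ennreal_mult ennreal_plus)
 finally show ?thesis
  using L V a_nonneg[OF d1, of i] by (subst (asm) ennreal_le_iff) (auto simp: rho_def)
qed

text \<open>At a fixed scale \<open>e\<close> three limits are taken in order: \<open>i\<close> to
  infinity removes the L1 distance and turns \<open>a i d\<close> into \<open>A\<close>,
  \<open>d\<close> to 0 removes the Taylor error, and \<open>l\<close> to 0 the factor from
  \<open>powr_add_weighted\<close>. Cutting to a ball makes the left side finite beforehand, since
  the mollified gradient is bounded.\<close>

lemma mollified_gradient_bound:
 assumes e: "0 < e" "e <= 1" and U: "open U"
  and u: "integrable lborel u" and w: "!!i. integrable lborel (w i)"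
  and en: "!!i. energy p (k i) U (w i) <= en L" and L: "0 <= L"
  and L1: "(%i. LL y. abs(w i y - u y)) ----> 0"
 shows "(NN x. en (norm (cgrad e u x) powr p) * ind ({x. ball x (2 * e) \<subseteq> U} \<inter> ball 0 R) x) <= en (L / A)"
proof -
 let ?X = "(NN x. en (norm (cgrad e u x) powr p) * ind ({x. ball x (2 * e) \<subseteq> U} \<inter> ball 0 R) x)"
 define V where "V = measure lborel (ball (0::'a) R)"
 have V: "emeasure lborel (ball (0::'a) R) = en V" "0 <= V"
  using emeasure_lborel_ball_finite[of "0::'a" R] unfolding V_def by (auto intro!: emeasure_eq_ennreal_measure)
 note tm = test_fun_moll[OF e(1) subset_UNIV[of "cball (0::'a) e"]]
 obtain C where C: "0 <= C" "!!x h::'a. abs(moll e (x + h) - moll e x - dd (moll e) x h) <= C * (norm h)\<^sup>2"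
  using test_fun_second_order[OF tm] by blast
 obtain Lip where Lip: "0 <= Lip" "!!x y::'a. abs(moll e x - moll e y) <= Lip * norm (x - y)"
  using test_fun_lipschitz[OF tm] by blast
 obtain B where B: "0 <= B" "!!x. norm (cgrad e u x) <= B" using cgrad_bounded[OF e(1) u] by blast
 have "?X <= (\<integral>\<^sup>+x. en (B powr p) * ind (ball 0 R) x \<partial>(lborel :: 'a measure))"
  using B p by (intro nn_integral_mono) (auto simp: indicator_def intro!: ennreal_leI powr_mono2)
 also have "... = en (B powr p * V)" by (subst nn_integral_cmult_indicator) (auto simp: V ennreal_mult)
 finally have "?X < \<infinity>" by (auto intro: le_less_trans)
 then obtain J where J: "?X = en J" "0 <= J" by (cases ?X) auto
 let ?I = "LL y. abs(u y)" and ?N = "real DIM('a) powr p * real DIM('a)"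
 have main: "A * J <= (1 - l) powr (1 - p) * L + l powr (1 - p) * eps" if l: "0 < l" "l < 1" and eps: "0 < eps" for l eps
 proof -
  have lim: "A * J <= (1 - l) powr (1 - p) * L + l powr (1 - p) * (C * ?I * d) powr p * V * (?N * A)" if d: "0 < d" "d <= e" for d
  proof (rule LIMSEQ_le)
   show "(%i. a i d * J) ----> A * J" using d e by (intro tendsto_intros a_lim) auto
   have "(%i. C * ?I * d + Lip * (LL y. abs(w i y - u y))) ----> C * ?I * d + Lip * 0"
    by (intro tendsto_intros L1)
   moreover have "0 <= C * ?I * d + Lip * (LL y. abs(w i y - u y))" for i
    using C(1) Lip(1) d by (intro add_nonneg_nonneg mult_nonneg_nonneg) auto
   ultimately have pw: "(%i. (C * ?I * d + Lip * (LL y. abs(w i y - u y))) powr p) ----> (C * ?I * d) powr p"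
    using p by (intro tendsto_powr2 tendsto_const) auto
   show "(%i. (1 - l) powr (1 - p) * L + l powr (1 - p) * (C * ?I * d + Lip * (LL y. abs(w i y - u y))) powr p * V * (?N * a i d))
    ----> (1 - l) powr (1 - p) * L + l powr (1 - p) * (C * ?I * d) powr p * V * (?N * A)"
    using d e by (intro tendsto_add tendsto_mult tendsto_const pw a_lim) auto
   show "EX N. ALL i>=N. a i d * J <= (1 - l) powr (1 - p) * L + l powr (1 - p) * (C * ?I * d + Lip * (LL y. abs(w i y - u y))) powr p * V * (?N * a i d)"
    using mollified_gradient_bound_aux[OF e d l U u w en L C Lip V J] by blast
  qed
  have "((%d. C * ?I * d) \<longlongrightarrow> C * ?I * 0) (at_right 0)" by (intro tendsto_intros)
  moreover have "\<forall>\<^sub>F d in at_right 0. 0 <= C * ?I * d"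
   using eventually_at_right_less[of "0::real"] C(1) by (auto elim!: eventually_mono intro!: mult_nonneg_nonneg)
  ultimately have "((%d. (C * ?I * d) powr p) \<longlongrightarrow> (C * ?I * 0) powr p) (at_right 0)"
   using p by (intro tendsto_powr2 tendsto_const) auto
  then have "((%d. (C * ?I * d) powr p * V * (?N * A)) \<longlongrightarrow> (C * ?I * 0) powr p * V * (?N * A)) (at_right 0)"
   by (intro tendsto_mult tendsto_const)
  then have "\<forall>\<^sub>F d in at_right 0. (C * ?I * d) powr p * V * (?N * A) < eps" using eps p by (intro order_tendstoD(2)) auto
  moreover have "\<forall>\<^sub>F d in at_right 0. 0 < d & d <= e" using e by (auto simp: eventually_at_right[of 0 e] intro!: exI[of _ e])
  ultimately have "\<forall>\<^sub>F d in at_right 0. (C * ?I * d) powr p * V * (?N * A) < eps & 0 < d & d <= e" by (rule eventually_conj)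
  then obtain d where d: "(C * ?I * d) powr p * V * (?N * A) < eps" "0 < d" "d <= e"
   by (auto dest!: eventually_happens)
  have "A * J <= (1 - l) powr (1 - p) * L + l powr (1 - p) * ((C * ?I * d) powr p * V * (?N * A))"
   using lim[OF d(2,3)] by (simp only: mult.assoc)
  also have "... <= (1 - l) powr (1 - p) * L + l powr (1 - p) * eps"
   using d(1) by (intro add_left_mono mult_left_mono) auto
  finally show ?thesis .
 qed
 have "en (A * J) <= en L"
 proof (rule weighted_limit_le[where p=p])
  fix l eps :: real assume "0 < l" "l < 1" "0 < eps"
  from ennreal_leI[OF main[OF this]] \<open>0 < eps\<close>
  show "en (A * J) <= en ((1 - l) powr (1 - p)) * en L + en (l powr (1 - p)) * en eps"
   using L by (simp add: ennreal_plus ennreal_mult)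
 qed
 then have "A * J <= L" using L by simp
 then have "J <= L / A" using A_pos by (simp add: field_simps)
 then show ?thesis using J by (simp add: ennreal_leI)
qed

text \<open>The mollified gradients, cut off near the boundary of \<open>U\<close>, are bounded in
  L^p uniformly in the scale, and a weak limit point is the gradient sought. Only pairings with
  multiples of test functions are needed to identify it, and these converge because the mollified
  functions converge in L1.\<close>

theorem energy_liminf:
 assumes U: "open U" and um [measurable]: "u : bmeas" and ub: "!!x. abs(u x) <= 1"
  and wm [measurable]: "!!i. w i : bmeas" and wb: "!!i x. abs(w i x) <= 1"
  and S: "bounded S" "!!x. x ~: S ==> u x = 0" "!!i x. x ~: S ==> w i x = 0"
  and en: "!!i. energy p (k i) U (w i) <= en L" and L: "0 <= L"
  and L1: "(%i. LL y. abs(w i y - u y)) ----> 0"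
 obtains G T where "G : bmeas" "bounded T" "!!x. x ~: T ==> G x = 0" "!!x. x ~: U ==> G x = 0"
  "!!b. b : Basis ==> integrable lborel (%x. G x \<bullet> b)" "wgrad U u G"
  "(NN x. en (norm (G x) powr p)) <= en (L / A)"
proof -
 have u: "integrable lborel u" by (rule integrable_bounded_support[OF um ub S(1,2)])
 have w: "integrable lborel (w i)" for i by (rule integrable_bounded_support[OF wm wb S(1,3)])
 obtain R0 where R0: "S \<subseteq> ball 0 R0" using S(1) bounded_subset_ballD by blast
 define R where "R = R0 + 1"
 define T where "T = ball (0::'a) R \<inter> U"
 have [measurable]: "T : sets borel" using U by (auto simp: T_def)
 have bT: "bounded T" by (auto simp: T_def)
 define M where "M = density lborel (%x. en (ind T x))"
 have Mb [measurable_cong, simp]: "sets M = sets borel" by (simp add: M_def)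
 have fM: "finite_measure M"
 proof (rule finite_measureI)
  show "emeasure M (space M) ~= \<infinity>"
   using emeasure_lborel_bounded[OF bT] by (simp add: M_def emeasure_density ennreal_indicator)
 qed
 \<comment> \<open>The offset 2 keeps all scales below 1, so every mollified gradient vanishes
   outside \<open>ball 0 R\<close> and passing to the finite measure \<open>M\<close> loses
   nothing.\<close>
 define eps where "eps j = 1 / real (j + 2)" for j
 have eps: "0 < eps j" "eps j <= 1" "eps j < 1" for j by (auto simp: eps_def)
 define W where "W j = {x. ball x (2 * eps j) \<subseteq> U}" for j
 have [measurable]: "W j : sets borel" for j unfolding W_def using closed_inner_parallel by (intro borel_closed)
 define f where "f j x = ind (W j) x *\<^sub>R cgrad (eps j) u x" for j x
 note [measurable] = cgrad_borel[OF eps(1) u]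
 have fm [measurable]: "f j : bmeas" for j unfolding f_def by measurable
 have fmM: "f j : borel_measurable M" for j using fm by (simp add: M_def)
 have fb: "(\<integral>\<^sup>+x. en (norm (f j x) powr p) \<partial>M) <= en (L / A)" for j
 proof -
  have "(\<integral>\<^sup>+x. en (norm (f j x) powr p) \<partial>M) = (NN x. en (ind T x) * en (norm (f j x) powr p))"
   unfolding M_def by (subst nn_integral_density) auto
  also have "... <= (NN x. en (norm (cgrad (eps j) u x) powr p) * ind ({x. ball x (2 * eps j) \<subseteq> U} \<inter> ball 0 R) x)"
   using p by (intro nn_integral_mono) (auto simp: f_def indicator_def W_def T_def)
  also have "... <= en (L / A)" by (rule mollified_gradient_bound[OF eps(1,2) U u w en L L1])
  finally show ?thesis .
 qed
 obtain F where Fm': "F : borel_measurable M" and Fp: "(\<integral>\<^sup>+x. en (norm (F x) powr p) \<partial>M) <= en (L / A)"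
  and Fw: "!!g c B. g : borel_measurable M ==> (!!x. norm (g x) <= B) ==>
   (%j. \<integral>x. f j x \<bullet> g x \<partial>M) ----> c ==> (\<integral>x. F x \<bullet> g x \<partial>M) = c"
  by (rule weak_compactness_Lp[OF fM fmM p fb]) (rule that, assumption, assumption, fast)
 have [measurable]: "F : bmeas" using Fm' by (simp add: M_def)
 define G where "G x = ind T x *\<^sub>R F x" for x
 have Gm: "G : bmeas" unfolding G_def by measurable
 have Gp: "(NN x. en (norm (G x) powr p)) <= en (L / A)"
 proof -
  have "(NN x. en (norm (G x) powr p)) = (NN x. en (ind T x) * en (norm (F x) powr p))"
   using p by (intro nn_integral_cong) (auto simp: G_def indicator_def)
  also have "... = (\<integral>\<^sup>+x. en (norm (F x) powr p) \<partial>M)" unfolding M_def by (subst nn_integral_density) auto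
  finally show ?thesis using Fp by simp
 qed
 have Gi: "integrable lborel (%x. G x \<bullet> b)" if "b : Basis" for b
 proof (rule integrableI_bounded)
  show "(%x. G x \<bullet> b) : borel_measurable lborel" using Gm by measurable
  have "(NN x. en (norm (G x \<bullet> b))) <= (NN x. ind T x + en (norm (G x) powr p))"
  proof (rule nn_integral_mono)
   fix x
   show "en (norm (G x \<bullet> b)) <= ind T x + en (norm (G x) powr p)"
   proof (cases "x : T")
    case True
    have "abs(G x \<bullet> b) <= norm (G x)" using that by (rule Basis_le_norm)
    also have "... <= 1 + norm (G x) powr p"
    proof (cases "norm (G x) <= 1")
     case False
     then have "norm (G x) powr 1 <= norm (G x) powr p" using p by (intro powr_mono) auto
     then show ?thesis using False by simp
    qed (smt (verit) powr_ge_zero)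
    finally have "en (abs(G x \<bullet> b)) <= en (1 + norm (G x) powr p)" by (rule ennreal_leI)
    then show ?thesis using True by (simp add: ennreal_plus)
   qed (simp add: G_def)
  qed
  also have "... = emeasure lborel T + (NN x. en (norm (G x) powr p))"
   using Gm by (subst nn_integral_add) auto
  also have "... < \<infinity>" using emeasure_lborel_bounded[OF bT] Gp by (auto intro: le_less_trans)
  finally show "(NN x. en (norm (G x \<bullet> b))) < \<infinity>" .
 qed
 have wg: "wgrad U u G"
  unfolding wgrad_def
 proof (intro allI impI)
  fix \<phi> i assume phi: "test_fun U \<phi>" and i: "i : (Basis :: 'a set)"
  note [measurable] = test_fun_borel[OF phi] smooth_fun_deriv_borel[OF test_fun_smooth[OF phi]]
  obtain K where K: "compact K" "K \<subseteq> U" "!!x. x ~: K ==> \<phi> x = 0" using test_fun_cases[OF phi] by metis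
  obtain B where B: "0 <= B" "!!x. abs(\<phi> x) <= B" using test_fun_bounded[OF phi] by blast
  obtain BD where BD: "0 <= BD" "!!x. abs(dd \<phi> x i) <= BD" using test_fun_bounded[OF test_fun_deriv[OF phi]] by blast
  let ?D = "%x. dd \<phi> x i"
  obtain r where r: "0 < r" "(\<Union>x\<in>K. ball x r) \<subseteq> U" using compact_subset_open_imp_ball_epsilon_subset[OF K(1) U K(2)] by blast
  have dens: "(\<integral>x. H x \<bullet> (\<phi> x *\<^sub>R i) \<partial>M) = (LL x. ((ind T x *\<^sub>R H x) \<bullet> i) * \<phi> x)"
   if [measurable]: "H : bmeas" for H :: "'a => 'a"
   unfolding M_def by (subst integral_density) (auto simp: mult_ac intro!: Bochner_Integration.integral_cong)
  \<comment> \<open>The compact support of \<open>\<phi>\<close> has a margin \<open>r\<close> in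
    \<open>U\<close>; once \<open>2 * eps j < r\<close>, the cut-off in \<open>f j\<close> equals 1
    there and integration by parts applies to the full mollified gradient.\<close>
  have ev: "\<forall>\<^sub>F j in sequentially. (\<integral>x. f j x \<bullet> (\<phi> x *\<^sub>R i) \<partial>M) = - (LL x. convol u (moll (eps j)) x * ?D x)"
  proof -
   have "eps ----> 0"
    unfolding eps_def using LIMSEQ_ignore_initial_segment[OF lim_1_over_n, of 2] by simp
   then have "\<forall>\<^sub>F j in sequentially. eps j < r / 2" using r by (intro order_tendstoD(2)) auto
   then show ?thesis
   proof (rule eventually_mono)
    fix j assume j: "eps j < r / 2"
    have "(\<integral>x. f j x \<bullet> (\<phi> x *\<^sub>R i) \<partial>M) = (LL x. (cgrad (eps j) u x \<bullet> i) * \<phi> x)"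
    proof (subst dens, simp, rule Bochner_Integration.integral_cong, simp)
     fix x
     show "((ind T x *\<^sub>R f j x) \<bullet> i) * \<phi> x = (cgrad (eps j) u x \<bullet> i) * \<phi> x"
     proof (cases "x : K")
      case True
      have "ball x (2 * eps j) \<subseteq> ball x r" using j by (intro subset_ball) auto
      then have "x : W j" using True r(2) unfolding W_def by blast
      moreover have "x : U" using True K by auto
      moreover have "cgrad (eps j) u x = 0" if "x ~: ball 0 R"
      proof (rule cgrad_eq_0[OF eps(1,3), of S])
       fix y assume "y : S"
       then have "norm y < R0" using R0 by auto
       then show "1 <= dist x y" using that norm_triangle_ineq2[of x y] by (simp add: dist_norm R_def)
      qed (use S in auto)
      ultimately show ?thesis by (cases "x : ball 0 R") (auto simp: f_def T_def indicator_def)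
     qed (simp add: K)
    qed
    also have "... = - (LL x. convol u (moll (eps j)) x * ?D x)"
     by (rule cgrad_by_parts[OF eps(1) u S(1,2) phi])
    finally show "(\<integral>x. f j x \<bullet> (\<phi> x *\<^sub>R i) \<partial>M) = - (LL x. convol u (moll (eps j)) x * ?D x)" .
   qed
  qed
  have uD: "integrable lborel (%x. u x * ?D x)" by (rule integrable_mult_test_fun[OF u test_fun_deriv[OF phi]])
  have lim: "(%j. LL x. convol u (moll (eps j)) x * ?D x) ----> (LL x. u x * ?D x)"
  proof (rule LIMSEQ_I)
   fix e :: real assume e: "0 < e"
   have fin: "(NN x. pw 1 (u x)) < \<infinity>" using u by (simp add: integrable_iff_bounded)
   obtain d where d: "0 < d" "!!e'. 0 < e' ==> e' < d ==>
    (NN x. pw 1 (convol u (moll e') x - u x)) <= en (e / (2 * (BD + 1)))"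
    using convol_moll_Lp[of 1 u "e / (2 * (BD + 1))"] u fin e BD by auto
   obtain N where N: "1 / d < real N" using reals_Archimedean2 by blast
   show "EX no. ALL n>=no. norm ((LL x. convol u (moll (eps n)) x * ?D x) - (LL x. u x * ?D x)) < e"
   proof (intro exI[of _ N] allI impI)
    fix n assume n: "N <= n"
    have "eps n < d"
    proof -
     have "1 / d < real (n + 2)" using N n by simp
     then show ?thesis using d(1) by (simp add: eps_def field_simps)
    qed
    then have le: "(NN x. en (abs(convol u (moll (eps n)) x - u x))) <= en (e / (2 * (BD + 1)))" using d(2)[OF eps(1)] by simp
    note [measurable] = convol_moll_borel[OF eps(1) u]
    have di: "integrable lborel (%x. convol u (moll (eps n)) x - u x)"
     using le by (intro integrableI_bounded) (auto intro: le_less_trans)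
    have "en (LL x. abs(convol u (moll (eps n)) x - u x)) <= en (e / (2 * (BD + 1)))"
     using le nn_integral_eq_integral[OF Bochner_Integration.integrable_abs[OF di]] by simp
    then have r: "(LL x. abs(convol u (moll (eps n)) x - u x)) <= e / (2 * (BD + 1))"
     using e BD by (subst (asm) ennreal_le_iff) auto
    have dD: "integrable lborel (%x. (convol u (moll (eps n)) x - u x) * ?D x)"
     by (rule integrable_mult_test_fun[OF di test_fun_deriv[OF phi]])
    have cD: "integrable lborel (%x. convol u (moll (eps n)) x * ?D x)"
     using Bochner_Integration.integrable_add[OF dD uD] by (simp add: left_diff_distrib)
    have "(LL x. convol u (moll (eps n)) x * ?D x) - (LL x. u x * ?D x) = (LL x. (convol u (moll (eps n)) x - u x) * ?D x)"
     using cD uD by (simp add: left_diff_distrib)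
    then have "norm ((LL x. convol u (moll (eps n)) x * ?D x) - (LL x. u x * ?D x)) <= (LL x. abs((convol u (moll (eps n)) x - u x) * ?D x))"
     using integral_abs_bound by simp
    also have "... <= (LL x. BD * abs(convol u (moll (eps n)) x - u x))"
    proof (rule integral_mono[OF Bochner_Integration.integrable_abs[OF dD]])
     show "integrable lborel (%x. BD * abs(convol u (moll (eps n)) x - u x))" using di by simp
     show "abs((convol u (moll (eps n)) x - u x) * ?D x) <= BD * abs(convol u (moll (eps n)) x - u x)" for x
      unfolding abs_mult using BD(2)[of x] by (subst mult.commute) (rule mult_right_mono, auto)
    qed
    also have "... = BD * (LL x. abs(convol u (moll (eps n)) x - u x))" by simp
    also have "... <= BD * (e / (2 * (BD + 1)))" using r BD by (intro mult_left_mono) auto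
    also have "... < e" using BD(1) e mult_nonneg_nonneg[of BD e] by (simp add: field_simps add_nonneg_pos)
    finally show "norm ((LL x. convol u (moll (eps n)) x * ?D x) - (LL x. u x * ?D x)) < e" .
   qed
  qed
  have "(%j. \<integral>x. f j x \<bullet> (\<phi> x *\<^sub>R i) \<partial>M) ----> - (LL x. u x * ?D x)"
   using tendsto_cong[OF ev] tendsto_minus[OF lim] by simp
  then have "(\<integral>x. F x \<bullet> (\<phi> x *\<^sub>R i) \<partial>M) = - (LL x. u x * ?D x)"
   using B i by (intro Fw[of "%x. \<phi> x *\<^sub>R i" B]) (auto simp: M_def)
  then show "(LL x. u x * ?D x) = - (LL x. (G x \<bullet> i) * \<phi> x)"
   using dens[of F] by (simp add: G_def)
 qed
 show thesis by (rule that[OF Gm bT _ _ Gi wg Gp]) (auto simp: G_def T_def)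
qed

end


section \<open>The fractional kernels and the translation condition\<close>

definition bbm_kernel :: "real => real => 'a::euclidean_space => real" where
 "bbm_kernel p s h = (1 - s) * norm h powr - (real DIM('a) + s * p)"

lemma bbm_kernel_borel [measurable]: "bbm_kernel p s : bmeas"
 unfolding bbm_kernel_def[abs_def] by measurable

lemma bbm_kernel_nonneg: "s <= 1 ==> 0 <= bbm_kernel p s h"
 by (simp add: bbm_kernel_def)

text \<open>The radial integral contributes \<open>1 / (p * (1 - s))\<close>, which the factor
  \<open>1 - s\<close> of the kernel cancels. What remains is \<open>K_np / p\<close> times a power
  of \<open>d\<close> that tends to 1 with \<open>s\<close>.\<close>

lemma bbm_kernel_moment:
 fixes v :: "'a::euclidean_space"
 assumes p: "0 < p" and s: "0 < s" "s < 1" and d: "0 < d"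
 shows "(NN h. en (bbm_kernel p s h) * pw p (h \<bullet> v) * ind (ball 0 d) h)
  = en (cnp p TYPE('a) * (real DIM('a) + p) / p * d powr (p * (1 - s)) * norm v powr p)"
proof -
 let ?n = "real DIM('a)"
 have ps: "p * (1 - s) > 0" using p s by simp
 have "(NN h. en (bbm_kernel p s h) * pw p (h \<bullet> v) * ind (ball 0 d) h)
  = (NN h. en (1 - s) * (pw p (h \<bullet> v) * en (norm h powr - (?n + s * p)) * ind (ball 0 d) h))"
  using s by (intro nn_integral_cong) (simp add: bbm_kernel_def ennreal_mult mult_ac)
 also have "... = en (1 - s) * (NN h. pw p (h \<bullet> v) * en (norm h powr - (?n + s * p)) * ind (ball 0 d) h)"
  by (rule nn_integral_cmult) measurable
 also have "(NN h. pw p (h \<bullet> v) * en (norm h powr - (?n + s * p)) * ind (ball 0 d) h)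
  = en ((norm v powr p * cnp p TYPE('a)) * (?n + p) / ((?n + p) - (?n + s * p)) * d powr ((?n + p) - (?n + s * p)))"
 proof (rule nn_integral_powr_ball)
  show "(NN x. pw p (x \<bullet> v) * ind (ball 0 r) x) = en ((norm v powr p * cnp p TYPE('a)) * r powr (?n + p))" if "0 < r" for r
   using nn_integral_ball_inner_powr[OF p that, of v] by (simp add: mult_ac)
  show "0 < ?n + s * p" using p s by (simp add: add_pos_pos)
  show "?n + s * p < ?n + p" using p s by simp
 qed (use d cnp_nonneg[of p, where ?'a='a] in auto)
 also have "(?n + p) - (?n + s * p) = p * (1 - s)" by (simp add: algebra_simps)
 also have "en (1 - s) * en (norm v powr p * cnp p TYPE('a) * (?n + p) / (p * (1 - s)) * d powr (p * (1 - s)))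
  = en ((1 - s) * (norm v powr p * cnp p TYPE('a) * (?n + p) / (p * (1 - s)) * d powr (p * (1 - s))))"
  using s p cnp_nonneg[of p, where ?'a='a] by (subst ennreal_mult) auto
 also have "(1 - s) * (norm v powr p * cnp p TYPE('a) * (?n + p) / (p * (1 - s)) * d powr (p * (1 - s)))
  = cnp p TYPE('a) * (?n + p) / p * d powr (p * (1 - s)) * norm v powr p"
  using s p by (simp add: field_simps)
 finally show ?thesis .
qed

lemma kernel_sequence_bbm:
 assumes p: "1 < p" and s: "!!i. 0 < s i & s i < 1" and lim: "s ----> 1"
 shows "kernel_sequence p (%i. bbm_kernel p (s i) :: 'a::euclidean_space => real)
  (%i d. cnp p TYPE('a) * (real DIM('a) + p) / p * d powr (p * (1 - s i))) (cnp p TYPE('a) * (real DIM('a) + p) / p)"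
proof
 fix d :: real assume d: "0 < d" "d <= 1"
 have "(%i. d powr (p * (1 - s i))) ----> d powr (p * (1 - 1))" using d by (intro tendsto_intros lim) auto
 then have "(%i. cnp p TYPE('a) * (real DIM('a) + p) / p * d powr (p * (1 - s i))) ----> cnp p TYPE('a) * (real DIM('a) + p) / p * 1"
  using d by (intro tendsto_mult tendsto_const) auto
 then show "(%i. cnp p TYPE('a) * (real DIM('a) + p) / p * d powr (p * (1 - s i))) ----> cnp p TYPE('a) * (real DIM('a) + p) / p" by simp
next
 show "0 < cnp p TYPE('a) * (real DIM('a) + p) / p"
  using p cnp_pos[of p, where ?'a='a] by (intro divide_pos_pos mult_pos_pos) (auto simp: add_pos_pos)
next
 fix i and d :: real and v :: 'a assume "0 < d"
 then show "(NN h. en (bbm_kernel p (s i) h) * pw p (h \<bullet> v) * ind (ball 0 d) h)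
  = en (cnp p TYPE('a) * (real DIM('a) + p) / p * d powr (p * (1 - s i)) * norm v powr p)"
  using p s by (intro bbm_kernel_moment) auto
qed (use p s cnp_nonneg[of p, where ?'a='a] in \<open>auto simp: less_imp_le intro!: bbm_kernel_nonneg\<close>)

lemma nn_integral_ball_norm_powr_le:
 assumes "0 <= p" "0 < r"
 shows "(\<integral>\<^sup>+h. en (ind (ball 0 r) h) * en (norm h powr p) \<partial>(lborel :: 'a::euclidean_space measure))
  <= en (unit_ball_vol (real DIM('a)) * r powr (real DIM('a) + p))"
proof -
 have "(\<integral>\<^sup>+h. en (ind (ball 0 r) h) * en (norm h powr p) \<partial>(lborel :: 'a measure))
  <= (\<integral>\<^sup>+h. en (r powr p) * ind (ball 0 r) h \<partial>(lborel :: 'a measure))"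
  using assms by (intro nn_integral_mono) (auto simp: indicator_def intro!: ennreal_leI powr_mono2)
 also have "... = en (r powr p) * emeasure lborel (ball (0::'a) r)" by (rule nn_integral_cmult_indicator) auto
 also have "... = en (unit_ball_vol (real DIM('a)) * r powr (real DIM('a) + p))"
  using assms by (simp add: emeasure_ball powr_add powr_realpow mult_ac flip: ennreal_mult)
 finally show ?thesis .
qed

text \<open>The scale-invariant first-order condition of Bourgain--Brezis--Mironescu type that is stable under
 reflections and cut-offs and, for \<open>p > 1\<close>, characterises \<open>W\<^sup>1\<^sup>,\<^sup>p\<close>.\<close>

definition AT :: "real => 'a::euclidean_space set => ('a => real) => bool" where
 "AT p B v \<longleftrightarrow> (EX C>=0. ALL r>0. energy p (ind (ball 0 r)) B v <= en (C * r powr (real DIM('a) + p)))"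

text \<open>Indicators of shrinking balls, scaled by \<open>r i powr - (DIM('a) + p)\<close>, form a
  kernel sequence with limit constant \<open>cnp\<close>. For this scaling the bound in
  \<open>AT\<close> is uniform in \<open>i\<close>, so the lower bound applies to the constant
  sequence \<open>v\<close>.\<close>

lemma AT_wgrad:
 fixes v :: "'a::euclidean_space => real"
 assumes p: "1 < p" and vm [measurable]: "v : bmeas" and vb: "!!x. abs(v x) <= 1"
  and S: "bounded S" "!!x. x ~: S ==> v x = 0" and AT: "AT p UNIV v"
 obtains G T where "G : bmeas" "bounded T" "!!x. x ~: T ==> G x = 0"
  "!!b. b : Basis ==> integrable lborel (%x. G x \<bullet> b)" "wgrad UNIV v G"
  "(NN x. en (norm (G x) powr p)) < \<infinity>"
proof -
 let ?b = "real DIM('a) + p"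
 obtain C where C: "0 <= C" "!!r. 0 < r ==> energy p (ind (ball 0 r)) UNIV v <= en (C * r powr ?b)"
  using AT unfolding AT_def by auto
 define r where "r i = 1 / real (Suc i)" for i
 have r: "0 < r i" for i by (simp add: r_def)
 define k :: "nat => 'a => real" where "k i h = r i powr - ?b * ind (ball 0 (r i)) h" for i h
 define a where "a i d = cnp p TYPE('a) * (min d (r i) / r i) powr ?b" for i d
 have ks: "kernel_sequence p k a (cnp p TYPE('a))"
 proof
  show "1 < p" by fact
  show "k i : bmeas" "0 <= k i h" for i h unfolding k_def by auto
  show "0 < cnp p TYPE('a)" using p by (intro cnp_pos) auto
  show "0 <= a i d" for i d unfolding a_def using cnp_nonneg[of p, where ?'a='a] by auto
  fix d :: real assume d: "0 < d" "d <= 1"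
  have "r ----> 0" unfolding r_def by (rule LIMSEQ_Suc[OF lim_1_over_n])
  then have "\<forall>\<^sub>F i in sequentially. r i < d" using d by (intro order_tendstoD(2)) auto
  then have "\<forall>\<^sub>F i in sequentially. a i d = cnp p TYPE('a)"
   by (rule eventually_mono) (use r in \<open>auto simp: a_def less_imp_neq[OF r, symmetric]\<close>)
  then show "(%i. a i d) ----> cnp p TYPE('a)" by (rule tendsto_eventually)
  fix i and v :: 'a
  have m: "0 < min d (r i)" using d r by auto
  have "(NN h. en (k i h) * pw p (h \<bullet> v) * ind (ball 0 d) h)
   = (NN h. en (r i powr - ?b) * (pw p (h \<bullet> v) * ind (ball 0 (min d (r i))) h))"
   by (intro nn_integral_cong) (auto simp: k_def indicator_def)
  also have "... = en (r i powr - ?b) * en (norm v powr p * min d (r i) powr ?b * cnp p TYPE('a))"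
   using p by (subst nn_integral_cmult) (auto simp: nn_integral_ball_inner_powr[OF _ m])
  also have "... = en (r i powr - ?b * (norm v powr p * min d (r i) powr ?b * cnp p TYPE('a)))"
   using cnp_nonneg[of p, where ?'a='a] by (subst ennreal_mult) auto
  also have "r i powr - ?b * (norm v powr p * min d (r i) powr ?b * cnp p TYPE('a)) = a i d * norm v powr p"
  proof -
   have "(min d (r i) / r i) powr ?b = min d (r i) powr ?b * r i powr - ?b"
    using m r[of i] powr_divide[of "min d (r i)" "r i" ?b]
    unfolding powr_minus_divide[of "r i" ?b] by simp
   then show ?thesis by (simp only: a_def mult_ac)
  qed
  finally show "(NN h. en (k i h) * pw p (h \<bullet> v) * ind (ball 0 d) h) = en (a i d * norm v powr p)" .
 qed
 have en: "energy p (k i) UNIV v <= en C" for i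
 proof -
  have "energy p (k i) UNIV v = (NN h. en (r i powr - ?b) * (en (ind (ball 0 (r i)) h) * trd p UNIV v h))"
   unfolding energy_def k_def by (intro nn_integral_cong) (simp add: ennreal_mult mult.assoc)
  also have "... = en (r i powr - ?b) * energy p (ind (ball 0 (r i))) UNIV v"
   unfolding energy_def by (subst nn_integral_cmult) auto
  also have "... <= en (r i powr - ?b) * en (C * r i powr ?b)" by (intro mult_left_mono C r) auto
  also have "... = en (C * (r i powr - ?b * r i powr ?b))" using C by (subst ennreal_mult[symmetric]) (auto simp: mult_ac)
  also have "r i powr - ?b * r i powr ?b = 1" using r[of i] by (simp flip: powr_add)
  finally show ?thesis by simp
 qed
 show thesis
 proof (rule kernel_sequence.energy_liminf[OF ks open_UNIV vm vb vm vb S S(2) en C(1)])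
  fix G T
  assume G: "G : bmeas" "bounded T" "!!x. x ~: T ==> G x = 0"
   "!!b. b : Basis ==> integrable lborel (%x. G x \<bullet> b)" "wgrad UNIV v G"
   "(NN x. en (norm (G x) powr p)) <= en (C / cnp p TYPE('a))"
  then show thesis by (intro that[OF G(1-5)]) (auto intro: le_less_trans)
 qed auto
qed

text \<open>A Leibniz rule for differences. If an endpoint lies outside \<open>B\<close>, then
  \<open>\<beta>\<close> vanishes there and the difference of products is bounded by the Lipschitz
  increment of \<open>\<beta>\<close> alone; hence increments of \<open>w\<close> enter only inside
  \<open>B\<close> although the product lives on the whole space. The factor \<open>2 * V\<close>
  counts positions with \<open>x\<close> or \<open>x + h\<close> in \<open>S\<close>.\<close>

lemma trd_product_le:
 fixes w \<beta> :: "'a::euclidean_space => real"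
 assumes p: "1 <= p" and [measurable]: "w : bmeas" "\<beta> : bmeas" "B : sets borel" "S : sets borel"
  and w: "!!x. abs(w x) <= 1" and b: "!!x. 0 <= \<beta> x" "!!x. \<beta> x <= 1" "!!x y. abs(\<beta> x - \<beta> y) <= L * norm (x - y)" and L: "0 <= L"
  and bB: "!!x. x ~: B ==> \<beta> x = 0" and bS: "!!x. x ~: S ==> \<beta> x * w x = 0" and V: "emeasure lborel S = en V" "0 <= V"
 shows "trd p UNIV (%x. \<beta> x * w x) h <= en (2 powr p) * trd p B w h + en (2 powr p * L powr p * (2 * V)) * en (norm h powr p)"
proof -
 have pt: "pw p (\<beta> (x + h) * w (x + h) - \<beta> x * w x)
  <= en (2 powr p) * (pw p (w (x + h) - w x) * ind B x * ind B (x + h))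
  + en (2 powr p * L powr p * norm h powr p) * (ind S x + ind S (x + h))" for x
 proof (cases "x : S \<or> x + h : S")
  case False
  then have z: "\<beta> x * w x = 0" "\<beta> (x + h) * w (x + h) = 0" using bS by auto
  show ?thesis unfolding z by simp
 next
  case True
  let ?I = "(if x : B & x + h : B then abs(w (x + h) - w x) else 0)"
  have bl: "abs(\<beta> (x + h) - \<beta> x) <= L * norm h" using b(3)[of "x + h" x] by simp
  have "abs(\<beta> (x + h) * w (x + h) - \<beta> x * w x) <= ?I + L * norm h"
  proof (cases "x : B & x + h : B")
   case True
   have "\<beta> (x + h) * w (x + h) - \<beta> x * w x = \<beta> (x + h) * (w (x + h) - w x) + (\<beta> (x + h) - \<beta> x) * w x" by (simp add: algebra_simps)
   moreover have "abs(\<beta> (x + h) * (w (x + h) - w x)) <= 1 * abs(w (x + h) - w x)"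
    unfolding abs_mult using b[of "x + h"] by (intro mult_right_mono) auto
   moreover have "abs((\<beta> (x + h) - \<beta> x) * w x) <= (L * norm h) * 1"
    unfolding abs_mult using bl w by (intro mult_mono) auto
   ultimately show ?thesis using True by simp
  next
   case False
   then have "\<beta> x = 0 \<or> \<beta> (x + h) = 0" using bB by auto
   then have "abs(\<beta> (x + h) * w (x + h) - \<beta> x * w x) <= abs(\<beta> (x + h) - \<beta> x)"
    using mult_left_mono[OF w abs_ge_zero] by (auto simp: abs_mult)
   then have "abs(\<beta> (x + h) * w (x + h) - \<beta> x * w x) <= L * norm h" using bl by simp
   then show ?thesis by auto
  qed
  then have "abs(\<beta> (x + h) * w (x + h) - \<beta> x * w x) powr p <= (?I + L * norm h) powr p" using p by (intro powr_mono2) auto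
  also have "... <= 2 powr p * (?I powr p + (L * norm h) powr p)" using p L by (intro powr_add_le2) auto
  also have "... = 2 powr p * ?I powr p + 2 powr p * L powr p * norm h powr p" using L by (simp add: powr_mult distrib_left)
  finally have "pw p (\<beta> (x + h) * w (x + h) - \<beta> x * w x) <= en (2 powr p * ?I powr p) + en (2 powr p * L powr p * norm h powr p)"
   by (simp add: ennreal_leI flip: ennreal_plus)
  also have "... <= en (2 powr p) * (pw p (w (x + h) - w x) * ind B x * ind B (x + h))
  + en (2 powr p * L powr p * norm h powr p) * (ind S x + ind S (x + h))"
  proof (rule add_mono)
   show "en (2 powr p * ?I powr p) <= en (2 powr p) * (pw p (w (x + h) - w x) * ind B x * ind B (x + h))"
    using p by (auto simp: ennreal_mult)
   have "(1::ennreal) <= ind S x + ind S (x + h)" using True by (auto simp: indicator_def)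
   from mult_left_mono[OF this, of "en (2 powr p * L powr p * norm h powr p)"]
   show "en (2 powr p * L powr p * norm h powr p) <= en (2 powr p * L powr p * norm h powr p) * (ind S x + ind S (x + h))"
    by simp
  qed
  finally show ?thesis .
 qed
 have "trd p UNIV (%x. \<beta> x * w x) h <= (NN x. en (2 powr p) * (pw p (w (x + h) - w x) * ind B x * ind B (x + h))
  + en (2 powr p * L powr p * norm h powr p) * (ind S x + ind S (x + h)))"
  unfolding trd_def using pt by (intro nn_integral_mono) auto
 also have "... = en (2 powr p) * trd p B w h + en (2 powr p * L powr p * norm h powr p) * ((NN x. ind S x) + (NN x. ind S (x + h)))"
  unfolding trd_def by (subst nn_integral_add, simp, simp, subst nn_integral_cmult, simp, subst nn_integral_cmult, simp, subst nn_integral_add) auto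
 also have "(NN x. ind S (x + h)) = emeasure lborel S"
  by (subst nn_integral_translate) auto
 also have "en (2 powr p * L powr p * norm h powr p) * ((NN x. ind S x) + emeasure lborel S)
  = en (2 powr p * L powr p * (2 * V)) * en (norm h powr p)"
  using V by (simp add: mult_ac flip: ennreal_plus ennreal_mult)
 finally show ?thesis .
qed

lemma energy_product_le:
 fixes w \<beta> :: "'a::euclidean_space => real"
 assumes p: "1 <= p" and wm [measurable]: "w : bmeas" and bm [measurable]: "\<beta> : bmeas"
  and Bm [measurable]: "B : sets borel" and Sm [measurable]: "S : sets borel"
  and w: "!!x. abs(w x) <= 1" and b: "!!x. 0 <= \<beta> x" "!!x. \<beta> x <= 1" "!!x y. abs(\<beta> x - \<beta> y) <= L * norm (x - y)" and L: "0 <= L"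
  and bB: "!!x. x ~: B ==> \<beta> x = 0" and bS: "!!x. x ~: S ==> \<beta> x * w x = 0" and V: "emeasure lborel S = en V" "0 <= V"
  and km [measurable]: "k : bmeas"
 shows "energy p k UNIV (%x. \<beta> x * w x) <= en (2 powr p) * energy p k B w
  + en (2 powr p * L powr p * (2 * V)) * (NN h. en (k h) * en (norm h powr p))"
proof -
 have "energy p k UNIV (%x. \<beta> x * w x) <= (NN h. en (2 powr p) * (en (k h) * trd p B w h)
  + en (2 powr p * L powr p * (2 * V)) * (en (k h) * en (norm h powr p)))"
  unfolding energy_def
 proof (rule nn_integral_mono)
  fix h :: 'a
  from mult_left_mono[OF trd_product_le[OF p wm bm Bm Sm w b L bB bS V, of h], of "en (k h)"]
  show "en (k h) * trd p UNIV (%x. \<beta> x * w x) h <= en (2 powr p) * (en (k h) * trd p B w h)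
  + en (2 powr p * L powr p * (2 * V)) * (en (k h) * en (norm h powr p))"
   by (simp add: distrib_left mult_ac)
 qed
 also have "... = en (2 powr p) * energy p k B w
  + en (2 powr p * L powr p * (2 * V)) * (NN h. en (k h) * en (norm h powr p))"
  unfolding energy_def by (subst nn_integral_add) (auto simp: nn_integral_cmult)
 finally show ?thesis .
qed

lemma AT_product:
 fixes w \<beta> :: "'a::euclidean_space => real"
 assumes p: "1 <= p" and wm [measurable]: "w : bmeas" and bm [measurable]: "\<beta> : bmeas"
  and Bm [measurable]: "B : sets borel" and w: "!!x. abs(w x) <= 1"
  and b: "!!x. 0 <= \<beta> x" "!!x. \<beta> x <= 1" "!!x y. abs(\<beta> x - \<beta> y) <= L * norm (x - y)" and L: "0 <= L"
  and bB: "!!x. x ~: B ==> \<beta> x = 0" and S: "bounded S" and bS: "!!x. x ~: S ==> \<beta> x * w x = 0" and AT: "AT p B w"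
 shows "AT p UNIV (%x. \<beta> x * w x)"
proof -
 obtain c r0 where S0: "S \<subseteq> ball c r0" using S bounded_subset_ballD by blast
 define V where "V = measure lborel (ball c r0)"
 have V: "emeasure lborel (ball c r0) = en V" "0 <= V"
  using emeasure_lborel_ball_finite[of c r0] unfolding V_def by (auto intro!: emeasure_eq_ennreal_measure)
 have bS': "!!x. x ~: ball c r0 ==> \<beta> x * w x = 0" using bS S0 by blast
 let ?b = "real DIM('a) + p"
 obtain C where C: "0 <= C" "!!r. 0 < r ==> energy p (ind (ball 0 r)) B w <= en (C * r powr ?b)"
  using AT unfolding AT_def by auto
 define K where "K = 2 powr p * C + 2 powr p * L powr p * (2 * V) * unit_ball_vol (real DIM('a))"
 have "energy p (ind (ball 0 r)) UNIV (%x. \<beta> x * w x) <= en (K * r powr ?b)" if r: "0 < r" for r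
 proof -
  have "energy p (ind (ball 0 r)) UNIV (%x. \<beta> x * w x) <= en (2 powr p) * energy p (ind (ball 0 r)) B w
   + en (2 powr p * L powr p * (2 * V)) * (\<integral>\<^sup>+h. en (ind (ball 0 r) h) * en (norm h powr p) \<partial>(lborel :: 'a measure))"
   by (rule energy_product_le[OF p wm bm Bm _ w b L bB bS' V]) auto
  also have "... <= en (2 powr p) * en (C * r powr ?b) + en (2 powr p * L powr p * (2 * V)) * en (unit_ball_vol (real DIM('a)) * r powr ?b)"
   using p r by (intro add_mono mult_left_mono C nn_integral_ball_norm_powr_le) auto
  also have "... = en (2 powr p * (C * r powr ?b) + 2 powr p * L powr p * (2 * V) * (unit_ball_vol (real DIM('a)) * r powr ?b))"
   using C V L by (simp add: ennreal_mult ennreal_plus)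
  also have "2 powr p * (C * r powr ?b) + 2 powr p * L powr p * (2 * V) * (unit_ball_vol (real DIM('a)) * r powr ?b) = K * r powr ?b"
   by (simp add: K_def algebra_simps)
  finally show ?thesis .
 qed
 moreover have "0 <= K" using C V L by (simp add: K_def)
 ultimately show ?thesis unfolding AT_def by blast
qed

lemma AT_add:
 fixes f g :: "'a::euclidean_space => real"
 assumes p: "1 <= p" and [measurable]: "f : bmeas" "g : bmeas" and f: "AT p UNIV f" and g: "AT p UNIV g"
 shows "AT p UNIV (%x. f x + g x)"
proof -
 let ?b = "real DIM('a) + p"
 obtain C where C: "0 <= C" "!!r. 0 < r ==> energy p (ind (ball 0 r)) UNIV f <= en (C * r powr ?b)"
  using f unfolding AT_def by auto
 obtain D where D: "0 <= D" "!!r. 0 < r ==> energy p (ind (ball 0 r)) UNIV g <= en (D * r powr ?b)"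
  using g unfolding AT_def by auto
 have tr: "trd p UNIV (%x. f x + g x) h <= en (2 powr p) * (trd p UNIV f h + trd p UNIV g h)" for h
 proof -
  have "trd p UNIV (%x. f x + g x) h <= (NN x. en (2 powr p) * (pw p (f (x + h) - f x) + pw p (g (x + h) - g x)))"
   unfolding trd_def
  proof (rule nn_integral_mono)
   fix x
   have "abs(f (x + h) + g (x + h) - (f x + g x)) powr p <= (abs(f (x + h) - f x) + abs(g (x + h) - g x)) powr p"
    using p by (intro powr_mono2) auto
   also have "... <= 2 powr p * (abs(f (x + h) - f x) powr p + abs(g (x + h) - g x) powr p)" using p by (intro powr_add_le2) auto
   finally show "pw p (f (x + h) + g (x + h) - (f x + g x)) * ind UNIV x * ind UNIV (x + h)
    <= en (2 powr p) * (pw p (f (x + h) - f x) + pw p (g (x + h) - g x))"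
    by (simp add: ennreal_leI flip: ennreal_plus ennreal_mult)
  qed
  also have "... = en (2 powr p) * (trd p UNIV f h + trd p UNIV g h)"
   unfolding trd_def by (simp add: nn_integral_cmult nn_integral_add)
  finally show ?thesis .
 qed
 have "energy p (ind (ball 0 r)) UNIV (%x. f x + g x) <= en (2 powr p * (C + D) * r powr ?b)" if r: "0 < r" for r
 proof -
  have "energy p (ind (ball 0 r)) UNIV (%x. f x + g x)
   <= (NN h. en (2 powr p) * (en (ind (ball 0 r) h) * trd p UNIV f h + en (ind (ball 0 r) h) * trd p UNIV g h))"
   unfolding energy_def using tr by (intro nn_integral_mono) (auto simp: indicator_def)
  also have "... = en (2 powr p) * (energy p (ind (ball 0 r)) UNIV f + energy p (ind (ball 0 r)) UNIV g)"
   unfolding energy_def by (simp add: nn_integral_cmult nn_integral_add)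
  also have "... <= en (2 powr p) * (en (C * r powr ?b) + en (D * r powr ?b))"
   using C D r by (intro mult_left_mono add_mono) auto
  also have "... = en (2 powr p * (C + D) * r powr ?b)" using C D by (simp add: algebra_simps flip: ennreal_plus ennreal_mult)
  finally show ?thesis .
 qed
 moreover have "0 <= 2 powr p * (C + D)" using C D by simp
 ultimately show ?thesis unfolding AT_def by blast
qed

lemma AT_of_trd:
 fixes v :: "'a::euclidean_space => real"
 assumes p: "0 <= p" and C: "0 <= C" "!!h. trd p B v h <= en (C * norm h powr p)"
 shows "AT p B v"
proof -
 let ?b = "real DIM('a) + p"
 have "energy p (ind (ball 0 r)) B v <= en (C * unit_ball_vol (real DIM('a)) * r powr ?b)" if r: "0 < r" for r
 proof -
  have "energy p (ind (ball 0 r)) B v <= (\<integral>\<^sup>+h. en C * (en (ind (ball 0 r) h) * en (norm h powr p)) \<partial>(lborel :: 'a measure))"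
   unfolding energy_def using C by (intro nn_integral_mono) (auto simp: indicator_def simp flip: ennreal_mult)
  also have "... = en C * (\<integral>\<^sup>+h. en (ind (ball 0 r) h) * en (norm h powr p) \<partial>(lborel :: 'a measure))"
   by (rule nn_integral_cmult) measurable
  also have "... <= en C * en (unit_ball_vol (real DIM('a)) * r powr ?b)"
   using p r by (intro mult_left_mono nn_integral_ball_norm_powr_le) auto
  also have "... = en (C * unit_ball_vol (real DIM('a)) * r powr ?b)" using C by (simp add: mult.assoc flip: ennreal_mult)
  finally show ?thesis .
 qed
 moreover have "0 <= C * unit_ball_vol (real DIM('a))" using C by simp
 ultimately show ?thesis unfolding AT_def by blast
qed


section \<open>Estimates at small scales, uniform in the fractional order\<close>

lemma trd_double:
 fixes w :: "'a::euclidean_space => real"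
 assumes p: "1 <= p" and [measurable]: "w : bmeas"
 shows "trd p UNIV w (2 *\<^sub>R h) <= en (2 powr p) * trd p UNIV w h"
proof -
 let ?d = "%x. pw p (w (x + h) - w x)"
 have "trd p UNIV w (2 *\<^sub>R h) <= (NN x. en (2 powr (p - 1)) * (?d (x + h) + ?d x))"
  unfolding trd_def
 proof (rule nn_integral_mono)
  fix x
  have h2: "x + 2 *\<^sub>R h = x + h + h" by (simp add: scaleR_2)
  have "abs(w (x + 2 *\<^sub>R h) - w x) powr p <= (abs(w (x + h + h) - w (x + h)) + abs(w (x + h) - w x)) powr p"
   unfolding h2 using p by (intro powr_mono2) auto
  \<comment> \<open>Equal weights give exactly \<open>2 powr p\<close> in total. A larger constant
    would accumulate over the dyadic scales and spoil the iteration.\<close>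
  also have "... <= (1 - 1/2) powr (1 - p) * abs(w (x + h + h) - w (x + h)) powr p + (1/2) powr (1 - p) * abs(w (x + h) - w x) powr p"
   using p by (intro powr_add_weighted) auto
  also have "... = 2 powr (p - 1) * (abs(w (x + h + h) - w (x + h)) powr p + abs(w (x + h) - w x) powr p)"
   using powr_minus_divide[of "1/2::real" "p - 1"] by (simp add: powr_divide distrib_left)
  finally show "pw p (w (x + 2 *\<^sub>R h) - w x) * ind UNIV x * ind UNIV (x + 2 *\<^sub>R h) <= en (2 powr (p - 1)) * (?d (x + h) + ?d x)"
   by (simp add: ennreal_leI flip: ennreal_plus ennreal_mult)
 qed
 also have "... = en (2 powr (p - 1)) * ((NN x. ?d (x + h)) + (NN x. ?d x))"
  by (simp add: nn_integral_cmult nn_integral_add)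
 also have "(NN x. ?d (x + h)) = (NN x. ?d x)" by (rule nn_integral_translate) measurable
 also have "en (2 powr (p - 1)) * ((NN x. ?d x) + (NN x. ?d x)) = en (2 powr (p - 1)) * 2 * trd p UNIV w h"
  by (simp add: trd_def mult.assoc flip: mult_2)
 also have "en (2 powr (p - 1)) * 2 = en (2 powr p)"
  using ennreal_mult[of "2 powr (p - 1)" 2] by (simp add: powr_diff)
 finally show ?thesis .
qed

lemma ball_energy_double:
 fixes w :: "'a::euclidean_space => real"
 assumes p: "1 <= p" and [measurable]: "w : bmeas"
 shows "energy p (ind (ball 0 (2 * t))) UNIV w <= en (2 powr (real DIM('a) + p)) * energy p (ind (ball 0 t)) UNIV w"
proof -
 have "energy p (ind (ball 0 (2 * t))) UNIV w
  = en (abs 2 ^ DIM('a)) * (NN h. en (ind (ball 0 (2 * t)) (2 *\<^sub>R h :: 'a)) * trd p UNIV w (2 *\<^sub>R h))"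
  unfolding energy_def by (rule nn_integral_scaleR) auto
 also have "... <= en (abs 2 ^ DIM('a)) * (NN h. en (2 powr p) * (en (ind (ball 0 t) h) * trd p UNIV w h))"
  using trd_double[OF p, of w] by (intro mult_left_mono nn_integral_mono) (auto simp: indicator_def)
 also have "... = en (abs 2 ^ DIM('a)) * (en (2 powr p) * energy p (ind (ball 0 t)) UNIV w)"
  unfolding energy_def by (subst nn_integral_cmult) auto
 also have "... = en (2 powr (real DIM('a) + p)) * energy p (ind (ball 0 t)) UNIV w"
  by (simp add: powr_add powr_realpow ennreal_mult mult.assoc)
 finally show ?thesis .
qed

lemma ball_energy_dyadic:
 fixes w :: "'a::euclidean_space => real"
 assumes p: "1 <= p" and [measurable]: "w : bmeas"
 shows "energy p (ind (ball 0 t)) UNIV w <= en ((2 powr (real DIM('a) + p)) ^ j) * energy p (ind (ball 0 (t / 2 ^ j))) UNIV w"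
proof (induction j)
 case (Suc j)
 have "energy p (ind (ball 0 (2 * (t / 2 ^ Suc j)))) UNIV w <= en (2 powr (real DIM('a) + p)) * energy p (ind (ball 0 (t / 2 ^ Suc j))) UNIV w"
  by (rule ball_energy_double[OF p]) measurable
 moreover have "2 * (t / 2 ^ Suc j) = t / 2 ^ j" by simp
 ultimately have "energy p (ind (ball 0 (t / 2 ^ j))) UNIV w <= en (2 powr (real DIM('a) + p)) * energy p (ind (ball 0 (t / 2 ^ Suc j))) UNIV w"
  by (simp only:)
 from order_trans[OF Suc mult_left_mono[OF this, of "en ((2 powr (real DIM('a) + p)) ^ j)"]]
 show ?case by (simp add: ennreal_mult mult_ac)
qed simp

text \<open>The numbers \<open>(t / 2 ^ j) powr - a\<close> at least double with \<open>j\<close>,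
  so the sum is at most twice its last active term, and that term has
  \<open>x < t / 2 ^ j\<close>.\<close>

lemma dyadic_sum_le:
 fixes x t a :: real
 assumes t: "0 < t" and a: "1 <= a" and x: "0 < x"
 shows "(\<Sum>j<N. (t / 2 ^ j) powr - a * ind {..<t / 2 ^ j} x) <= 2 * x powr - a"
proof -
 let ?y = "%j. (t / 2 ^ j) powr - a"
 have step: "2 * ?y j <= ?y (Suc j)" for j
 proof -
  have "(2::real) powr 1 <= 2 powr a" using a by (intro powr_mono) auto
  then have "2 * ?y j <= 2 powr a * ?y j" by (intro mult_right_mono) auto
  also have "... = ?y (Suc j)" using t by (simp add: powr_minus powr_divide powr_mult)
  finally show ?thesis .
 qed
 have sum: "(\<Sum>j<N. ?y j) <= ?y N" for N
 proof (induction N)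
  case (Suc N)
  then show ?case using step[of N] by simp
 qed simp
 show ?thesis
 proof (induction N)
  case (Suc N)
  show ?case
  proof (cases "x < t / 2 ^ N")
   case True
   have "(\<Sum>j<N. ?y j * ind {..<t / 2 ^ j} x) <= (\<Sum>j<N. ?y j)" by (intro sum_mono) (auto simp: indicator_def)
   also have "... <= ?y N" by (rule sum)
   finally have "(\<Sum>j<Suc N. ?y j * ind {..<t / 2 ^ j} x) <= 2 * ?y N" using True by simp
   also have "... <= 2 * x powr - a" using True x a by (intro mult_left_mono powr_mono2') auto
   finally show ?thesis .
  next
   case False
   then show ?thesis using Suc by (simp add: indicator_def)
  qed
 qed simp
qed

text \<open>The energy over the ball of radius \<open>t\<close> is compared with every smaller
  dyadic radius, and all these balls together fit under the single kernel. The rescaled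
  contributions form a geometric series of ratio \<open>q = 2 powr - (p * (1 - s))\<close>, whose
  sum is of order \<open>1 / (1 - s)\<close> and offsets the factor \<open>1 - s\<close> of the
  kernel; the constant is therefore uniform as \<open>s\<close> tends to 1.\<close>

lemma small_scale_estimate:
 fixes w :: "'a::euclidean_space => real"
 assumes p: "1 <= p" and s: "0 < s" "s < 1" and wm [measurable]: "w : bmeas" and t: "0 < t" "t <= 1" and C: "0 <= C"
  and en: "energy p (%h. bbm_kernel p s h * ind (ball 0 1) h) UNIV w <= en C"
 shows "energy p (ind (ball 0 t)) UNIV w <= en (4 * p * C * t powr (real DIM('a) + s * p))"
proof -
 define a where "a = real DIM('a) + s * p"
 define Q where "Q = 2 powr (real DIM('a) + p)"
 define q where "q = 2 powr - (p * (1 - s))"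
 have a: "1 <= a" using s p by (simp add: a_def add_increasing2)
 have q: "0 < q" "q < 1" using s p powr_less_one[of 2 "- (p * (1 - s))"] by (auto simp: q_def)
 let ?b = "%r. energy p (ind (ball (0::'a) r)) UNIV w"
 have trd0: "trd p UNIV w 0 = 0" by (simp add: trd_def)
 have lower: "en ((1 - s) / 2 * t powr - a * (\<Sum>j<N. q ^ j)) * ?b t <= en C" for N
 proof -
  have "en ((1 - s) / 2 * t powr - a * (\<Sum>j<N. q ^ j)) * ?b t
   = (\<Sum>j<N. en ((1 - s) / 2 * t powr - a * q ^ j) * ?b t)"
   using s q by (simp add: sum_distrib_left sum_distrib_right[symmetric] sum_ennreal)
  also have "... <= (\<Sum>j<N. en ((1 - s) / 2 * (t / 2 ^ j) powr - a) * ?b (t / 2 ^ j))"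
  proof (rule sum_mono)
   fix j
   have "en ((1 - s) / 2 * t powr - a * q ^ j) * ?b t <= en ((1 - s) / 2 * t powr - a * q ^ j) * (en (Q ^ j) * ?b (t / 2 ^ j))"
    unfolding Q_def by (intro mult_left_mono ball_energy_dyadic p wm) auto
   also have "... = en ((1 - s) / 2 * t powr - a * (q * Q) ^ j) * ?b (t / 2 ^ j)"
   proof -
    define X where "X = (1 - s) / 2 * t powr - a * q ^ j"
    have X: "0 <= X" using s q by (simp add: X_def)
    have "(1 - s) / 2 * t powr - a * (q * Q) ^ j = X * Q ^ j" by (simp add: X_def power_mult_distrib mult.assoc)
    moreover have "0 <= Q ^ j" by (simp add: Q_def)
    ultimately show ?thesis unfolding X_def[symmetric] using X by (simp add: ennreal_mult mult.assoc)
   qed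
   also have "(1 - s) / 2 * t powr - a * (q * Q) ^ j = (1 - s) / 2 * (t / 2 ^ j) powr - a"
   proof -
    have "q * Q = 2 powr a" unfolding q_def Q_def a_def by (simp add: algebra_simps flip: powr_add)
    moreover have "(2 powr a) ^ j = (2 ^ j) powr a"
    proof -
     have "(2 powr a) ^ j = (2 powr a) powr real j" by (subst powr_realpow) auto
     also have "... = (2 powr real j) powr a" by (simp only: powr_powr mult.commute)
     also have "2 powr real j = 2 ^ j" by (simp add: powr_realpow)
     finally show ?thesis .
    qed
    moreover have "(t / 2 ^ j) powr - a = t powr - a / (2 ^ j) powr - a" using t by (intro powr_divide)
    moreover have "(2 ^ j) powr - a = 1 / (2 ^ j) powr a" by (rule powr_minus_divide)
    ultimately show ?thesis by (simp only: divide_divide_eq_right mult_1_right times_divide_eq_right div_by_1 mult.assoc)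
   qed
   finally show "en ((1 - s) / 2 * t powr - a * q ^ j) * ?b t <= en ((1 - s) / 2 * (t / 2 ^ j) powr - a) * ?b (t / 2 ^ j)" .
  qed
  also have "... = (NN h. (\<Sum>j<N. en ((1 - s) / 2 * (t / 2 ^ j) powr - a) * (en (ind (ball 0 (t / 2 ^ j)) h) * trd p UNIV w h)))"
   unfolding energy_def by (subst nn_integral_sum) (auto simp: nn_integral_cmult)
  also have "... <= (NN h. en (bbm_kernel p s h * ind (ball 0 1) h) * trd p UNIV w h)"
  proof (rule nn_integral_mono)
   fix h :: 'a
   show "(\<Sum>j<N. en ((1 - s) / 2 * (t / 2 ^ j) powr - a) * (en (ind (ball 0 (t / 2 ^ j)) h) * trd p UNIV w h))
    <= en (bbm_kernel p s h * ind (ball 0 1) h) * trd p UNIV w h"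
   proof (cases "h = 0")
    case False
    have "(\<Sum>j<N. en ((1 - s) / 2 * (t / 2 ^ j) powr - a) * (en (ind (ball 0 (t / 2 ^ j)) h) * trd p UNIV w h))
     = (\<Sum>j<N. en ((1 - s) / 2 * ((t / 2 ^ j) powr - a * ind {..<t / 2 ^ j} (norm h)))) * trd p UNIV w h"
     unfolding sum_distrib_right using s by (intro sum.cong) (auto simp: indicator_def)
    also have "(\<Sum>j<N. en ((1 - s) / 2 * ((t / 2 ^ j) powr - a * ind {..<t / 2 ^ j} (norm h))))
     = en ((1 - s) / 2 * (\<Sum>j<N. (t / 2 ^ j) powr - a * ind {..<t / 2 ^ j} (norm h)))"
     unfolding sum_distrib_left using s by (intro sum_ennreal) auto
    also have "... <= en (bbm_kernel p s h * ind (ball 0 1) h)"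
    proof (rule ennreal_leI, cases "norm h < 1")
     case True
     have "(1 - s) / 2 * (\<Sum>j<N. (t / 2 ^ j) powr - a * ind {..<t / 2 ^ j} (norm h)) <= (1 - s) / 2 * (2 * norm h powr - a)"
      using s t a False by (intro mult_left_mono dyadic_sum_le) auto
     then show "(1 - s) / 2 * (\<Sum>j<N. (t / 2 ^ j) powr - a * ind {..<t / 2 ^ j} (norm h)) <= bbm_kernel p s h * ind (ball 0 1) h"
      using True by (simp add: bbm_kernel_def a_def)
    next
     case h: False
     have "t / 2 ^ j <= t / 1" for j using t by (intro divide_left_mono) auto
     then have "t / 2 ^ j <= norm h" for j using h t by (smt (verit) div_by_1)
     then have "(\<Sum>j<N. (t / 2 ^ j) powr - a * ind {..<t / 2 ^ j} (norm h)) = 0"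
      by (intro sum.neutral) (auto simp: indicator_def not_less)
     then show "(1 - s) / 2 * (\<Sum>j<N. (t / 2 ^ j) powr - a * ind {..<t / 2 ^ j} (norm h)) <= bbm_kernel p s h * ind (ball 0 1) h"
      using s bbm_kernel_nonneg[of s p h] by simp
    qed
    finally show ?thesis by (simp add: mult_right_mono)
   qed (simp add: trd0)
  qed
  also have "... <= en C" using en by (simp add: energy_def)
  finally show ?thesis .
 qed
 \<comment> \<open>Stopping here retains at least half of the geometric series, and
   \<open>1 - q <= p * (1 - s)\<close> bounds it from below. The 4 in the constant is this 2 times
   the 2 of \<open>dyadic_sum_le\<close>.\<close>
 obtain N where N: "q ^ N < 1/2" using real_arch_pow_inv[of "1/2" q] q by auto
 have "1 / (2 * (1 - q)) <= (\<Sum>j<N. q ^ j)"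
 proof -
  have "(1/2) / (1 - q) <= (1 - q ^ N) / (1 - q)" using N q by (intro divide_right_mono) auto
  then show ?thesis using q by (simp add: sum_gp_strict)
 qed
 moreover have "1 - q <= p * (1 - s)"
 proof -
  have "1 + - (p * (1 - s)) * ln 2 <= exp (- (p * (1 - s)) * ln 2)" by (rule exp_ge_add_one_self)
  then have "1 - p * (1 - s) * ln 2 <= q" by (simp add: q_def powr_def)
  moreover have "p * (1 - s) * ln 2 <= p * (1 - s) * 1" using p s ln_2_less_1 by (intro mult_left_mono) auto
  ultimately show ?thesis by simp
 qed
 then have "1 / (2 * (p * (1 - s))) <= 1 / (2 * (1 - q))" using q by (intro divide_left_mono) auto
 ultimately have S: "1 / (2 * (p * (1 - s))) <= (\<Sum>j<N. q ^ j)" by linarith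
 have "t powr - a / (4 * p) = (1 - s) / 2 * t powr - a * (1 / (2 * (p * (1 - s))))" using s p by (simp add: field_simps)
 also have "... <= (1 - s) / 2 * t powr - a * (\<Sum>j<N. q ^ j)" using S s by (intro mult_left_mono) auto
 finally have "en (t powr - a / (4 * p)) * ?b t <= en C"
  using lower[of N] by (meson ennreal_leI mult_right_mono order_trans zero_le)
 then have "en (4 * p * t powr a) * (en (t powr - a / (4 * p)) * ?b t) <= en (4 * p * t powr a) * en C"
  by (intro mult_left_mono) auto
 moreover have "en (4 * p * t powr a) * en (t powr - a / (4 * p)) = 1"
  using t p by (simp add: powr_minus field_simps flip: ennreal_mult)
 ultimately have "?b t <= en (4 * p * t powr a) * en C" by (simp flip: mult.assoc)
 also have "... = en (4 * p * C * t powr a)" using C p by (simp add: mult_ac flip: ennreal_mult)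
 finally show ?thesis by (simp add: a_def)
qed

text \<open>The mollifier is at most a multiple of \<open>1 / e ^ DIM('a)\<close> on its ball, so
  the error is controlled by a ball energy. With \<open>1/2 <= s\<close> and \<open>e <= 1\<close>
  the power \<open>e powr (s * p)\<close> is replaced by one that is free of
  \<open>s\<close>.\<close>

lemma mollification_rate:
 fixes w :: "'a::euclidean_space => real"
 assumes p: "1 <= p" and s: "1/2 <= s" "s < 1" and w: "integrable lborel w" and e: "0 < e" "e <= 1" and C: "0 <= C"
  and en: "energy p (%h. bbm_kernel p s h * ind (ball 0 1) h) UNIV w <= en C"
 shows "(NN x. pw p (convol w (moll e) x - w x))
  <= en (4 * p * C / integral\<^sup>L lborel (bump :: 'a => real) * e powr (p / 2))"
proof -
 have wm [measurable]: "w : bmeas" using borel_measurable_integrable[OF w] by simp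
 let ?Z = "integral\<^sup>L lborel (bump :: 'a => real)" and ?n = "real DIM('a)"
 have Z: "0 < ?Z" by (rule bump_integral_pos)
 have "(NN x. pw p (convol w (moll e) x - w x))
  <= (NN y. en (moll e y) * (NN x. pw p (w (x - y) - w x)))"
  by (rule convol_moll_dist_le[OF p e(1) w])
 also have "... = (NN y. en (moll e (0 - y)) * trd p UNIV w (0 - y))"
  by (simp add: trd_def moll_minus)
 also have "... = (NN y. en (moll e y) * trd p UNIV w y)"
  by (rule nn_integral_reflect) measurable
 also have "... <= (NN y. en (1 / (e ^ DIM('a) * ?Z)) * (en (ind (ball 0 e) y) * trd p UNIV w y))"
 proof (rule nn_integral_mono)
  fix y :: 'a
  show "en (moll e y) * trd p UNIV w y <= en (1 / (e ^ DIM('a) * ?Z)) * (en (ind (ball 0 e) y) * trd p UNIV w y)"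
  proof (cases "norm y < e")
   case True
   then show ?thesis using moll_le[OF e(1), of y] by (simp add: mult_right_mono ennreal_leI)
  qed (simp add: moll_eq_0[OF e(1)])
 qed
 also have "... = en (1 / (e ^ DIM('a) * ?Z)) * energy p (ind (ball 0 e)) UNIV w"
  unfolding energy_def by (rule nn_integral_cmult) measurable
 also have "... <= en (1 / (e ^ DIM('a) * ?Z)) * en (4 * p * C * e powr (?n + s * p))"
  using s by (intro mult_left_mono small_scale_estimate p wm e C en) auto
 also have "... = en (1 / (e ^ DIM('a) * ?Z) * (4 * p * C * e powr (?n + s * p)))"
  using e Z C p by (subst ennreal_mult) auto
 also have "1 / (e ^ DIM('a) * ?Z) * (4 * p * C * e powr (?n + s * p)) = 4 * p * C / ?Z * e powr (s * p)"
  using e by (simp add: powr_add powr_realpow field_simps)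
 also have "en (4 * p * C / ?Z * e powr (s * p)) <= en (4 * p * C / ?Z * e powr (p / 2))"
 proof (intro ennreal_leI mult_left_mono)
  have "1/2 * p <= s * p" using s p by (intro mult_right_mono) auto
  then show "e powr (s * p) <= e powr (p / 2)" using e by (intro powr_mono') auto
 qed (use C p Z in auto)
 finally show ?thesis .
qed

lemma diagonal_convergent_subseq:
 fixes f :: "nat => nat => real"
 assumes b: "!!n k. abs(f n k) <= B"
 obtains r where "strict_mono r" "!!n. convergent (%k. f n (r k))"
proof -
 interpret subseqs "%n r. convergent (%k. f n (r k))"
 proof
  fix n and s :: "nat => nat"
  have "bounded (range (%k. f n (s k)))" using b by (intro boundedI[of _ B]) auto
  then obtain l r where "strict_mono r" "((%k. f n (s k)) \<circ> r) ----> l"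
   using bounded_imp_convergent_subsequence by blast
  then show "EX r'. strict_mono r' & convergent (%k. f n ((s \<circ> r') k))" by (auto simp: convergent_def o_def)
 qed
 have "convergent (%k. f n (diagseq k))" for n
 proof -
  \<comment> \<open>The diagonal sequence is a subsequence of the \<open>n\<close>-th extracted one
    only from the index \<open>Suc n\<close> on.\<close>
  have "convergent (%k. f n ((diagseq \<circ> ((+) (Suc n))) k))"
  proof (rule diagseq_holds)
   fix r s :: "nat => nat" and n assume "strict_mono r" "convergent (%k. f n (s k))"
   then show "convergent (%k. f n ((s \<circ> r) k))" using convergent_subseq_convergent[of "%k. f n (s k)" r] by (simp add: o_def)
  qed
  then show ?thesis using convergent_ignore_initial_segment[of "%k. f n (diagseq k)" "Suc n"] by (simp add: o_def add.commute)
 qed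
 then show thesis using that subseq_diagseq by blast
qed


section \<open>Compactness of sequences with bounded nonlocal energy\<close>

lemma powr_add_le5:
 fixes p a b c d e :: real
 assumes "0 <= p" "0 <= a" "0 <= b" "0 <= c" "0 <= d" "0 <= e"
 shows "(a + b + c + d + e) powr p <= 5 powr p * (a powr p + b powr p + c powr p + d powr p + e powr p)"
proof -
 define m where "m = max a (max b (max c (max d e)))"
 have "(a + b + c + d + e) powr p <= (5 * m) powr p"
  using assms by (intro powr_mono2) (auto simp: m_def)
 also have "... = 5 powr p * m powr p" using assms by (intro powr_mult)
 also have "m powr p <= a powr p + b powr p + c powr p + d powr p + e powr p"
 proof -
  have "m = a \<or> m = b \<or> m = c \<or> m = d \<or> m = e" by (auto simp: m_def max_def)
  then show ?thesis by auto
 qed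
 finally show ?thesis by (simp add: mult_left_mono)
qed

lemma convol_moll_abs_le:
 fixes f :: "'a::euclidean_space => real"
 assumes e: "0 < e" and f: "integrable lborel f" and b: "!!x. abs(f x) <= B"
 shows "abs(convol f (moll e) x) <= B"
proof -
 have [measurable]: "f : bmeas" using borel_measurable_integrable[OF f] by simp
 have "abs(convol f (moll e) x) <= (LL y. abs(moll e y * f (x - y)))"
  unfolding convol_moll_commute[OF \<open>f : bmeas\<close>] by (rule integral_abs_bound)
 also have "... <= (\<integral>y. moll e y * B \<partial>(lborel :: 'a measure))"
 proof (rule integral_mono[OF Bochner_Integration.integrable_abs[OF convol_moll_integrable[OF e f]]])
  show "integrable lborel (%y::'a. moll e y * B)" using moll_integrable[OF e, where ?'a='a] by simp
  show "abs(moll e y * f (x - y)) <= moll e y * B" for y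
   unfolding abs_mult using b[of "x - y"] moll_nonneg[OF e, of y] by (simp add: mult_left_mono)
 qed
 finally show ?thesis by (simp add: moll_integral[OF e])
qed

text \<open>The cut-off \<open>\<eta> j\<close> extends the functions by zero at a cost
  \<open>C j\<close> that is independent of \<open>k\<close>, so \<open>mollification_rate\<close>
  makes the mollification error small uniformly in \<open>k\<close>. For fixed \<open>j\<close> and
  scale the mollified functions are bounded and equi-Lipschitz; convergence on a countable dense set
  spreads to all points. That \<open>C j\<close> may grow with \<open>j\<close> is harmless, since
  \<open>j\<close> is fixed before the scale.\<close>

theorem nonlocal_compactness:
 fixes u :: "nat => 'a::euclidean_space => real" and Om :: "'a set"
 assumes p: "1 < p" and O: "open Om" "bounded Om" and s: "!!i. 0 < s i & s i < 1" and s_lim: "s ----> 1"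
  and um [measurable]: "!!k. u k : bmeas" and ub: "!!k x. abs(u k x) <= 1" and u0: "!!k x. x ~: Om ==> u k x = 0"
  and en: "!!k. energy p (bbm_kernel p (s k)) Om (u k) <= en M" and M: "0 <= M"
 obtains r f where "strict_mono r" "f : bmeas" "!!x. abs(f x) <= 1" "!!x. x ~: Om ==> f x = 0"
  "AE x in lborel. (%i. u (r i) x) ----> f x"
proof -
 have [measurable]: "Om : sets borel" using O by auto
 define V where "V = measure lborel Om"
 have V: "emeasure lborel Om = en V" "0 <= V"
  using emeasure_lborel_bounded[OF O(2)] unfolding V_def by (auto intro!: emeasure_eq_ennreal_measure)
 obtain R where R: "Om \<subseteq> ball 0 R" using O(2) bounded_subset_ballD by blast
 have ne: "- Om ~= {}"
 proof
  assume "- Om = {}"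
  then have "Om = UNIV" by auto
  then show False using O(2) not_bounded_UNIV by simp
 qed
 have u: "integrable lborel (u k)" for k by (rule integrable_bounded_support[OF um ub O(2) u0])
 define \<eta> where "\<eta> j x = min 1 (real j * infdist x (- Om))" for j :: nat and x
 have eta_c: "continuous_on UNIV (\<eta> j)" for j unfolding \<eta>_def by (intro continuous_intros)
 have [measurable]: "\<eta> j : bmeas" for j using eta_c by (rule borel_measurable_continuous_onI)
 have eta: "0 <= \<eta> j x" "\<eta> j x <= 1" for j x by (auto simp: \<eta>_def infdist_nonneg)
 have eta0: "\<eta> j x = 0" if "x ~: Om" for j x using that by (simp add: \<eta>_def)
 have eta_lip: "abs(\<eta> j x - \<eta> j y) <= real j * norm (x - y)" for j x y
 proof -
  have "abs(\<eta> j x - \<eta> j y) <= abs(real j * infdist x (- Om) - real j * infdist y (- Om))" by (auto simp: \<eta>_def)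
  also have "... = real j * abs(infdist x (- Om) - infdist y (- Om))" by (simp add: abs_mult flip: right_diff_distrib)
  also have "... <= real j * dist x y" using infdist_triangle_abs[of x "- Om" y] by (intro mult_left_mono) auto
  finally show ?thesis by (simp add: dist_norm)
 qed
 have eta_ev: "\<forall>\<^sub>F j in sequentially. \<eta> j x = 1" if x: "x : Om" for x
 proof -
  have "infdist x (- Om) > 0" using O x ne by (subst infdist_pos_not_in_closed) auto
  then obtain N where N: "1 / infdist x (- Om) < real N" using reals_Archimedean2 by blast
  have "\<eta> j x = 1" if "j >= N" for j
  proof -
   have "1 / infdist x (- Om) <= real j" using N that by linarith
   then show ?thesis using \<open>infdist x (- Om) > 0\<close> by (simp add: \<eta>_def field_simps)
  qed
  then show ?thesis by (auto simp: eventually_sequentially)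
 qed
 define w where "w j k x = \<eta> j x * u k x" for j k x
 have [measurable]: "w j k : bmeas" for j k unfolding w_def by measurable
 have wb: "abs(w j k x) <= 1" for j k x unfolding w_def abs_mult using eta[of j x] ub[of k x] by (simp add: mult_le_one)
 have w0: "w j k x = 0" if "x ~: Om" for j k x using u0[OF that] by (simp add: w_def)
 have w: "integrable lborel (w j k)" for j k by (rule integrable_bounded_support[OF _ wb O(2) w0]) measurable
 have wV: "(LL x. abs(w j k x)) <= V" for j k
 proof -
  have "(LL x. abs(w j k x)) <= (LL x. ind Om x)"
  proof (rule integral_mono)
   show "integrable lborel (ind Om :: 'a => real)" using V by (auto simp: integrable_indicator_iff)
   show "abs(w j k x) <= ind Om x" for x using wb[of j k x] w0[of x j k] by (auto simp: indicator_def)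
  qed (use w in auto)
  also have "... = V" by (simp add: V_def)
  finally show ?thesis .
 qed
 define A1 where "A1 = cnp p TYPE('a) * (real DIM('a) + p) / p"
 have A1: "0 <= A1" using p cnp_nonneg[of p, where ?'a='a] by (simp add: A1_def)
 define C where "C j = 2 powr p * M + 2 powr p * real j powr p * (2 * V) * (real DIM('a) powr p * real DIM('a) * A1)" for j :: nat
 have C: "0 <= C j" for j using M V A1 by (simp add: C_def)
 have en_w: "energy p (%h. bbm_kernel p (s k) h * ind (ball 0 1) h) UNIV (w j k) <= en (C j)" for j k
 proof -
  let ?k = "%h. bbm_kernel p (s k) h * ind (ball (0::'a) 1) h"
  have "energy p ?k UNIV (w j k) <= en (2 powr p) * energy p ?k Om (u k)
   + en (2 powr p * real j powr p * (2 * V)) * (NN h. en (?k h) * en (norm h powr p))"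
   unfolding w_def by (rule energy_product_le[OF _ um _ _ _ ub eta eta_lip _ eta0 _ V]) (use p u0 in auto)
  also have "... <= en (2 powr p) * en M + en (2 powr p * real j powr p * (2 * V)) * en (real DIM('a) powr p * real DIM('a) * A1)"
  proof (intro add_mono mult_left_mono)
   have "energy p ?k Om (u k) <= energy p (bbm_kernel p (s k)) Om (u k)"
    unfolding energy_def using s[of k] by (intro nn_integral_mono mult_right_mono) (auto simp: indicator_def bbm_kernel_nonneg)
   also have "... <= en M" by (rule en)
   finally show "energy p ?k Om (u k) <= en M" .
   have "(NN h. en (?k h) * en (norm h powr p))
    = (NN h. en (bbm_kernel p (s k) h) * en (norm h powr p) * ind (ball (0::'a) 1) h)"
    by (intro nn_integral_cong) (auto simp: indicator_def)
   also have "... <= en (real DIM('a) powr p * real DIM('a) * A1)"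
   proof (rule kernel_norm_powr_le)
    show "(NN h. en (bbm_kernel p (s k) h) * pw p (h \<bullet> v) * ind (ball 0 1) h) = en (A1 * norm v powr p)" for v :: 'a
     using bbm_kernel_moment[of p "s k" 1 v] p s[of k] by (simp add: A1_def)
   qed (use p s[of k] A1 in \<open>auto simp: bbm_kernel_nonneg\<close>)
   finally show "(NN h. en (?k h) * en (norm h powr p)) <= en (real DIM('a) powr p * real DIM('a) * A1)" .
  qed auto
  also have "... = en (C j)" using M V A1 unfolding C_def by (simp add: ennreal_mult ennreal_plus)
  finally show ?thesis .
 qed
 define K where "K j = 4 * p * C j / integral\<^sup>L lborel (bump :: 'a => real)" for j
 have rate: "(NN x. pw p (convol (w j k) (moll e) x - w j k x)) <= en (K j * e powr (p / 2))"
  if "1/2 <= s k" "0 < e" "e <= 1" for j k e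
  unfolding K_def using p s[of k] that by (intro mollification_rate[OF _ _ _ w _ _ C en_w]) auto
 obtain D :: "'a set" where D: "countable D" "!!X. open X ==> X ~= {} ==> EX d:D. d : X"
  using countable_dense_setE by blast
 have Dne: "D ~= {}" using D(2)[of UNIV] by auto
 define ep where "ep m = 1 / real (Suc m)" for m
 have ep: "0 < ep m" "ep m <= 1" for m by (auto simp: ep_def)
 \<comment> \<open>One number encodes cut-off level, mollification scale and point of the dense set,
   so a single diagonal extraction serves all triples.\<close>
 define F where "F n k = (case prod_decode n of (j, n') => case prod_decode n' of (m, i) =>
  convol (w j k) (moll (ep m)) (from_nat_into D i))" for n k
 have "abs(F n k) <= 1" for n k
  unfolding F_def by (auto split: prod.splits intro!: convol_moll_abs_le ep w wb)
 then obtain r where r: "strict_mono r" "!!n. convergent (%k. F n (r k))" using diagonal_convergent_subseq by blast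
 define v where "v j m k = convol (w j (r k)) (moll (ep m))" for j m k
 have vb: "abs(v j m k x) <= 1" for j m k x unfolding v_def by (intro convol_moll_abs_le ep w wb)
 have [measurable]: "v j m k : bmeas" for j m k unfolding v_def by (intro convol_moll_borel ep w)
 have v0: "v j m k x = 0" if "x ~: ball 0 (R + 1)" for j m k x
  unfolding v_def
 proof (rule convol_eq_0[of Om _ "ep m"])
  fix y assume "y : Om"
  then have "norm y < R" using R by auto
  then show "ep m <= dist x y" using that ep(2)[of m] norm_triangle_ineq2[of x y] by (simp add: dist_norm)
 qed (use w0 moll_eq_0[OF ep(1)] in auto)
 have conv_D: "convergent (%k. v j m k d)" if d: "d : D" for j m d
 proof -
  obtain i where "from_nat_into D i = d" using d D(1) from_nat_into_surj by metis
  then show ?thesis using r(2)[of "prod_encode (j, prod_encode (m, i))"] by (simp add: F_def v_def)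
 qed
 have conv: "convergent (%k. v j m k x)" for j m x
 proof (rule Cauchy_convergent, rule CauchyI)
  fix e :: real assume e: "0 < e"
  note tm = test_fun_moll[OF ep(1)[of m] subset_UNIV[of "cball (0::'a) (ep m)"]]
  obtain Lip where Lip: "0 <= Lip" "!!x y::'a. abs(moll (ep m) x - moll (ep m) y) <= Lip * norm (x - y)" using test_fun_lipschitz[OF tm] by blast
  obtain B where B: "!!x::'a. abs(moll (ep m) x) <= B" using test_fun_bounded[OF tm] by blast
  define \<delta> where "\<delta> = e / (3 * (Lip * V + 1))"
  have LV: "0 < Lip * V + 1" using Lip V by (simp add: add_nonneg_pos)
  have \<delta>: "0 < \<delta>" using e LV by (simp add: \<delta>_def)
  obtain d where d: "d : D" "d : ball x \<delta>" using D(2)[of "ball x \<delta>"] \<delta> by auto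
  have lip: "abs(v j m k x - v j m k d) <= e / 3" for k
  proof -
   have "abs(v j m k x - v j m k d) <= Lip * norm (x - d) * (LL y. abs(w j (r k) y))"
    unfolding v_def by (rule convol_lipschitz[OF w _ B Lip(2)]) auto
   also have "... <= Lip * \<delta> * V" using d wV Lip V \<delta> by (intro mult_mono mult_left_mono) (auto simp: dist_norm)
   also have "... = (Lip * V) * \<delta>" by simp
   also have "... <= (Lip * V + 1) * \<delta>" using \<delta> by (intro mult_right_mono) auto
   also have "... = e / 3"
   proof -
    have "c * (e / (3 * c)) = e / 3" if "c ~= 0" for c :: real using that by simp
    from this[of "Lip * V + 1"] show ?thesis using LV by (simp only: \<delta>_def)
   qed
   finally show ?thesis .
  qed
  have "Cauchy (%k. v j m k d)" using conv_D[OF d(1)] by (rule convergent_Cauchy)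
  then obtain N where N: "!!k l. N <= k ==> N <= l ==> abs(v j m k d - v j m l d) < e / 3"
   using e CauchyD[of "%k. v j m k d" "e / 3"] by auto
  show "EX N. ALL k>=N. ALL l>=N. norm (v j m k x - v j m l x) < e"
  proof (intro exI[of _ N] allI impI)
   fix k l assume "N <= k" "N <= l"
   then show "norm (v j m k x - v j m l x) < e" using lip[of k] lip[of l] N[of k l] by (simp add: abs_if split: if_splits)
  qed
 qed
 define g where "g j m x = lim (%k. v j m k x)" for j m x
 have vg: "(%k. v j m k x) ----> g j m x" for j m x using conv unfolding g_def by (simp add: convergent_LIMSEQ_iff)
 have [measurable]: "g j m : bmeas" for j m unfolding g_def by (rule borel_measurable_lim_metric) measurable
 have gb: "abs(g j m x) <= 1" for j m x by (rule LIMSEQ_le_const2[OF tendsto_rabs[OF vg]]) (use vb in auto)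
 have g0: "g j m x = 0" if "x ~: ball 0 (R + 1)" for j m x 
 proof -
  have "(%k. v j m k x) = (%k. 0)" using v0[OF that] by auto
  then show ?thesis using vg[of j m x] LIMSEQ_unique[OF _ tendsto_const] by metis
 qed
 have vgp: "(%k. NN x. pw p (v j m k x - g j m x)) ----> 0" for j m
 proof -
  have "(%k. NN x. pw p (v j m k x - g j m x)) ----> (\<integral>\<^sup>+x. 0 \<partial>(lborel :: 'a measure))"
  proof (rule nn_integral_dominated_convergence[where w="%x. en (2 powr p) * ind (ball 0 (R + 1)) x"])
   show "AE x in lborel. pw p (v j m k x - g j m x) <= en (2 powr p) * ind (ball 0 (R + 1)) x" for k
   proof (rule AE_I2)
    fix x
    have "abs(v j m k x - g j m x) <= 2" using vb[of j m k x] gb[of j m x] by linarith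
    then have "abs(v j m k x - g j m x) powr p <= 2 powr p" using p by (intro powr_mono2) auto
    then show "pw p (v j m k x - g j m x) <= en (2 powr p) * ind (ball 0 (R + 1)) x"
     using v0[of x j m k] g0[of x j m] by (cases "x : ball 0 (R + 1)") (auto simp: ennreal_leI)
   qed
   show "(\<integral>\<^sup>+x. en (2 powr p) * ind (ball 0 (R + 1)) x \<partial>(lborel :: 'a measure)) < \<infinity>"
    using emeasure_lborel_ball_finite[of "0::'a" "R + 1"] by (subst nn_integral_cmult_indicator) (auto simp: ennreal_mult_less_top)
   show "AE x in lborel. (%k. pw p (v j m k x - g j m x)) ----> 0"
   proof (rule AE_I2)
    fix x
    have "(%k. abs(v j m k x - g j m x)) ----> abs(g j m x - g j m x)" by (intro tendsto_intros vg)
    then have "(%k. abs(v j m k x - g j m x) powr p) ----> 0" using p by (intro tendsto_zero_powrI[where b=p]) auto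
    then show "(%k. pw p (v j m k x - g j m x)) ----> 0" by (metis ennreal_0 tendsto_ennrealI)
   qed
  qed auto
  then show ?thesis by simp
 qed
 \<comment> \<open>Twice \<open>1 - \<eta> j\<close> dominates, for all indices at once, the part of
   a difference of two members of the sequence that the cut-off discards.\<close>
 have etap: "(%j. NN x. en ((2 * (1 - \<eta> j x) * ind Om x) powr p)) ----> 0"
 proof -
  have "(%j. NN x. en ((2 * (1 - \<eta> j x) * ind Om x) powr p)) ----> (\<integral>\<^sup>+x. 0 \<partial>(lborel :: 'a measure))"
  proof (rule nn_integral_dominated_convergence[where w="%x. en (2 powr p) * ind Om x"])
   show "AE x in lborel. en ((2 * (1 - \<eta> j x) * ind Om x) powr p) <= en (2 powr p) * ind Om x" for j
    using p eta[of j] by (intro AE_I2) (auto simp: indicator_def intro!: ennreal_leI powr_mono2)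
   show "(NN x. en (2 powr p) * ind Om x) < \<infinity>"
    by (subst nn_integral_cmult_indicator) (auto simp: V ennreal_mult_less_top)
   show "AE x in lborel. (%j. en ((2 * (1 - \<eta> j x) * ind Om x) powr p)) ----> 0"
   proof (rule AE_I2)
    fix x
    show "(%j. en ((2 * (1 - \<eta> j x) * ind Om x) powr p)) ----> 0"
    proof (cases "x : Om")
     case True
     show ?thesis by (rule tendsto_eventually, rule eventually_mono[OF eta_ev[OF True]]) auto
    qed simp
   qed
  qed auto
  then show ?thesis by simp
 qed
 have cau: "EX N. ALL n>=N. ALL m>=n. (NN x. en (norm (u (r n) x - u (r m) x) powr p)) <= en e" if e: "0 < e" for e
 proof -
  \<comment> \<open>Order of the choices: \<open>j\<close> for the cut-off error, then the scale
    \<open>m\<close> for this \<open>j\<close>, then the index beyond which the mollified functions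
    are close to their limit and \<open>1/2 < s (r k)\<close>.\<close>
  define e' where "e' = e / (5 powr p * 5)"
  have e': "0 < e'" using e by (simp add: e'_def)
  have "\<forall>\<^sub>F j in sequentially. (NN x. en ((2 * (1 - \<eta> j x) * ind Om x) powr p)) < en e'"
   using e' by (intro order_tendstoD(2)[OF etap]) auto
  then obtain j where j: "(NN x. en ((2 * (1 - \<eta> j x) * ind Om x) powr p)) < en e'" by (auto simp: eventually_sequentially)
  have "(%m. ep m powr (p / 2)) ----> 0"
   unfolding ep_def using p by (intro tendsto_zero_powrI[where b="p / 2"] LIMSEQ_Suc[OF lim_1_over_n]) auto
  then have "(%m. K j * ep m powr (p / 2)) ----> K j * 0" by (intro tendsto_mult tendsto_const)
  then have "\<forall>\<^sub>F m in sequentially. K j * ep m powr (p / 2) < e'" using e' by (intro order_tendstoD(2)) auto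
  then obtain m where m: "K j * ep m powr (p / 2) < e'" by (auto simp: eventually_sequentially)
  have "\<forall>\<^sub>F k in sequentially. (NN x. pw p (v j m k x - g j m x)) < en e'"
   using e' by (intro order_tendstoD(2)[OF vgp]) auto
  moreover have "\<forall>\<^sub>F k in sequentially. 1/2 < s (r k)"
   using LIMSEQ_subseq_LIMSEQ[OF s_lim r(1)] by (intro order_tendstoD(1)) (auto simp: o_def)
  ultimately have "\<forall>\<^sub>F k in sequentially. (NN x. pw p (v j m k x - g j m x)) < en e' & 1/2 < s (r k)" by (rule eventually_conj)
  then obtain N where N: "!!k. N <= k ==> (NN x. pw p (v j m k x - g j m x)) < en e'" "!!k. N <= k ==> 1/2 < s (r k)"
   by (auto simp: eventually_sequentially)
  have wv: "(NN x. pw p (v j m k x - w j (r k) x)) <= en e'" if "N <= k" for k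
   using rate[of "r k" "ep m" j] N(2)[OF that] ep[of m] m unfolding v_def by (meson ennreal_leI less_imp_le order_trans)
  show ?thesis
  proof (intro exI[of _ N] allI impI)
   fix k l assume k: "N <= k" and "k <= l"
   then have l: "N <= l" by simp
   let ?a = "%x. pw p (v j m k x - w j (r k) x)" and ?b = "%x. pw p (v j m k x - g j m x)"
   let ?c = "%x. pw p (v j m l x - g j m x)" and ?d = "%x. pw p (v j m l x - w j (r l) x)"
   let ?e = "%x. en ((2 * (1 - \<eta> j x) * ind Om x) powr p)"
   have "(NN x. en (norm (u (r k) x - u (r l) x) powr p))
    <= (NN x. en (5 powr p) * (?a x + ?b x + ?c x + ?d x + ?e x))"
   proof (rule nn_integral_mono)
    fix x
    have "abs(u (r k) x - u (r l) x) <= abs(w j (r k) x - w j (r l) x) + 2 * (1 - \<eta> j x) * ind Om x"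
    proof (cases "x : Om")
     case True
     have "u (r k) x - u (r l) x = (w j (r k) x - w j (r l) x) + (1 - \<eta> j x) * (u (r k) x - u (r l) x)" by (simp add: w_def algebra_simps)
     moreover have "abs(u (r k) x - u (r l) x) <= 2" using ub[of "r k" x] ub[of "r l" x] by linarith
     then have "abs((1 - \<eta> j x) * (u (r k) x - u (r l) x)) <= (1 - \<eta> j x) * 2" unfolding abs_mult using eta(2)[of j x] mult_left_mono[of "abs(u (r k) x - u (r l) x)" 2 "1 - \<eta> j x"] by simp
     ultimately show ?thesis using True by simp
    qed (simp add: u0)
    then have "abs(u (r k) x - u (r l) x) powr p <= (abs(v j m k x - w j (r k) x) + abs(v j m k x - g j m x) + abs(v j m l x - g j m x) + abs(v j m l x - w j (r l) x) + 2 * (1 - \<eta> j x) * ind Om x) powr p"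
     using p by (intro powr_mono2) auto
    also have "... <= 5 powr p * (abs(v j m k x - w j (r k) x) powr p + abs(v j m k x - g j m x) powr p + abs(v j m l x - g j m x) powr p + abs(v j m l x - w j (r l) x) powr p + (2 * (1 - \<eta> j x) * ind Om x) powr p)"
     using p eta(2)[of j x] by (intro powr_add_le5) auto
    finally show "en (norm (u (r k) x - u (r l) x) powr p) <= en (5 powr p) * (?a x + ?b x + ?c x + ?d x + ?e x)"
     by (simp add: ennreal_leI flip: ennreal_plus ennreal_mult)
   qed
   also have "... = en (5 powr p) * ((NN x. ?a x) + (NN x. ?b x) + (NN x. ?c x) + (NN x. ?d x) + (NN x. ?e x))"
    by (simp add: nn_integral_cmult nn_integral_add)
   also have "... <= en (5 powr p) * (en e' + en e' + en e' + en e' + en e')"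
    using wv[OF k] wv[OF l] less_imp_le[OF N(1)[OF k]] less_imp_le[OF N(1)[OF l]] less_imp_le[OF j] by (intro mult_left_mono add_mono) auto
   also have "... = en (5 powr p * (e' + e' + e' + e' + e'))" using e' by (subst ennreal_mult) (auto simp del: ennreal_plus simp flip: ennreal_plus)
   also have "5 powr p * (e' + e' + e' + e' + e') = e" by (simp add: e'_def)
   finally show "(NN x. en (norm (u (r k) x - u (r l) x) powr p)) <= en e" .
  qed
 qed
 have um': "!!n. (%x. u (r n) x) : borel_measurable lborel" by simp
 obtain r' f where r': "strict_mono r'" and fm: "f : borel_measurable lborel" and f: "AE x in lborel. (%i. u (r (r' i)) x) ----> f x"
  using Cauchy_powr_AE_subseq[of "%n. u (r n)" lborel p, OF um' _ cau] p by auto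
 have [measurable]: "f : bmeas" using fm by simp
 \<comment> \<open>Clamping and restricting to \<open>Om\<close> alters the limit only on a null set
   and makes its bound and support hold at every point.\<close>
 define F' where "F' x = ind Om x * max (- 1) (min 1 (f x))" for x
 show thesis
 proof (rule that[of "r \<circ> r'" F'])
  show "strict_mono (r \<circ> r')" using r(1) r' by (rule strict_mono_o)
  show "F' : bmeas" unfolding F'_def by measurable
  show "abs(F' x) <= 1" "x ~: Om ==> F' x = 0" for x by (auto simp: F'_def indicator_def)
  show "AE x in lborel. (%i. u ((r \<circ> r') i) x) ----> F' x"
   using f
  proof (rule AE_mp, intro AE_I2 impI)
   fix x assume "(%i. u (r (r' i)) x) ----> f x"
   then have "(%i. ind Om x * max (- 1) (min 1 (u (r (r' i)) x))) ----> F' x"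
    unfolding F'_def by (intro tendsto_intros)
   moreover have "ind Om x * max (- 1) (min 1 (u k x)) = u k x" for k
    using ub[of k x] u0[of x k] by (auto simp: indicator_def)
   ultimately show "(%i. u ((r \<circ> r') i) x) ----> F' x" by simp
  qed
 qed
qed


subsection \<open>Lipschitz domains\<close>

text \<open>A chart is recorded by the signed vertical height \<open>\<phi>\<close> below the graph, in the direction \<open>E\<close>.\<close>

definition lip_chart :: "'a::euclidean_space set => 'a => real => 'a => ('a => real) => real => bool" where
 "lip_chart Om z R E \<phi> L \<longleftrightarrow> 0 < R & norm E = 1 & 1 <= L & (ALL x y. abs(\<phi> x - \<phi> y) <= L * norm (x - y)) &
  (ALL x t. \<phi> (x + t *\<^sub>R E) = \<phi> x - t) & (ALL x:ball z R. x : Om \<longleftrightarrow> 0 < \<phi> x)"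

text \<open>\<open>E\<close> is the direction that \<open>T\<close> sends to \<open>e_dir\<close>,
  and \<open>\<phi>\<close> is the graph function minus the vertical coordinate. In the constant
  \<open>2 * L + 1\<close> the 2 bounds the horizontal projection and the 1 comes from the vertical
  coordinate.\<close>

lemma lipschitz_domain_chart:
 fixes Om :: "'a::euclidean_space set"
 assumes "lipschitz_domain Om" "z : frontier Om"
 obtains R E \<phi> L where "lip_chart Om z R E \<phi> L"
proof -
 let ?e = "e_dir :: 'a"
 obtain r T g L where r: "0 < r" and T: "orthogonal_transformation T" and g: "L-lipschitz_on UNIV g"
  and eq: "Om \<inter> ball z r = {x : ball z r. T (x - z) \<bullet> ?e < g (T (x - z) - (T (x - z) \<bullet> ?e) *\<^sub>R ?e)}"
  using assms unfolding lipschitz_domain_def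
  by (elim conjE) (drule (1) bspec, elim exE conjE, rule that)
 have lin: "linear T" using T by (simp add: orthogonal_transformation_def)
 obtain E where E: "T E = ?e" using orthogonal_transformation_surj[OF T] by (metis surj_def)
 have nE: "norm E = 1" using orthogonal_transformation_norm[OF T, of E] E norm_e_dir by metis
 have ee: "?e \<bullet> ?e = 1" using norm_e_dir[where ?'a='a] by (simp add: norm_eq_1)
 have L: "0 <= L" using g by (rule lipschitz_on_nonneg)
 define P where "P x = T (x - z) - (T (x - z) \<bullet> ?e) *\<^sub>R ?e" for x
 define \<phi> where "\<phi> x = g (P x) - T (x - z) \<bullet> ?e" for x
 have Td: "T (x - z) - T (y - z) = T (x - y)" for x y by (simp flip: linear_diff[OF lin])
 have inner_le: "abs(T (x - y) \<bullet> ?e) <= norm (x - y)" for x y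
  using Cauchy_Schwarz_ineq2[of "T (x - y)" ?e] by (simp add: orthogonal_transformation_norm[OF T] norm_e_dir)
 have lip: "abs(\<phi> x - \<phi> y) <= (2 * L + 1) * norm (x - y)" for x y
 proof -
  have "P x - P y = T (x - y) - (T (x - y) \<bullet> ?e) *\<^sub>R ?e"
   unfolding Td[of x y, symmetric] by (simp add: P_def inner_diff_left scaleR_diff_left)
  then have "norm (P x - P y) <= norm (T (x - y)) + norm ((T (x - y) \<bullet> ?e) *\<^sub>R ?e)" by (metis norm_triangle_ineq4)
  also have "... <= 2 * norm (x - y)" using inner_le[of x y] by (simp add: orthogonal_transformation_norm[OF T] norm_e_dir)
  finally have "abs(g (P x) - g (P y)) <= L * (2 * norm (x - y))"
   using lipschitz_onD[OF g, of "P x" "P y"] L mult_left_mono[of "norm (P x - P y)" "2 * norm (x - y)" L] by (simp add: dist_norm)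
  moreover have "T (x - z) \<bullet> ?e - T (y - z) \<bullet> ?e = T (x - y) \<bullet> ?e" unfolding Td[of x y, symmetric] by (simp add: inner_diff_left)
  ultimately show ?thesis using inner_le[of x y] unfolding \<phi>_def by (simp add: algebra_simps)
 qed
 have shift: "\<phi> (x + t *\<^sub>R E) = \<phi> x - t" for x t
 proof -
  have "T (x + t *\<^sub>R E - z) = T (x - z) + t *\<^sub>R ?e"
   by (simp add: linear_add[OF lin] linear_diff[OF lin] linear_cmul[OF lin] E)
  then show ?thesis by (simp add: \<phi>_def P_def inner_add_left ee algebra_simps)
 qed
 have "lip_chart Om z r E \<phi> (2 * L + 1)"
  unfolding lip_chart_def using r nE L lip shift eq by (auto simp: \<phi>_def P_def)
 then show thesis by (rule that)
qed

lemma lip_chart_continuous: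
 assumes "lip_chart Om z R E \<phi> L"
 shows "continuous_on UNIV \<phi>"
proof -
 have "L-lipschitz_on UNIV \<phi>"
  using assms unfolding lip_chart_def by (intro lipschitz_onI) (auto simp: dist_norm)
 then show ?thesis by (rule lipschitz_on_continuous_on)
qed

lemma lip_chart_borel: "lip_chart Om z R E \<phi> L ==> \<phi> : bmeas"
 by (intro borel_measurable_continuous_onI lip_chart_continuous)

lemma lip_chart_frontier:
 assumes c: "lip_chart Om z R E \<phi> L" and O: "open Om" and y: "y : frontier Om" "y : ball z R"
 shows "\<phi> y = 0"
proof (rule ccontr)
 assume "\<phi> y ~= 0"
 moreover have "y ~: Om" using y O by (simp add: frontier_def interior_open)
 then have "~  0 < \<phi> y" using c y unfolding lip_chart_def by blast
 ultimately have "\<phi> y < 0" by simp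
 then have yO: "y : {x. \<phi> x < 0} \<inter> ball z R" using y by auto
 have "open {x. \<phi> x < 0}" using lip_chart_continuous[OF c] by (intro open_Collect_less continuous_on_const) auto
 then have "open ({x. \<phi> x < 0} \<inter> ball z R)" by auto
 moreover have "({x. \<phi> x < 0} \<inter> ball z R) \<inter> Om = {}" using c unfolding lip_chart_def by force
 ultimately have "({x. \<phi> x < 0} \<inter> ball z R) \<inter> closure Om = {}" by (simp add: open_Int_closure_eq_empty)
 then show False using yO y(1) by (auto simp: frontier_def)
qed

text \<open>Along \<open>E\<close> the height drops at unit rate, so each line in that direction
  spends length 1 in the slab with \<open>\<phi>\<close> between 0 and 1. Inserting this length and
  exchanging integrals slices the space into lines without choosing coordinates.\<close>

lemma fiber_integral:
 fixes \<phi> :: "'a::euclidean_space => real" and f :: "'a => ennreal"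
 assumes [measurable]: "\<phi> : bmeas" "f : bmeas" and sh: "!!x t. \<phi> (x + t *\<^sub>R E) = \<phi> x - t"
 shows "(NN x. f x) = (NN x. ind {0..1} (\<phi> x) * (NN t. f (x + t *\<^sub>R E)))"
proof -
 let ?I = "ind {0..1::real} :: real => ennreal"
 have one: "(NN t. ?I (c - t)) = 1" for c
  by (subst nn_integral_reflect) auto
 have "(NN x. f x) = (NN x. (NN t. f x * ?I (\<phi> (x + t *\<^sub>R E))))"
  by (intro nn_integral_cong) (subst nn_integral_cmult, auto simp: sh one)
 also have "... = (NN t. (NN x. f x * ?I (\<phi> (x + t *\<^sub>R E))))"
  by (rule lborel_pair.Fubini') measurable
 also have "... = (NN t. (NN x. f (x - t *\<^sub>R E) * ?I (\<phi> x)))"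
 proof (rule nn_integral_cong)
  fix t :: real
  show "(NN x. f x * ?I (\<phi> (x + t *\<^sub>R E))) = (NN x. f (x - t *\<^sub>R E) * ?I (\<phi> x))"
   using nn_integral_translate[of "%x. f (x - t *\<^sub>R E) * ?I (\<phi> x)" "t *\<^sub>R E"] by simp
 qed
 also have "... = (NN x. (NN t. f (x - t *\<^sub>R E) * ?I (\<phi> x)))"
  by (rule lborel_pair.Fubini') measurable
 also have "... = (NN x. ?I (\<phi> x) * (NN t. f (x + t *\<^sub>R E)))"
 proof (rule nn_integral_cong)
  fix x
  have "(NN t. f (x + (0 - t) *\<^sub>R E)) = (NN t. f (x + t *\<^sub>R E))"
   by (rule nn_integral_reflect) measurable
  then show "(NN t. f (x - t *\<^sub>R E) * ?I (\<phi> x)) = ?I (\<phi> x) * (NN t. f (x + t *\<^sub>R E))"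
   by (subst nn_integral_multc) (auto simp: mult.commute)
 qed
 finally show ?thesis .
qed

text \<open>On each line in direction \<open>E\<close> the map acts as the reflection of
  \<open>t\<close> to \<open>2 * \<phi> x - t\<close>, so no Jacobian of \<open>\<phi>\<close>
  appears.\<close>

lemma nn_integral_graph_reflection:
 fixes \<phi> :: "'a::euclidean_space => real" and f :: "'a => ennreal"
 assumes phm [measurable]: "\<phi> : bmeas" and fm [measurable]: "f : bmeas" and sh: "!!x t. \<phi> (x + t *\<^sub>R E) = \<phi> x - t"
 shows "(NN x. f (x + (2 * \<phi> x) *\<^sub>R E)) = (NN x. f x)"
proof -
 have inner: "(NN t. f (x + t *\<^sub>R E + (2 * \<phi> (x + t *\<^sub>R E)) *\<^sub>R E)) = (NN t. f (x + t *\<^sub>R E))" for x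
 proof -
  have "(NN t. f (x + (2 * \<phi> x - t) *\<^sub>R E)) = (NN t. f (x + t *\<^sub>R E))"
   by (rule nn_integral_reflect) measurable
  moreover have "x + t *\<^sub>R E + (2 * \<phi> (x + t *\<^sub>R E)) *\<^sub>R E = x + (2 * \<phi> x - t) *\<^sub>R E" for t
   by (simp add: sh algebra_simps scaleR_2 flip: scaleR_add_left)
  ultimately show ?thesis by (simp only:)
 qed
 have "(NN x. f (x + (2 * \<phi> x) *\<^sub>R E))
  = (NN x. ind {0..1} (\<phi> x) * (NN t. f (x + t *\<^sub>R E + (2 * \<phi> (x + t *\<^sub>R E)) *\<^sub>R E)))"
  by (rule fiber_integral[OF phm _ sh]) measurable
 also have "... = (NN x. f x)" unfolding inner by (rule fiber_integral[OF phm fm sh, symmetric])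
 finally show ?thesis .
qed

text \<open>Each line in direction \<open>E\<close> meets the graph in a single point.\<close>

lemma AE_graph:
 fixes \<phi> :: "'a::euclidean_space => real"
 assumes phm [measurable]: "\<phi> : bmeas" and sh: "!!x t. \<phi> (x + t *\<^sub>R E) = \<phi> x - t"
 shows "AE x in lborel. \<phi> x ~= 0"
proof -
 let ?f = "%x. ind {0} (\<phi> x) :: ennreal"
 have "(NN x. ?f x) = (NN x. ind {0..1} (\<phi> x) * (NN t. ?f (x + t *\<^sub>R E)))"
  by (rule fiber_integral[OF phm _ sh]) measurable
 also have "(%x. NN t. ?f (x + t *\<^sub>R E)) = (%x. 0)"
 proof
  fix x
  have "?f (x + t *\<^sub>R E) = ind {\<phi> x} t" for t by (auto simp: sh indicator_def)
  then show "(NN t. ?f (x + t *\<^sub>R E)) = 0" by simp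
 qed
 finally have "(NN x. ?f x) = 0" by simp
 then have "AE x in lborel. ?f x = 0" by (subst (asm) nn_integral_0_iff_AE) auto
 then show ?thesis by (rule AE_mp) (auto simp: indicator_def intro!: AE_I2)
qed

lemma lipschitz_domain_frontier_null:
 fixes Om :: "'a::euclidean_space set"
 assumes l: "lipschitz_domain Om"
 shows "AE x in lborel. x ~: frontier Om"
proof -
 have O: "open Om" "bounded Om" using l by (auto simp: lipschitz_domain_def)
 have "EX R>0. AE x in lborel. x : frontier Om --> x ~: ball z R" if z: "z : frontier Om" for z
 proof -
  obtain R E \<phi> L where c: "lip_chart Om z R E \<phi> L" using lipschitz_domain_chart[OF l z] by blast
  have "AE x in lborel. \<phi> x ~= 0" using c by (intro AE_graph lip_chart_borel) (auto simp: lip_chart_def)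
  then have "AE x in lborel. x : frontier Om --> x ~: ball z R"
   by (rule AE_mp) (use lip_chart_frontier[OF c O(1)] in \<open>auto intro!: AE_I2\<close>)
  then show ?thesis using c by (auto simp: lip_chart_def)
 qed
 then obtain R where R: "!!z. z : frontier Om ==> 0 < R z" "!!z. z : frontier Om ==> AE x in lborel. x : frontier Om --> x ~: ball z (R z)"
  by metis
 have cF: "compact (frontier Om)" using O(2) by (rule compact_frontier_bounded)
 have cov: "frontier Om \<subseteq> (\<Union>z\<in>frontier Om. ball z (R z))" using R(1) by force
 obtain Z where Z: "Z \<subseteq> frontier Om" "finite Z" "frontier Om \<subseteq> (\<Union>z\<in>Z. ball z (R z))"
  using compactE_image[OF cF open_ball cov] by blast
 have "AE x in lborel. ALL z:Z. x : frontier Om --> x ~: ball z (R z)"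
  using Z R(2) by (subst AE_finite_all) auto
 then show ?thesis by (rule AE_mp) (use Z(3) in \<open>auto intro!: AE_I2\<close>)
qed

lemma nonlocal_double_integral:
 fixes u k :: "'a::euclidean_space => real"
 assumes [measurable]: "u : bmeas" "k : bmeas" "A : sets borel" "B : sets borel"
 shows "(NN h. en (k h) * (NN x. pw p (u (x + h) - u x) * ind A x * ind B (x + h)))
  = (NN x. (NN y. en (k (y - x)) * pw p (u y - u x) * ind A x * ind B y))"
proof -
 have "(NN h. en (k h) * (NN x. pw p (u (x + h) - u x) * ind A x * ind B (x + h)))
  = (NN h. (NN x. en (k h) * (pw p (u (x + h) - u x) * ind A x * ind B (x + h))))"
  by (intro nn_integral_cong nn_integral_cmult[symmetric]) measurable
 also have "... = (NN x. (NN h. en (k h) * (pw p (u (x + h) - u x) * ind A x * ind B (x + h))))"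
  by (rule lborel_pair.Fubini') measurable
 also have "... = (NN x. (NN y. en (k (y - x)) * pw p (u y - u x) * ind A x * ind B y))"
 proof (rule nn_integral_cong)
  fix x
  show "(NN h. en (k h) * (pw p (u (x + h) - u x) * ind A x * ind B (x + h)))
   = (NN y. en (k (y - x)) * pw p (u y - u x) * ind A x * ind B y)"
   using nn_integral_translate[of "%y. en (k (y - x)) * pw p (u y - u x) * ind A x * ind B y" x]
   by (simp add: add.commute mult.assoc)
 qed
 finally show ?thesis .
qed

lemma energy_double_integral:
 fixes u k :: "'a::euclidean_space => real"
 assumes "u : bmeas" "k : bmeas" "B : sets borel"
 shows "energy p k B u = (NN x. (NN y. en (k (y - x)) * pw p (u y - u x) * ind B x * ind B y))"
 unfolding energy_def trd_def by (rule nonlocal_double_integral[OF assms assms(3)])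

lemma nn_integral_inner_powr_le:
 fixes G :: "'a::euclidean_space => 'a"
 assumes [measurable]: "G : bmeas" "U : sets borel" and p: "0 <= p"
  and I: "(NN x. en (norm (G x) powr p) * ind U x) <= en I" "0 <= I"
 shows "(NN x. pw p (G x \<bullet> h) * ind U x) <= en (I * norm h powr p)"
proof -
 have "(NN x. pw p (G x \<bullet> h) * ind U x) <= (NN x. en (norm h powr p) * (en (norm (G x) powr p) * ind U x))"
 proof (rule nn_integral_mono)
  fix x
  have "abs(G x \<bullet> h) powr p <= (norm (G x) * norm h) powr p" using p by (intro powr_mono2 Cauchy_Schwarz_ineq2) auto
  also have "... = norm h powr p * norm (G x) powr p" by (simp add: powr_mult mult.commute)
  finally show "pw p (G x \<bullet> h) * ind U x <= en (norm h powr p) * (en (norm (G x) powr p) * ind U x)"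
   by (cases "x : U") (auto simp: ennreal_leI simp flip: ennreal_mult)
 qed
 also have "... = en (norm h powr p) * (NN x. en (norm (G x) powr p) * ind U x)" by (rule nn_integral_cmult) measurable
 also have "... <= en (norm h powr p) * en I" by (intro mult_left_mono I) auto
 also have "... = en (I * norm h powr p)" using I by (simp add: mult.commute flip: ennreal_mult)
 finally show ?thesis .
qed

locale sobolev_fun =
 fixes p :: real and Om :: "'a::euclidean_space set" and u :: "'a => real" and G :: "'a => 'a" and I :: real
 assumes p: "1 <= p" and open_dom: "open Om" and bounded_dom: "bounded Om"
  and u_borel [measurable]: "u : bmeas" and u_le: "!!x. abs(u x) <= 1" and u_zero: "!!x. x ~: Om ==> u x = 0"
  and G_borel [measurable]: "G : bmeas" and G_int: "!!b. b : Basis ==> integrable lborel (%x. G x \<bullet> b)"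
  and wgrad: "wgrad Om u G" and I: "(NN x. en (norm (G x) powr p) * ind Om x) <= en I" "0 <= I"
begin

lemma dom_borel [measurable]: "Om : sets borel" using open_dom by auto

lemma u_int: "integrable lborel u" by (rule integrable_bounded_support[OF u_borel u_le bounded_dom u_zero])

lemma u_Lp: "(NN x. pw p (u x)) < \<infinity>"
proof -
 have "(NN x. pw p (u x)) <= (NN x. ind Om x)"
  using p u_le u_zero by (intro nn_integral_mono) (auto simp: indicator_def intro!: powr_le1)
 also have "... < \<infinity>" using emeasure_lborel_bounded[OF bounded_dom] by simp
 finally show ?thesis .
qed

lemma shift_estimate:
 assumes A [measurable]: "A : sets borel" and seg: "!!x t. x : A ==> 0 <= t ==> t <= 1 ==> x + t *\<^sub>R h : Om"
 shows "(NN x. pw p (u (x + h) - u x) * ind A x) <= en (I * norm h powr p)"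
proof -
 have "(NN x. pw p (u (x + h) - u x) * ind A x) <= (NN x. pw p (G x \<bullet> h) * ind Om x)"
  by (rule translation_estimate[OF p wgrad u_int u_Lp G_borel G_int A open_dom seg])
 also have "... <= en (I * norm h powr p)" using p by (intro nn_integral_inner_powr_le I) auto
 finally show ?thesis .
qed

lemma AT_interior:
 assumes "ball z r \<subseteq> Om"
 shows "AT p (ball z r) u"
proof (rule AT_of_trd[of p I])
 fix h :: 'a
 let ?A = "{x. x : ball z r & x + h : ball z r}"
 have [measurable]: "?A : sets borel" by (simp add: dist_norm)
 have "trd p (ball z r) u h = (NN x. pw p (u (x + h) - u x) * ind ?A x)"
  unfolding trd_def by (intro nn_integral_cong) (auto simp: indicator_def)
 also have "... <= en (I * norm h powr p)"
 proof (rule shift_estimate)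
  fix x and t :: real assume x: "x : ?A" and t: "0 <= t" "t <= 1"
  have "(1 - t) *\<^sub>R x + t *\<^sub>R (x + h) : ball z r" using x t convexD[OF convex_ball[of z r], of x "x + h" "1 - t" t] by auto
  then show "x + t *\<^sub>R h : Om" using assms by (auto simp: algebra_simps)
 qed measurable
 finally show "trd p (ball z r) u h <= en (I * norm h powr p)" .
qed (use p I in auto)

text \<open>The segment between two points below the graph may leave the domain, so the increment
  takes a detour: shift by \<open>\<tau> = L * norm h\<close> along \<open>- E\<close> into the
  domain, translate by \<open>h\<close> there, and shift back. Since \<open>\<phi>\<close> changes
  by at most \<open>\<tau>\<close> along the translation, the shifted segment stays inside. For
  \<open>norm h < 2 * r\<close> the condition \<open>r * (1 + 2 * L) <= R\<close> keeps the detour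
  in the chart, and for larger \<open>h\<close> no pair is left.\<close>

lemma AT_boundary:
 assumes c: "lip_chart Om z R E \<phi> L" and r: "0 < r" "r * (1 + 2 * L) <= R"
 shows "AT p (Om \<inter> ball z r) u"
proof (rule AT_of_trd[of p "3 powr p * (2 * L powr p + 1) * I"])
 have E: "norm E = 1" and L: "1 <= L" and lip: "!!x y. abs(\<phi> x - \<phi> y) <= L * norm (x - y)"
  and sh: "!!x t. \<phi> (x + t *\<^sub>R E) = \<phi> x - t" and dom: "!!x. x : ball z R ==> x : Om \<longleftrightarrow> 0 < \<phi> x"
  using c unfolding lip_chart_def by auto
 let ?D = "Om \<inter> ball z r"
 show "0 <= 3 powr p * (2 * L powr p + 1) * I" using I by simp
 fix h :: 'a
 define A where "A = {x. x : ?D & x + h : ?D}"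
 have [measurable]: "A : sets borel" unfolding A_def by measurable
 have tA: "trd p ?D u h = (NN x. pw p (u (x + h) - u x) * ind A x)"
  unfolding trd_def by (intro nn_integral_cong) (auto simp: indicator_def A_def)
 show "trd p ?D u h <= en (3 powr p * (2 * L powr p + 1) * I * norm h powr p)"
 proof (cases "norm h < 2 * r")
  case False
  have "A = {}"
  proof (rule ccontr)
   assume "A ~= {}"
   then obtain x where "dist z x < r" "dist z (x + h) < r" by (auto simp: A_def)
   then have "dist x (x + h) < r + r" using dist_triangle[of x "x + h" z] by (simp add: dist_commute)
   then show False using False by (simp add: dist_norm)
  qed
  then show ?thesis unfolding tA by simp
 next
  case True
  define \<tau> where "\<tau> = L * norm h"
  have \<tau>: "0 <= \<tau>" using L by (simp add: \<tau>_def)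
  have rR: "r + \<tau> < R \<or> h = 0"
  proof (cases "h = 0")
   case False
   have "\<tau> < L * (2 * r)" unfolding \<tau>_def using True L by (intro mult_strict_left_mono) auto
   then show ?thesis using r by (simp add: algebra_simps)
  qed simp
  show ?thesis
  proof (cases "h = 0")
   case True
   then show ?thesis unfolding tA by simp
  next
   case False
   then have rR: "r + \<tau> < R" using rR by simp
   let ?v = "- \<tau> *\<^sub>R E"
   have nv: "norm ?v = \<tau>" using E \<tau> by simp
   have up: "x + t *\<^sub>R ?v : Om" if x: "x : ?D" and t: "0 <= t" "t <= 1" for x t
   proof -
    have "norm (t *\<^sub>R ?v) <= \<tau>" using t \<tau> E mult_right_mono[of t 1 \<tau>] by simp
    then have "x + t *\<^sub>R ?v : ball z R" using x rR norm_triangle_ineq[of "x - z" "t *\<^sub>R ?v"] by (simp add: dist_norm norm_minus_commute algebra_simps)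
    moreover have "x : ball z R" using x rR \<tau> by auto
    then have "0 < \<phi> x" using x dom by auto
    then have "0 < \<phi> (x + t *\<^sub>R ?v)" using sh[of x "- (t * \<tau>)"] t \<tau> by (simp add: add_pos_nonneg)
    ultimately show ?thesis using dom by blast
   qed
   have t1: "(NN x. pw p (u (x + ?v) - u x) * ind A x) <= en (I * \<tau> powr p)"
    using shift_estimate[of A ?v] up nv by (auto simp: A_def)
   let ?A2 = "{y. y - ?v : A}" and ?A3 = "{y. y - h : A}"
   have [measurable]: "?A2 : sets borel" "?A3 : sets borel" by measurable
   have "(NN x. pw p (u (x + ?v + h) - u (x + ?v)) * ind A x) = (NN y. pw p (u (y + h) - u y) * ind ?A2 y)"
    using nn_integral_translate[of "%y. pw p (u (y + h) - u y) * ind ?A2 y" ?v] by (simp add: indicator_def)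
   also have "... <= en (I * norm h powr p)"
   proof (rule shift_estimate)
    fix y and t :: real assume y: "y : ?A2" and t: "0 <= t" "t <= 1"
    define x where "x = y - ?v"
    have x: "x : ?D" "x + h : ?D" using y by (auto simp: x_def A_def)
    have yx: "y + t *\<^sub>R h = (x + t *\<^sub>R h) + (- \<tau>) *\<^sub>R E" by (simp add: x_def algebra_simps)
    have "(1 - t) *\<^sub>R x + t *\<^sub>R (x + h) : ball z r" using x t convexD[OF convex_ball[of z r], of x "x + h" "1 - t" t] by auto
    then have "x + t *\<^sub>R h : ball z r" by (simp add: algebra_simps)
    then have "(x + t *\<^sub>R h) + (- \<tau>) *\<^sub>R E : ball z R"
     using rR \<tau> E norm_triangle_ineq[of "x + t *\<^sub>R h - z" "(- \<tau>) *\<^sub>R E"] by (simp add: dist_norm norm_minus_commute algebra_simps)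
    moreover have "0 < \<phi> ((x + t *\<^sub>R h) + (- \<tau>) *\<^sub>R E)"
    proof -
    have "0 < \<phi> x" using x dom[of x] rR \<tau> by auto
    have "abs(\<phi> (x + t *\<^sub>R h) - \<phi> x) <= L * (t * norm h)" using lip[of "x + t *\<^sub>R h" x] t by simp
    also have "... <= \<tau>" unfolding \<tau>_def using t L mult_right_mono[of t 1 "norm h"] by (intro mult_left_mono) auto
    finally show ?thesis using \<open>0 < \<phi> x\<close> unfolding sh by linarith
    qed
    ultimately show "y + t *\<^sub>R h : Om" unfolding yx using dom by blast
   qed measurable
   finally have t2: "(NN x. pw p (u (x + ?v + h) - u (x + ?v)) * ind A x) <= en (I * norm h powr p)" .
   have "(NN x. pw p (u (x + h + ?v) - u (x + h)) * ind A x) = (NN y. pw p (u (y + ?v) - u y) * ind ?A3 y)"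
    using nn_integral_translate[of "%y. pw p (u (y + ?v) - u y) * ind ?A3 y" h] by (simp add: indicator_def)
   also have "... <= en (I * \<tau> powr p)" using shift_estimate[of ?A3 ?v] up nv by (auto simp: A_def)
   finally have t3: "(NN x. pw p (u (x + h + ?v) - u (x + h)) * ind A x) <= en (I * \<tau> powr p)" .
   let ?a = "%x. pw p (u (x + ?v) - u x) * ind A x"
   let ?b = "%x. pw p (u (x + ?v + h) - u (x + ?v)) * ind A x"
   let ?c = "%x. pw p (u (x + h + ?v) - u (x + h)) * ind A x"
   have "trd p ?D u h <= (NN x. en (3 powr p) * (?a x + ?b x + ?c x))"
    unfolding tA
   proof (rule nn_integral_mono)
    fix x
    have comm: "x + ?v + h = x + h + ?v" by simp
    have "abs(u (x + h) - u x) powr p <= (abs(u (x + ?v) - u x) + abs(u (x + ?v + h) - u (x + ?v)) + abs(u (x + h + ?v) - u (x + h))) powr p"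
     unfolding comm using p by (intro powr_mono2) auto
    also have "... <= 3 powr p * (abs(u (x + ?v) - u x) powr p + abs(u (x + ?v + h) - u (x + ?v)) powr p + abs(u (x + h + ?v) - u (x + h)) powr p)"
     using p by (intro powr_add_le3) auto
    finally have "pw p (u (x + h) - u x) <= en (3 powr p) * (pw p (u (x + ?v) - u x) + pw p (u (x + ?v + h) - u (x + ?v)) + pw p (u (x + h + ?v) - u (x + h)))"
     by (simp add: ennreal_leI flip: ennreal_plus ennreal_mult)
    from mult_right_mono[OF this zero_le, of "ind A x"]
    show "pw p (u (x + h) - u x) * ind A x <= en (3 powr p) * (?a x + ?b x + ?c x)"
     by (simp only: distrib_right mult.assoc)
   qed
   also have "... = en (3 powr p) * ((NN x. ?a x) + (NN x. ?b x) + (NN x. ?c x))"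
    by (simp add: nn_integral_cmult nn_integral_add)
   also have "... <= en (3 powr p) * (en (I * \<tau> powr p) + en (I * norm h powr p) + en (I * \<tau> powr p))"
    by (intro mult_left_mono add_mono t1 t2 t3) auto
   also have "... = en (3 powr p * (I * \<tau> powr p + I * norm h powr p + I * \<tau> powr p))"
    using I by (subst ennreal_mult) (auto simp del: ennreal_plus simp flip: ennreal_plus)
   also have "3 powr p * (I * \<tau> powr p + I * norm h powr p + I * \<tau> powr p) = 3 powr p * (2 * L powr p + 1) * I * norm h powr p"
    using L by (simp add: \<tau>_def powr_mult algebra_simps)
   finally show ?thesis .
  qed
 qed
qed (use p in auto)

end


section \<open>Extension from a Lipschitz domain to the whole space\<close>

definition cutoff :: "'a::euclidean_space => real => 'a => real" where
 "cutoff z r x = max 0 (min 1 (2 - 2 / r * dist x z))"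

lemma cutoff_borel [measurable]: "cutoff z r : bmeas"
 unfolding cutoff_def[abs_def] by measurable

lemma cutoff_bounds: "0 <= cutoff z r x" "cutoff z r x <= 1"
 by (auto simp: cutoff_def)

lemma cutoff_eq_1: "0 < r ==> x : ball z (r / 2) ==> cutoff z r x = 1"
 by (auto simp: cutoff_def dist_commute field_simps)

lemma cutoff_eq_0: "0 < r ==> x ~: ball z r ==> cutoff z r x = 0"
 by (auto simp: cutoff_def dist_commute field_simps max_def min_def)

lemma cutoff_lipschitz:
 assumes "0 < r"
 shows "abs(cutoff z r x - cutoff z r y) <= 2 / r * norm (x - y)"
proof -
 have "abs(cutoff z r x - cutoff z r y) <= abs(2 / r * dist y z - 2 / r * dist x z)" by (auto simp: cutoff_def)
 also have "... = 2 / r * abs(dist y z - dist x z)" unfolding right_diff_distrib[symmetric] abs_mult using assms by simp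
 also have "... <= 2 / r * norm (x - y)"
  using assms dist_triangle[of y z x] dist_triangle[of x z y] by (intro mult_left_mono) (auto simp: dist_norm norm_minus_commute)
 finally show ?thesis .
qed

context sobolev_fun
begin

text \<open>The folding map \<open>st\<close> sends a neighbourhood of \<open>z\<close> into the
  domain and is Lipschitz with constant \<open>K\<close>, so pairs closer than \<open>t\<close> go
  to pairs closer than \<open>K * t\<close>. Each point is either kept or reflected, which gives
  four combinations for a pair; by measure preservation every one of them contributes the same
  energy of \<open>u\<close>.\<close>

lemma local_extension_boundary:
 assumes c: "lip_chart Om z R E \<phi> L" and z: "z : frontier Om"
 obtains r v where "0 < r" "v : bmeas" "!!x. abs(v x) <= 1"
  "!!x. x : Om ==> x : ball z r ==> v x = u x" "AT p (ball z r) v"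
proof -
 have R: "0 < R" and E: "norm E = 1" and L: "1 <= L" and lip: "!!x y. abs(\<phi> x - \<phi> y) <= L * norm (x - y)"
  and sh: "!!x t. \<phi> (x + t *\<^sub>R E) = \<phi> x - t" and dom: "!!x. x : ball z R ==> x : Om \<longleftrightarrow> 0 < \<phi> x"
  using c unfolding lip_chart_def by auto
 have phm [measurable]: "\<phi> : bmeas" by (rule lip_chart_borel[OF c])
 have z0: "\<phi> z = 0" using lip_chart_frontier[OF c open_dom z] R by simp
 define K where "K = 1 + 2 * L"
 have K: "1 <= K" "0 < K" using L by (auto simp: K_def)
 \<comment> \<open>One division by \<open>K\<close> makes \<open>AT_boundary\<close> applicable on
   \<open>ball z r1\<close>; the second, in \<open>r\<close>, ensures that reflected points of
   \<open>ball z r\<close> remain in \<open>ball z r1\<close>.\<close>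
 define r1 where "r1 = R / K"
 have "r1 * K = R" using K by (simp add: r1_def)
 then have r1b: "r1 * (1 + 2 * L) <= R" unfolding K_def by simp
 have "0 < r1" "r1 <= R" using R K by (auto simp: r1_def field_simps)
 note r1 = this(1) r1b this(2)
 define r where "r = r1 / K"
 have r: "0 < r" "r * K = r1" "r <= r1" using r1 K by (auto simp: r_def field_simps)
 define D where "D = Om \<inter> ball z r1"
 have [measurable]: "D : sets borel" unfolding D_def by measurable
 obtain C where C: "0 <= C" "!!t. 0 < t ==> energy p (ind (ball 0 t)) D u <= en (C * t powr (real DIM('a) + p))"
  using AT_boundary[OF c r1(1,2)] unfolding AT_def D_def by auto
 define \<rho> where "\<rho> x = x + (2 * \<phi> x) *\<^sub>R E" for x
 have [measurable]: "\<rho> : bmeas" unfolding \<rho>_def by measurable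
 have refl: "(NN x. f (\<rho> x)) = (NN x. f x)" if "f : bmeas" for f
  unfolding \<rho>_def by (rule nn_integral_graph_reflection[OF phm that sh])
 have phr: "\<phi> (\<rho> x) = - \<phi> x" for x unfolding \<rho>_def sh by simp
 define st where "st x = (if 0 < \<phi> x then x else \<rho> x)" for x
 define v where "v x = u (st x)" for x
 have [measurable]: "st : bmeas" unfolding st_def by measurable
 have vm [measurable]: "v : bmeas" unfolding v_def by measurable
 have near: "norm (\<rho> x - y) <= norm (x - y) + 2 * abs(\<phi> x)" for x y
 proof -
  have e: "\<rho> x - y = (x - y) + (2 * \<phi> x) *\<^sub>R E" by (simp add: \<rho>_def)
  show ?thesis unfolding e using norm_triangle_ineq[of "x - y" "(2 * \<phi> x) *\<^sub>R E"] E by (simp add: abs_mult)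
 qed
 have stD: "st x : D" if x: "x : ball z r" "\<phi> x ~= 0" for x
 proof -
  have "abs(\<phi> x) <= L * norm (x - z)" using lip[of x z] z0 by simp
  then have "norm (st x - z) <= norm (x - z) + 2 * (L * norm (x - z))" using near[of x z] L by (auto simp: st_def)
  also have "... = K * norm (x - z)" by (simp add: K_def algebra_simps)
  also have "... < K * r" using x K by (intro mult_strict_left_mono) (auto simp: dist_norm norm_minus_commute)
  finally have "st x : ball z r1" using r(2) by (simp add: dist_norm norm_minus_commute mult.commute)
  moreover have "0 < \<phi> (st x)" using x(2) phr[of x] by (auto simp: st_def)
  ultimately show ?thesis using dom[of "st x"] r1(3) by (auto simp: D_def)
 qed
 have stlip: "norm (st y - st x) <= K * norm (y - x)" for x y
 proof -
  have d: "abs(\<phi> y - \<phi> x) <= L * norm (y - x)" by (rule lip)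
  have KL: "K * norm (y - x) = norm (y - x) + 2 * (L * norm (y - x))" by (simp add: K_def algebra_simps)
  have nn: "0 <= L * norm (y - x)" using L by simp
  consider "0 < \<phi> x" "0 < \<phi> y" | "0 < \<phi> x" "\<phi> y <= 0" | "\<phi> x <= 0" "0 < \<phi> y" | "\<phi> x <= 0" "\<phi> y <= 0" by linarith
  then show ?thesis
  proof cases
   case 1
   then show ?thesis using nn unfolding KL by (simp add: st_def)
  next
   case 2
   then show ?thesis using near[of y x] d unfolding KL by (simp add: st_def)
  next
   case 3
   then show ?thesis using near[of x y] d unfolding KL by (simp add: st_def norm_minus_commute)
  next
   case 4
   have e: "\<rho> y - \<rho> x = (y - x) + (2 * (\<phi> y - \<phi> x)) *\<^sub>R E" by (simp add: \<rho>_def algebra_simps)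
   have "norm ((2 * (\<phi> y - \<phi> x)) *\<^sub>R E) = 2 * abs(\<phi> y - \<phi> x)" unfolding norm_scaleR E abs_mult by simp
   then have "norm (\<rho> y - \<rho> x) <= norm (y - x) + 2 * abs(\<phi> y - \<phi> x)"
    unfolding e using norm_triangle_ineq[of "y - x" "(2 * (\<phi> y - \<phi> x)) *\<^sub>R E"] by (simp only:)
   then show ?thesis using d 4 unfolding KL by (simp add: st_def)
  qed
 qed
 have ae: "AE x in lborel. \<phi> x ~= 0" by (rule AE_graph[OF phm sh])
 have "energy p (ind (ball 0 t)) (ball z r) v <= en (4 * C * K powr (real DIM('a) + p) * t powr (real DIM('a) + p))" if t: "0 < t" for t
 proof -
  define F where "F x y = en (ind (ball 0 (K * t)) (y - x)) * pw p (u y - u x) * ind D x * ind D y" for x y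
  have Fm [measurable]: "(%z. F (fst z) (snd z)) : borel_measurable (borel \<Otimes>\<^sub>M borel)" unfolding F_def by measurable
  have FF [measurable (raw)]: "(%q. F (f q) (g q)) : borel_measurable M" if "f : borel_measurable M" "g : borel_measurable M" for f g and M :: "'c measure"
   using measurable_compose[OF measurable_Pair[OF that] Fm] by simp
  define J where "J = (NN x. (NN y. F x y))"
  have J: "J = energy p (ind (ball 0 (K * t))) D u"
   unfolding J_def F_def by (rule energy_double_integral[symmetric]) measurable
  have "energy p (ind (ball 0 t)) (ball z r) v
   = (NN x. (NN y. en (ind (ball 0 t) (y - x)) * pw p (v y - v x) * ind (ball z r) x * ind (ball z r) y))"
   by (rule energy_double_integral) measurable
  also have "... <= (NN x. (NN y. F x y + F (\<rho> x) y + F x (\<rho> y) + F (\<rho> x) (\<rho> y)))"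
  proof (rule nn_integral_mono_AE, use ae in \<open>rule AE_mp\<close>, intro AE_I2 impI)
   fix x assume x0: "\<phi> x ~= 0"
   show "(NN y. en (ind (ball 0 t) (y - x)) * pw p (v y - v x) * ind (ball z r) x * ind (ball z r) y)
    <= (NN y. F x y + F (\<rho> x) y + F x (\<rho> y) + F (\<rho> x) (\<rho> y))"
   proof (rule nn_integral_mono_AE, use ae in \<open>rule AE_mp\<close>, intro AE_I2 impI)
    fix y assume y0: "\<phi> y ~= 0"
    show "en (ind (ball 0 t) (y - x)) * pw p (v y - v x) * ind (ball z r) x * ind (ball z r) y
     <= F x y + F (\<rho> x) y + F x (\<rho> y) + F (\<rho> x) (\<rho> y)"
    proof (cases "x : ball z r & y : ball z r & norm (y - x) < t")
     case True
     have "norm (st y - st x) <= K * norm (y - x)" by (rule stlip)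
     also have "... < K * t" using True K by (intro mult_strict_left_mono) auto
     finally have "F (st x) (st y) = pw p (v y - v x)"
      using stD[of x] stD[of y] True x0 y0 by (simp add: F_def v_def)
     moreover have "F (st x) (st y) <= F x y + F (\<rho> x) y + F x (\<rho> y) + F (\<rho> x) (\<rho> y)"
     proof -
      have "F (st x) (st y) = F x y \<or> F (st x) (st y) = F (\<rho> x) y \<or> F (st x) (st y) = F x (\<rho> y) \<or> F (st x) (st y) = F (\<rho> x) (\<rho> y)"
       by (auto simp: st_def)
      then show ?thesis by (auto intro: add_increasing add_increasing2)
     qed
     ultimately show ?thesis using True by simp
    qed (auto simp: indicator_def)
   qed
  qed
  also have "... = (NN x. (NN y. F x y) + (NN y. F (\<rho> x) y) + (NN y. F x (\<rho> y)) + (NN y. F (\<rho> x) (\<rho> y)))"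
   by (simp add: nn_integral_add)
  also have "... = (NN x. (NN y. F x y) + (NN y. F (\<rho> x) y) + (NN y. F x y) + (NN y. F (\<rho> x) y))"
   using refl[of "F _"] by simp
  also have "... = J + (NN x. (NN y. F (\<rho> x) y)) + J + (NN x. (NN y. F (\<rho> x) y))"
   unfolding J_def by (simp add: nn_integral_add)
  also have "(NN x. (NN y. F (\<rho> x) y)) = J"
   unfolding J_def by (rule refl[of "%x. NN y. F x y"]) measurable
  also have "J + J + J + J = 4 * J"
  proof -
   have "(4::ennreal) = 1 + 1 + 1 + 1" by simp
   then show ?thesis by (simp only: distrib_right mult_1)
  qed
  also have "... <= 4 * en (C * (K * t) powr (real DIM('a) + p))" unfolding J using t K by (intro mult_left_mono C) auto
  also have "... = en (4 * C * K powr (real DIM('a) + p) * t powr (real DIM('a) + p))"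
   using C K t by (simp add: powr_mult ennreal_mult mult_ac)
  finally show ?thesis .
 qed
 moreover have "0 <= 4 * C * K powr (real DIM('a) + p)" using C by simp
 ultimately have "AT p (ball z r) v" unfolding AT_def by blast
 moreover have "v x = u x" if "x : Om" "x : ball z r" for x
  using that dom[of x] r r1(3) by (auto simp: v_def st_def)
 ultimately show thesis using that[OF r(1) vm] u_le by (auto simp: v_def)
qed

lemma local_extension:
 assumes l: "lipschitz_domain Om" and z: "z : closure Om"
 obtains r v where "0 < r" "v : bmeas" "!!x. abs(v x) <= 1"
  "!!x. x : Om ==> x : ball z r ==> v x = u x" "AT p (ball z r) v"
proof (cases "z : Om")
 case True
 then obtain r where r: "0 < r" "ball z r \<subseteq> Om" using open_dom open_contains_ball by blast
 then show ?thesis using that[OF r(1) u_borel u_le _ AT_interior[OF r(2)]] by blast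
next
 case False
 then have z: "z : frontier Om" using z open_dom by (simp add: frontier_def interior_open)
 then obtain R E \<phi> L where "lip_chart Om z R E \<phi> L" using lipschitz_domain_chart[OF l] by blast
 from local_extension_boundary[OF this z] that show ?thesis by blast
qed

text \<open>One ball of a finite cover is glued in at a time by a convex combination with a cut-off.
  The bound by 1 persists, and points of \<open>Om\<close> that are already correct stay so, because
  the local extension equals \<open>u\<close> in \<open>Om\<close> wherever the cut-off is nonzero.
  \<open>AT\<close> passes through products and sums.\<close>

theorem global_extension:
 assumes l: "lipschitz_domain Om"
 obtains v S where "v : bmeas" "!!x. abs(v x) <= 1" "bounded S" "!!x. x ~: S ==> v x = 0"
  "!!x. x : Om ==> v x = u x" "AT p UNIV v"
proof -
 define Q where "Q z r w \<longleftrightarrow> 0 < r & w : bmeas & (ALL x. abs(w x) <= 1) & (ALL x. x : Om --> x : ball z r --> w x = u x) & AT p (ball z r) w" for z r w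
 have "EX r w. Q z r w" if zc: "z : closure Om" for z
 proof (rule local_extension[OF l zc])
  fix r w assume "0 < r" "w : bmeas" "!!x. abs(w x) <= 1"
   "!!x. x : Om ==> x : ball z r ==> w x = u x" "AT p (ball z r) w"
  then show "EX r w. Q z r w" unfolding Q_def by blast
 qed
 then obtain r w where Q: "!!z. z : closure Om ==> Q z (r z) (w z)" by metis
 then have rw: "!!z. z : closure Om ==> 0 < r z" "!!z. z : closure Om ==> w z : bmeas"
  "!!z x. z : closure Om ==> abs(w z x) <= 1" "!!z x. z : closure Om ==> x : Om ==> x : ball z (r z) ==> w z x = u x"
  "!!z. z : closure Om ==> AT p (ball z (r z)) (w z)"
  unfolding Q_def by blast+
 have cC: "compact (closure Om)" using bounded_dom by (simp add: compact_closure)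
 have cov: "closure Om \<subseteq> (\<Union>z\<in>closure Om. ball z (r z / 2))" using rw(1) by force
 obtain Z where Z: "Z \<subseteq> closure Om" "finite Z" "closure Om \<subseteq> (\<Union>z\<in>Z. ball z (r z / 2))"
  using compactE_image[OF cC open_ball cov] by blast
 have "EX v S. v : bmeas & (ALL x. abs(v x) <= 1) & bounded S & (ALL x. x ~: S --> v x = 0) &
  (ALL x:Om \<inter> (\<Union>z\<in>F. ball z (r z / 2)). v x = u x) & AT p UNIV v" if "F \<subseteq> Z" for F
  using finite_subset[OF that Z(2)] that
 proof (induction F rule: finite_induct)
  case empty
  have "AT p UNIV (%x::'a. 0)" by (rule AT_of_trd[of p 0]) (use p in \<open>auto simp: trd_def\<close>)
  then show ?case by (intro exI[of _ "%x. 0"] exI[of _ "{}"]) auto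
 next
  case (insert z F)
  then obtain v S where v [measurable]: "v : bmeas" and vb: "!!x. abs(v x) <= 1" and S: "bounded S" "!!x. x ~: S ==> v x = 0"
   and vu: "!!x. x : Om ==> x : (\<Union>z\<in>F. ball z (r z / 2)) ==> v x = u x" and AT: "AT p UNIV v" by auto
  have zc: "z : closure Om" using insert Z by auto
  note [measurable] = rw(2)[OF zc]
  let ?b = "cutoff z (r z)"
  define v' where "v' x = (1 - ?b x) * v x + ?b x * w z x" for x
  have "AT p UNIV (%x. (1 - ?b x) * v x)"
  proof (rule AT_product[OF p v _ _ vb _ _ _ _ _ S(1) _ AT])
   show "abs((1 - ?b x) - (1 - ?b y)) <= 2 / r z * norm (x - y)" for x y
    using cutoff_lipschitz[OF rw(1)[OF zc], of z x y] by simp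
  qed (use rw(1)[OF zc] S(2) cutoff_bounds[of z "r z"] in \<open>auto simp: less_imp_le\<close>)
  moreover have "AT p UNIV (%x. ?b x * w z x)"
   by (rule AT_product[OF p rw(2)[OF zc] _ _ rw(3)[OF zc] cutoff_bounds cutoff_lipschitz[OF rw(1)[OF zc]] _ _ bounded_ball _ rw(5)[OF zc]])
    (use rw(1)[OF zc] cutoff_eq_0[OF rw(1)[OF zc]] in \<open>auto simp: less_imp_le\<close>)
  ultimately have "AT p UNIV v'" unfolding v'_def by (intro AT_add[OF p]) measurable
  moreover have "v' : bmeas" unfolding v'_def by measurable
  moreover have "abs(v' x) <= 1" for x
  proof -
   have "abs(v' x) <= (1 - ?b x) * abs(v x) + ?b x * abs(w z x)" unfolding v'_def using cutoff_bounds[of z "r z" x]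
    by (intro order_trans[OF abs_triangle_ineq]) (simp add: abs_mult)
   also have "... <= (1 - ?b x) * 1 + ?b x * 1" using vb[of x] rw(3)[OF zc, of x] cutoff_bounds[of z "r z" x] by (intro add_mono mult_left_mono) auto
   finally show ?thesis by simp
  qed
  moreover have "bounded (S \<union> ball z (r z))" using S by simp
  moreover have "v' x = 0" if "x ~: S \<union> ball z (r z)" for x
   using that S(2) cutoff_eq_0[OF rw(1)[OF zc], of x z] by (simp add: v'_def)
  moreover have "v' x = u x" if x: "x : Om" "x : (\<Union>z\<in>insert z F. ball z (r z / 2))" for x
  proof (cases "x : ball z (r z / 2)")
   case True
   then have "x : ball z (r z)" using rw(1)[OF zc] by auto
   then show ?thesis using cutoff_eq_1[OF rw(1)[OF zc] True] rw(4)[OF zc x(1)] by (simp add: v'_def)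
  next
   case False
   then have vx: "v x = u x" using x vu by auto
   show ?thesis
   proof (cases "x : ball z (r z)")
    case True
    then show ?thesis using vx rw(4)[OF zc x(1)] by (simp add: v'_def algebra_simps)
   next
    case False
    then show ?thesis using vx cutoff_eq_0[OF rw(1)[OF zc], of x z] by (simp add: v'_def)
   qed
  qed
  ultimately show ?case by (intro exI[of _ v'] exI[of _ "S \<union> ball z (r z)"]) blast
 qed
 from this[of Z] obtain v S where vS: "v : bmeas" "!!x. abs(v x) <= 1" "bounded S" "!!x. x ~: S ==> v x = 0"
  "!!x. x : Om ==> x : (\<Union>z\<in>Z. ball z (r z / 2)) ==> v x = u x" "AT p UNIV v" by auto
 have "v x = u x" if "x : Om" for x using that vS(5)[OF that] Z(3) closure_subset by blast
 then show thesis using that[OF vS(1-4) _ vS(6)] by blast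
qed

end


subsection \<open>Passing between Lebesgue and Borel measurable functions\<close>

lemma borel_version_on:
 fixes u :: "'a::euclidean_space => real"
 assumes u: "u : borel_measurable (lebesgue_on S)" and S: "S : sets borel"
 obtains v where "v : bmeas" "!!x. x ~: S ==> v x = 0" "AE x in lborel. x : S --> u x = v x"
proof -
 have "(%x. if x : S then u x else 0) : borel_measurable lebesgue"
  using u S by (subst borel_measurable_if) auto
 then obtain v where v: "v : borel_measurable lborel" "AE x in lborel. (if x : S then u x else 0) = v x"
  using completion_ex_borel_measurable_real by blast
 show thesis
 proof (rule that[of "%x. ind S x * v x"])
  show "(%x. ind S x * v x) : bmeas" using v(1) S by measurable
  show "AE x in lborel. x : S --> u x = ind S x * v x" using v(2) by (rule AE_mp) (auto intro!: AE_I2)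
 qed auto
qed

lemma borel_version_bounded:
 fixes u :: "'a::euclidean_space => real"
 assumes u: "u : borel_measurable lebesgue" and b: "AE x in lebesgue. abs(u x) <= 1"
 obtains v where "v : bmeas" "!!x. abs(v x) <= 1" "AE x in lborel. u x = v x"
proof -
 obtain v where v: "v : borel_measurable lborel" "AE x in lborel. u x = v x"
  using completion_ex_borel_measurable_real[OF u] by blast
 have b': "AE x in lborel. abs(u x) <= 1" using b by (simp add: AE_completion_iff)
 show thesis
 proof (rule that[of "%x. max (-1) (min 1 (v x))"])
  show "(%x. max (-1) (min 1 (v x))) : bmeas" using v(1) by measurable
  show "AE x in lborel. u x = max (-1) (min 1 (v x))" using v(2) b' by eventually_elim auto
 qed auto
qed

lemma set_lebesgue_integral_borel:
 fixes f g :: "'a::euclidean_space => real"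
 assumes f: "f : borel_measurable (lebesgue_on S)" and S: "S : sets borel" and g [measurable]: "g : bmeas"
  and fg: "AE x in lborel. x : S --> f x = g x" and g0: "!!x. x ~: S ==> g x = 0"
 shows "(LINT x:S|lebesgue. f x) = (LL x. g x)"
proof -
 have "(%x. if x : S then f x else 0) : borel_measurable lebesgue" using f S by (subst borel_measurable_if) auto
 then have fm: "(%x. ind S x *\<^sub>R f x) : borel_measurable lebesgue" by (rule measurable_cong[THEN iffD1, rotated]) auto
 have "(LINT x:S|lebesgue. f x) = (\<integral>x. g x \<partial>lebesgue)"
  unfolding set_lebesgue_integral_def
 proof (rule integral_cong_AE[OF fm])
  show "AE x in lebesgue. indicat_real S x *\<^sub>R f x = g x"
   unfolding AE_completion_iff using fg by (rule AE_mp) (use g0 in \<open>auto simp: indicator_def intro!: AE_I2\<close>)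
 qed (simp add: measurable_completion)
 also have "... = (LL x. g x)" by (rule integral_completion) simp
 finally show ?thesis .
qed

lemma borel_imp_lebesgue_on: "f : bmeas ==> f : borel_measurable (lebesgue_on S)"
 by (intro measurable_restrict_space1 measurable_completion) simp

lemma set_nn_integral_cong_AE_lebesgue:
 assumes "AE x in lborel. x : S --> f x = g x"
 shows "set_nn_integral lebesgue S f = (NN x. g x * ind S x)"
 unfolding nn_integral_completion
 by (rule nn_integral_cong_AE, use assms in \<open>rule AE_mp\<close>) (auto simp: indicator_def intro!: AE_I2)

lemma integrable_of_Lp_bounded_support:
 fixes f :: "'a::euclidean_space => real"
 assumes p: "1 <= p" and [measurable]: "f : bmeas" "S : sets borel" and S: "emeasure lborel S < \<infinity>" "!!x. x ~: S ==> f x = 0"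
  and fin: "(NN x. pw p (f x)) < \<infinity>"
 shows "integrable lborel f"
proof (rule integrableI_bounded)
 have "(NN x. en (norm (f x))) <= (NN x. ind S x + pw p (f x))"
 proof (rule nn_integral_mono)
  fix x
  have "abs(f x) <= 1 + abs(f x) powr p"
  proof (cases "abs(f x) <= 1")
   case False
   then have "abs(f x) powr 1 <= abs(f x) powr p" using p by (intro powr_mono) auto
   then show ?thesis using False by simp
  qed (smt (verit) powr_ge_zero)
  then have "en (abs(f x)) <= 1 + pw p (f x)" by (metis ennreal_1 ennreal_leI ennreal_plus powr_ge_zero zero_le_one)
  then show "en (norm (f x)) <= ind S x + pw p (f x)" using S(2)[of x] by (cases "x : S") auto
 qed
 also have "... = emeasure lborel S + (NN x. pw p (f x))" by (subst nn_integral_add) auto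
 also have "... < \<infinity>" using S fin by simp
 finally show "(NN x. en (norm (f x))) < \<infinity>" .
qed simp

lemma weak_grad_borel:
 fixes u v :: "'a::euclidean_space => real"
 assumes p: "1 <= p" and O: "open Om" "bounded Om" and w: "weak_grad p Om u G" and um: "u : borel_measurable (lebesgue_on Om)"
  and vm [measurable]: "v : bmeas" and v0: "!!x. x ~: Om ==> v x = 0" and uv: "AE x in lborel. x : Om --> u x = v x"
 obtains H where "H : bmeas" "!!x. x ~: Om ==> H x = 0" "AE x in lborel. x : Om --> G x = H x"
  "!!b. b : Basis ==> integrable lborel (%x. H x \<bullet> b)" "wgrad Om v H" "(NN x. en (norm (H x) powr p)) < \<infinity>"
proof -
 have Om [measurable]: "Om : sets borel" using O by auto
 have comp: "(%x. G x \<bullet> b) : borel_measurable (lebesgue_on Om)" "set_nn_integral lebesgue Om (%x. pw p (G x \<bullet> b)) < \<infinity>"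
  if "b : Basis" for b using w that unfolding weak_grad_def in_Lp_def by auto
 define Q where "Q b h \<longleftrightarrow> h : bmeas & (ALL x. x ~: Om --> h x = 0) & (AE x in lborel. x : Om --> G x \<bullet> b = h x)" for b :: 'a and h :: "'a => real"
 have "ALL b:Basis. EX h. Q b h"
 proof
  fix b :: 'a assume b: "b : Basis"
  show "EX h. Q b h"
  proof (rule borel_version_on[OF comp(1)[OF b] Om])
   fix v assume "v : bmeas" "!!x. x ~: Om ==> v x = 0" "AE x in lborel. x : Om --> G x \<bullet> b = v x"
   then have "Q b v" unfolding Q_def by simp
   then show "EX h. Q b h" by blast
  qed
 qed
 then obtain h where hQ: "ALL b:Basis. Q b (h b)" by (rule bchoice[THEN exE])
 then have h: "!!b. b : Basis ==> h b : bmeas" "!!b x. b : Basis ==> x ~: Om ==> h b x = 0"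
  "!!b. b : Basis ==> AE x in lborel. x : Om --> G x \<bullet> b = h b x" by (simp_all add: Q_def)
 define H where "H x = (\<Sum>b\<in>Basis. h b x *\<^sub>R b)" for x
 have Hb: "H x \<bullet> b = h b x" if "b : Basis" for x b using that by (simp add: H_def inner_sum_left inner_Basis if_distrib sum.delta cong: if_cong)
 have Hm [measurable]: "H : bmeas" unfolding H_def using h(1) by (intro borel_measurable_sum borel_measurable_scaleR) auto
 have H0: "H x = 0" if "x ~: Om" for x using h(2) that by (simp add: H_def)
 have "AE x in lborel. ALL b:Basis. x : Om --> G x \<bullet> b = h b x" using h(3) by (subst AE_finite_all) auto
 then have GH: "AE x in lborel. x : Om --> G x = H x"
 proof (rule AE_mp, intro AE_I2 impI)
  fix x assume "ALL b:Basis. x : Om --> G x \<bullet> b = h b x" "x : Om"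
  then show "G x = H x" by (intro euclidean_eqI[of "G x"]) (simp add: Hb)
 qed
 have hp: "(NN x. pw p (H x \<bullet> b)) < \<infinity>" if b: "b : Basis" for b
 proof -
  have "(NN x. pw p (H x \<bullet> b)) = (NN x. pw p (H x \<bullet> b) * ind Om x)"
   using H0 by (intro nn_integral_cong) (auto simp: indicator_def)
  also have "... = set_nn_integral lebesgue Om (%x. pw p (G x \<bullet> b))"
   by (rule set_nn_integral_cong_AE_lebesgue[symmetric], use GH in \<open>rule AE_mp\<close>) (auto intro!: AE_I2)
  finally show ?thesis using comp(2)[OF b] by simp
 qed
 have Hi: "integrable lborel (%x. H x \<bullet> b)" if "b : Basis" for b
  using p H0 by (intro integrable_of_Lp_bounded_support[OF _ _ Om emeasure_lborel_bounded[OF O(2)] _ hp[OF that]]) auto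
 have Hp: "(NN x. en (norm (H x) powr p)) < \<infinity>"
 proof -
  have "(NN x. en (norm (H x) powr p)) <= (NN x. en (real DIM('a) powr p) * (\<Sum>b\<in>Basis. pw p (H x \<bullet> b)))"
  proof (rule nn_integral_mono)
   fix x
   show "en (norm (H x) powr p) <= en (real DIM('a) powr p) * (\<Sum>b\<in>Basis. pw p (H x \<bullet> b))"
    using norm_powr_le_Basis[of p "H x"] p by (simp add: ennreal_leI sum_ennreal sum_nonneg flip: ennreal_mult)
  qed
  also have "... = en (real DIM('a) powr p) * (\<Sum>b\<in>Basis. NN x. pw p (H x \<bullet> b))"
   by (subst nn_integral_cmult, simp del: sum_ennreal, subst nn_integral_sum) auto
  also have "... < \<infinity>" using hp by (auto simp: ennreal_mult_less_top ennreal_sum_less_top less_top)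
  finally show ?thesis .
 qed
 have "wgrad Om v H"
  unfolding wgrad_def
 proof (intro allI impI)
  fix \<phi> i assume phi: "test_fun Om \<phi>" and i: "i : (Basis::'a set)"
  note [measurable] = test_fun_borel[OF phi] smooth_fun_deriv_borel[OF test_fun_smooth[OF phi]]
  have "(LINT x:Om|lebesgue. u x * dd \<phi> x i) = (LL x. v x * dd \<phi> x i)"
  proof (rule set_lebesgue_integral_borel[OF _ Om])
   show "(%x. u x * dd \<phi> x i) : borel_measurable (lebesgue_on Om)"
    by (intro borel_measurable_times um borel_imp_lebesgue_on) measurable
   show "AE x in lborel. x : Om --> u x * dd \<phi> x i = v x * dd \<phi> x i"
    using uv by (rule AE_mp) (auto intro!: AE_I2)
  qed (use v0 in auto)
  moreover have "(LINT x:Om|lebesgue. (G x \<bullet> i) * \<phi> x) = (LL x. (H x \<bullet> i) * \<phi> x)"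
  proof (rule set_lebesgue_integral_borel[OF _ Om])
   show "(%x. (G x \<bullet> i) * \<phi> x) : borel_measurable (lebesgue_on Om)"
    by (intro borel_measurable_times comp(1)[OF i] borel_imp_lebesgue_on) measurable
   show "AE x in lborel. x : Om --> (G x \<bullet> i) * \<phi> x = (H x \<bullet> i) * \<phi> x" using GH by (rule AE_mp) (auto intro!: AE_I2)
  qed (use H0 in auto)
  moreover have "(LINT x:Om|lebesgue. u x * dd \<phi> x i) = - (LINT x:Om|lebesgue. (G x \<bullet> i) * \<phi> x)"
   using w phi i unfolding weak_grad_def by blast
  ultimately show "(LL x. v x * dd \<phi> x i) = - (LL x. (H x \<bullet> i) * \<phi> x)" by simp
 qed
 then show thesis using that[OF Hm H0 GH Hi _ Hp] by blast
qed

lemma weak_grad_of_wgrad: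
 fixes u v :: "'a::euclidean_space => real"
 assumes p: "0 <= p" and O: "open Om" and w: "wgrad Om v H" and um: "u : borel_measurable (lebesgue_on Om)"
  and vm [measurable]: "v : bmeas" and uv: "AE x in lborel. x : Om --> u x = v x"
  and Hm [measurable]: "H : bmeas" and Hp: "(NN x. en (norm (H x) powr p) * ind Om x) < \<infinity>"
 shows "weak_grad p Om u H"
proof -
 have Om [measurable]: "Om : sets borel" using O by auto
 have "in_Lp p Om (%x. H x \<bullet> i)" if i: "i : Basis" for i
  unfolding in_Lp_def
 proof
  show "(%x. H x \<bullet> i) : borel_measurable (lebesgue_on Om)" by (rule borel_imp_lebesgue_on) measurable
  have "set_nn_integral lebesgue Om (%x. pw p (H x \<bullet> i)) <= (NN x. en (norm (H x) powr p) * ind Om x)"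
   unfolding nn_integral_completion using p Basis_le_norm[OF i] by (intro nn_integral_mono mult_right_mono ennreal_leI powr_mono2) auto
  then show "set_nn_integral lebesgue Om (%x. pw p (H x \<bullet> i)) < \<infinity>" using Hp by simp
 qed
 moreover have "(LINT x:Om|lebesgue. u x * dd \<phi> x i) = - (LINT x:Om|lebesgue. (H x \<bullet> i) * \<phi> x)"
  if phi: "test_fun Om \<phi>" and i: "i : Basis" for \<phi> i
 proof -
  note [measurable] = test_fun_borel[OF phi] smooth_fun_deriv_borel[OF test_fun_smooth[OF phi]]
  obtain K where K: "K \<subseteq> Om" "!!x. x ~: K ==> \<phi> x = 0" "!!x w. x ~: K ==> dd \<phi> x w = 0"
   using test_fun_cases[OF phi] by metis
  have "(LINT x:Om|lebesgue. u x * dd \<phi> x i) = (LL x. v x * dd \<phi> x i)"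
  proof (rule set_lebesgue_integral_borel[OF _ Om])
   show "(%x. u x * dd \<phi> x i) : borel_measurable (lebesgue_on Om)"
    by (intro borel_measurable_times um borel_imp_lebesgue_on) measurable
   show "AE x in lborel. x : Om --> u x * dd \<phi> x i = v x * dd \<phi> x i"
    using uv by (rule AE_mp) (auto intro!: AE_I2)
   show "v x * dd \<phi> x i = 0" if "x ~: Om" for x using that K by auto
  qed measurable
  moreover have "(LINT x:Om|lebesgue. (H x \<bullet> i) * \<phi> x) = (LL x. (H x \<bullet> i) * \<phi> x)"
  proof (rule set_lebesgue_integral_borel[OF _ Om])
   show "(%x. (H x \<bullet> i) * \<phi> x) : borel_measurable (lebesgue_on Om)" by (rule borel_imp_lebesgue_on) measurable
   show "(H x \<bullet> i) * \<phi> x = 0" if "x ~: Om" for x using that K by auto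
  qed auto
  ultimately show ?thesis using w phi i unfolding wgrad_def by simp
 qed
 ultimately show ?thesis unfolding weak_grad_def by blast
qed

lemma wgrad_unique:
 assumes O: "open Om" and w: "wgrad Om v H" "wgrad Om v H'"
  and H: "!!b. b : Basis ==> integrable lborel (%x. H x \<bullet> b)" and H': "!!b. b : Basis ==> integrable lborel (%x. H' x \<bullet> b)"
 shows "AE x in lborel. x : Om --> H x = H' x"
proof -
 have "AE x in lborel. x : Om --> H x \<bullet> b - H' x \<bullet> b = 0" if b: "b : Basis" for b
 proof (rule fundamental_lemma_variations[OF _ O])
  show "integrable lborel (%x. H x \<bullet> b - H' x \<bullet> b)" using H[OF b] H'[OF b] by auto
  fix \<phi> assume phi: "test_fun Om \<phi>"
  have "(LL x. (H x \<bullet> b) * \<phi> x) = (LL x. (H' x \<bullet> b) * \<phi> x)"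
   using w phi b unfolding wgrad_def by simp
  then show "(LL x. (H x \<bullet> b - H' x \<bullet> b) * \<phi> x) = 0"
   using integrable_mult_test_fun[OF H[OF b] phi] integrable_mult_test_fun[OF H'[OF b] phi] by (simp add: left_diff_distrib)
 qed
 then have "AE x in lborel. ALL b:Basis. x : Om --> H x \<bullet> b - H' x \<bullet> b = 0" by (subst AE_finite_all) auto
 then show ?thesis
 proof (rule AE_mp, intro AE_I2 impI)
  fix x assume "ALL b:Basis. x : Om --> H x \<bullet> b - H' x \<bullet> b = 0" "x : Om"
  then show "H x = H' x" by (intro euclidean_eqI[of "H x"]) simp
 qed
qed

text \<open>\<open>Ep_1\<close> refers to a gradient picked by \<open>SOME\<close>. The last
  equation hands its integral over to a Borel gradient \<open>H\<close> that vanishes outside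
  \<open>Om\<close>, for which \<open>wgrad_unique\<close> is available.\<close>

lemma W1p_cases:
 fixes u :: "'a::euclidean_space => real"
 assumes p: "1 <= p" and O: "open Om" "bounded Om" and w: "W1p p Om u" and b: "AE x in lebesgue. x : Om --> abs(u x) <= 1"
 obtains v H where "v : bmeas" "!!x. abs(v x) <= 1" "!!x. x ~: Om ==> v x = 0" "AE x in lborel. x : Om --> u x = v x"
  "H : bmeas" "!!x. x ~: Om ==> H x = 0" "!!b. b : Basis ==> integrable lborel (%x. H x \<bullet> b)" "wgrad Om v H"
  "(NN x. en (norm (H x) powr p)) < \<infinity>"
  "set_nn_integral lebesgue Om (%x. en (norm ((SOME G. weak_grad p Om u G) x) powr p)) = (NN x. en (norm (H x) powr p))"
proof -
 have Om: "Om : sets borel" using O by auto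
 have um: "u : borel_measurable (lebesgue_on Om)" using w unfolding W1p_def in_Lp_def by auto
 obtain v0 where v0 [measurable]: "v0 : bmeas" and v0z: "!!x. x ~: Om ==> v0 x = 0" and uv0: "AE x in lborel. x : Om --> u x = v0 x"
  by (rule borel_version_on[OF um Om]) (rule that, assumption, fast, assumption)
 define v where "v x = max (-1) (min 1 (v0 x))" for x
 have vm: "v : bmeas" unfolding v_def by measurable
 have vb: "abs(v x) <= 1" for x by (auto simp: v_def)
 have vz: "v x = 0" if "x ~: Om" for x using v0z[OF that] by (simp add: v_def)
 have "AE x in lborel. x : Om --> abs(u x) <= 1" using b by (simp add: AE_completion_iff)
 then have uv: "AE x in lborel. x : Om --> u x = v x" using uv0 by eventually_elim (auto simp: v_def)
 define G where "G = (SOME G. weak_grad p Om u G)"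
 have "EX G. weak_grad p Om u G" using w by (auto simp: W1p_def)
 then have wG: "weak_grad p Om u G" unfolding G_def by (rule someI_ex)
 obtain H where H: "H : bmeas" "!!x. x ~: Om ==> H x = 0" "AE x in lborel. x : Om --> G x = H x"
  "!!b. b : Basis ==> integrable lborel (%x. H x \<bullet> b)" "wgrad Om v H" "(NN x. en (norm (H x) powr p)) < \<infinity>"
  by (rule weak_grad_borel[OF p O wG um vm _ uv]) (erule vz, rule that, assumption, fast, assumption, fast, assumption, assumption)
 have "set_nn_integral lebesgue Om (%x. en (norm (G x) powr p)) = (NN x. en (norm (H x) powr p) * ind Om x)"
  by (rule set_nn_integral_cong_AE_lebesgue, use H(3) in \<open>rule AE_mp\<close>) (auto intro!: AE_I2)
 also have "... = (NN x. en (norm (H x) powr p))" using H(2) by (intro nn_integral_cong) (auto simp: indicator_def)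
 finally have "set_nn_integral lebesgue Om (%x. en (norm (G x) powr p)) = (NN x. en (norm (H x) powr p))" .
 then show thesis unfolding G_def by (intro that[of v H] vm vb vz uv H)
qed

subsection \<open>The nonlocal functional in translation form\<close>

text \<open>The factor 1/2 falls on the interior part alone: \<open>energy\<close> counts each pair
  in \<open>Om\<close> twice, whereas pairs across the boundary occur once.\<close>

lemma Kp_s_borel:
 fixes u v :: "'a::euclidean_space => real"
 assumes uv: "AE x in lborel. u x = v x" and vm [measurable]: "v : bmeas" and O [measurable]: "Om : sets borel" and s: "s < 1"
 shows "en (1 - s) * Kp_s p s u Om = en (1/2) * energy p (bbm_kernel p s) Om v
  + (NN h. en (bbm_kernel p s h) * (NN x. pw p (v (x + h) - v x) * ind Om x * ind (- Om) (x + h)))"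
proof -
 let ?a = "real DIM('a) + s * p"
 have k: "en (1 - s) * en (abs(a - b) powr p / norm (x - y) powr ?a) = en (bbm_kernel p s (y - x)) * pw p (b - a)" for a b and x y :: 'a
 proof -
  have "abs(a - b) powr p / norm (x - y) powr ?a = norm (y - x) powr - ?a * abs(b - a) powr p"
   unfolding powr_minus_divide by (simp add: abs_minus_commute norm_minus_commute)
  then show ?thesis using s by (simp only: bbm_kernel_def ennreal_mult[symmetric]) (simp add: mult.assoc flip: ennreal_mult)
 qed
 let ?q = "%u x y. en (abs(u x - u y) powr p / norm (x - y) powr ?a)"
 have K1: "set_nn_integral lebesgue Om (%x. set_nn_integral lebesgue Om (%y. ?q u x y)) = (NN x. (NN y. ?q v x y * ind Om y) * ind Om x)"
 proof (rule set_nn_integral_cong_AE_lebesgue, use uv in \<open>rule AE_mp\<close>, intro AE_I2 impI)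
  fix x assume "u x = v x"
  then show "set_nn_integral lebesgue Om (%y. ?q u x y) = (NN y. ?q v x y * ind Om y)"
   by (intro set_nn_integral_cong_AE_lebesgue, use uv in \<open>elim AE_mp\<close>) (auto intro!: AE_I2)
 qed
 have K2: "set_nn_integral lebesgue Om (%y. set_nn_integral lebesgue (UNIV - Om) (%x. ?q u x y)) = (NN y. (NN x. ?q v x y * ind (UNIV - Om) x) * ind Om y)"
 proof (rule set_nn_integral_cong_AE_lebesgue, use uv in \<open>rule AE_mp\<close>, intro AE_I2 impI)
  fix y assume "u y = v y"
  then show "set_nn_integral lebesgue (UNIV - Om) (%x. ?q u x y) = (NN x. ?q v x y * ind (UNIV - Om) x)"
   by (intro set_nn_integral_cong_AE_lebesgue, use uv in \<open>elim AE_mp\<close>) (auto intro!: AE_I2)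
 qed
 have E1: "en (1 - s) * (NN x. (NN y. ?q v x y * ind Om y) * ind Om x) = energy p (bbm_kernel p s) Om v"
 proof -
  have "energy p (bbm_kernel p s) Om v = (NN x. (NN y. en (bbm_kernel p s (y - x)) * pw p (v y - v x) * ind Om x * ind Om y))"
   by (rule energy_double_integral) measurable
  also have "... = (NN x. en (1 - s) * ((NN y. ?q v x y * ind Om y) * ind Om x))"
  proof (rule nn_integral_cong)
   fix x
   have "(NN y. en (bbm_kernel p s (y - x)) * pw p (v y - v x) * ind Om x * ind Om y)
    = (NN y. (en (1 - s) * ind Om x) * (?q v x y * ind Om y))"
    by (intro nn_integral_cong) (simp only: k[symmetric] mult_ac)
   also have "... = (en (1 - s) * ind Om x) * (NN y. ?q v x y * ind Om y)" by (rule nn_integral_cmult) measurable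
   finally show "(NN y. en (bbm_kernel p s (y - x)) * pw p (v y - v x) * ind Om x * ind Om y)
    = en (1 - s) * ((NN y. ?q v x y * ind Om y) * ind Om x)" by (simp only: mult_ac)
  qed
  also have "... = en (1 - s) * (NN x. (NN y. ?q v x y * ind Om y) * ind Om x)" by (rule nn_integral_cmult) measurable
  finally show ?thesis by simp
 qed
 have E2: "en (1 - s) * (NN y. (NN x. ?q v x y * ind (UNIV - Om) x) * ind Om y)
  = (NN h. en (bbm_kernel p s h) * (NN x. pw p (v (x + h) - v x) * ind Om x * ind (- Om) (x + h)))"
 proof -
  have k': "en (1 - s) * ?q v x y = en (bbm_kernel p s (x - y)) * pw p (v x - v y)" for x y
   using k[of "v y" "v x" y x] by (simp add: abs_minus_commute norm_minus_commute)
  have "(NN h. en (bbm_kernel p s h) * (NN x. pw p (v (x + h) - v x) * ind Om x * ind (- Om) (x + h)))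
   = (NN y. (NN x. en (bbm_kernel p s (x - y)) * pw p (v x - v y) * ind Om y * ind (- Om) x))"
   by (rule nonlocal_double_integral) measurable
  also have "... = (NN y. en (1 - s) * ((NN x. ?q v x y * ind (UNIV - Om) x) * ind Om y))"
  proof (rule nn_integral_cong)
   fix y
   have "(NN x. en (bbm_kernel p s (x - y)) * pw p (v x - v y) * ind Om y * ind (- Om) x)
    = (NN x. (en (1 - s) * ind Om y) * (?q v x y * ind (UNIV - Om) x))"
    by (intro nn_integral_cong) (simp only: k'[symmetric] mult_ac Compl_eq_Diff_UNIV)
   also have "... = (en (1 - s) * ind Om y) * (NN x. ?q v x y * ind (UNIV - Om) x)" by (rule nn_integral_cmult) measurable
   finally show "(NN x. en (bbm_kernel p s (x - y)) * pw p (v x - v y) * ind Om y * ind (- Om) x)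
    = en (1 - s) * ((NN x. ?q v x y * ind (UNIV - Om) x) * ind Om y)" by (simp only: mult_ac)
  qed
  also have "... = en (1 - s) * (NN y. (NN x. ?q v x y * ind (UNIV - Om) x) * ind Om y)" by (rule nn_integral_cmult) measurable
  finally show ?thesis by simp
 qed
 show ?thesis unfolding Kp_s_def K1 K2 distrib_left E2 unfolding mult.left_commute[of "en (1 - s)" "en (1 / 2)"] E1 by (rule refl)
qed


subsection \<open>Approximation by test functions\<close>

lemma nn_integral_powr_add_le:
 fixes f g h :: "'a::euclidean_space => real"
 assumes p: "0 <= p" and [measurable]: "f : bmeas" "g : bmeas"
  and h: "!!x. abs(h x) <= abs(f x) + abs(g x)"
  and a: "(NN x. pw p (f x)) <= en a" "0 <= a" and b: "(NN x. pw p (g x)) <= en b" "0 <= b"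
 shows "(NN x. pw p (h x)) <= en (2 powr p * (a + b))"
proof -
 have "(NN x. pw p (h x)) <= (NN x. en (2 powr p) * (pw p (f x) + pw p (g x)))"
 proof (rule nn_integral_mono)
  fix x
  have "abs(h x) powr p <= (abs(f x) + abs(g x)) powr p" using h p by (intro powr_mono2) auto
  also have "... <= 2 powr p * (abs(f x) powr p + abs(g x) powr p)" by (rule powr_add_le2) (use p in auto)
  finally show "pw p (h x) <= en (2 powr p) * (pw p (f x) + pw p (g x))"
   by (simp add: ennreal_leI flip: ennreal_plus ennreal_mult)
 qed
 also have "... = en (2 powr p) * ((NN x. pw p (f x)) + (NN x. pw p (g x)))"
  by (subst nn_integral_cmult, simp, subst nn_integral_add) auto
 also have "... <= en (2 powr p) * (en a + en b)" using a b by (intro mult_left_mono add_mono) auto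
 finally show ?thesis using a b by (simp flip: ennreal_plus ennreal_mult)
qed

text \<open>A common bound \<open>d\<close> for scale and shift leaves both free below it. This
  matters because the admissible scale is known only after the shift has been fixed.\<close>

lemma Lp_shift_mollify:
 fixes f :: "'a::euclidean_space => real"
 assumes p: "1 <= p" and f: "integrable lborel f"
  and fin: "(NN x. pw p (f x)) < \<infinity>" and eta: "0 < (eta::real)"
 obtains d where "0 < d" "!!e h. 0 < e ==> e < d ==> norm h < d ==>
  (NN x. pw p (convol f (moll e) (x + h) - f x)) <= en eta"
proof -
 define c where "c = eta / 2 powr p / 2"
 have c: "0 < c" "2 powr p * (c + c) = eta" using eta by (auto simp: c_def)
 have fm [measurable]: "f : bmeas" using f by auto
 obtain d1 where d1: "0 < d1" "!!e. 0 < e ==> e < d1 ==> (NN x. pw p (convol f (moll e) x - f x)) <= en c"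
  by (rule convol_moll_Lp[OF p f fin c(1)]) (rule that, assumption, fast)
 obtain d2 where d2: "0 < d2" "!!h. norm h < d2 ==> (NN x. pw p (f (x + h) - f x)) <= en c"
  by (rule Lp_translation_continuous[OF _ fm fin c(1)]) (use p in simp, rule that, assumption, fast)
 show thesis
 proof (rule that[of "min d1 d2"])
  fix e h assume e: "0 < e" "e < min d1 d2" and h: "norm (h::'a) < min d1 d2"
  note [measurable] = convol_moll_borel[OF e(1) f]
  have "(NN x. pw p (convol f (moll e) (x + h) - f (x + h))) = (NN x. pw p (convol f (moll e) x - f x))"
   by (rule nn_integral_translate) measurable
  then have 1: "(NN x. pw p (convol f (moll e) (x + h) - f (x + h))) <= en c" using d1(2)[of e] e by simp
  have "(NN x. pw p (convol f (moll e) (x + h) - f x)) <= en (2 powr p * (c + c))"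
   by (rule nn_integral_powr_add_le[OF _ _ _ _ 1 _ d2(2)]) (use p h c in auto)
  then show "(NN x. pw p (convol f (moll e) (x + h) - f x)) <= en eta" using c(2) by simp
 qed (use d1 d2 in auto)
qed

definition sobolev_grad :: "real => ('a::euclidean_space => real) => ('a => 'a) => bool" where
 "sobolev_grad p f G \<longleftrightarrow> G : bmeas & (ALL b:Basis. integrable lborel (%x. G x \<bullet> b)) & wgrad UNIV f G
  & (NN x. en (norm (G x) powr p)) < \<infinity>"

text \<open>Membership in the Sobolev closure of the test functions, by components and with an
  epsilon instead of a sequence, a form that is directly additive.\<close>

definition test_limit :: "real => 'a::euclidean_space set => ('a => real) => ('a => 'a) => bool" where
 "test_limit p Om f G \<longleftrightarrow> (ALL e>0. EX \<phi>. test_fun Om \<phi> & (NN x. pw p (\<phi> x - f x)) <= en e &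
  (ALL b:Basis. (NN x. pw p (dd \<phi> x b - G x \<bullet> b)) <= en e))"

lemma sobolev_grad_comp_Lp:
 assumes p: "0 <= p" and G: "sobolev_grad p f G" and b: "b : Basis"
 shows "(NN x. pw p (G x \<bullet> b)) < \<infinity>"
proof -
 have "(NN x. pw p (G x \<bullet> b)) <= (NN x. en (norm (G x) powr p))"
  using p b by (intro nn_integral_mono ennreal_leI powr_mono2) (auto intro: Basis_le_norm)
 also have "... < \<infinity>" using G by (simp add: sobolev_grad_def)
 finally show ?thesis .
qed

text \<open>A small shift makes the support a compact part of \<open>Om\<close>; mollifying at a
  scale below its distance to the boundary then gives a test function. One \<open>d\<close> serves
  \<open>f\<close> and all components of the gradient at once.\<close>

lemma test_limit_of_shift:
 fixes f :: "'a::euclidean_space => real"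
 assumes p: "1 <= p" and O: "open Om" and f: "integrable lborel f" and fp: "(NN x. pw p (f x)) < \<infinity>"
  and G: "sobolev_grad p f G"
  and sh: "!!d. 0 < d ==> EX h K. norm h < d & compact K & K \<subseteq> Om & (ALL x. x ~: K --> f (x + h) = 0)"
 shows "test_limit p Om f G"
 unfolding test_limit_def
proof (intro allI impI)
 fix eta :: real assume eta: "0 < eta"
 have w: "wgrad UNIV f G" and Gi: "!!b. b : Basis ==> integrable lborel (%x. G x \<bullet> b)" using G by (auto simp: sobolev_grad_def)
 define P where "P q d \<longleftrightarrow> (ALL e h. 0 < e --> e < d --> norm h < d -->
  (NN x. pw p (convol q (moll e) (x + h) - q x)) <= en eta)" for q :: "'a => real" and d
 have ev: "\<forall>\<^sub>F d in at_right 0. P q d" if q: "integrable lborel q" "(NN x. pw p (q x)) < \<infinity>" for q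
 proof (rule Lp_shift_mollify[OF p q eta])
  fix d assume "0 < d" and d: "!!e h. 0 < e ==> e < d ==> norm h < d ==>
  (NN x. pw p (convol q (moll e) (x + h) - q x)) <= en eta"
  have "P q d'" if "d' < d" for d' unfolding P_def
  proof (intro allI impI)
   fix e and h :: 'a assume "0 < e" "e < d'" "norm h < d'"
   then show "(NN x. pw p (convol q (moll e) (x + h) - q x)) <= en eta" using that by (intro d) auto
  qed
  then show ?thesis unfolding eventually_at_right_field using \<open>0 < d\<close> by blast
 qed
 have "\<forall>\<^sub>F d in at_right 0. ALL b:Basis. P (%x. G x \<bullet> b) d"
  by (rule eventually_ball_finite) (use p in \<open>auto intro!: ev Gi sobolev_grad_comp_Lp[OF _ G]\<close>)
 then have "\<forall>\<^sub>F d in at_right 0. P f d & (ALL b:Basis. P (%x. G x \<bullet> b) d)" using ev[OF f fp] by eventually_elim auto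
 then have "\<forall>\<^sub>F d in at_right 0. 0 < d & P f d & (ALL b:Basis. P (%x. G x \<bullet> b) d)"
  using eventually_at_right_less[of 0] by eventually_elim auto
 then obtain d where d: "0 < d" "P f d" "ALL b:Basis. P (%x. G x \<bullet> b) d" using eventually_happens'[OF trivial_limit_at_right_real] by blast
 obtain h K where h: "norm h < d" and K: "compact K" "K \<subseteq> Om" and fz: "!!x. x ~: K ==> f (x + h) = 0" using sh[OF d(1)] by blast
 obtain e0 where e0: "0 < e0" "(\<Union>x\<in>K. cball x e0) \<subseteq> Om" using compact_subset_open_imp_cball_epsilon_subset[OF K(1) O K(2)] by blast
 define e where "e = min e0 (d / 2)"
 have e: "0 < e" "e < d" "e <= e0" using e0 d by (auto simp: e_def)
 define F where "F = convol f (moll e)"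
 define \<phi> where "\<phi> x = F (x + h)" for x
 have m: "test_fun UNIV (moll e :: 'a => real)" by (rule test_fun_moll[OF e(1)]) simp
 have D: "(\<phi> has_derivative (%v. convol (%y. G y \<bullet> v) (moll e) (x + h))) (at x)" for x
 proof -
  have "(F has_derivative (%v. convol f (%z. dd (moll e) z v) (x + h))) (at (x + h))"
   unfolding F_def by (rule convol_has_derivative[OF f m])
  then have "(F has_derivative (%v. convol (%y. G y \<bullet> v) (moll e) (x + h))) (at (x + h))"
   by (simp only: wgrad_convol[OF w f Gi e(1) subset_UNIV])
  moreover have "((%x. x + h) has_derivative (%v. v)) (at x)" by (auto intro!: derivative_eq_intros)
  ultimately show ?thesis unfolding \<phi>_def using has_derivative_compose[of "%x. x + h" "%v. v" x UNIV F] by simp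
 qed
 have Df: "dd \<phi> x v = convol (%y. G y \<bullet> v) (moll e) (x + h)" for x v
  by (simp add: frechet_derivative_at[OF D, symmetric])
 have "smooth_fun F" unfolding F_def by (rule smooth_fun_convol[OF f m])
 then have sm: "smooth_fun \<phi>" using smooth_fun_affine[of F 1 h 1] unfolding \<phi>_def by (simp add: add.commute)
 have tf: "test_fun Om \<phi>"
 proof (rule test_funI[OF sm])
  show "compact {x + y |x y. x : K & y : cball 0 e}" by (rule compact_sums[OF K(1) compact_cball])
  show "{x + y |x y. x : K & y : cball 0 e} \<subseteq> Om"
  proof safe
   fix x y :: 'a assume "x : K" "y : cball 0 e"
   then have "x + y : cball x e0" using e by (auto simp: dist_norm)
   then show "x + y : Om" using e0 \<open>x : K\<close> by blast
  qed
  fix x assume x: "x ~: {x + y |x y. x : K & y : cball 0 e}"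
  show "\<phi> x = 0" unfolding \<phi>_def F_def
  proof (rule convol_eq_0[where S="{y. y - h : K}"])
   show "f y = 0" if "y ~: {y. y - h : K}" for y using fz[of "y - h"] that by simp
   show "moll e z = 0" if "e <= norm z" for z using moll_eq_0[OF e(1) that] .
   fix y assume y: "y : {y. y - h : K}"
   show "e <= dist (x + h) y"
   proof (rule ccontr)
    assume "~  e <= dist (x + h) y"
    then have "x + h - y : cball 0 e" by (simp add: dist_norm norm_minus_commute[of y])
    moreover have "x = (y - h) + (x + h - y)" by simp
    ultimately show False using x y by blast
   qed
  qed
 qed
 show "EX \<phi>. test_fun Om \<phi> & (NN x. pw p (\<phi> x - f x)) <= en eta &
  (ALL b:Basis. (NN x. pw p (dd \<phi> x b - G x \<bullet> b)) <= en eta)"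
 proof (intro exI[of _ \<phi>] conjI ballI tf)
  show "(NN x. pw p (\<phi> x - f x)) <= en eta"
   using d(2)[unfolded P_def, rule_format, OF e(1,2) h] by (simp add: \<phi>_def F_def)
  show "(NN x. pw p (dd \<phi> x b - G x \<bullet> b)) <= en eta" if "b : Basis" for b
   using d(3)[rule_format, OF that, unfolded P_def, rule_format, OF e(1,2) h] by (simp add: Df)
 qed
qed

lemma sobolev_grad_add:
 fixes f g :: "'a::euclidean_space => real"
 assumes p: "0 <= p" and fi: "integrable lborel f" and gi: "integrable lborel g" and F: "sobolev_grad p f F" and G: "sobolev_grad p g G"
 shows "sobolev_grad p (%x. f x + g x) (%x. F x + G x)"
proof -
 have [measurable]: "F : bmeas" "G : bmeas" using F G by (auto simp: sobolev_grad_def)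
 have Fi: "!!b. b : Basis ==> integrable lborel (%x. F x \<bullet> b)" and Gi: "!!b. b : Basis ==> integrable lborel (%x. G x \<bullet> b)"
  and Fw: "wgrad UNIV f F" and Gw: "wgrad UNIV g G" using F G by (auto simp: sobolev_grad_def)
 obtain a where a: "(NN x. en (norm (F x) powr p)) = en a" "0 <= a" using F by (cases "NN x. en (norm (F x) powr p)") (auto simp: sobolev_grad_def)
 obtain b where b: "(NN x. en (norm (G x) powr p)) = en b" "0 <= b" using G by (cases "NN x. en (norm (G x) powr p)") (auto simp: sobolev_grad_def)
 have "(NN x. pw p (norm (F x + G x))) <= en (2 powr p * (a + b))"
  by (rule nn_integral_powr_add_le[OF p, of "%x. norm (F x)" "%x. norm (G x)"]) (use a b in \<open>auto intro: norm_triangle_ineq\<close>)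
 then have "(NN x. en (norm (F x + G x) powr p)) < \<infinity>" by (simp add: le_less_trans)
 moreover have "wgrad UNIV (%x. f x + g x) (%x. F x + G x)"
  unfolding wgrad_def
 proof (intro allI impI)
  fix \<psi> :: "'a => real" and i :: 'a assume t: "test_fun UNIV \<psi>" and i: "i : Basis"
  note ii = integrable_mult_test_fun[OF fi test_fun_deriv[OF t]] integrable_mult_test_fun[OF gi test_fun_deriv[OF t]]
   integrable_mult_test_fun[OF Fi[OF i] t] integrable_mult_test_fun[OF Gi[OF i] t]
  have "(LL x. f x * dd \<psi> x i) = - (LL x. (F x \<bullet> i) * \<psi> x)"
   "(LL x. g x * dd \<psi> x i) = - (LL x. (G x \<bullet> i) * \<psi> x)"
   using Fw Gw t i by (simp_all add: wgrad_def)
  then show "(LL x. (f x + g x) * dd \<psi> x i) = - (LL x. ((F x + G x) \<bullet> i) * \<psi> x)"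
   using ii by (simp add: distrib_right inner_add_left)
 qed
 ultimately show ?thesis unfolding sobolev_grad_def using Fi Gi by (auto simp: inner_add_left)
qed

lemma test_limit_add:
 assumes p: "0 <= p" and [measurable]: "f : bmeas" "g : bmeas" "F : bmeas" "G : bmeas"
  and f: "test_limit p Om f F" and g: "test_limit p Om g G"
 shows "test_limit p Om (%x. f x + g x) (%x. F x + G x)"
 unfolding test_limit_def
proof (intro allI impI)
 fix e :: real assume e: "0 < e"
 define c where "c = e / 2 powr p / 2"
 have c: "0 < c" "2 powr p * (c + c) = e" using e by (auto simp: c_def)
 obtain \<phi> where phi: "test_fun Om \<phi>" "(NN x. pw p (\<phi> x - f x)) <= en c"
  "!!b. b : Basis ==> (NN x. pw p (dd \<phi> x b - F x \<bullet> b)) <= en c"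
  using f c(1) unfolding test_limit_def by blast
 obtain \<psi> where psi: "test_fun Om \<psi>" "(NN x. pw p (\<psi> x - g x)) <= en c"
  "!!b. b : Basis ==> (NN x. pw p (dd \<psi> x b - G x \<bullet> b)) <= en c"
  using g c(1) unfolding test_limit_def by blast
 note [measurable] = test_fun_borel[OF phi(1)] test_fun_borel[OF psi(1)]
  smooth_fun_deriv_borel[OF test_fun_smooth[OF phi(1)]] smooth_fun_deriv_borel[OF test_fun_smooth[OF psi(1)]]
 obtain K1 where K1: "compact K1" "K1 \<subseteq> Om" "!!x. x ~: K1 ==> \<phi> x = 0" by (rule test_fun_cases[OF phi(1)]) (rule that, assumption, assumption, fast)
 obtain K2 where K2: "compact K2" "K2 \<subseteq> Om" "!!x. x ~: K2 ==> \<psi> x = 0" by (rule test_fun_cases[OF psi(1)]) (rule that, assumption, assumption, fast)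
 have t: "test_fun Om (%x. \<phi> x + \<psi> x)"
  by (rule test_funI[OF smooth_fun_add[OF test_fun_smooth[OF phi(1)] test_fun_smooth[OF psi(1)]], of "K1 \<union> K2"]) (use K1 K2 in auto)
 have dif: "\<phi> differentiable at x" "\<psi> differentiable at x" for x
  using test_fun_smooth[OF phi(1)] test_fun_smooth[OF psi(1)] unfolding smooth_fun_def by (metis iter_dd.simps(1))+
 have D: "dd (%x. \<phi> x + \<psi> x) x b = dd \<phi> x b + dd \<psi> x b" for x b
  using frechet_derivative_at[OF has_derivative_add[OF iffD1[OF frechet_derivative_works dif(1)] iffD1[OF frechet_derivative_works dif(2)]], symmetric, of x] by simp
 show "EX \<phi>. test_fun Om \<phi> & (NN x. pw p (\<phi> x - (f x + g x))) <= en e &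
  (ALL b:Basis. (NN x. pw p (dd \<phi> x b - (F x + G x) \<bullet> b)) <= en e)"
 proof (intro exI[of _ "%x. \<phi> x + \<psi> x"] conjI ballI t)
  show "(NN x. pw p (\<phi> x + \<psi> x - (f x + g x))) <= en e"
   unfolding c(2)[symmetric] by (rule nn_integral_powr_add_le[OF p _ _ _ phi(2) _ psi(2)]) (use c in auto)
  show "(NN x. pw p (dd (%x. \<phi> x + \<psi> x) x b - (F x + G x) \<bullet> b)) <= en e" if b: "b : Basis" for b
   unfolding c(2)[symmetric] D by (rule nn_integral_powr_add_le[OF p _ _ _ phi(3)[OF b] _ psi(3)[OF b]]) (use c in \<open>auto simp: inner_add_left\<close>)
 qed
qed

text \<open>Near a boundary point the shift is along the chart direction. If
  \<open>x + t *\<^sub>R E\<close> lies in \<open>Om\<close>, then \<open>t <= \<phi> x\<close>, so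
  the shifted support keeps the depth \<open>t\<close>. Supports within \<open>R / 2\<close>, moved
  by at most \<open>R / 4\<close>, stay within \<open>3 * R / 4\<close> and hence in the
  chart.\<close>

lemma test_limit_local:
 fixes Om :: "'a::euclidean_space set"
 assumes p: "1 < p" and l: "lipschitz_domain Om" and z: "z : closure Om"
 obtains r where "0 < r" "!!w. w : bmeas ==> (!!x. abs(w x) <= 1) ==> (!!x. x ~: Om \<inter> ball z r ==> w x = 0) ==> AT p UNIV w
  ==> EX G. sobolev_grad p w G & test_limit p Om w G"
proof -
 have O: "open Om" using l by (simp add: lipschitz_domain_def)
 have "EX r>0. ALL w. (ALL x. x ~: Om \<inter> ball z r --> w x = (0::real)) --> (ALL d>0. EX h K. norm h < d & compact K & K \<subseteq> Om & (ALL x. x ~: K --> w (x + h) = 0))"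
 proof (cases "z : Om")
  case True
  then obtain r where r: "0 < r" "cball z r \<subseteq> Om" using O open_contains_cball by blast
  show ?thesis
  proof (intro exI[of _ r] conjI allI impI r(1))
   fix w :: "'a => real" and d :: real assume "ALL x. x ~: Om \<inter> ball z r --> w x = 0" "0 < d"
   then show "EX h K. norm h < d & compact K & K \<subseteq> Om & (ALL x. x ~: K --> w (x + h) = 0)"
    using r by (intro exI[of _ 0] exI[of _ "cball z r"]) auto
  qed
 next
  case False
  then have "z : frontier Om" using z O by (simp add: frontier_def interior_open)
  then obtain R E \<phi> L where c: "lip_chart Om z R E \<phi> L" using lipschitz_domain_chart[OF l] by blast
  then have R: "0 < R" and E: "norm E = 1" and sh: "!!x t. \<phi> (x + t *\<^sub>R E) = \<phi> x - t" and iff: "!!x. x : ball z R ==> x : Om \<longleftrightarrow> 0 < \<phi> x"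
   by (auto simp: lip_chart_def)
  show ?thesis
  proof (intro exI[of _ "R / 2"] conjI allI impI)
   fix w :: "'a => real" and d :: real assume w: "ALL x. x ~: Om \<inter> ball z (R / 2) --> w x = 0" and d: "0 < d"
   define t where "t = min d R / 4"
   have t: "0 < t" "t < d" "t <= R / 4" using d R by (auto simp: t_def)
   let ?K = "cball z (3 * R / 4) \<inter> {x. t <= \<phi> x}"
   have "compact ?K" by (intro compact_Int_closed compact_cball closed_Collect_le continuous_on_const lip_chart_continuous[OF c])
   moreover have "?K \<subseteq> Om" using iff t R by auto
   moreover have "w (x + t *\<^sub>R E) = 0" if x: "x ~: ?K" for x
   proof (rule ccontr)
    assume "w (x + t *\<^sub>R E) ~= 0"
    then have a: "x + t *\<^sub>R E : Om" "x + t *\<^sub>R E : ball z (R / 2)" using w by blast+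
    then have "0 < \<phi> (x + t *\<^sub>R E)" using iff[of "x + t *\<^sub>R E"] R by auto
    then have "t <= \<phi> x" by (simp add: sh)
    moreover have "dist z x <= dist z (x + t *\<^sub>R E) + dist (x + t *\<^sub>R E) x" by (rule dist_triangle)
    then have "dist z x <= 3 * R / 4" using a(2) t E by (simp add: dist_norm)
    ultimately show False using x by simp
   qed
   ultimately show "EX h K. norm h < d & compact K & K \<subseteq> Om & (ALL x. x ~: K --> w (x + h) = 0)"
    using t E by (intro exI[of _ "t *\<^sub>R E"] exI[of _ ?K]) auto
  qed (use R in simp)
 qed
 then obtain r where r: "0 < r" and sh: "!!w d. (ALL x. x ~: Om \<inter> ball z r --> w x = (0::real)) ==> 0 < d ==> EX h K. norm h < d & compact K & K \<subseteq> Om & (ALL x. x ~: K --> w (x + h) = 0)"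
  by blast
 show thesis
 proof (rule that[OF r])
  fix w :: "'a => real" assume wm [measurable]: "w : bmeas" and wb: "!!x. abs(w x) <= 1" and w0: "!!x. x ~: Om \<inter> ball z r ==> w x = 0" and AT: "AT p UNIV w"
  have w0': "w x = 0" if "x ~: ball z r" for x using w0 that by blast
  obtain G where G: "G : bmeas" "!!b. b : Basis ==> integrable lborel (%x. G x \<bullet> b)" "wgrad UNIV w G" "(NN x. en (norm (G x) powr p)) < \<infinity>"
   by (rule AT_wgrad[OF p wm wb bounded_ball _ AT]) (erule w0', rule that, assumption, fast, assumption, assumption)
  then have sg: "sobolev_grad p w G" by (simp add: sobolev_grad_def)
  have wi: "integrable lborel w" by (rule integrable_bounded_support[OF wm wb bounded_ball w0'])
  have wp: "(NN x. pw p (w x)) < \<infinity>"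
  proof -
   have "(NN x. pw p (w x)) <= (NN x. ind (ball z r) x)"
    using wb p w0' by (intro nn_integral_mono) (auto simp: indicator_def powr_le1)
   also have "... < \<infinity>" using emeasure_lborel_bounded[of "ball z r"] by simp
   finally show ?thesis .
  qed
  have "test_limit p Om w G" by (rule test_limit_of_shift[OF _ O wi wp sg sh]) (use p w0 in auto)
  then show "EX G. sobolev_grad p w G & test_limit p Om w G" using sg by blast
 qed
qed

text \<open>The induction is over subfamilies of a finite cover, for all functions supported in the
  union of the half-radius balls. Splitting by a cut-off leaves one part supported near a single
  centre, and the other vanishes on that half-radius ball, so it is supported in the remaining
  ones.\<close>

theorem test_limit_of_AT:
 fixes Om :: "'a::euclidean_space set" and f :: "'a => real"
 assumes p: "1 < p" and l: "lipschitz_domain Om" and fm: "f : bmeas" and fb: "!!x. abs(f x) <= 1"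
  and f0: "!!x. x ~: Om ==> f x = 0" and AT: "AT p UNIV f"
 obtains G where "sobolev_grad p f G" "test_limit p Om f G"
proof -
 have bO: "bounded Om" using l by (simp add: lipschitz_domain_def)
 define Q where "Q r z \<longleftrightarrow> 0 < r & (ALL w. w : bmeas --> (ALL x. abs(w x) <= 1) --> (ALL x. x ~: Om \<inter> ball z r --> w x = 0) --> AT p UNIV w
  --> (EX G. sobolev_grad p w G & test_limit p Om w G))" for r z
 have "EX r. Q r z" if "z : closure Om" for z
 proof (rule test_limit_local[OF p l that])
  fix r assume "0 < r" "!!w. w : bmeas ==> (!!x. abs(w x) <= 1) ==> (!!x. x ~: Om \<inter> ball z r ==> w x = 0) ==> AT p UNIV w
  ==> EX G. sobolev_grad p w G & test_limit p Om w G"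
  then have "Q r z" unfolding Q_def by simp
  then show ?thesis by blast
 qed
 then obtain r where Q: "!!z. z : closure Om ==> Q (r z) z" by metis
 then have r: "!!z. z : closure Om ==> 0 < r z" by (simp add: Q_def)
 have cC: "compact (closure Om)" using bO by (simp add: compact_closure)
 have cov: "closure Om \<subseteq> (\<Union>z\<in>closure Om. ball z (r z / 2))" using r by force
 obtain Z where Z: "Z \<subseteq> closure Om" "finite Z" "closure Om \<subseteq> (\<Union>z\<in>Z. ball z (r z / 2))"
  using compactE_image[OF cC open_ball cov] by blast
 have *: "EX G. sobolev_grad p w G & test_limit p Om w G"
  if "F \<subseteq> Z" and w: "w : bmeas" "!!x. abs(w x) <= 1" "!!x. x ~: Om ==> w x = 0" "!!x. x ~: (\<Union>z\<in>F. ball z (r z / 2)) ==> w x = 0" "AT p UNIV w" for F w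
  using finite_subset[OF that(1) Z(2)] that
 proof (induction F arbitrary: w rule: finite_induct)
  case empty
  then have w0: "w = (%x. 0)" by auto
  have "sobolev_grad p w (%x. 0)" using p by (simp add: w0 sobolev_grad_def wgrad_def)
  moreover have "test_limit p Om w (%x. 0)" unfolding test_limit_def
  proof (intro allI impI exI[of _ "%x. 0"] conjI ballI)
   have "smooth_fun (%x::'a. 0)" using smooth_fun_affine[OF smooth_fun_moll, where k=0 and ?'a='a] by simp
   then show "test_fun Om (%x. 0)" by (rule test_funI[of _ "{}"]) auto
  qed (use p in \<open>auto simp: w0\<close>)
  ultimately show ?case by blast
 next
  case (insert z F)
  note [measurable] = insert.prems(2)
  have zc: "z : closure Om" using insert Z by auto
  let ?b = "cutoff z (r z)"
  have b1: "AT p UNIV (%x. (1 - ?b x) * w x)"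
  proof (rule AT_product[OF _ insert.prems(2) _ _ insert.prems(3) _ _ _ _ _ bO _ insert.prems(6)])
   show "abs((1 - ?b x) - (1 - ?b y)) <= 2 / r z * norm (x - y)" for x y
    using cutoff_lipschitz[OF r[OF zc], of z x y] by simp
  qed (use p r[OF zc] insert.prems(4) cutoff_bounds[of z "r z"] in \<open>auto simp: less_imp_le\<close>)
  have b2: "AT p UNIV (%x. ?b x * w x)"
   by (rule AT_product[OF _ insert.prems(2) _ _ insert.prems(3) cutoff_bounds cutoff_lipschitz[OF r[OF zc]] _ _ bO _ insert.prems(6)])
    (use p r[OF zc] insert.prems(4) in \<open>auto simp: less_imp_le\<close>)
  have le1: "abs((1 - ?b x) * w x) <= 1" "abs(?b x * w x) <= 1" for x
   using insert.prems(3)[of x] cutoff_bounds[of z "r z" x] by (auto simp: abs_mult intro!: mult_le_one)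
  have "(1 - ?b x) * w x = 0" if "x ~: (\<Union>z\<in>F. ball z (r z / 2))" for x
   using that cutoff_eq_1[OF r[OF zc], of x z] insert.prems(5)[of x] by (cases "x : ball z (r z / 2)") auto
  moreover have "(%x. (1 - ?b x) * w x) : bmeas" "(%x. ?b x * w x) : bmeas" by measurable
  note bm = this
  ultimately obtain G1 where G1: "sobolev_grad p (%x. (1 - ?b x) * w x) G1" "test_limit p Om (%x. (1 - ?b x) * w x) G1"
   using insert.IH[of "%x. (1 - ?b x) * w x"] insert.prems(1,4) le1(1) b1 by auto
  have "?b x * w x = 0" if "x ~: Om \<inter> ball z (r z)" for x using that insert.prems(4)[of x] cutoff_eq_0[OF r[OF zc], of x z] by auto
  then obtain G2 where G2: "sobolev_grad p (%x. ?b x * w x) G2" "test_limit p Om (%x. ?b x * w x) G2"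
   using Q[OF zc] bm(2) le1(2) b2 unfolding Q_def by blast
  have weq: "w = (%x. (1 - ?b x) * w x + ?b x * w x)" by (auto simp: algebra_simps)
  have i1: "integrable lborel (%x. (1 - ?b x) * w x)" by (rule integrable_bounded_support[OF bm(1) le1(1) bO]) (simp add: insert.prems(4))
  have i2: "integrable lborel (%x. ?b x * w x)" by (rule integrable_bounded_support[OF bm(2) le1(2) bO]) (simp add: insert.prems(4))
  have p0: "0 <= p" using p by simp
  have Gm: "G1 : bmeas" "G2 : bmeas" using G1 G2 by (auto simp: sobolev_grad_def)
  show ?case
   using sobolev_grad_add[OF p0 i1 i2 G1(1) G2(1)] test_limit_add[OF p0 bm Gm G1(2) G2(2)] unfolding weq[symmetric] by blast
 qed
 have "EX G. sobolev_grad p f G & test_limit p Om f G"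
 proof (rule *[OF subset_refl fm fb f0 _ AT])
  show "f x = 0" if "x ~: (\<Union>z\<in>Z. ball z (r z / 2))" for x using that Z(3) closure_subset by (intro f0) blast
 qed
 then show thesis using that by blast
qed

lemma test_fun_wgrad:
 fixes \<phi> :: "'a::euclidean_space => real"
 assumes phi: "test_fun Om \<phi>"
 shows "wgrad Om \<phi> (%x. \<Sum>b\<in>Basis. dd \<phi> x b *\<^sub>R b)"
 unfolding wgrad_def
proof (intro allI impI)
 fix \<psi> i assume psi: "test_fun Om \<psi>" and i: "i : (Basis :: 'a set)"
 obtain C where C: "0 <= C" "!!x h. abs(\<phi> (x + h) - \<phi> x - dd \<phi> x h) <= C * (norm h)\<^sup>2"
  by (rule test_fun_second_order[OF phi]) (rule that, assumption, fast)
 have lin: "dd \<phi> x (t *\<^sub>R i) = t * dd \<phi> x i" for x t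
  using linear_frechet_derivative[of \<phi> "at x"] test_fun_smooth[OF phi] unfolding smooth_fun_def by (metis iter_dd.simps(1) linear_scale real_scaleR_def)
 have "(LL x. dd \<phi> x i * \<psi> x) = - (LL x. \<phi> x * dd \<psi> x i)"
 proof (rule integral_by_parts_remainder[OF test_fun_integrable[OF phi] psi])
  show "integrable lborel (%x. dd \<phi> x i * \<psi> x)"
   by (rule integrable_mult_test_fun[OF test_fun_integrable[OF test_fun_deriv[OF phi]] psi])
  show "abs(\<phi> (x + t *\<^sub>R i) - \<phi> x - t * dd \<phi> x i) <= C * t\<^sup>2" for x t
   using C(2)[of x "t *\<^sub>R i"] i by (simp add: lin)
 qed
 then show "(LL x. \<phi> x * dd \<psi> x i) = - (LL x. ((\<Sum>b\<in>Basis. dd \<phi> x b *\<^sub>R b) \<bullet> i) * \<psi> x)"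
  using i by (simp add: inner_sum_left inner_Basis if_distrib sum.delta cong: if_cong)
qed

lemma in_Lp_of_bounded:
 fixes u :: "'a::euclidean_space => real"
 assumes "0 <= p" "bounded Om" "Om : sets borel" "u : bmeas" "!!x. abs(u x) <= 1"
 shows "in_Lp p Om u"
proof -
 have "set_nn_integral lebesgue Om (%x. pw p (u x)) = (NN x. pw p (u x) * ind Om x)"
  by (rule set_nn_integral_cong_AE_lebesgue) simp
 also have "... <= (NN x. ind Om x)"
  using assms by (intro nn_integral_mono) (auto simp: indicator_def powr_le1)
 also have "... < \<infinity>" using emeasure_lborel_bounded[OF assms(2)] assms(3) by simp
 finally show ?thesis using assms by (simp add: in_Lp_def borel_imp_lebesgue_on)
qed

theorem W01p_of_AT:
 fixes Om :: "'a::euclidean_space set" and f :: "'a => real"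
 assumes p: "1 < p" and l: "lipschitz_domain Om" and fm [measurable]: "f : bmeas" and fb: "!!x. abs(f x) <= 1"
  and f0: "!!x. x ~: Om ==> f x = 0" and AT: "AT p UNIV f"
 shows "W01p p Om f"
proof -
 have O: "open Om" and bO: "bounded Om" using l by (auto simp: lipschitz_domain_def)
 then have Om [measurable]: "Om : sets borel" by auto
 have p0: "0 <= p" "0 < p" using p by auto
 obtain G where G: "sobolev_grad p f G" "test_limit p Om f G" by (rule test_limit_of_AT[OF p l fm fb f0 AT])
 then have Gm [measurable]: "G : bmeas" and Gw: "wgrad UNIV f G" and Gp: "(NN x. en (norm (G x) powr p)) < \<infinity>" by (auto simp: sobolev_grad_def)
 have sub: "(NN x. q x * ind Om x) <= (NN x. q x)" for q :: "'a => ennreal" by (intro nn_integral_mono) (auto simp: indicator_def)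
 have wG: "weak_grad p Om f G"
  by (rule weak_grad_of_wgrad[OF p0(1) O wgrad_mono[OF Gw subset_UNIV] borel_imp_lebesgue_on[OF fm] fm _ Gm]) (use le_less_trans[OF sub Gp] in auto)
 have W1: "W1p p Om f" unfolding W1p_def using in_Lp_of_bounded[OF p0(1) bO Om fm fb] wG by blast
 define D where "D \<phi> x = (\<Sum>b\<in>Basis. dd \<phi> x b *\<^sub>R b)" for \<phi> and x :: 'a
 have Db: "D \<phi> x \<bullet> b = dd \<phi> x b" if "b : Basis" for \<phi> x b
  using that by (simp add: D_def inner_sum_left inner_Basis if_distrib sum.delta cong: if_cong)
 define c where "c = real DIM('a) powr p * real DIM('a)"
 have c: "0 < c" by (simp add: c_def)
 define R where "R e \<phi> \<longleftrightarrow> test_fun Om \<phi> & (NN x. pw p (\<phi> x - f x)) <= en e &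
  (NN x. en (norm (D \<phi> x - G x) powr p)) <= en (c * e)" for e \<phi>
 have "EX \<phi>. R e \<phi>" if e: "0 < e" for e
 proof -
  obtain \<phi> where phi: "test_fun Om \<phi>" "(NN x. pw p (\<phi> x - f x)) <= en e"
   "!!b. b : Basis ==> (NN x. pw p (dd \<phi> x b - G x \<bullet> b)) <= en e"
   using G(2) e unfolding test_limit_def by blast
  note [measurable] = smooth_fun_deriv_borel[OF test_fun_smooth[OF phi(1)]]
  have "(NN x. en (norm (D \<phi> x - G x) powr p))
   <= (NN x. en (real DIM('a) powr p) * (\<Sum>b\<in>Basis. pw p (dd \<phi> x b - G x \<bullet> b)))"
  proof (rule nn_integral_mono)
   fix x
   have "norm (D \<phi> x - G x) powr p <= real DIM('a) powr p * (\<Sum>b\<in>Basis. abs(dd \<phi> x b - G x \<bullet> b) powr p)"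
    using norm_powr_le_Basis[OF p0(2), of "D \<phi> x - G x"] by (simp add: inner_diff_left Db)
   then show "en (norm (D \<phi> x - G x) powr p) <= en (real DIM('a) powr p) * (\<Sum>b\<in>Basis. pw p (dd \<phi> x b - G x \<bullet> b))"
    by (simp add: ennreal_leI sum_ennreal sum_nonneg flip: ennreal_mult)
  qed
  also have "... = en (real DIM('a) powr p) * (\<Sum>b\<in>Basis. NN x. pw p (dd \<phi> x b - G x \<bullet> b))"
   by (subst nn_integral_cmult, simp del: sum_ennreal, subst nn_integral_sum) auto
  also have "... <= en (real DIM('a) powr p) * (\<Sum>b\<in>(Basis :: 'a set). en e)" using phi(3) by (intro mult_left_mono sum_mono) auto
  also have "... = en (c * e)" using e by (simp add: c_def ennreal_mult mult.assoc ennreal_of_nat_eq_real_of_nat)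
  finally show ?thesis unfolding R_def using phi by blast
 qed
 then have "EX \<phi>. ALL j. R (1 / real (Suc j)) (\<phi> j)" by (intro choice) simp
 then obtain \<phi> where R: "!!j. R (1 / real (Suc j)) (\<phi> j)" by blast
 have t: "test_fun Om (\<phi> j)" for j using R by (simp add: R_def)
 have wphi: "weak_grad p Om (\<phi> j) (D (\<phi> j))" for j
 proof (rule weak_grad_of_wgrad[OF p0(1) O _ borel_imp_lebesgue_on[OF test_fun_borel[OF t]] test_fun_borel[OF t]])
  show "wgrad Om (\<phi> j) (D (\<phi> j))" unfolding D_def by (rule test_fun_wgrad[OF t])
  note [measurable] = smooth_fun_deriv_borel[OF test_fun_smooth[OF t]]
  show Dm [measurable]: "D (\<phi> j) : bmeas" unfolding D_def by measurable
  obtain a where a: "(NN x. en (norm (G x) powr p)) = en a" "0 <= a" using Gp by (cases "NN x. en (norm (G x) powr p)") auto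
  have "norm (D (\<phi> j) x) <= norm (D (\<phi> j) x - G x) + norm (G x)" for x using norm_triangle_ineq[of "D (\<phi> j) x - G x" "G x"] by simp
  then have "(NN x. pw p (norm (D (\<phi> j) x))) <= en (2 powr p * (c * (1 / real (Suc j)) + a))"
   by (intro nn_integral_powr_add_le[OF p0(1), of "%x. norm (D (\<phi> j) x - G x)" "%x. norm (G x)"]) (use R[of j] a c in \<open>auto simp: R_def\<close>)
  then have "(NN x. en (norm (D (\<phi> j) x) powr p)) < \<infinity>" by (simp add: le_less_trans)
  then show "(NN x. en (norm (D (\<phi> j) x) powr p) * ind Om x) < \<infinity>" by (rule le_less_trans[OF sub])
 qed auto
 have lim: "X ----> 0" if X: "!!j. X j <= en (k * (1 / real (Suc j)))" "0 < k" for X k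
 proof (rule tendsto_0_ennrealI)
  fix e :: real assume e: "0 < e"
  obtain N where N: "inverse (real (Suc N)) < e / k" using reals_Archimedean[of "e / k"] e X(2) by auto
  have "X n <= en e" if "N <= n" for n
  proof -
   have "1 / real (Suc n) <= inverse (real (Suc N))" using that by (simp add: field_simps)
   then have "k * (1 / real (Suc n)) <= k * (e / k)" using N X(2) by (intro mult_left_mono) linarith+
   then show ?thesis using X(1)[of n] X(2) by (auto intro: order_trans ennreal_leI)
  qed
  then show "\<forall>\<^sub>F n in sequentially. X n <= en e" unfolding eventually_sequentially by blast
 qed
 have leb: "set_nn_integral lebesgue Om q <= (NN x. q x)" for q :: "'a => ennreal"
  using sub[of q] set_nn_integral_cong_AE_lebesgue[of Om q q] by simp
 have "Lp_conv p Om \<phi> f" unfolding Lp_conv_def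
  by (rule lim[of _ 1]) (use R in \<open>auto simp: R_def intro!: order_trans[OF leb]\<close>)
 moreover have "(%j. set_nn_integral lebesgue Om (%x. en (norm (D (\<phi> j) x - G x) powr p))) ----> 0"
  by (rule lim[of _ c]) (use R c in \<open>auto simp: R_def intro!: order_trans[OF leb]\<close>)
 ultimately show ?thesis unfolding W01p_def using W1 wG t wphi by (intro conjI exI[of _ G] exI[of _ \<phi>] exI[of _ "%j. D (\<phi> j)"] allI)
qed


subsection \<open>Compactness and the liminf inequality\<close>

text \<open>A distance above the level \<open>\<eta>\<close> is at most
  \<open>\<eta> powr (1 - p)\<close> times its \<open>p\<close>-th power; distances below it cost at
  most \<open>\<eta>\<close> times the volume of \<open>S\<close>.\<close>

lemma L1_of_Lp_convergence:
 fixes v :: "nat => 'a::euclidean_space => real"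
 assumes p: "1 <= p" and vm [measurable]: "!!k. v k : bmeas" and um [measurable]: "u : bmeas"
  and b: "!!k x. abs(v k x) <= 1" "!!x. abs(u x) <= 1" and S: "bounded S" and S0: "!!k x. x ~: S ==> v k x = 0" "!!x. x ~: S ==> u x = 0"
  and Sm [measurable]: "S : sets borel" and lim: "(%k. NN x. pw p (v k x - u x)) ----> 0"
 shows "(%k. LL x. abs(v k x - u x)) ----> 0"
proof (rule tendstoI)
 fix e :: real assume e: "0 < e"
 define V where "V = measure lborel S"
 have V: "emeasure lborel S = en V" "0 <= V" using emeasure_lborel_bounded[OF S] by (auto simp: V_def emeasure_eq_ennreal_measure)
 define \<eta> where "\<eta> = e / (2 * (V + 1))"
 have eta: "0 < \<eta>" using e V by (simp add: \<eta>_def)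
 have etaV: "\<eta> * V < e / 2" using e V by (simp add: \<eta>_def field_simps)
 define c where "c = e / 2 * \<eta> powr (p - 1)"
 have c: "0 < c" using e eta by (simp add: c_def)
 have cc: "\<eta> powr (1 - p) * c = e / 2"
 proof -
  have "\<eta> powr (1 - p) * \<eta> powr (p - 1) = 1" using eta by (simp flip: powr_add)
  then show ?thesis by (simp add: c_def)
 qed
 have "\<forall>\<^sub>F k in sequentially. (NN x. pw p (v k x - u x)) < en c" using order_tendstoD(2)[OF lim, of "en c"] c by simp
 then show "\<forall>\<^sub>F k in sequentially. dist (LL x. abs(v k x - u x)) 0 < e"
 proof eventually_elim
  case (elim k)
  have "abs(abs(v k x - u x)) <= 2" for x using b(1)[of k x] b(2)[of x] by simp
  then have i: "integrable lborel (%x. abs(v k x - u x))" by (intro integrable_bounded_support[OF _ _ S]) (auto simp: S0)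
  have pt: "abs(v k x - u x) <= \<eta> * ind S x + \<eta> powr (1 - p) * abs(v k x - u x) powr p" for x
  proof (cases "abs(v k x - u x) <= \<eta>")
   case True
   then show ?thesis using S0(1)[of x k] S0(2)[of x] by (cases "x : S") (auto intro: order_trans)
  next
   case False
   then have d: "0 < abs(v k x - u x)" using eta by linarith
   have "abs(v k x - u x) = abs(v k x - u x) powr (1 - p) * abs(v k x - u x) powr p" using d by (simp flip: powr_add)
   also have "... <= \<eta> powr (1 - p) * abs(v k x - u x) powr p" using False eta p by (intro mult_right_mono powr_mono2') auto
   finally show ?thesis using eta by (simp add: indicator_def)
  qed
  have "en (LL x. abs(v k x - u x)) = (NN x. en (abs(v k x - u x)))" by (rule nn_integral_eq_integral[OF i, symmetric]) auto
  also have "... <= (NN x. en \<eta> * ind S x + en (\<eta> powr (1 - p)) * pw p (v k x - u x))"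
  proof (rule nn_integral_mono)
   fix x
   have "en (abs(v k x - u x)) <= en (\<eta> * ind S x + \<eta> powr (1 - p) * abs(v k x - u x) powr p)" by (rule ennreal_leI[OF pt])
   also have "... = en \<eta> * ind S x + en (\<eta> powr (1 - p)) * pw p (v k x - u x)"
    using eta by (simp add: ennreal_mult ennreal_indicator)
   finally show "en (abs(v k x - u x)) <= en \<eta> * ind S x + en (\<eta> powr (1 - p)) * pw p (v k x - u x)" .
  qed
  also have "... = en \<eta> * en V + en (\<eta> powr (1 - p)) * (NN x. pw p (v k x - u x))"
   by (simp add: nn_integral_add nn_integral_cmult V(1))
  also have "... <= en \<eta> * en V + en (\<eta> powr (1 - p)) * en c" using elim by (intro add_left_mono mult_left_mono) auto
  also have "... = en (\<eta> * V + e / 2)" unfolding cc[symmetric] using eta V c by (simp add: ennreal_mult)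
  finally have "(LL x. abs(v k x - u x)) <= \<eta> * V + e / 2" using eta V e by (subst (asm) ennreal_le_iff) auto
  then show ?case using etaV by (simp add: dist_real_def)
 qed
qed

lemma Lp_of_AE_convergence:
 fixes v :: "nat => 'a::euclidean_space => real"
 assumes p: "0 < p" and vm [measurable]: "!!k. v k : bmeas" and um [measurable]: "u : bmeas"
  and b: "!!k x. abs(v k x) <= 1" "!!x. abs(u x) <= 1" and S: "bounded S" and S0: "!!k x. x ~: S ==> v k x = 0" "!!x. x ~: S ==> u x = 0"
  and Sm [measurable]: "S : sets borel" and lim: "AE x in lborel. (%k. v k x) ----> u x"
 shows "(%k. NN x. pw p (v k x - u x)) ----> 0"
proof -
 have "(%k. NN x. pw p (v k x - u x)) ----> (\<integral>\<^sup>+x. 0 \<partial>(lborel :: 'a measure))"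
 proof (rule nn_integral_dominated_convergence[where w="%x. en (2 powr p) * ind S x"])
  show "AE x in lborel. pw p (v j x - u x) <= en (2 powr p) * ind S x" for j
  proof (rule AE_I2)
   fix x
   have "abs(v j x - u x) <= 2" using b(1)[of j x] b(2)[of x] by simp
   then have "abs(v j x - u x) powr p <= 2 powr p" using p by (intro powr_mono2) auto
   then show "pw p (v j x - u x) <= en (2 powr p) * ind S x" using S0(1)[of x j] S0(2)[of x] by (cases "x : S") (auto intro: ennreal_leI)
  qed
  show "(NN x. en (2 powr p) * ind S x) < \<infinity>" using emeasure_lborel_bounded[OF S] by (simp add: nn_integral_cmult ennreal_mult_less_top)
  show "AE x in lborel. (%i. pw p (v i x - u x)) ----> 0"
   using lim
  proof eventually_elim
   case (elim x)
   have "(%i. abs(v i x - u x) powr p) ----> abs(u x - u x) powr p" using elim p by (intro tendsto_powr' tendsto_intros) auto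
   then have "(%i. pw p (v i x - u x)) ----> pw p (u x - u x)" by (rule tendsto_ennrealI)
   then show ?case by simp
  qed
 qed auto
 then show ?thesis by simp
qed

text \<open>The excess of \<open>abs (u x)\<close> over 1 is at most the distance of
  \<open>u x\<close> to any number of modulus at most 1, so its integral is dominated by a sequence
  tending to 0.\<close>

lemma AE_le_1_of_Lp_convergence:
 fixes v :: "nat => 'a::euclidean_space => real"
 assumes p: "0 < p" and um [measurable]: "u : bmeas" "S : sets borel"
  and b: "!!k x. abs(v k x) <= 1" and lim: "(%k. NN x. pw p (v k x - u x) * ind S x) ----> 0"
 shows "AE x in lborel. x : S --> abs(u x) <= 1"
proof -
 let ?q = "%x. en ((max 0 (abs(u x) - 1)) powr p) * ind S x"
 have "(NN x. ?q x) <= (NN x. pw p (v k x - u x) * ind S x)" for k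
 proof (intro nn_integral_mono mult_right_mono ennreal_leI powr_mono2)
  show "max 0 (abs(u x) - 1) <= abs(v k x - u x)" for x using b[of k x] by linarith
 qed (use p in auto)
 then have "(NN x. ?q x) <= 0" by (intro LIMSEQ_le_const[OF lim]) auto
 then have "(NN x. ?q x) = 0" by simp
 then have "AE x in lborel. ?q x = 0" by (subst (asm) nn_integral_0_iff_AE) auto
 then show ?thesis by (rule AE_mp) (auto simp: indicator_def split: if_splits intro!: AE_I2)
qed

text \<open>Pairs outside \<open>Om\<close> contribute nothing. The two kinds of mixed pairs are
  exchanged by reversing \<open>h\<close>, and they contribute equally because the kernel is
  even.\<close>

lemma energy_UNIV_le:
 fixes v :: "'a::euclidean_space => real"
 assumes vm [measurable]: "v : bmeas" and Om [measurable]: "Om : sets borel" and v0: "!!x. x ~: Om ==> v x = 0"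
  and km [measurable]: "k : bmeas" and even: "!!h. k (- h) = k h"
 shows "energy p k UNIV v <= energy p k Om v
  + 2 * (NN h. en (k h) * (NN x. pw p (v (x + h) - v x) * ind Om x * ind (- Om) (x + h)))"
proof -
 define C where "C h = (NN x. pw p (v (x + h) - v x) * ind Om x * ind (- Om) (x + h))" for h
 have Cm [measurable]: "C : bmeas" unfolding C_def by measurable
 have t: "trd p UNIV v h <= trd p Om v h + (C h + C (- h))" for h
 proof -
  have "C (- h) = (NN x. pw p (v (x + h + - h) - v (x + h)) * ind Om (x + h) * ind (- Om) (x + h + - h))"
   unfolding C_def by (rule nn_integral_translate[symmetric]) measurable
  then have C': "C (- h) = (NN x. pw p (v (x + h) - v x) * ind Om (x + h) * ind (- Om) x)"
   by (simp add: abs_minus_commute)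
  have "trd p UNIV v h <= (NN x. pw p (v (x + h) - v x) * ind Om x * ind Om (x + h)
    + (pw p (v (x + h) - v x) * ind Om x * ind (- Om) (x + h)
    + pw p (v (x + h) - v x) * ind Om (x + h) * ind (- Om) x))"
   unfolding trd_def by (intro nn_integral_mono) (auto simp: indicator_def v0)
  also have "... = trd p Om v h + (C h + C (- h))" unfolding C' unfolding trd_def C_def by (simp add: nn_integral_add)
  finally show ?thesis .
 qed
 have "(NN h. en (k h) * C (- h)) = (NN h. en (k (- h)) * C (- h))" by (simp add: even)
 also have "... = (NN h. en (k h) * C h)"
  using nn_integral_reflect[of "%h. en (k h) * C h" 0] by simp
 finally have r: "(NN h. en (k h) * C (- h)) = (NN h. en (k h) * C h)" .
 have "energy p k UNIV v <= (NN h. en (k h) * trd p Om v h + (en (k h) * C h + en (k h) * C (- h)))"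
  unfolding energy_def distrib_left[symmetric] using t by (intro nn_integral_mono mult_left_mono) auto
 also have "... = energy p k Om v + ((NN h. en (k h) * C h) + (NN h. en (k h) * C (- h)))"
  unfolding energy_def by (simp add: nn_integral_add)
 finally show ?thesis unfolding r unfolding C_def by (simp only: mult_2)
qed

text \<open>The representative is cut to \<open>Om\<close>, and the factor 2 undoes the 1/2 in
  \<open>Kp_s\<close>. With zero exterior values the interaction with the complement belongs to this
  truncated function, so its energy on the whole space is bounded too.\<close>

lemma Xsp_borel:
 fixes u :: "'a::euclidean_space => real"
 assumes X: "Xsp s p Om u" and s: "s < 1" and Om [measurable]: "Om : sets borel"
 obtains v where "v : bmeas" "!!x. abs(v x) <= 1" "!!x. x ~: Om ==> v x = 0" "AE x in lborel. x : Om --> u x = v x"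
  "energy p (bbm_kernel p s) Om v <= 2 * (en (1 - s) * Kp_s p s u Om)"
  "Xsp0 s p Om u ==> energy p (bbm_kernel p s) UNIV v <= 2 * (en (1 - s) * Kp_s p s u Om)"
proof -
 have um: "u : borel_measurable lebesgue" and ub: "AE x in lebesgue. abs(u x) <= 1" using X by (auto simp: Xsp_def)
 obtain w where wm [measurable]: "w : bmeas" and wb: "!!x. abs(w x) <= 1" and uw: "AE x in lborel. u x = w x"
  by (rule borel_version_bounded[OF um ub]) (rule that, assumption, fast, assumption)
 define v where "v x = ind Om x * w x" for x
 have vm [measurable]: "v : bmeas" unfolding v_def by measurable
 have v0: "v x = 0" if "x ~: Om" for x using that by (simp add: v_def)
 have uv: "AE x in lborel. x : Om --> u x = v x" using uw by eventually_elim (simp add: v_def)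
 have two: "2 * (en (1 / 2) * E + C) = E + 2 * C" for E C
 proof -
  have "2 * en (1 / 2) = en 2 * en (1 / 2)" by simp
  also have "... = 1" by (subst ennreal_mult[symmetric]) auto
  finally show ?thesis by (simp add: distrib_left flip: mult.assoc)
 qed
 have "trd p Om v h = trd p Om w h" for h unfolding trd_def by (intro nn_integral_cong) (auto simp: indicator_def v_def)
 then have "energy p (bbm_kernel p s) Om v = energy p (bbm_kernel p s) Om w" by (simp add: energy_def)
 then have e1: "energy p (bbm_kernel p s) Om v <= 2 * (en (1 - s) * Kp_s p s u Om)"
  unfolding Kp_s_borel[OF uw wm Om s] two by simp
 have e2: "energy p (bbm_kernel p s) UNIV v <= 2 * (en (1 - s) * Kp_s p s u Om)" if "Xsp0 s p Om u"
 proof -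
  have "AE x in lborel. x ~: Om --> u x = 0" using that by (simp add: Xsp0_def AE_completion_iff)
  then have uv': "AE x in lborel. u x = v x" using uv
  proof eventually_elim
   case (elim x) then show ?case using v0[of x] by (cases "x : Om") auto
  qed
  show ?thesis unfolding Kp_s_borel[OF uv' vm Om s] two
   by (rule energy_UNIV_le[OF vm Om v0]) (auto simp: bbm_kernel_def)
 qed
 show thesis by (rule that[OF vm _ _ uv e1 e2]) (auto simp: v0 v_def indicator_def wb)
qed

text \<open>Infinitely many energies at most \<open>l\<close> are what a liminf below
  \<open>l\<close> provides; along a subsequence of these indices the uniform bound of
  \<open>energy_liminf\<close> holds.\<close>

lemma bbm_liminf:
 fixes w :: "nat => 'a::euclidean_space => real"
 assumes p: "1 < p" and s: "!!i. 0 < s i & s i < 1" and s_lim: "s ----> 1" and U: "open U" and S: "bounded S"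
  and um: "u : bmeas" "!!x. abs(u x) <= 1" "!!x. x ~: S ==> u x = 0"
  and wm: "!!i. w i : bmeas" "!!i x. abs(w i x) <= 1" "!!i x. x ~: S ==> w i x = 0"
  and L1: "(%i. LL y. abs(w i y - u y)) ----> 0"
  and l: "infinite {i. energy p (bbm_kernel p (s i)) U (w i) <= en l}" "0 <= l"
 obtains G where "G : bmeas" "!!x. x ~: U ==> G x = 0" "!!b. b : Basis ==> integrable lborel (%x. G x \<bullet> b)" "wgrad U u G"
  "(NN x. en (norm (G x) powr p)) <= en (l / (cnp p TYPE('a) * (real DIM('a) + p) / p))"
proof -
 obtain r :: "nat => nat" where r: "strict_mono r" "!!n. energy p (bbm_kernel p (s (r n))) U (w (r n)) <= en l" using infinite_enumerate[OF l(1)] by auto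
 have sr: "(%i. s (r i)) ----> 1" using LIMSEQ_subseq_LIMSEQ[OF s_lim r(1)] by (simp add: o_def)
 have L1r: "(%i. LL y. abs(w (r i) y - u y)) ----> 0" using LIMSEQ_subseq_LIMSEQ[OF L1 r(1)] by (simp add: o_def)
 have ks: "kernel_sequence p (%i. bbm_kernel p (s (r i)) :: 'a => real)
  (%i d. cnp p TYPE('a) * (real DIM('a) + p) / p * d powr (p * (1 - s (r i)))) (cnp p TYPE('a) * (real DIM('a) + p) / p)"
  by (rule kernel_sequence_bbm[OF p s sr])
 show thesis
  by (rule kernel_sequence.energy_liminf[OF ks U um(1,2) wm(1) wm(2) S um(3) wm(3) r(2) l(2) L1r]) (assumption, assumption, rule that)
qed

lemma powr_integrable_of_bounded:
 fixes f :: "'a::euclidean_space => real"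
 assumes p: "1 <= p" and fi: "integrable lborel f" and fb: "!!x. abs(f x) <= 1"
 shows "(NN x. pw p (f x)) < \<infinity>"
proof -
 have "abs(f x) powr p <= abs(f x)" for x
  using fb[of x] powr_mono'[of 1 p "abs(f x)"] p by simp
 then have "(NN x. pw p (f x)) <= (NN x. en (norm (f x)))" by (intro nn_integral_mono ennreal_leI) simp
 also have "... < \<infinity>" using fi by (simp add: integrable_iff_bounded)
 finally show ?thesis .
qed

lemma AT_of_sobolev_grad:
 fixes f :: "'a::euclidean_space => real"
 assumes p: "1 <= p" and fm [measurable]: "f : bmeas" and fb: "!!x. abs(f x) <= 1" and S: "bounded S" "!!x. x ~: S ==> f x = 0"
  and G: "sobolev_grad p f G"
 shows "AT p UNIV f"
proof -
 have Gm [measurable]: "G : bmeas" and Gi: "!!b. b : Basis ==> integrable lborel (%x. G x \<bullet> b)" and w: "wgrad UNIV f G" using G by (auto simp: sobolev_grad_def)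
 obtain I where I: "(NN x. en (norm (G x) powr p)) = en I" "0 <= I" using G by (cases "NN x. en (norm (G x) powr p)") (auto simp: sobolev_grad_def)
 have fi: "integrable lborel f" by (rule integrable_bounded_support[OF fm fb S])
 have fp: "(NN x. pw p (f x)) < \<infinity>" by (rule powr_integrable_of_bounded[OF p fi fb])
 show ?thesis
 proof (rule AT_of_trd[OF _ I(2)])
  fix h :: 'a
  have "trd p UNIV f h = (NN x. pw p (f (x + h) - f x) * ind UNIV x)" by (simp add: trd_def)
  also have "... <= (NN x. pw p (G x \<bullet> h) * ind UNIV x)" by (rule translation_estimate[OF p w fi fp Gm Gi]) auto
  also have "... <= en (I * norm h powr p)" by (rule nn_integral_inner_powr_le[OF Gm]) (use p I in auto)
  finally show "trd p UNIV f h <= en (I * norm h powr p)" .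
 qed (use p in simp)
qed

text \<open>The limit is shown to be Sobolev by the lower bound on \<open>Om\<close>. With zero
  exterior values the same bound with \<open>UNIV\<close> in place of \<open>Om\<close> gives a
  gradient of the zero extension on all of space, and from it the approximation by test
  functions.\<close>

theorem compactness:
 fixes Om :: "'a::euclidean_space set" and uk :: "nat => 'a => real"
 assumes s: "!!k. 0 < s k & s k < 1" and s_lim: "s ----> 1" and p: "1 < p" and dom: "lipschitz_domain Om"
  and M: "0 < M" and X: "!!k. Xsp (s k) p Om (uk k)" and en: "!!k. en (1 - s k) * Kp_s p (s k) (uk k) Om <= en M"
 obtains r u where "strict_mono r" "W1p p Om u" "Lp_conv p Om (%k. uk (r k)) u" "(ALL k. Xsp0 (s k) p Om (uk k)) ==> W01p p Om u"
proof -
 have O: "open Om" and bO: "bounded Om" using dom by (auto simp: lipschitz_domain_def)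
 then have Om [measurable]: "Om : sets borel" by auto
 have s1: "s k < 1" for k using s[of k] by simp
 define Q where "Q k v \<longleftrightarrow> v : bmeas & (ALL x. abs(v x) <= 1) & (ALL x. x ~: Om --> v x = 0) & (AE x in lborel. x : Om --> uk k x = v x)
  & energy p (bbm_kernel p (s k)) Om v <= en (2 * M) & (Xsp0 (s k) p Om (uk k) --> energy p (bbm_kernel p (s k)) UNIV v <= en (2 * M))" for k v
 have le: "2 * (en (1 - s k) * Kp_s p (s k) (uk k) Om) <= en (2 * M)" for k
  using mult_left_mono[OF en[of k], of "en 2"] M by (simp add: ennreal_mult)
 have "EX v. Q k v" for k
 proof (rule Xsp_borel[OF X s1 Om])
  fix v assume "v : bmeas" "!!x. abs(v x) <= 1" "!!x. x ~: Om ==> v x = 0" "AE x in lborel. x : Om --> uk k x = v x"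
   "energy p (bbm_kernel p (s k)) Om v <= 2 * (en (1 - s k) * Kp_s p (s k) (uk k) Om)"
   "Xsp0 (s k) p Om (uk k) ==> energy p (bbm_kernel p (s k)) UNIV v <= 2 * (en (1 - s k) * Kp_s p (s k) (uk k) Om)"
  then have "Q k v" unfolding Q_def using order_trans[OF _ le[of k]] by simp
  then show "EX v. Q k v" by blast
 qed
 then obtain v where Q: "!!k. Q k (v k)" by metis
 then have vm [measurable]: "!!k. v k : bmeas" and vb: "!!k x. abs(v k x) <= 1" and v0: "!!k x. x ~: Om ==> v k x = 0"
  and uv: "!!k. AE x in lborel. x : Om --> uk k x = v k x" and ev: "!!k. energy p (bbm_kernel p (s k)) Om (v k) <= en (2 * M)"
  and ev0: "!!k. Xsp0 (s k) p Om (uk k) ==> energy p (bbm_kernel p (s k)) UNIV (v k) <= en (2 * M)"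
  by (simp_all add: Q_def)
 have M2: "0 <= 2 * M" using M by simp
 obtain r f where r: "strict_mono r" and fm [measurable]: "f : bmeas" and fb: "!!x. abs(f x) <= 1" and f0: "!!x. x ~: Om ==> f x = 0"
  and lim: "AE x in lborel. (%i. v (r i) x) ----> f x"
  by (rule nonlocal_compactness[OF p O bO s s_lim vm vb v0 ev M2]) (assumption, rule that, assumption, assumption, fast, fast, assumption)
 have p0: "0 < p" "0 <= p" "1 <= p" using p by auto
 have Lp: "(%i. NN x. pw p (v (r i) x - f x)) ----> 0"
  by (rule Lp_of_AE_convergence[OF p0(1) vm fm vb fb bO v0 f0 Om lim])
 have L1: "(%i. LL x. abs(v (r i) x - f x)) ----> 0"
  by (rule L1_of_Lp_convergence[OF p0(3) vm fm vb fb bO v0 f0 Om Lp])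
 have sr: "(%i. s (r i)) ----> 1" using LIMSEQ_subseq_LIMSEQ[OF s_lim r] by (simp add: o_def)
 have eq: "set_nn_integral lebesgue Om (%x. pw p (uk (r i) x - f x)) = (NN x. pw p (v (r i) x - f x))" for i
 proof -
  have "set_nn_integral lebesgue Om (%x. pw p (uk (r i) x - f x)) = (NN x. pw p (v (r i) x - f x) * ind Om x)"
   by (rule set_nn_integral_cong_AE_lebesgue, use uv[of "r i"] in \<open>rule AE_mp\<close>) (auto intro!: AE_I2)
  also have "... = (NN x. pw p (v (r i) x - f x))" by (intro nn_integral_cong) (auto simp: indicator_def v0 f0)
  finally show ?thesis .
 qed
 have conv: "Lp_conv p Om (%k. uk (r k)) f" unfolding Lp_conv_def eq by (rule Lp)
 have inf: "infinite {i. energy p (bbm_kernel p (s (r i))) Om (v (r i)) <= en (2 * M)}" using ev by simp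
 obtain G where G: "G : bmeas" "wgrad Om f G" "(NN x. en (norm (G x) powr p)) <= en (2 * M / (cnp p TYPE('a) * (real DIM('a) + p) / p))"
  by (rule bbm_liminf[OF p s sr O bO fm fb f0 vm vb v0 L1 inf M2]) (assumption, assumption, rule that)
 have sub: "(NN x. q x * ind Om x) <= (NN x. q x)" for q :: "'a => ennreal" by (intro nn_integral_mono) (auto simp: indicator_def)
 have "(NN x. en (norm (G x) powr p) * ind Om x) < \<infinity>" by (rule le_less_trans[OF order_trans[OF sub G(3)]]) simp
 then have "weak_grad p Om f G" by (intro weak_grad_of_wgrad[OF p0(2) O G(2) borel_imp_lebesgue_on[OF fm] fm _ G(1)]) auto
 then have W: "W1p p Om f" unfolding W1p_def using in_Lp_of_bounded[OF p0(2) bO Om fm fb] by blast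
 have W0: "W01p p Om f" if "ALL k. Xsp0 (s k) p Om (uk k)"
 proof (rule W01p_of_AT[OF p dom fm fb f0])
  have inf0: "infinite {i. energy p (bbm_kernel p (s (r i))) UNIV (v (r i)) <= en (2 * M)}" using ev0 that by simp
  obtain H where H: "H : bmeas" "!!b. b : Basis ==> integrable lborel (%x. H x \<bullet> b)" "wgrad UNIV f H" "(NN x. en (norm (H x) powr p)) <= en (2 * M / (cnp p TYPE('a) * (real DIM('a) + p) / p))"
   by (rule bbm_liminf[OF p s sr open_UNIV bO fm fb f0 vm vb v0 L1 inf0 M2]) (assumption, assumption, rule that)
  have "sobolev_grad p f H" unfolding sobolev_grad_def using H by (simp add: le_less_trans)
  then show "AT p UNIV f" by (intro AT_of_sobolev_grad[OF p0(3) fm fb bO f0])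
 qed
 show thesis by (rule that[OF r W conv W0])
qed

lemma liminf_add_ennreal:
 fixes a b :: "nat => ennreal"
 shows "liminf a + liminf b <= liminf (%k. a k + b k)"
proof -
 have i: "incseq (%n. INF m\<in>{n..}. f m)" for f :: "nat => ennreal" by (intro incseq_SucI INF_superset_mono) auto
 have "liminf a + liminf b = (SUP n. (INF m\<in>{n..}. a m) + (INF m\<in>{n..}. b m))"
  unfolding liminf_SUP_INF by (rule ennreal_SUP_add[OF i i, symmetric])
 also have "... <= (SUP n. INF m\<in>{n..}. a m + b m)" by (intro SUP_mono' INF_greatest add_mono INF_lower)
 finally show ?thesis unfolding liminf_SUP_INF .
qed

definition clamp1 :: "real => real" where "clamp1 x = max (-1) (min 1 x)"

text \<open>\<open>W\<close> is constrained only on the interval. Composed with the clamp it is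
  lower semicontinuous on the whole line and thus Borel, and the clamp fixes the values of bounded
  representatives.\<close>

lemma lsc_clamp_borel:
 assumes "lsc_on_interval W"
 shows "(%x. W (clamp1 x)) : bmeas"
proof (rule borel_measurableI_greater)
 fix c
 have "open {x. c < W (clamp1 x)}"
  unfolding open_dist
 proof (intro ballI)
  fix x assume "x : {x. c < W (clamp1 x)}"
  then have "c < W (clamp1 x)" "clamp1 x : {-1..1}" by (auto simp: clamp1_def)
  then obtain d where d: "0 < d" "!!y. y : {-1..1} ==> abs(y - clamp1 x) < d ==> c < W y"
   using assms unfolding lsc_on_interval_def by blast
  have "c < W (clamp1 y)" if "dist y x < d" for y
   by (rule d(2)) (use that in \<open>auto simp: clamp1_def dist_real_def\<close>)
  then show "EX e>0. ALL y. dist y x < e --> y : {x. c < W (clamp1 x)}" using d(1) by blast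
 qed
 then show "{x : space borel. c < W (clamp1 x)} : sets borel" by simp
qed

lemma lsc_liminf_ennreal:
 assumes W: "lsc_on_interval W" and x: "abs x <= 1" "!!k. abs(y k) <= 1" and lim: "y ----> x"
 shows "en (W x) <= liminf (%k. en (W (y k)))"
 unfolding le_Liminf_iff
proof (intro allI impI)
 fix c assume c: "c < en (W x)"
 then obtain c' where c': "c = en c'" "0 <= c'" by (cases c) auto
 then have "c' < W x" using c by (simp add: ennreal_less_iff)
 moreover have "x : {-1..1}" using x(1) by auto
 ultimately obtain d where d: "0 < d" "!!y. y : {-1..1} ==> abs(y - x) < d ==> c' < W y" using W unfolding lsc_on_interval_def by blast
 have "\<forall>\<^sub>F k in sequentially. dist (y k) x < d" using lim d(1) by (rule tendstoD)
 then show "\<forall>\<^sub>F k in sequentially. c < en (W (y k))"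
 proof eventually_elim
  case (elim k)
  have "y k : {-1..1}" using x(2)[of k] by auto
  then have "c' < W (y k)" using d(2) elim by (simp add: dist_real_def)
  then show ?case using c' by (simp add: ennreal_less_iff)
 qed
qed

text \<open>Pass first to a subsequence realising the liminf, then to a further one converging
  almost everywhere; Fatou's lemma and lower semicontinuity conclude.\<close>

lemma potential_liminf:
 fixes w :: "nat => 'a::euclidean_space => real"
 assumes W: "lsc_on_interval W" and um [measurable]: "u : bmeas" and ub: "!!x. abs(u x) <= 1"
  and wm [measurable]: "!!i. w i : bmeas" and wb: "!!i x. abs(w i x) <= 1"
  and i: "!!i. integrable lborel (%x. w i x - u x)" and Om [measurable]: "Om : sets borel"
  and L1: "(%i. LL y. abs(w i y - u y)) ----> 0"
 shows "(NN x. en (W (u x)) * ind Om x) <= liminf (%i. NN x. en (W (w i x)) * ind Om x)"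
proof -
 let ?b = "%i. NN x. en (W (w i x)) * ind Om x"
 obtain r where r: "strict_mono r" "(?b \<circ> r) ----> liminf ?b" using liminf_subseq_lim[of ?b] by blast
 have "(%n. LL x. norm (w (r n) x - u x)) ----> 0" using LIMSEQ_subseq_LIMSEQ[OF L1 r(1)] by (simp add: o_def)
 then obtain q where q: "strict_mono q" "AE x in lborel. (%n. w (r (q n)) x - u x) ----> 0"
  using tendsto_L1_AE_subseq[of lborel "%n x. w (r n) x - u x"] i by blast
 have cl: "clamp1 (w i x) = w i x" for i x using wb[of i x] by (auto simp: clamp1_def)
 have "(%x. en (W (clamp1 (w i x))) * ind Om x) : bmeas" for i
  using lsc_clamp_borel[OF W] by measurable
 then have m: "(%x. en (W (w i x)) * ind Om x) : borel_measurable lborel" for i unfolding cl by simp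
 have "(NN x. en (W (u x)) * ind Om x) <= (NN x. liminf (%n. en (W (w (r (q n)) x)) * ind Om x))"
 proof (rule nn_integral_mono_AE, use q(2) in eventually_elim)
  fix x assume "(%n. w (r (q n)) x - u x) ----> 0"
  then have "(%n. w (r (q n)) x) ----> u x" by (simp add: LIM_zero_iff)
  then show "en (W (u x)) * ind Om x <= liminf (%n. en (W (w (r (q n)) x)) * ind Om x)"
   using lsc_liminf_ennreal[OF W ub, of "%n. w (r (q n)) x"] wb by (cases "x : Om") auto
 qed
 also have "... <= liminf (%n. ?b (r (q n)))" by (rule nn_integral_liminf) (rule m)
 also have "... = liminf ?b"
  using LIMSEQ_subseq_LIMSEQ[OF r(2) q(1)] by (intro lim_imp_Liminf) (auto simp: o_def)
 finally show ?thesis .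
qed

text \<open>Kinetic part \<open>a\<close> and potential part \<open>b\<close> are treated
  separately, as the liminf is superadditive. If \<open>liminf a\<close> is infinite there is
  nothing to show; if it is finite, the lower bound first yields that \<open>u\<close> is a Sobolev
  function and then the sharp inequality.\<close>

theorem liminf_inequality:
 fixes Om :: "'a::euclidean_space set" and u :: "'a => real" and uk :: "nat => 'a => real"
 assumes s: "!!k. 0 < s k & s k < 1" and s_lim: "s ----> 1" and p: "1 < p" and O: "open Om" and bO: "bounded Om" and W: "lsc_on_interval W"
  and uL: "in_Lp p Om u" and X: "!!k. Xsp (s k) p Om (uk k)" and conv: "Lp_conv p Om uk u"
 shows "Ep_1 W p u Om <= liminf (%k. Ep_s W p (s k) (uk k) Om)"
proof -
 have Om [measurable]: "Om : sets borel" using O by auto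
 have p0: "0 < p" "0 <= p" "1 <= p" using p by auto
 have s1: "s k < 1" for k using s[of k] by simp
 define Q where "Q k v \<longleftrightarrow> v : bmeas & (ALL x. abs(v x) <= 1) & (ALL x. x ~: Om --> v x = 0) & (AE x in lborel. x : Om --> uk k x = v x)
  & energy p (bbm_kernel p (s k)) Om v <= 2 * (en (1 - s k) * Kp_s p (s k) (uk k) Om)" for k v
 have "EX v. Q k v" for k
 proof (rule Xsp_borel[OF X s1 Om])
  fix v assume "v : bmeas" "!!x. abs(v x) <= 1" "!!x. x ~: Om ==> v x = 0" "AE x in lborel. x : Om --> uk k x = v x"
   "energy p (bbm_kernel p (s k)) Om v <= 2 * (en (1 - s k) * Kp_s p (s k) (uk k) Om)"
  then have "Q k v" unfolding Q_def by simp
  then show "EX v. Q k v" by blast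
 qed
 then obtain v where Q: "!!k. Q k (v k)" by metis
 then have vm [measurable]: "!!k. v k : bmeas" and vb: "!!k x. abs(v k x) <= 1" and v0: "!!k x. x ~: Om ==> v k x = 0"
  and uv: "!!k. AE x in lborel. x : Om --> uk k x = v k x" and ev: "!!k. energy p (bbm_kernel p (s k)) Om (v k) <= 2 * (en (1 - s k) * Kp_s p (s k) (uk k) Om)"
  by (simp_all add: Q_def)
 have um: "u : borel_measurable (lebesgue_on Om)" using uL by (simp add: in_Lp_def)
 obtain f0 where f0m [measurable]: "f0 : bmeas" and f00: "!!x. x ~: Om ==> f0 x = 0" and uf0: "AE x in lborel. x : Om --> u x = f0 x"
  by (rule borel_version_on[OF um Om]) (rule that, assumption, fast, assumption)
 have eq: "set_nn_integral lebesgue Om (%x. pw p (uk k x - u x)) = (NN x. pw p (v k x - f0 x) * ind Om x)" for k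
 proof (rule set_nn_integral_cong_AE_lebesgue)
  show "AE x in lborel. x : Om --> pw p (uk k x - u x) = pw p (v k x - f0 x)" using uv[of k] uf0 by eventually_elim auto
 qed
 have lim0: "(%k. NN x. pw p (v k x - f0 x) * ind Om x) ----> 0" using conv unfolding Lp_conv_def eq .
 have f0b: "AE x in lborel. x : Om --> abs(f0 x) <= 1" by (rule AE_le_1_of_Lp_convergence[OF p0(1) f0m Om vb lim0])
 define f where "f x = clamp1 (f0 x)" for x
 have fm [measurable]: "f : bmeas" unfolding f_def clamp1_def by measurable
 have fb: "abs(f x) <= 1" for x by (auto simp: f_def clamp1_def)
 have fz: "f x = 0" if "x ~: Om" for x using f00[OF that] by (simp add: f_def clamp1_def)
 have ff0: "AE x in lborel. f0 x = f x" using f0b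
 proof eventually_elim
  case (elim x) then show ?case using f00[of x] by (cases "x : Om") (auto simp: f_def clamp1_def)
 qed
 have uf: "AE x in lborel. x : Om --> u x = f x" using uf0 ff0 by eventually_elim auto
 have "(NN x. pw p (v k x - f0 x) * ind Om x) = (NN x. pw p (v k x - f x))" for k
 proof (rule nn_integral_cong_AE, use ff0 in eventually_elim)
  fix x assume "f0 x = f x"
  then show "pw p (v k x - f0 x) * ind Om x = pw p (v k x - f x)" using v0[of x k] fz[of x] by (cases "x : Om") auto
 qed
 then have Lp: "(%k. NN x. pw p (v k x - f x)) ----> 0" using lim0 by simp
 have L1: "(%i. LL x. abs(v i x - f x)) ----> 0" by (rule L1_of_Lp_convergence[OF p0(3) vm fm vb fb bO v0 fz Om Lp])
 have fi: "integrable lborel f" by (rule integrable_bounded_support[OF fm fb bO fz])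
 have vi: "integrable lborel (v k)" for k by (rule integrable_bounded_support[OF vm vb bO v0])
 define a where "a k = en (1 - s k) * Kp_s p (s k) (uk k) Om" for k
 define b where "b k = set_nn_integral lebesgue Om (%x. en (W (uk k x)))" for k
 have E: "Ep_s W p (s k) (uk k) Om = a k + b k" for k by (simp add: Ep_s_def a_def b_def)
 define A where "A = cnp p TYPE('a) * (real DIM('a) + p) / p"
 have A: "0 < A" using cnp_pos[OF p0(2), where ?'a='a] p by (simp add: A_def)
 have KA: "K_np p TYPE('a) / (2 * p) = A / 2" using p by (simp add: A_def K_np_def cnp_def field_simps)
 have ub: "AE x in lebesgue. x : Om --> abs(u x) <= 1" unfolding AE_completion_iff using uf by eventually_elim (simp add: fb)
 have grad: "EX G. G : bmeas & (ALL b:Basis. integrable lborel (%x. G x \<bullet> b)) & wgrad Om f G & (ALL x. x ~: Om --> G x = 0) & (NN x. en (norm (G x) powr p)) <= en (2 * l / A)"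
  if l: "liminf a < en l" "0 <= l" for l
 proof -
  have inf: "infinite {k. energy p (bbm_kernel p (s k)) Om (v k) <= en (2 * l)}"
  proof
   assume "finite {k. energy p (bbm_kernel p (s k)) Om (v k) <= en (2 * l)}"
   then have "\<forall>\<^sub>F k in sequentially. ~  energy p (bbm_kernel p (s k)) Om (v k) <= en (2 * l)"
    unfolding cofinite_eq_sequentially[symmetric] eventually_cofinite by simp
   then have "\<forall>\<^sub>F k in sequentially. en l <= a k"
   proof eventually_elim
    case (elim k)
    then have "en 2 * en l < 2 * a k" using ev[of k] l(2) by (simp add: a_def ennreal_mult) 
    then have "~  a k <= en l" using mult_left_mono[of "a k" "en l" "en 2"] by (auto simp: not_le[symmetric])
    then show ?case by simp
   qed
   then have "en l <= liminf a" by (rule Liminf_bounded)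
   then show False using l by simp
  qed
  have l2: "0 <= 2 * l" using l by simp
  obtain G where G: "G : bmeas" "!!x. x ~: Om ==> G x = 0" "!!b. b : Basis ==> integrable lborel (%x. G x \<bullet> b)" "wgrad Om f G"
   "(NN x. en (norm (G x) powr p)) <= en (2 * l / (cnp p TYPE('a) * (real DIM('a) + p) / p))"
   by (rule bbm_liminf[OF p s s_lim O bO fm fb fz vm vb v0 L1 inf l2]) (assumption, assumption, rule that, assumption, fast, fast, assumption, assumption)
  then show ?thesis unfolding A_def by (intro exI[of _ G]) simp
 qed
 have pot: "set_nn_integral lebesgue Om (%x. en (W (u x))) <= liminf b"
 proof -
  have "set_nn_integral lebesgue Om (%x. en (W (u x))) = (NN x. en (W (f x)) * ind Om x)"
   by (rule set_nn_integral_cong_AE_lebesgue, use uf in \<open>rule AE_mp\<close>) (auto intro!: AE_I2)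
  also have "... <= liminf (%k. NN x. en (W (v k x)) * ind Om x)"
   using vi fi by (intro potential_liminf[OF W fm fb vm vb _ Om L1]) auto
  also have "(%k. NN x. en (W (v k x)) * ind Om x) = b"
  proof
   fix k
   show "(NN x. en (W (v k x)) * ind Om x) = b k" unfolding b_def
    by (rule set_nn_integral_cong_AE_lebesgue[symmetric], use uv[of k] in \<open>rule AE_mp\<close>) (auto intro!: AE_I2)
  qed
  finally show ?thesis .
 qed
 have kin: "W1p p Om u & en (K_np p TYPE('a) / (2 * p)) * set_nn_integral lebesgue Om (%x. en (norm ((SOME G. weak_grad p Om u G) x) powr p)) <= liminf a"
  if fin: "liminf a < \<infinity>"
 proof -
  obtain l0 where l0: "liminf a < en l0" "0 <= l0"
  proof -
   obtain c where "liminf a = en c" "0 <= c" using fin by (cases "liminf a") auto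
   then show thesis by (intro that[of "c + 1"]) (auto simp: ennreal_less_iff)
  qed
  obtain G where G: "G : bmeas" "wgrad Om f G" "ALL x. x ~: Om --> G x = 0" "(NN x. en (norm (G x) powr p)) <= en (2 * l0 / A)" using grad[OF l0] by auto
  have "(NN x. en (norm (G x) powr p) * ind Om x) <= (NN x. en (norm (G x) powr p))" by (intro nn_integral_mono) (auto simp: indicator_def)
  also have "... < \<infinity>" using G(4) by (rule le_less_trans) simp
  finally have "weak_grad p Om u G" by (rule weak_grad_of_wgrad[OF p0(2) O G(2) um fm uf G(1)])
  then have W1: "W1p p Om u" using uL by (auto simp: W1p_def)
  obtain g H where g: "g : bmeas" "!!x. x ~: Om ==> g x = 0" "AE x in lborel. x : Om --> u x = g x"
   and Hm [measurable]: "H : bmeas" and H0: "!!x. x ~: Om ==> H x = 0" and Hi: "!!b. b : Basis ==> integrable lborel (%x. H x \<bullet> b)" and Hw: "wgrad Om g H"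
   and Heq: "set_nn_integral lebesgue Om (%x. en (norm ((SOME G. weak_grad p Om u G) x) powr p)) = (NN x. en (norm (H x) powr p))"
  proof (rule W1p_cases[OF p0(3) O bO W1 ub])
   fix v H assume "v : bmeas" "!!x. x ~: Om ==> v x = 0" "AE x in lborel. x : Om --> u x = v x"
    "H : bmeas" "!!x. x ~: Om ==> H x = 0" "!!b. b : Basis ==> integrable lborel (%x. H x \<bullet> b)" "wgrad Om v H"
    "set_nn_integral lebesgue Om (%x. en (norm ((SOME G. weak_grad p Om u G) x) powr p)) = (NN x. en (norm (H x) powr p))"
   then show thesis by (rule that)
  qed
  have gf: "AE x in lborel. g x = f x" using g(3) uf
  proof eventually_elim
   case (elim x) then show ?case using g(2)[of x] fz[of x] by (cases "x : Om") auto
  qed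
  have "wgrad Om f H"
   unfolding wgrad_def
  proof (intro allI impI)
   fix \<phi> :: "'a => real" and i :: 'a assume t: "test_fun Om \<phi>" and i: "i : Basis"
   note [measurable] = g(1) smooth_fun_deriv_borel[OF test_fun_smooth[OF t]]
   have "(LL x. f x * dd \<phi> x i) = (LL x. g x * dd \<phi> x i)"
    by (rule integral_cong_AE, measurable, use gf in eventually_elim) simp
   then show "(LL x. f x * dd \<phi> x i) = - (LL x. (H x \<bullet> i) * \<phi> x)" using Hw t i by (simp add: wgrad_def)
  qed
  note Hwf = this
  \<comment> \<open>The gradient obtained from a bound \<open>l\<close> depends on \<open>l\<close>.
    Uniqueness identifies it with \<open>H\<close> almost everywhere, so \<open>l\<close> may
    decrease to \<open>liminf a\<close>.\<close>
  have "en (A / 2) * (NN x. en (norm (H x) powr p)) <= liminf a"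
  proof (rule dense_ge)
   fix y assume y: "liminf a < y"
   show "en (A / 2) * (NN x. en (norm (H x) powr p)) <= y"
   proof (cases y)
    case (real l)
    then obtain G' where G': "G' : bmeas" "ALL b:Basis. integrable lborel (%x. G' x \<bullet> b)" "wgrad Om f G'" "ALL x. x ~: Om --> G' x = 0" "(NN x. en (norm (G' x) powr p)) <= en (2 * l / A)"
     using grad[of l] y by auto
    have "AE x in lborel. x : Om --> H x = G' x" by (rule wgrad_unique[OF O Hwf G'(3) Hi]) (use G' in auto)
    then have "AE x in lborel. en (norm (H x) powr p) = en (norm (G' x) powr p)"
    proof eventually_elim
     case (elim x) then show ?case using H0[of x] G'(4) by (cases "x : Om") auto
    qed
    then have "(NN x. en (norm (H x) powr p)) = (NN x. en (norm (G' x) powr p))" by (rule nn_integral_cong_AE)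
    then have "en (A / 2) * (NN x. en (norm (H x) powr p)) <= en (A / 2) * en (2 * l / A)" using G'(5) by (intro mult_left_mono) auto
    also have "... = y" using A real by (simp flip: ennreal_mult)
    finally show ?thesis .
   qed simp
  qed
  then show ?thesis using W1 unfolding Heq KA by simp
 qed
 show ?thesis
 proof (cases "liminf a < \<infinity>")
  case True
  have "Ep_1 W p u Om <= liminf a + liminf b" unfolding Ep_1_def using kin[OF True] ub pot by (simp add: add_mono)
  also have "... <= liminf (%k. Ep_s W p (s k) (uk k) Om)" unfolding E by (rule liminf_add_ennreal)
  finally show ?thesis .
 next
  case False
  then have "liminf a = \<infinity>" by (simp add: less_top[symmetric])
  moreover have "liminf a <= liminf (%k. Ep_s W p (s k) (uk k) Om)" unfolding E by (intro Liminf_mono always_eventually) simp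
  ultimately show ?thesis by (simp add: top_unique)
 qed
qed


subsection \<open>The limsup inequality\<close>

lemma bbm_near_le:
 fixes G :: "'a::euclidean_space => 'a"
 assumes p: "0 < p" and s: "0 < s" "s < 1" and d: "0 < d" "d <= 1" and Gm [measurable]: "G : bmeas" and Um [measurable]: "U : sets borel"
 shows "(NN h. en (bbm_kernel p s h) * (NN x. pw p (G x \<bullet> h) * ind U x) * ind (ball 0 d) h)
  <= en (cnp p TYPE('a) * (real DIM('a) + p) / p) * (NN x. en (norm (G x) powr p) * ind U x)"
proof -
 define A where "A = cnp p TYPE('a) * (real DIM('a) + p) / p"
 have A: "0 <= A" using cnp_nonneg[where ?'a='a, of p] p by (simp add: A_def)
 have dp: "d powr (p * (1 - s)) <= 1" using d p s by (intro powr_le1) auto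
 have "(NN h. en (bbm_kernel p s h) * (NN x. pw p (G x \<bullet> h) * ind U x) * ind (ball 0 d) h)
  = (NN h. (NN x. en (bbm_kernel p s h) * pw p (h \<bullet> G x) * ind (ball 0 d) h * ind U x))"
 proof (rule nn_integral_cong)
  fix h :: 'a
  have "(NN x. en (bbm_kernel p s h) * pw p (h \<bullet> G x) * ind (ball 0 d) h * ind U x)
   = (NN x. (en (bbm_kernel p s h) * ind (ball 0 d) h) * (pw p (G x \<bullet> h) * ind U x))"
   by (intro nn_integral_cong) (simp only: inner_commute[of h] mult_ac)
  also have "... = (en (bbm_kernel p s h) * ind (ball 0 d) h) * (NN x. pw p (G x \<bullet> h) * ind U x)"
   by (rule nn_integral_cmult) measurable
  finally show "en (bbm_kernel p s h) * (NN x. pw p (G x \<bullet> h) * ind U x) * ind (ball 0 d) h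
   = (NN x. en (bbm_kernel p s h) * pw p (h \<bullet> G x) * ind (ball 0 d) h * ind U x)" by (simp only: mult_ac)
 qed
 also have "... = (NN x. (NN h. en (bbm_kernel p s h) * pw p (h \<bullet> G x) * ind (ball 0 d) h * ind U x))"
  by (rule lborel_pair.Fubini') measurable
 also have "... = (NN x. (NN h. en (bbm_kernel p s h) * pw p (h \<bullet> G x) * ind (ball 0 d) h) * ind U x)"
  by (intro nn_integral_cong nn_integral_multc) measurable
 also have "... = (NN x. en (A * d powr (p * (1 - s)) * norm (G x) powr p) * ind U x)"
  unfolding bbm_kernel_moment[OF p s d(1)] A_def ..
 also have "... <= (NN x. en A * (en (norm (G x) powr p) * ind U x))"
 proof (rule nn_integral_mono)
  fix x
  have "A * d powr (p * (1 - s)) * norm (G x) powr p <= A * 1 * norm (G x) powr p" using A dp by (intro mult_right_mono mult_left_mono) auto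
  then have "en (A * d powr (p * (1 - s)) * norm (G x) powr p) <= en A * en (norm (G x) powr p)"
   using A by (simp add: ennreal_leI flip: ennreal_mult)
  then show "en (A * d powr (p * (1 - s)) * norm (G x) powr p) * ind U x <= en A * (en (norm (G x) powr p) * ind U x)"
   by (simp add: mult_right_mono flip: mult.assoc)
 qed
 also have "... = en A * (NN x. en (norm (G x) powr p) * ind U x)" by (rule nn_integral_cmult) measurable
 finally show ?thesis unfolding A_def .
qed

text \<open>An upper bound for the mass of the kernel outside the ball of radius \<open>d\<close>,
  taken from \<open>nn_integral_powr_tail\<close>; the factor \<open>1 - s\<close> makes it vanish
  in the limit.\<close>

definition bbm_tail :: "'a::euclidean_space itself => real => real => real => real" where
 "bbm_tail _ p d s = (1 - s) * ((real DIM('a) + s * p) * unit_ball_vol (real DIM('a)) * d powr (- (s * p)) / (s * p))"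

lemma bbm_tail_nonneg: "0 < p ==> 0 < s ==> s < 1 ==> 0 <= bbm_tail TYPE('a::euclidean_space) p d s"
 by (simp add: bbm_tail_def)

lemma bbm_tail_limit:
 assumes "s ----> 1" "0 < p" "0 < d"
 shows "(%k. bbm_tail TYPE('a::euclidean_space) p d (s k)) ----> 0"
proof -
 have "(%k. bbm_tail TYPE('a) p d (s k)) ----> bbm_tail TYPE('a) p d 1"
  unfolding bbm_tail_def using assms by (intro tendsto_intros) auto
 then show ?thesis by (simp add: bbm_tail_def)
qed

lemma bbm_tail_le:
 assumes p: "0 < p" and s: "0 < s" "s < 1" and d: "0 < d"
 shows "(\<integral>\<^sup>+h. en (bbm_kernel p s h) * ind (- ball 0 d) h \<partial>(lborel :: 'a::euclidean_space measure)) <= en (bbm_tail TYPE('a) p d s)"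
proof -
 let ?a = "real DIM('a) + s * p"
 have "(\<integral>\<^sup>+h. en (bbm_kernel p s h) * ind (- ball 0 d) h \<partial>(lborel :: 'a measure))
  = (\<integral>\<^sup>+h. en (1 - s) * (en (norm h powr - ?a) * ind (- ball 0 d) h) \<partial>(lborel :: 'a measure))"
  using s by (intro nn_integral_cong) (simp add: bbm_kernel_def ennreal_mult mult.assoc)
 also have "... = en (1 - s) * (\<integral>\<^sup>+h. en (norm h powr - ?a) * ind (- ball 0 d) h \<partial>(lborel :: 'a measure))"
  by (rule nn_integral_cmult) measurable
 also have "... <= en (1 - s) * en (?a * unit_ball_vol (real DIM('a)) * d powr (real DIM('a) - ?a) / (?a - real DIM('a)))"
  using p s by (intro mult_left_mono nn_integral_powr_tail d) auto
 also have "... = en (bbm_tail TYPE('a) p d s)" unfolding bbm_tail_def using p s by (subst ennreal_mult[symmetric]) auto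
 finally show ?thesis .
qed

text \<open>Below the distance \<open>d\<close> the gradient controls \<open>q\<close>, with the
  sharp directional moment; beyond it the crude bound \<open>V\<close> meets a kernel mass that
  vanishes in the limit.\<close>

lemma bbm_split_le:
 fixes G :: "'a::euclidean_space => 'a" and q :: "'a => ennreal"
 assumes p: "0 < p" and s: "0 < s" "s < 1" and d: "0 < d" "d <= 1" and Gm [measurable]: "G : bmeas" and Um [measurable]: "U : sets borel"
  and qm [measurable]: "q : bmeas" and V: "0 <= V" "!!h. q h <= en V"
  and near: "!!h. norm h < d ==> q h <= (NN x. pw p (G x \<bullet> h) * ind U x)"
 shows "(NN h. en (bbm_kernel p s h) * q h)
  <= en (cnp p TYPE('a) * (real DIM('a) + p) / p) * (NN x. en (norm (G x) powr p) * ind U x) + en (V * bbm_tail TYPE('a) p d s)"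
proof -
 let ?N = "%h. en (bbm_kernel p s h) * (NN x. pw p (G x \<bullet> h) * ind U x) * ind (ball 0 d) h"
 let ?T = "%h::'a. en V * (en (bbm_kernel p s h) * ind (- ball 0 d) h)"
 have "(NN h. en (bbm_kernel p s h) * q h) <= (NN h. ?N h + ?T h)"
 proof (rule nn_integral_mono)
  fix h :: 'a
  show "en (bbm_kernel p s h) * q h <= ?N h + ?T h"
  proof (cases "norm h < d")
   case True
   then show ?thesis using mult_left_mono[OF near[OF True], of "en (bbm_kernel p s h)"] by simp
  next
   case False
   then show ?thesis using mult_left_mono[OF V(2)[of h], of "en (bbm_kernel p s h)"] by (simp add: mult.commute)
  qed
 qed
 also have "... = (NN h. ?N h) + (NN h. ?T h)" by (rule nn_integral_add) measurable
 also have "(NN h. ?T h) = en V * (\<integral>\<^sup>+h. en (bbm_kernel p s h) * ind (- ball 0 d) h \<partial>(lborel :: 'a measure))"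
  by (rule nn_integral_cmult) measurable
 also have "(NN h. ?N h) + ... <= en (cnp p TYPE('a) * (real DIM('a) + p) / p) * (NN x. en (norm (G x) powr p) * ind U x)
  + en V * en (bbm_tail TYPE('a) p d s)"
  by (intro add_mono bbm_near_le mult_left_mono bbm_tail_le p s d Gm Um) auto
 finally show ?thesis using V bbm_tail_nonneg[OF p s, where ?'a='a] by (simp add: ennreal_mult)
qed

definition thick :: "real => 'a::euclidean_space set => 'a set" where
 "thick d S = (\<Union>y\<in>S. ball y d)"

lemma thick_borel [measurable]: "thick d S : sets borel" unfolding thick_def by (intro borel_open open_UN ballI open_ball)

text \<open>The neighbourhoods shrink to the closure of \<open>S\<close>, which agrees with
  \<open>S\<close> up to a null set.\<close>

lemma thick_limit:
 fixes q :: "'a::euclidean_space => ennreal"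
 assumes [measurable]: "q : bmeas" "S : sets borel" and fin: "(NN x. q x) < \<infinity>" and S: "AE x in lborel. x : closure S --> x : S"
 shows "(%j. NN x. q x * ind (thick (1 / real (Suc j)) S) x) ----> (NN x. q x * ind S x)"
proof (rule nn_integral_dominated_convergence[where w=q])
 show "AE x in lborel. (%j. q x * ind (thick (1 / real (Suc j)) S) x) ----> q x * ind S x"
  using S
 proof eventually_elim
  case (elim x)
  have "\<forall>\<^sub>F j in sequentially. q x * ind (thick (1 / real (Suc j)) S) x = q x * ind S x"
  proof (cases "x : S")
   case True
   then have "x : thick (1 / real (Suc j)) S" for j unfolding thick_def by (intro UN_I[of x]) auto
   then show ?thesis using True by simp
  next
   case False
   then have "x ~: closure S" using elim by blast
   then obtain e where e: "0 < e" "!!y. y : S ==> e <= dist y x" unfolding closure_approachable by (meson not_le)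
   obtain N where N: "inverse (real (Suc N)) < e" using reals_Archimedean[OF e(1)] by blast
   have "x ~: thick (1 / real (Suc j)) S" if "N <= j" for j
   proof
    assume "x : thick (1 / real (Suc j)) S"
    then obtain y where y: "y : S" "dist y x < 1 / real (Suc j)" by (auto simp: thick_def)
    have "1 / real (Suc j) <= inverse (real (Suc N))" using that by (simp add: field_simps)
    then show False using y e(2)[OF y(1)] N by linarith
   qed
   then show ?thesis using False unfolding eventually_sequentially by (intro exI[of _ N]) simp
  qed
  then show ?case by (rule tendsto_eventually)
 qed
qed (use fin in \<open>auto simp: indicator_def\<close>)

text \<open>The first term carries half of the constant because of the 1/2 in \<open>Kp_s\<close>
  and becomes the limit energy. The second has the full constant but lives on a neighbourhood of the
  frontier, and the third collects both tails.\<close>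

lemma sobolev_energy_le:
 fixes v :: "'a::euclidean_space => real"
 assumes p: "1 <= p" and s: "0 < s" "s < 1" and d: "0 < d" "d <= 1" and O: "open Om" and V: "emeasure lborel Om = en V" "0 <= V"
  and vm [measurable]: "v : bmeas" and vb: "!!x. abs(v x) <= 1" and vi: "integrable lborel v" and G: "sobolev_grad p v G"
  and uv: "AE x in lborel. u x = v x"
 shows "en (1 - s) * Kp_s p s u Om <=
   en (cnp p TYPE('a) * (real DIM('a) + p) / p / 2) * (NN x. en (norm (G x) powr p) * ind (thick d Om) x)
  + en (cnp p TYPE('a) * (real DIM('a) + p) / p) * (NN x. en (norm (G x) powr p) * ind (thick d (frontier Om)) x)
  + en (2 * (2 powr p * V * bbm_tail TYPE('a) p d s))"
proof -
 have Om [measurable]: "Om : sets borel" using O by auto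
 have Gm [measurable]: "G : bmeas" and Gi: "!!b. b : Basis ==> integrable lborel (%x. G x \<bullet> b)" and w: "wgrad UNIV v G" using G by (auto simp: sobolev_grad_def)
 have vp: "(NN x. pw p (v x)) < \<infinity>" by (rule powr_integrable_of_bounded[OF p vi vb])
 have p0: "0 < p" using p by simp
 define A where "A = cnp p TYPE('a) * (real DIM('a) + p) / p"
 have A: "0 <= A" using cnp_nonneg[where ?'a='a, of p] p by (simp add: A_def)
 define C where "C h = (NN x. pw p (v (x + h) - v x) * ind Om x * ind (- Om) (x + h))" for h
 have Cm [measurable]: "C : bmeas" unfolding C_def by measurable
 have V': "0 <= 2 powr p * V" using V by simp
 have bd: "(NN x. pw p (v (x + h) - v x) * ind Om x * ind B (x + h)) <= en (2 powr p * V)" for h B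
 proof -
  have "(NN x. pw p (v (x + h) - v x) * ind Om x * ind B (x + h)) <= (NN x. en (2 powr p) * ind Om x)"
  proof (rule nn_integral_mono)
   fix x
   have "abs(v (x + h) - v x) <= 2" using vb[of "x + h"] vb[of x] by simp
   then have "abs(v (x + h) - v x) powr p <= 2 powr p" using p by (intro powr_mono2) auto
   then show "pw p (v (x + h) - v x) * ind Om x * ind B (x + h) <= en (2 powr p) * ind Om x"
    by (auto simp: indicator_def intro: ennreal_leI)
  qed
  also have "... = en (2 powr p * V)" using V by (simp add: nn_integral_cmult ennreal_mult)
  finally show ?thesis .
 qed
 have E1: "energy p (bbm_kernel p s) Om v <= en A * (NN x. en (norm (G x) powr p) * ind (thick d Om) x) + en (2 powr p * V * bbm_tail TYPE('a) p d s)"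
  unfolding energy_def A_def
 proof (rule bbm_split_le[OF p0 s d Gm thick_borel _ V'])
  show "trd p Om v h <= en (2 powr p * V)" for h unfolding trd_def by (rule bd)
  fix h :: 'a assume h: "norm h < d"
  have "trd p Om v h <= (NN x. pw p (v (x + h) - v x) * ind Om x)" unfolding trd_def by (intro nn_integral_mono) (auto simp: indicator_def)
  also have "... <= (NN x. pw p (G x \<bullet> h) * ind (thick d Om) x)"
  proof (rule translation_estimate[OF p wgrad_mono[OF w subset_UNIV] vi vp Gm Gi Om])
   show "open (thick d Om)" unfolding thick_def by blast
   fix x t assume x: "x : Om" and t: "0 <= t" "t <= (1::real)"
   have "norm (t *\<^sub>R h) < d" using h t mult_left_le_one_le[of "norm h" t] by simp
   then have "x + t *\<^sub>R h : ball x d" by (simp add: dist_norm)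
   then show "x + t *\<^sub>R h : thick d Om" unfolding thick_def using x by blast
  qed
  finally show "trd p Om v h <= (NN x. pw p (G x \<bullet> h) * ind (thick d Om) x)" .
 qed measurable
 have E2: "(NN h. en (bbm_kernel p s h) * C h) <= en A * (NN x. en (norm (G x) powr p) * ind (thick d (frontier Om)) x) + en (2 powr p * V * bbm_tail TYPE('a) p d s)"
  unfolding A_def
 proof (rule bbm_split_le[OF p0 s d Gm thick_borel Cm V'])
  show "C h <= en (2 powr p * V)" for h unfolding C_def by (rule bd)
  fix h :: 'a assume h: "norm h < d"
  let ?B = "{x : space borel. x : Om & x + h ~: Om}"
  have Bm: "?B : sets borel" by measurable
  have "C h = (NN x. pw p (v (x + h) - v x) * ind ?B x)" unfolding C_def by (intro nn_integral_cong) (auto simp: indicator_def)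
  also have "... <= (NN x. pw p (G x \<bullet> h) * ind (thick d (frontier Om)) x)"
  proof (rule translation_estimate[OF p wgrad_mono[OF w subset_UNIV] vi vp Gm Gi Bm])
   show "open (thick d (frontier Om))" unfolding thick_def by blast
   fix x t assume x: "x : ?B" and t: "0 <= t" "t <= (1::real)"
   \<comment> \<open>A segment from \<open>Om\<close> to its complement crosses the frontier, and
     all its points lie within \<open>norm h < d\<close> of the crossing.\<close>
   have "closed_segment x (x + h) \<inter> frontier Om ~= {}"
    using x by (intro connected_Int_frontier connected_segment) (auto intro!: ends_in_segment)
   then obtain a where a: "0 <= a" "a <= 1" "(1 - a) *\<^sub>R x + a *\<^sub>R (x + h) : frontier Om" unfolding closed_segment_def by auto
   have "(1 - a) *\<^sub>R x + a *\<^sub>R (x + h) = x + a *\<^sub>R h" by (simp add: algebra_simps)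
   then have f: "x + a *\<^sub>R h : frontier Om" using a by simp
   have "dist (x + a *\<^sub>R h) (x + t *\<^sub>R h) = abs(a - t) * norm h" by (simp add: dist_norm flip: scaleR_left_diff_distrib)
   also have "... <= 1 * norm h" using a t by (intro mult_right_mono) auto
   finally have "x + t *\<^sub>R h : ball (x + a *\<^sub>R h) d" using h by simp
   then show "x + t *\<^sub>R h : thick d (frontier Om)" unfolding thick_def using f by blast
  qed
  finally show "C h <= (NN x. pw p (G x \<bullet> h) * ind (thick d (frontier Om)) x)" .
 qed
 define T where "T = 2 powr p * V * bbm_tail TYPE('a) p d s"
 have T: "0 <= T" using V bbm_tail_nonneg[OF p0 s, where ?'a='a] by (simp add: T_def)
 have arith: "en (1 / 2) * E + F <= en (A / 2) * X + en A * Y + en (2 * T)"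
  if "E <= en A * X + en T" "F <= en A * Y + en T" for E F X Y
 proof -
  have "en (1 / 2) * E + F <= en (1 / 2) * (en A * X + en T) + (en A * Y + en T)" using that by (intro add_mono mult_left_mono) auto
  also have "... = en (A / 2) * X + en A * Y + (en (T / 2) + en T)"
  proof -
   have "en (1 / 2) * (en A * X) = en (A / 2) * X" by (subst mult.assoc[symmetric], subst ennreal_mult[symmetric]) (use A in auto)
   moreover have "en (1 / 2) * en T = en (T / 2)" by (subst ennreal_mult[symmetric]) (use T in auto)
   ultimately show ?thesis by (simp only: distrib_left ac_simps)
  qed
  also have "... <= en (A / 2) * X + en A * Y + en (2 * T)" using T by (intro add_left_mono) (simp add: ennreal_leI flip: ennreal_plus)
  finally show ?thesis .
 qed
 show ?thesis
  unfolding Kp_s_borel[OF uv vm Om s(2)] by (rule arith[OF E1[folded T_def] E2[folded T_def, unfolded C_def], unfolded A_def T_def])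
qed

lemma sobolev_imp_Kp_s_finite:
 fixes v :: "'a::euclidean_space => real"
 assumes p: "1 <= p" and s: "0 < s" "s < 1" and O: "open Om" "bounded Om"
  and vm: "v : bmeas" and vb: "!!x. abs(v x) <= 1" and vi: "integrable lborel v" and G: "sobolev_grad p v G"
  and uv: "AE x in lborel. u x = v x"
 shows "Kp_s p s u Om < \<infinity>"
proof -
 have V: "emeasure lborel Om = en (measure lborel Om)" using emeasure_lborel_bounded[OF O(2)] by (simp add: emeasure_eq_ennreal_measure)
 have fin: "(NN x. en (norm (G x) powr p) * ind U x) < \<infinity>" for U
 proof -
  have "(NN x. en (norm (G x) powr p) * ind U x) <= (NN x. en (norm (G x) powr p))" by (intro nn_integral_mono) (auto simp: indicator_def)
  also have "... < \<infinity>" using G by (simp add: sobolev_grad_def)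
  finally show ?thesis .
 qed
 have "en (1 - s) * Kp_s p s u Om < \<infinity>"
  by (rule le_less_trans[OF sobolev_energy_le[OF p s _ _ O(1) V _ vm vb vi G uv, of 1]]) (use fin in \<open>auto simp: ennreal_mult_less_top less_top\<close>)
 then show ?thesis using s by (auto simp: ennreal_mult_less_top ennreal_eq_0_iff)
qed

text \<open>For fixed \<open>d\<close> the tail disappears as \<open>s\<close> tends to 1; then
  \<open>d\<close> tends to 0 through \<open>1 / Suc j\<close>. The constant \<open>b\<close> is
  carried along to hold the potential term.\<close>

lemma sobolev_energy_limsup:
 fixes v :: "'a::euclidean_space => real"
 assumes p: "1 <= p" and s: "!!k. 0 < s k & s k < 1" and s_lim: "s ----> 1" and dom: "lipschitz_domain Om"
  and vm: "v : bmeas" and vb: "!!x. abs(v x) <= 1" and vi: "integrable lborel v" and G: "sobolev_grad p v G"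
  and uv: "AE x in lborel. u x = v x"
 shows "limsup (%k. en (1 - s k) * Kp_s p (s k) u Om + b)
  <= en (cnp p TYPE('a) * (real DIM('a) + p) / p / 2) * (NN x. en (norm (G x) powr p) * ind Om x) + b"
proof -
 have O: "open Om" "bounded Om" using dom by (auto simp: lipschitz_domain_def)
 then have Om [measurable]: "Om : sets borel" by auto
 define V where "V = measure lborel Om"
 have V: "emeasure lborel Om = en V" "0 <= V" using emeasure_lborel_bounded[OF O(2)] by (simp_all add: V_def emeasure_eq_ennreal_measure)
 have Gm [measurable]: "G : bmeas" and Gp: "(NN x. en (norm (G x) powr p)) < \<infinity>" using G by (auto simp: sobolev_grad_def)
 define A where "A = cnp p TYPE('a) * (real DIM('a) + p) / p"
 define J where "J U = (NN x. en (norm (G x) powr p) * ind U x)" for U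
 define R where "R d = en (A / 2) * J (thick d Om) + en A * J (thick d (frontier Om))" for d
 have bound: "limsup (%k. en (1 - s k) * Kp_s p (s k) u Om + b) <= R d + b" if d: "0 < d" "d <= 1" for d
 proof (rule ennreal_le_epsilon)
  fix e :: real assume e: "0 < e"
  define T where "T k = 2 * (2 powr p * V * bbm_tail TYPE('a) p d (s k))" for k
  have "T ----> 2 * (2 powr p * V * 0)" unfolding T_def using p d by (intro tendsto_intros bbm_tail_limit[OF s_lim]) auto
  then have "\<forall>\<^sub>F k in sequentially. T k < e" using e by (intro order_tendstoD) auto
  then have "\<forall>\<^sub>F k in sequentially. en (1 - s k) * Kp_s p (s k) u Om + b <= R d + b + en e"
  proof eventually_elim
   case (elim k)
   have "en (1 - s k) * Kp_s p (s k) u Om <= R d + en (T k)"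
    unfolding R_def J_def A_def T_def using sobolev_energy_le[OF p _ _ d O(1) V vm vb vi G uv, of "s k"] s[of k] by simp
   also have "... <= R d + en e" using elim by (intro add_left_mono ennreal_leI) simp
   finally have "en (1 - s k) * Kp_s p (s k) u Om + b <= R d + en e + b" by (rule add_right_mono)
   then show ?case by (simp only: add.assoc add.commute[of b])
  qed
  then show "limsup (%k. en (1 - s k) * Kp_s p (s k) u Om + b) <= R d + b + en e" by (rule Limsup_bounded)
 qed
 have nf: "AE x in lborel. x ~: frontier Om" by (rule lipschitz_domain_frontier_null[OF dom])
 have "AE x in lborel. x : closure Om --> x : Om" using nf by eventually_elim (simp add: frontier_def interior_open[OF O(1)])
 then have l1: "(%j. J (thick (1 / real (Suc j)) Om)) ----> J Om" unfolding J_def by (intro thick_limit Gp) auto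
 have l2: "(%j. J (thick (1 / real (Suc j)) (frontier Om))) ----> J (frontier Om)" unfolding J_def by (intro thick_limit Gp) auto
 have "J (frontier Om) = (\<integral>\<^sup>+x. 0 \<partial>(lborel :: 'a measure))" unfolding J_def by (rule nn_integral_cong_AE, use nf in eventually_elim) simp
 then have J0: "J (frontier Om) = 0" by simp
 have "(%j. R (1 / real (Suc j)) + b) ----> en (A / 2) * J Om + en A * J (frontier Om) + b"
  unfolding R_def by (intro tendsto_add tendsto_const ennreal_tendsto_cmult l1 l2) auto
 then have "limsup (%k. en (1 - s k) * Kp_s p (s k) u Om + b) <= en (A / 2) * J Om + en A * J (frontier Om) + b"
  by (rule LIMSEQ_le_const) (use bound in auto)
 then show ?thesis unfolding J0 by (simp add: J_def A_def)
qed

lemma sobolev_grad_test_fun: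
 fixes \<phi> :: "'a::euclidean_space => real"
 assumes p: "0 <= p" and phi: "test_fun UNIV \<phi>"
 shows "sobolev_grad p \<phi> (%x. \<Sum>b\<in>Basis. dd \<phi> x b *\<^sub>R b)"
proof -
 define D where "D x = (\<Sum>b\<in>Basis. dd \<phi> x b *\<^sub>R b)" for x
 have Db: "D x \<bullet> b = dd \<phi> x b" if "b : Basis" for x b
  using that by (simp add: D_def inner_sum_left inner_Basis if_distrib sum.delta cong: if_cong)
 note [measurable] = smooth_fun_deriv_borel[OF test_fun_smooth[OF phi]]
 have Dm: "D : bmeas" unfolding D_def by measurable
 have "EX B. ALL x. abs(dd \<phi> x b) <= B" for b
  by (rule test_fun_bounded[OF test_fun_deriv[OF phi]]) blast
 then obtain B where B: "!!b x. abs(dd \<phi> x b) <= B b" by metis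
 obtain K where K: "compact K" "!!x v. x ~: K ==> dd \<phi> x v = 0" by (rule test_fun_cases[OF phi]) (rule that, assumption, fast)
 have "(NN x. en (norm (D x) powr p)) <= (NN x. en ((\<Sum>b\<in>Basis. B b) powr p) * ind K x)"
 proof (rule nn_integral_mono)
  fix x
  have "norm (D x) <= (\<Sum>b\<in>Basis. abs(D x \<bullet> b))" by (rule norm_le_l1)
  also have "... <= (\<Sum>b\<in>Basis. B b)" by (intro sum_mono) (simp add: Db B)
  finally have "norm (D x) powr p <= (\<Sum>b\<in>Basis. B b) powr p" using p by (intro powr_mono2) auto
  then show "en (norm (D x) powr p) <= en ((\<Sum>b\<in>Basis. B b) powr p) * ind K x"
   using K(2)[of x] by (cases "x : K") (auto simp: D_def intro: ennreal_leI)
 qed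
 also have "... = en ((\<Sum>b\<in>Basis. B b) powr p) * emeasure lborel K" using K(1) by (intro nn_integral_cmult_indicator) (auto simp: compact_imp_closed)
 also have "... < \<infinity>" using emeasure_lborel_bounded[OF compact_imp_bounded[OF K(1)]] by (simp add: ennreal_mult_less_top)
 finally have "(NN x. en (norm (D x) powr p)) < \<infinity>" .
 moreover have "integrable lborel (%x. D x \<bullet> b)" if "b : Basis" for b
  using test_fun_integrable[OF test_fun_deriv[OF phi]] by (simp add: Db[OF that])
 moreover have "wgrad UNIV \<phi> D" unfolding D_def by (rule test_fun_wgrad[OF phi])
 ultimately have "sobolev_grad p \<phi> D" unfolding sobolev_grad_def using Dm by simp
 then show ?thesis unfolding D_def .
qed

text \<open>Meant for functions outside the Sobolev space, where the limit energy is infinite: only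
  convergence and admissibility of each approximant are at stake, and mollified functions are test
  functions with finite nonlocal energy for every order.\<close>

lemma recovery_by_mollification:
 fixes Om :: "'a::euclidean_space set" and u :: "'a => real"
 assumes s: "!!k. 0 < s k & s k < 1" and p: "1 < p" and O: "open Om" "bounded Om"
  and uL: "in_Lp p Om u" and ub: "AE x in lebesgue. x : Om --> abs(u x) <= 1"
 obtains uk where "!!k. Xsp (s k) p Om (uk k)" "Lp_conv p Om uk u"
proof -
 have Om [measurable]: "Om : sets borel" using O by auto
 have p1: "1 <= p" using p by simp
 have um: "u : borel_measurable (lebesgue_on Om)" using uL by (simp add: in_Lp_def)
 obtain f0 where f0m [measurable]: "f0 : bmeas" and f00: "!!x. x ~: Om ==> f0 x = 0" and uf0: "AE x in lborel. x : Om --> u x = f0 x"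
  by (rule borel_version_on[OF um Om]) (rule that, assumption, fast, assumption)
 define f where "f x = clamp1 (f0 x)" for x
 have fm [measurable]: "f : bmeas" unfolding f_def clamp1_def by measurable
 have fb: "abs(f x) <= 1" for x by (auto simp: f_def clamp1_def)
 have fz: "f x = 0" if "x ~: Om" for x using f00[OF that] by (simp add: f_def clamp1_def)
 have "AE x in lborel. x : Om --> abs(u x) <= 1" using ub by (simp add: AE_completion_iff)
 then have uf: "AE x in lborel. x : Om --> u x = f x" using uf0 by eventually_elim (auto simp: f_def clamp1_def)
 have fi: "integrable lborel f" by (rule integrable_bounded_support[OF fm fb O(2) fz])
 have fp: "(NN x. pw p (f x)) < \<infinity>" by (rule powr_integrable_of_bounded[OF p1 fi fb])
 define e where "e k = 1 / real (Suc k)" for k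
 have e: "0 < e k" for k by (simp add: e_def)
 define uk where "uk k = convol f (moll (e k))" for k
 have X: "Xsp (s k) p Om (uk k)" for k
 proof -
  have m: "test_fun UNIV (moll (e k) :: 'a => real)" by (rule test_fun_moll[OF e]) simp
  obtain B where B: "!!x. x : Om ==> norm x <= B" using O(2) unfolding bounded_iff by blast
  have t: "test_fun UNIV (uk k)"
  proof (rule test_funI[where K="cball 0 (B + e k)"])
   show "smooth_fun (uk k)" unfolding uk_def by (rule smooth_fun_convol[OF fi m])
   fix x :: 'a assume x: "x ~: cball 0 (B + e k)"
   show "uk k x = 0" unfolding uk_def
   proof (rule convol_eq_0[where S=Om])
    show "e k <= dist x y" if "y : Om" for y using B[OF that] x norm_triangle_ineq2[of x y] by (simp add: dist_norm)
   qed (use fz moll_eq_0[OF e] in auto)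
  qed auto
  have b: "abs(uk k x) <= 1" for x unfolding uk_def by (rule convol_moll_abs_le[OF e fi fb])
  have p0: "0 <= p" using p by simp
  have "Kp_s p (s k) (uk k) Om < \<infinity>"
   by (rule sobolev_imp_Kp_s_finite[OF p1 _ _ O test_fun_borel[OF t] b test_fun_integrable[OF t] sobolev_grad_test_fun[OF p0 t]]) (use s[of k] in auto)
  moreover have "uk k : borel_measurable lebesgue" using test_fun_borel[OF t] by (simp add: measurable_completion)
  ultimately show ?thesis unfolding Xsp_def using b by simp
 qed
 have "Lp_conv p Om uk u"
  unfolding Lp_conv_def
 proof (rule tendsto_0_ennrealI)
  fix eta :: real assume eta: "0 < eta"
  obtain d where d: "0 < d" "!!e. 0 < e ==> e < d ==> (NN x. pw p (convol f (moll e) x - f x)) <= en eta"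
   by (rule convol_moll_Lp[OF p1 fi fp eta]) (rule that, assumption, fast)
  have "e ----> 0" unfolding e_def by (rule LIMSEQ_Suc[OF lim_1_over_n])
  then have "\<forall>\<^sub>F k in sequentially. e k < d" using d(1) by (rule order_tendstoD(2))
  then show "\<forall>\<^sub>F k in sequentially. set_nn_integral lebesgue Om (%x. pw p (uk k x - u x)) <= en eta"
  proof eventually_elim
   case (elim k)
   have "set_nn_integral lebesgue Om (%x. pw p (uk k x - u x)) = (NN x. pw p (uk k x - f x) * ind Om x)"
    by (rule set_nn_integral_cong_AE_lebesgue, use uf in \<open>rule AE_mp\<close>) (auto intro!: AE_I2)
   also have "... <= (NN x. pw p (uk k x - f x))" by (intro nn_integral_mono) (auto simp: indicator_def)
   also have "... <= en eta" unfolding uk_def by (rule d(2)[OF e elim])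
   finally show ?case .
  qed
 qed
 then show thesis using that X by blast
qed

text \<open>The upper bound comes from the extension, and equality follows from the liminf
  inequality applied to the constant sequence \<open>v\<close>.\<close>

theorem recovery_by_extension:
 fixes Om :: "'a::euclidean_space set" and u :: "'a => real"
 assumes s: "!!k. 0 < s k & s k < 1" and s_lim: "s ----> 1" and p: "1 < p" and dom: "lipschitz_domain Om" and W: "lsc_on_interval W" and u: "X1p p Om u"
 obtains v where "!!t. 0 < t ==> t < 1 ==> Xsp t p Om v" "!!x. x : Om ==> v x = u x" "Ep_1 W p u Om = limsup (%k. Ep_s W p (s k) v Om)"
proof -
 have O: "open Om" "bounded Om" using dom by (auto simp: lipschitz_domain_def)
 then have Om [measurable]: "Om : sets borel" by auto
 have p1: "1 <= p" using p by simp
 have W1: "W1p p Om u" and ub: "AE x in lebesgue. x : Om --> abs(u x) <= 1" using u by (auto simp: X1p_def)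
 have um: "u : borel_measurable (lebesgue_on Om)" using W1 by (simp add: W1p_def in_Lp_def)
 obtain g H where gm: "g : bmeas" and gb: "!!x. abs(g x) <= 1" and g0: "!!x. x ~: Om ==> g x = 0" and ug: "AE x in lborel. x : Om --> u x = g x"
  and Hm [measurable]: "H : bmeas" and H0: "!!x. x ~: Om ==> H x = 0" and Hi: "!!b. b : Basis ==> integrable lborel (%x. H x \<bullet> b)" and Hw: "wgrad Om g H"
  and Hp: "(NN x. en (norm (H x) powr p)) < \<infinity>"
  and Heq: "set_nn_integral lebesgue Om (%x. en (norm ((SOME G. weak_grad p Om u G) x) powr p)) = (NN x. en (norm (H x) powr p))"
 proof (rule W1p_cases[OF p1 O W1 ub])
  fix v H assume "v : bmeas" "!!x. abs(v x) <= 1" "!!x. x ~: Om ==> v x = 0" "AE x in lborel. x : Om --> u x = v x"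
   "H : bmeas" "!!x. x ~: Om ==> H x = 0" "!!b. b : Basis ==> integrable lborel (%x. H x \<bullet> b)" "wgrad Om v H"
   "(NN x. en (norm (H x) powr p)) < \<infinity>"
   "set_nn_integral lebesgue Om (%x. en (norm ((SOME G. weak_grad p Om u G) x) powr p)) = (NN x. en (norm (H x) powr p))"
  then show thesis by (rule that)
 qed
 have Hind: "(NN x. en (norm (H x) powr p) * ind Om x) = (NN x. en (norm (H x) powr p))"
  using H0 by (intro nn_integral_cong) (auto simp: indicator_def)
 obtain I where I: "(NN x. en (norm (H x) powr p)) = en I" "0 <= I" using Hp by (cases "NN x. en (norm (H x) powr p)") auto
 have sf: "sobolev_fun p Om g H I"
  by unfold_locales (use p1 O gm gb g0 Hm Hi Hw Hind I in auto)
 obtain v' S where v'm [measurable]: "v' : bmeas" and v'b: "!!x. abs(v' x) <= 1" and S: "bounded S" "!!x. x ~: S ==> v' x = 0"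
  and v'g: "!!x. x : Om ==> v' x = g x" and AT: "AT p UNIV v'"
  by (rule sobolev_fun.global_extension[OF sf dom]) (rule that, assumption, fast, assumption, fast, fast, assumption)
 have v'i: "integrable lborel v'" by (rule integrable_bounded_support[OF v'm v'b S])
 obtain G where G: "sobolev_grad p v' G"
 proof (rule AT_wgrad[OF p v'm v'b S AT])
  fix G T assume "G : bmeas" "!!b. b : Basis ==> integrable lborel (%x. G x \<bullet> b)" "wgrad UNIV v' G" "(NN x. en (norm (G x) powr p)) < \<infinity>"
  then show thesis by (intro that[of G]) (simp add: sobolev_grad_def)
 qed
 then have Gi: "!!b. b : Basis ==> integrable lborel (%x. G x \<bullet> b)" and Gw: "wgrad UNIV v' G" by (auto simp: sobolev_grad_def)
 \<comment> \<open>Agreement with \<open>u\<close> is required at every point of \<open>Om\<close>,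
   so the original \<open>u\<close> is used inside; the Borel extension \<open>v'\<close> differs
   from \<open>v\<close> only on a null set.\<close>
 define v where "v x = (if x : Om then u x else v' x)" for x
 have vv': "AE x in lborel. v x = v' x" using ug by eventually_elim (auto simp: v_def v'g)
 have "(%x. if x : Om then u x else 0) : borel_measurable lebesgue" using um Om by (subst borel_measurable_if) auto
 moreover have "(%x. if x : Om then 0 else v' x) : borel_measurable lebesgue" by (rule measurable_completion) measurable
 ultimately have "(%x. (if x : Om then u x else 0) + (if x : Om then 0 else v' x)) : borel_measurable lebesgue" by (rule borel_measurable_add)
 also have "(%x. (if x : Om then u x else 0) + (if x : Om then 0 else v' x)) = v" by (auto simp: v_def)
 finally have vm: "v : borel_measurable lebesgue" .
 have vb: "AE x in lebesgue. abs(v x) <= 1" unfolding AE_completion_iff using vv' by eventually_elim (simp add: v'b)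
 have X: "Xsp t p Om v" if "0 < t" "t < 1" for t
  unfolding Xsp_def using vm vb sobolev_imp_Kp_s_finite[OF p1 that O v'm v'b v'i G vv'] by simp
 \<comment> \<open>On \<open>Om\<close> the gradient \<open>G\<close> of the extension is also a
   weak gradient of \<open>g\<close>; uniqueness then matches it with the gradient that
   \<open>Ep_1\<close> measures.\<close>
 have "wgrad Om g G"
  unfolding wgrad_def
 proof (intro allI impI)
  fix \<phi> :: "'a => real" and i :: 'a assume t: "test_fun Om \<phi>" and i: "i : Basis"
  obtain K where K: "K \<subseteq> Om" "!!x v. x ~: K ==> dd \<phi> x v = 0" by (rule test_fun_cases[OF t]) (rule that, assumption, fast)
  have eq: "g x * dd \<phi> x i = v' x * dd \<phi> x i" for x using K v'g[of x] by (cases "x : K") auto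
  show "(LL x. g x * dd \<phi> x i) = - (LL x. (G x \<bullet> i) * \<phi> x)"
   unfolding eq using Gw test_fun_mono[OF t subset_UNIV] i by (simp add: wgrad_def)
 qed
 then have HG: "AE x in lborel. x : Om --> H x = G x" by (rule wgrad_unique[OF O(1) Hw _ Hi Gi])
 have "(NN x. en (norm (G x) powr p) * ind Om x) = (NN x. en (norm (H x) powr p) * ind Om x)"
  by (rule nn_integral_cong_AE, use HG in eventually_elim) (auto simp: indicator_def)
 then have GI: "(NN x. en (norm (G x) powr p) * ind Om x) = (NN x. en (norm (H x) powr p))" unfolding Hind .
 have pot: "set_nn_integral lebesgue Om (%x. en (W (v x))) = set_nn_integral lebesgue Om (%x. en (W (u x)))"
  by (intro nn_integral_cong) (auto simp: v_def indicator_def)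
 have KA: "K_np p TYPE('a) / (2 * p) = cnp p TYPE('a) * (real DIM('a) + p) / p / 2" using p by (simp add: K_np_def cnp_def field_simps)
 have "Ep_1 W p u Om = en (cnp p TYPE('a) * (real DIM('a) + p) / p / 2) * (NN x. en (norm (G x) powr p) * ind Om x)
  + set_nn_integral lebesgue Om (%x. en (W (u x)))"
  unfolding Ep_1_def GI KA using W1 ub Heq by simp
 then have up: "limsup (%k. Ep_s W p (s k) v Om) <= Ep_1 W p u Om"
  unfolding Ep_s_def pot using sobolev_energy_limsup[OF p1 s s_lim dom v'm v'b v'i G vv'] by simp
 have "Ep_1 W p u Om <= liminf (%k. Ep_s W p (s k) v Om)"
 proof (rule liminf_inequality[OF s s_lim p O W])
  show "in_Lp p Om u" using W1 by (simp add: W1p_def)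
  have "set_nn_integral lebesgue Om (%x. pw p (v x - u x)) = (\<integral>\<^sup>+x. 0 \<partial>(lebesgue :: 'a measure))" by (intro nn_integral_cong) (auto simp: v_def indicator_def)
  then show "Lp_conv p Om (%k. v) u" unfolding Lp_conv_def by simp
 qed (use X s in auto)
 also have "... <= limsup (%k. Ep_s W p (s k) v Om)" by (rule Liminf_le_Limsup) simp
 finally have "Ep_1 W p u Om = limsup (%k. Ep_s W p (s k) v Om)" using up by simp
 then show thesis by (intro that[of v] X) (simp_all add: v_def)
qed

no_notation indicator ("ind")

no_notation ennreal ("en")

no_notation LIMSEQ (infixr "---->" 60)

section \<open>Assembly of compactness, lower bound and recovery sequences\<close>

theorem mainTheorem8:
  fixes \<Omega> :: "'a::euclidean_space set"
    and s :: "nat \<Rightarrow> real" and p :: real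
    and W :: "real \<Rightarrow> real" and \<Lambda> m :: real
  assumes s_range: "\<forall>k. 0 < s k \<and> s k < 1"
    and s_lim: "s \<longlonglongrightarrow> 1"
    and p: "1 < p"
    and dom: "lipschitz_domain \<Omega>"
    and W_lsc: "lsc_on_interval W"
    and W_nonneg: "\<forall>x\<in>{-1..1}. 0 \<le> W x"
    and W_bound: "\<Lambda> \<ge> 1" "m \<ge> p" "\<forall>x\<in>{-1..1}. W x \<le> \<Lambda> * \<bar>1 + x\<bar> powr m"
  shows
    \<comment> \<open>(i) compactness\<close>
    "(\<forall>(uk :: nat \<Rightarrow> 'a \<Rightarrow> real) M.
        0 < M \<and> (\<forall>k. Xsp (s k) p \<Omega> (uk k)) \<and>
        (\<forall>k. ennreal (1 - s k) * Kp_s p (s k) (uk k) \<Omega> \<le> ennreal M) \<longrightarrow>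
        (\<exists>r u. strict_mono r \<and> W1p p \<Omega> u \<and> Lp_conv p \<Omega> (\<lambda>k. uk (r k)) u \<and>
               ((\<forall>k. Xsp0 (s k) p \<Omega> (uk k)) \<longrightarrow> W01p p \<Omega> u)))
   \<and> \<comment> \<open>(ii) liminf inequality\<close>
    (\<forall>(u :: 'a \<Rightarrow> real) uk. in_Lp p \<Omega> u \<and> (\<forall>k. Xsp (s k) p \<Omega> (uk k)) \<and> Lp_conv p \<Omega> uk u \<longrightarrow>
        Ep_1 W p u \<Omega> \<le> liminf (\<lambda>k. Ep_s W p (s k) (uk k) \<Omega>))
   \<and> \<comment> \<open>(iii) limsup inequality / recovery sequence\<close>
    (\<forall>(u :: 'a \<Rightarrow> real). in_Lp p \<Omega> u \<and> (AE x in lebesgue. x \<in> \<Omega> \<longrightarrow> \<bar>u x\<bar> \<le> 1) \<longrightarrow>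
        (\<exists>uk. (\<forall>k. Xsp (s k) p \<Omega> (uk k)) \<and> Lp_conv p \<Omega> uk u \<and>
              limsup (\<lambda>k. Ep_s W p (s k) (uk k) \<Omega>) \<le> Ep_1 W p u \<Omega>))
   \<and> (\<forall>(u :: 'a \<Rightarrow> real). X1p p \<Omega> u \<longrightarrow>
        (\<exists>v. (\<forall>t. 0 < t \<and> t < 1 \<longrightarrow> Xsp t p \<Omega> v) \<and> (\<forall>x\<in>\<Omega>. v x = u x) \<and>
             Ep_1 W p u \<Omega> = limsup (\<lambda>k. Ep_s W p (s k) v \<Omega>)))"
proof (intro conjI allI impI)
  have s: "\<And>k. 0 < s k \<and> s k < 1" using s_range by blast
  have O: "open \<Omega>" "bounded \<Omega>" using dom by (auto simp: lipschitz_domain_def)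
  have rec: "\<exists>v. (\<forall>t. 0 < t \<and> t < 1 \<longrightarrow> Xsp t p \<Omega> v) \<and> (\<forall>x\<in>\<Omega>. v x = u x) \<and> Ep_1 W p u \<Omega> = limsup (\<lambda>k. Ep_s W p (s k) v \<Omega>)"
    if "X1p p \<Omega> u" for u :: "'a \<Rightarrow> real"
  proof (rule recovery_by_extension[OF s s_lim p dom W_lsc that])
    fix v assume "\<And>t. 0 < t \<Longrightarrow> t < 1 \<Longrightarrow> Xsp t p \<Omega> v" "\<And>x. x \<in> \<Omega> \<Longrightarrow> v x = u x" "Ep_1 W p u \<Omega> = limsup (\<lambda>k. Ep_s W p (s k) v \<Omega>)"
    then show ?thesis by (intro exI[of _ v]) simp
  qed
  then show "\<exists>v. (\<forall>t. 0 < t \<and> t < 1 \<longrightarrow> Xsp t p \<Omega> v) \<and> (\<forall>x\<in>\<Omega>. v x = u x) \<and> Ep_1 W p u \<Omega> = limsup (\<lambda>k. Ep_s W p (s k) v \<Omega>)"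
    if "X1p p \<Omega> u" for u :: "'a \<Rightarrow> real" using that .
  show "\<exists>r u. strict_mono r \<and> W1p p \<Omega> u \<and> Lp_conv p \<Omega> (\<lambda>k. uk (r k)) u \<and> ((\<forall>k. Xsp0 (s k) p \<Omega> (uk k)) \<longrightarrow> W01p p \<Omega> u)"
    if h: "0 < M \<and> (\<forall>k. Xsp (s k) p \<Omega> (uk k)) \<and> (\<forall>k. ennreal (1 - s k) * Kp_s p (s k) (uk k) \<Omega> \<le> ennreal M)" for uk :: "nat \<Rightarrow> 'a \<Rightarrow> real" and M
  proof (rule compactness[OF s s_lim p dom, of M uk])
    fix r u assume "strict_mono r" "W1p p \<Omega> u" "Lp_conv p \<Omega> (\<lambda>k. uk (r k)) u" "(\<forall>k. Xsp0 (s k) p \<Omega> (uk k)) \<Longrightarrow> W01p p \<Omega> u"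
    then show ?thesis by (intro exI[of _ r] exI[of _ u]) simp
  qed (use h in auto)
  show "Ep_1 W p u \<Omega> \<le> liminf (\<lambda>k. Ep_s W p (s k) (uk k) \<Omega>)"
    if "in_Lp p \<Omega> u \<and> (\<forall>k. Xsp (s k) p \<Omega> (uk k)) \<and> Lp_conv p \<Omega> uk u" for u :: "'a \<Rightarrow> real" and uk
    using that by (intro liminf_inequality[OF s s_lim p O W_lsc]) auto
  show "\<exists>uk. (\<forall>k. Xsp (s k) p \<Omega> (uk k)) \<and> Lp_conv p \<Omega> uk u \<and> limsup (\<lambda>k. Ep_s W p (s k) (uk k) \<Omega>) \<le> Ep_1 W p u \<Omega>"
    if h: "in_Lp p \<Omega> u \<and> (AE x in lebesgue. x \<in> \<Omega> \<longrightarrow> \<bar>u x\<bar> \<le> 1)" for u :: "'a \<Rightarrow> real"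
  \<comment> \<open>For a Sobolev function the extension serves as a constant recovery sequence;
    otherwise the right side is infinite and any admissible approximation will do.\<close>
  proof (cases "W1p p \<Omega> u")
    case True
    then have "X1p p \<Omega> u" using h by (simp add: X1p_def)
    then obtain v where v: "\<forall>t. 0 < t \<and> t < 1 \<longrightarrow> Xsp t p \<Omega> v" "\<forall>x\<in>\<Omega>. v x = u x" "Ep_1 W p u \<Omega> = limsup (\<lambda>k. Ep_s W p (s k) v \<Omega>)" using rec by blast
    have "set_nn_integral lebesgue \<Omega> (\<lambda>x. ennreal (\<bar>v x - u x\<bar> powr p)) = (\<integral>\<^sup>+x. 0 \<partial>(lebesgue :: 'a measure))" using v(2) by (intro nn_integral_cong) (auto simp: indicator_def)
    then have "Lp_conv p \<Omega> (\<lambda>k. v) u" unfolding Lp_conv_def by simp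
    then show ?thesis using v(1,3) s by (intro exI[of _ "\<lambda>k. v"]) simp
  next
    case False
    then have E: "Ep_1 W p u \<Omega> = \<infinity>" by (simp add: Ep_1_def)
    show ?thesis
    proof (rule recovery_by_mollification[OF s p O, of u])
      fix uk assume "\<And>k. Xsp (s k) p \<Omega> (uk k)" "Lp_conv p \<Omega> uk u"
      then show ?thesis unfolding E by (intro exI[of _ uk]) simp
    qed (use h in auto)
  qed
qed

end
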